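(* Let $q\in[1,\infty)$ and $\theta\in(0,1)$. Let $X$ be a reflexive Banach function space (over a $\sigma$-finite measure space) that has the Fatou property and an absolutely continuous norm. Let $A$ and $B$ be sectorial operators in $X$ with dense domain and dense range, of angles $\omega_A$ and $\omega_B$ with $\omega_A+\omega_B<\pi$, whose resolvents commute. In addition, let $A$ and $B$ be $\mathcal R_q$-sectorial in $X$ of angles $\omega_A^{\ell^q}$ and $\omega_B^{\ell^q}$, respectively, and assume $\omega_A^{\ell^q}+\omega_B^{\ell^q}<\pi$ and $\rho\in(\omega_A^{\ell^q},\pi-\omega_B^{\ell^q})$. Suppose also that $0\in\rho(A)$ (the resolvent set of $A$). Denote by $A_\theta$ and $B_\theta$ the parts of $A$ and $B$, respectively, in $X_{\theta,\ell^q}(A)$. Then $A_\theta+B_\theta$ with domain $D(A_\theta+B_\theta)=D(A_\theta)\cap D(B_\theta)$ is closed in $X_{\theta,\ell^q}(A)$, and $A_\theta(A_\theta+B_\theta)^{-1}$ extends to a bounded operator on $X_{\theta,\ell^q}(A)$.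
   Context: Sectors: $\Sigma_\sigma=\{z\in\mathbb C\setminus\{0\}:|\arg z|<\sigma\}$ for $\sigma\in(0,\pi)$, $\Sigma_0=(0,\infty)$. $R(\lambda,A)=(\lambda-A)^{-1}$. A closed operator $A$ in a complex Banach space is sectorial of angle $\omega_A\in[0,\pi)$ if its spectrum is contained in $\overline{\Sigma_{\omega_A}}$ and $\sup\{\|\lambda R(\lambda,A)\|:\lambda\in\mathbb C\setminus\overline{\Sigma_\sigma}\}<\infty$ for every $\sigma\in(\omega_A,\pi)$. $H^\infty_0(\Sigma_\sigma)$ is the space of holomorphic $\phi:\Sigma_\sigma\to\mathbb C$ with $|\phi(z)|\le C\min\{|z|^\varepsilon,|z|^{-\varepsilon}\}$ for some $C,\varepsilon>0$; for $\sigma$ larger than the sectoriality angle of $A$, $\phi(A)$ is given by the usual holomorphic (Dunford–Riesz) functional calculus. Banach function space: for a $\sigma$-finite measure space $(\Omega,\mu)$, let $L^0(\Omega)$ be the space of equivalence classes of measurable functions. A Banach space $X\subseteq L^0(\Omega)$ is a Banach function space if (i) $f\in X$, $g\in L^0(\Omega)$, $|g|\le|f|$ a.e. imply $g\in X$ and $\|g\|_X\le\|f\|_X$; (ii) every measurable $E\subseteq\Omega$ of positive measure contains a measurable $F\subseteq E$ of positive measure with $\mathbf 1_F\in X$. Fatou property: (iii) if $f_n\in X$, $0\le f_n\le f_{n+1}$ and $\sup_n\|f_n\|_X<\infty$, then $f=\sup_nf_n\in X$ and $\|f\|_X=\sup_n\|f_n\|_X$. Absolutely continuous norm: (iv) if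 $f\in X$ and $(E_n)$ is a decreasing sequence of measurable sets with $\mathbf 1_{E_n}\to0$ a.e., then $\|f\mathbf 1_{E_n}\|_X\to0$. A set $\mathcal T$ of bounded linear operators on $X$ is $\ell^q$-bounded if there is $C>0$ such that for all $n\in\mathbb N$, $x_1,\dots,x_n\in X$, $T_1,\dots,T_n\in\mathcal T$: $\big\|(\sum_{j=1}^n|T_jx_j|^q)^{1/q}\big\|_X\le C\big\|(\sum_{j=1}^n|x_j|^q)^{1/q}\big\|_X$. A sectorial operator $A$ with dense domain and range is $\mathcal R_q$-sectorial of angle $\omega_A^{\ell^q}\in[\omega_A,\pi)$ if for every $\omega\in(\omega_A^{\ell^q},\pi)$ the set $\{\lambda R(\lambda,A):\lambda\in\mathbb C\setminus(\Sigma_\omega\cup\{0\})\}$ is $\ell^q$-bounded. Generalized Triebel–Lizorkin space (for $0\in\rho(A)$, $\theta>0$): with $L^q_*=L^q((0,\infty),\frac{dt}{t})$, $$X_{\theta,\ell^q}(A)=\Big\{x\in X:\ \|x\|_{X_{\theta,\ell^q}(A)}:=\Big\|\Big(\int_0^\infty|t^{-\theta}\phi(tA)x|^q\,\frac{dt}{t}\Big)^{1/q}\Big\|_X<\infty\Big\},$$ where $\phi\neq0$ is a function in $H^\infty_0(\Sigma_\omega)$ for some $\omega\in(\omega_A^{\ell^q},\pi)$ such that $z\mapsto z^{-\theta}\phi(z)\in H^\infty_0(\Sigma_\omega)$ (different choices give equivalent norms). The part of an operator $T$ in a subspace $Y\subseteq X$ has domain $\{x\in D(T)\cap Y:Tx\in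 Y\}$ and acts as $T$. *)

theory Defs
  imports "HOL-Analysis.Analysis"
begin

section \<open>Complex Banach spaces\<close>

class complex_banach = banach +
  fixes scaleC :: "complex \<Rightarrow> 'a \<Rightarrow> 'a" (infixr "*\<^sub>C" 75)
  assumes scaleC_add_right: "c *\<^sub>C (x + y) = c *\<^sub>C x + c *\<^sub>C y"
    and scaleC_add_left: "(c + d) *\<^sub>C x = c *\<^sub>C x + d *\<^sub>C x"
    and scaleC_scaleC: "c *\<^sub>C d *\<^sub>C x = (c * d) *\<^sub>C x"
    and scaleC_of_real: "complex_of_real r *\<^sub>C x = r *\<^sub>R x"
    and norm_scaleC: "norm (c *\<^sub>C x) = cmod c * norm x"

definition csubspace :: "'x::complex_banach set \<Rightarrow> bool" where
  "csubspace S \<longleftrightarrow>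
     0 \<in> S \<and> (\<forall>x\<in>S. \<forall>y\<in>S. x + y \<in> S) \<and> (\<forall>c. \<forall>x\<in>S. c *\<^sub>C x \<in> S)"

definition clinear_on :: "'x::complex_banach set \<Rightarrow> ('x \<Rightarrow> 'x) \<Rightarrow> bool" where
  "clinear_on S T \<longleftrightarrow>
     (\<forall>x\<in>S. \<forall>y\<in>S. T (x + y) = T x + T y) \<and> (\<forall>c. \<forall>x\<in>S. T (c *\<^sub>C x) = c *\<^sub>C T x)"

definition cdual :: "('x::complex_banach \<Rightarrow> complex) set" where
  "cdual = {f. bounded_linear f \<and> (\<forall>c x. f (c *\<^sub>C x) = c * f x)}"

text \<open>The canonical embedding into the bidual is onto: every bounded complex-linear functional
  \<open>\<Phi>\<close> on \<^const>\<open>cdual\<close> (normed by \<^const>\<open>onorm\<close>) is a point evaluation.\<close>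

definition reflexive_space :: "'x::complex_banach itself \<Rightarrow> bool" where
  "reflexive_space _ \<longleftrightarrow>
     (\<forall>\<Phi> :: ('x \<Rightarrow> complex) \<Rightarrow> complex.
        (\<forall>f\<in>cdual. \<forall>g\<in>cdual. \<Phi> (\<lambda>x. f x + g x) = \<Phi> f + \<Phi> g) \<and>
        (\<forall>c. \<forall>f\<in>cdual. \<Phi> (\<lambda>x. c * f x) = c * \<Phi> f) \<and>
        (\<exists>C. \<forall>f\<in>cdual. cmod (\<Phi> f) \<le> C * onorm f)
        \<longrightarrow> (\<exists>x. \<forall>f\<in>cdual. \<Phi> f = f x))"


section \<open>Unbounded operators\<close>

text \<open>The values of \<open>op_app\<close> outside \<open>op_dom\<close> are irrelevant.\<close>

datatype 'x unbounded_op = Op (op_dom: "'x set") (op_app: "'x \<Rightarrow> 'x")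

definition linear_op :: "'x::complex_banach unbounded_op \<Rightarrow> bool" where
  "linear_op A \<longleftrightarrow> csubspace (op_dom A) \<and> clinear_on (op_dom A) (op_app A)"

definition op_sum :: "'x::complex_banach unbounded_op \<Rightarrow> 'x unbounded_op \<Rightarrow> 'x unbounded_op" where
  "op_sum A B = Op (op_dom A \<inter> op_dom B) (\<lambda>x. op_app A x + op_app B x)"

definition part_op :: "'x unbounded_op \<Rightarrow> 'x set \<Rightarrow> 'x unbounded_op" where
  "part_op A Y = Op {x \<in> op_dom A \<inter> Y. op_app A x \<in> Y} (op_app A)"

text \<open>Closedness and boundedness of operators in a subspace \<open>Y\<close> carrying its own norm \<open>N\<close>.\<close>

definition closed_op_on ::
  "'x::complex_banach set \<Rightarrow> ('x \<Rightarrow> real) \<Rightarrow> 'x unbounded_op \<Rightarrow> bool" where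
  "closed_op_on Y N A \<longleftrightarrow>
     (\<forall>u. \<forall>x\<in>Y. \<forall>y\<in>Y.
        (\<forall>n. u n \<in> op_dom A) \<and>
        (\<lambda>n. N (u n - x)) \<longlonglongrightarrow> 0 \<and>
        (\<lambda>n. N (op_app A (u n) - y)) \<longlonglongrightarrow> 0
        \<longrightarrow> x \<in> op_dom A \<and> op_app A x = y)"

definition bounded_op_on ::
  "'x::complex_banach set \<Rightarrow> ('x \<Rightarrow> real) \<Rightarrow> ('x \<Rightarrow> 'x) \<Rightarrow> bool" where
  "bounded_op_on Y N T \<longleftrightarrow>
     (\<forall>x\<in>Y. T x \<in> Y) \<and> clinear_on Y T \<and> (\<exists>C. \<forall>x\<in>Y. N (T x) \<le> C * N x)"

definition resolvent :: "'x::complex_banach unbounded_op \<Rightarrow> complex \<Rightarrow> 'x \<Rightarrow> 'x" where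
  "resolvent A l = inv_into (op_dom A) (\<lambda>x. l *\<^sub>C x - op_app A x)"

definition resolvent_set :: "'x::complex_banach unbounded_op \<Rightarrow> complex set" where
  "resolvent_set A =
     {l. bij_betw (\<lambda>x. l *\<^sub>C x - op_app A x) (op_dom A) UNIV \<and> bounded_linear (resolvent A l)}"

abbreviation spectrum :: "'x::complex_banach unbounded_op \<Rightarrow> complex set" where
  "spectrum A \<equiv> - resolvent_set A"

definition resolvents_commute ::
  "'x::complex_banach unbounded_op \<Rightarrow> 'x unbounded_op \<Rightarrow> bool" where
  "resolvents_commute A B \<longleftrightarrow>
     (\<forall>l\<in>resolvent_set A. \<forall>m\<in>resolvent_set B. \<forall>x.
        resolvent A l (resolvent B m x) = resolvent B m (resolvent A l x))"

definition dense_dom_ran :: "'x::complex_banach unbounded_op \<Rightarrow> bool" where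
  "dense_dom_ran A \<longleftrightarrow> closure (op_dom A) = UNIV \<and> closure (op_app A ` op_dom A) = UNIV"


section \<open>Sectorial operators and the holomorphic functional calculus\<close>

definition sector :: "real \<Rightarrow> complex set" where
  "sector \<sigma> = (if \<sigma> = 0 then {z. Im z = 0 \<and> Re z > 0} else {z. z \<noteq> 0 \<and> \<bar>Arg z\<bar> < \<sigma>})"

definition sectorial :: "'x::complex_banach unbounded_op \<Rightarrow> real \<Rightarrow> bool" where
  "sectorial A \<omega> \<longleftrightarrow>
     0 \<le> \<omega> \<and> \<omega> < pi \<and> linear_op A \<and> closed_op_on UNIV norm A \<and>
     spectrum A \<subseteq> closure (sector \<omega>) \<and>
     (\<forall>\<sigma>. \<omega> < \<sigma> \<and> \<sigma> < pi \<longrightarrow>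
        bdd_above ((\<lambda>l. onorm (\<lambda>x. l *\<^sub>C resolvent A l x)) ` (- closure (sector \<sigma>))))"

definition H_infty_0 :: "real \<Rightarrow> (complex \<Rightarrow> complex) set" where
  "H_infty_0 \<sigma> =
     {\<phi>. \<phi> holomorphic_on sector \<sigma> \<and>
         (\<exists>C>0. \<exists>\<epsilon>>0. \<forall>z\<in>sector \<sigma>.
            cmod (\<phi> z) \<le> C * min (cmod z powr \<epsilon>) (cmod z powr (- \<epsilon>)))}"

text \<open>\<open>ray_integral \<alpha> \<phi> A x\<close> is the integral of \<open>\<phi>(z) R(z, A) x dz\<close> along the ray from \<open>0\<close> to
  infinity in direction \<open>e\<^sup>i\<^sup>\<alpha>\<close>, parametrised by \<open>z = exp (s + i \<alpha>)\<close> with real \<open>s\<close>, so that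
  \<open>dz = z ds\<close>. It is a Henstock-Kurzweil integral since the Bochner integral of the library needs
  a separable target space.\<close>

definition ray_integral ::
  "real \<Rightarrow> (complex \<Rightarrow> complex) \<Rightarrow> 'x::complex_banach unbounded_op \<Rightarrow> 'x \<Rightarrow> 'x" where
  "ray_integral \<alpha> \<phi> A x =
     integral UNIV (\<lambda>s. let z = exp (Complex s \<alpha>) in (\<phi> z * z) *\<^sub>C resolvent A z x)"

text \<open>\<open>\<phi>(A) x\<close> as the Cauchy integral over the boundary of \<^term>\<open>sector \<nu>\<close>, oriented so that the
  sector lies to the left. The value does not depend on \<open>\<nu>\<close> as long as \<open>\<nu>\<close> lies strictly between
  the sectoriality angle of \<open>A\<close> and the angle of a sector on which \<open>\<phi>\<close> is of class
  \<^const>\<open>H_infty_0\<close>.\<close>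

definition dunford ::
  "real \<Rightarrow> (complex \<Rightarrow> complex) \<Rightarrow> 'x::complex_banach unbounded_op \<Rightarrow> 'x \<Rightarrow> 'x" where
  "dunford \<nu> \<phi> A x =
     (1 / (2 * complex_of_real pi * \<i>)) *\<^sub>C (ray_integral (- \<nu>) \<phi> A x - ray_integral \<nu> \<phi> A x)"


section \<open>Banach function spaces\<close>

text \<open>The inclusion of \<open>X\<close> into the space of equivalence classes of measurable functions is given by
  a map \<open>emb\<close> choosing a representative of each element; it is linear and injective modulo
  null sets.\<close>

locale banach_function_space = sigma_finite_measure M
  for M :: "'a measure" +
  fixes emb :: "'x::complex_banach \<Rightarrow> 'a \<Rightarrow> complex"
  assumes emb_measurable: "emb x \<in> borel_measurable M"
    and emb_add: "AE w in M. emb (x + y) w = emb x w + emb y w"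
    and emb_scaleC: "AE w in M. emb (c *\<^sub>C x) w = c * emb x w"
    and emb_inj: "(AE w in M. emb x w = emb y w) \<Longrightarrow> x = y"
    and ideal: "\<lbrakk>g \<in> borel_measurable M; AE w in M. cmod (g w) \<le> cmod (emb f w)\<rbrakk>
      \<Longrightarrow> \<exists>y. (AE w in M. emb y w = g w) \<and> norm y \<le> norm f"
    and saturated: "\<lbrakk>E \<in> sets M; emeasure M E > 0\<rbrakk>
      \<Longrightarrow> \<exists>F\<in>sets M. F \<subseteq> E \<and> emeasure M F > 0 \<and> (\<exists>y. AE w in M. emb y w = indicator F w)"

definition fatou_property :: "'a measure \<Rightarrow> ('x::complex_banach \<Rightarrow> 'a \<Rightarrow> complex) \<Rightarrow> bool" where
  "fatou_property M emb \<longleftrightarrow>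
     (\<forall>u :: nat \<Rightarrow> 'x.
        (\<forall>n. AE w in M. emb (u n) w \<in> \<real>\<^sub>\<ge>\<^sub>0 \<and> emb (u (Suc n)) w \<in> \<real>\<^sub>\<ge>\<^sub>0 \<and>
                        Re (emb (u n) w) \<le> Re (emb (u (Suc n)) w)) \<and>
        bdd_above (range (\<lambda>n. norm (u n)))
        \<longrightarrow> (\<exists>f. (AE w in M. bdd_above (range (\<lambda>n. Re (emb (u n) w))) \<and>
                            emb f w = complex_of_real (SUP n. Re (emb (u n) w))) \<and>
                 norm f = (SUP n. norm (u n))))"

definition abs_continuous_norm ::
  "'a measure \<Rightarrow> ('x::complex_banach \<Rightarrow> 'a \<Rightarrow> complex) \<Rightarrow> bool" where
  "abs_continuous_norm M emb \<longleftrightarrow>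
     (\<forall>f :: 'x. \<forall>E :: nat \<Rightarrow> 'a set. \<forall>u.
        range E \<subseteq> sets M \<and> decseq E \<and>
        (AE w in M. (\<lambda>n. indicator (E n) w :: real) \<longlonglongrightarrow> 0) \<and>
        (\<forall>n. AE w in M. emb (u n) w = emb f w * indicator (E n) w)
        \<longrightarrow> (\<lambda>n. norm (u n)) \<longlonglongrightarrow> 0)"

text \<open>The norm of a function \<open>g \<ge> 0\<close>, with value \<open>\<infinity>\<close> (the infimum over the empty set) if \<open>g\<close> does not
  belong to the space; otherwise the infimum is over a single element.\<close>

definition fun_norm ::
  "'a measure \<Rightarrow> ('x::complex_banach \<Rightarrow> 'a \<Rightarrow> complex) \<Rightarrow> ('a \<Rightarrow> ennreal) \<Rightarrow> ennreal" where
  "fun_norm M emb g =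
     (INF y \<in> {y. AE w in M. g w < \<infinity> \<and> emb y w = complex_of_real (enn2real (g w))}. ennreal (norm y))"


section \<open>\<open>\<R>\<^sub>q\<close>-sectoriality and generalized Triebel-Lizorkin spaces\<close>

definition ellq_bounded ::
  "'a measure \<Rightarrow> ('x::complex_banach \<Rightarrow> 'a \<Rightarrow> complex) \<Rightarrow> real \<Rightarrow> ('x \<Rightarrow> 'x) set \<Rightarrow> bool" where
  "ellq_bounded M emb q \<T> \<longleftrightarrow>
     (\<forall>T\<in>\<T>. bounded_linear T) \<and>
     (\<exists>C>0. \<forall>(n::nat) (x :: nat \<Rightarrow> 'x) T. (\<forall>j<n. T j \<in> \<T>) \<longrightarrow>
        fun_norm M emb (\<lambda>w. ennreal ((\<Sum>j<n. cmod (emb (T j (x j)) w) powr q) powr (1 / q)))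
        \<le> ennreal C *
           fun_norm M emb (\<lambda>w. ennreal ((\<Sum>j<n. cmod (emb (x j) w) powr q) powr (1 / q))))"

definition Rq_sectorial ::
  "'a measure \<Rightarrow> ('x::complex_banach \<Rightarrow> 'a \<Rightarrow> complex) \<Rightarrow> real \<Rightarrow>
     'x unbounded_op \<Rightarrow> real \<Rightarrow> real \<Rightarrow> bool" where
  "Rq_sectorial M emb q A \<omega>\<^sub>A \<omega>q \<longleftrightarrow>
     sectorial A \<omega>\<^sub>A \<and> dense_dom_ran A \<and> \<omega>\<^sub>A \<le> \<omega>q \<and> \<omega>q < pi \<and>
     (\<forall>\<omega>. \<omega>q < \<omega> \<and> \<omega> < pi \<longrightarrow>
        ellq_bounded M emb q ((\<lambda>l x. l *\<^sub>C resolvent A l x) ` (- (sector \<omega> \<union> {0}))))"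

text \<open>The norm in \<open>L\<^sup>q((0,\<infinity>), dt/t)\<close>.\<close>

definition Lq_star_norm :: "real \<Rightarrow> (real \<Rightarrow> real) \<Rightarrow> ennreal" where
  "Lq_star_norm q h =
     (let I = (\<integral>\<^sup>+t\<in>{0<..}. ennreal (\<bar>h t\<bar> powr q / t) \<partial>lborel)
      in if I = \<infinity> then \<infinity> else ennreal (enn2real I powr (1 / q)))"

text \<open>To integrate \<open>t \<mapsto> \<bar>t\<^sup>-\<^sup>\<theta> (\<phi>(tA) x)(w)\<bar>\<^sup>q\<close> for fixed \<open>w\<close> one needs a jointly measurable version
  \<open>F\<close> of \<open>(t, w) \<mapsto> (\<phi>(tA) x)(w)\<close>. Any two such versions agree almost everywhere on the product, so
  the infimum in \<open>TL_ennorm\<close> is over a single value. The operator \<open>\<phi>(tA)\<close> is the function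
  \<open>z \<mapsto> \<phi>(t z)\<close> applied to \<open>A\<close>.\<close>

definition joint_versions ::
  "'a measure \<Rightarrow> ('x::complex_banach \<Rightarrow> 'a \<Rightarrow> complex) \<Rightarrow> real \<Rightarrow> (complex \<Rightarrow> complex) \<Rightarrow>
     'x unbounded_op \<Rightarrow> 'x \<Rightarrow> (real \<times> 'a \<Rightarrow> complex) set" where
  "joint_versions M emb \<nu> \<phi> A x =
     {F \<in> borel_measurable (lborel \<Otimes>\<^sub>M M).
        AE t in lborel. t > 0 \<longrightarrow>
          (AE w in M. F (t, w) = emb (dunford \<nu> (\<lambda>z. \<phi> (complex_of_real t * z)) A x) w)}"

definition TL_ennorm ::
  "'a measure \<Rightarrow> ('x::complex_banach \<Rightarrow> 'a \<Rightarrow> complex) \<Rightarrow> real \<Rightarrow> real \<Rightarrow> real \<Rightarrow>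
     (complex \<Rightarrow> complex) \<Rightarrow> 'x unbounded_op \<Rightarrow> 'x \<Rightarrow> ennreal" where
  "TL_ennorm M emb q \<theta> \<nu> \<phi> A x =
     (INF F \<in> joint_versions M emb \<nu> \<phi> A x.
        fun_norm M emb (\<lambda>w. Lq_star_norm q (\<lambda>t. t powr (- \<theta>) * cmod (F (t, w)))))"

definition TL_space ::
  "'a measure \<Rightarrow> ('x::complex_banach \<Rightarrow> 'a \<Rightarrow> complex) \<Rightarrow> real \<Rightarrow> real \<Rightarrow> real \<Rightarrow>
     (complex \<Rightarrow> complex) \<Rightarrow> 'x unbounded_op \<Rightarrow> 'x set" where
  "TL_space M emb q \<theta> \<nu> \<phi> A = {x. TL_ennorm M emb q \<theta> \<nu> \<phi> A x < \<infinity>}"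

definition TL_norm ::
  "'a measure \<Rightarrow> ('x::complex_banach \<Rightarrow> 'a \<Rightarrow> complex) \<Rightarrow> real \<Rightarrow> real \<Rightarrow> real \<Rightarrow>
     (complex \<Rightarrow> complex) \<Rightarrow> 'x unbounded_op \<Rightarrow> 'x \<Rightarrow> real" where
  "TL_norm M emb q \<theta> \<nu> \<phi> A x = enn2real (TL_ennorm M emb q \<theta> \<nu> \<phi> A x)"

end

theory Submission
  imports Defs "HOL-Complex_Analysis.Conformal_Mappings"
begin

text \<open>Substituting \<open>e\<^sup>t\<close> for \<open>t\<close> turns \<open>L\<^sup>q((0,\<infinity>), dt/t)\<close> into \<open>L\<^sup>q\<close> of the real line. Let \<open>P(z) = z R(z,A)\<close>
  and \<open>Q(z) = z (z + B)\<^sup>-\<^sup>1\<close>. The operators \<open>\<Phi>\<^sub>t = \<phi>(e\<^sup>t A)\<close> are contour integrals of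
  \<open>\<phi>(e\<^sup>t z) P(z) dz/z\<close>; let \<open>\<Psi>\<^sub>t\<close> be the same integral with \<open>Q(z) P(z)\<close> in place of \<open>P(z)\<close>. Since
  \<open>Q(z) P(z) (A + B) u = P(z) A u + Q(z) B u\<close> and \<open>Q\<close> is holomorphic inside the contour,
  \<open>\<Psi>\<^sub>t (A + B) u = \<Phi>\<^sub>t A u\<close>.

  The Calderon formula recovers a nonzero multiple of \<open>y\<close> as the integral of \<open>\<eta>(e\<^sup>t A) \<Phi>\<^sub>t y\<close> over the
  real line, where \<open>\<eta>(z) = z / (1 + z)\<^sup>m\<^sup>+\<^sup>2\<close> and \<open>m\<close> is chosen so that the constant does not vanish.
  Replacing \<open>\<Phi>\<^sub>t\<close> by \<open>\<Psi>\<^sub>t\<close> defines an operator \<open>T\<close> with \<open>\<Phi>\<^sub>t T y = \<Psi>\<^sub>t y\<close>, hence \<open>T (A + B) u = A u\<close>.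
  Inserting the Calderon formula into \<open>\<Psi>\<^sub>t y\<close> exhibits \<open>e\<^sup>-\<^sup>\<theta>\<^sup>t \<Psi>\<^sub>t y\<close> as \<open>e\<^sup>-\<^sup>\<theta>\<^sup>t \<Phi>\<^sub>t y\<close> convolved with a decaying
  kernel, acted on by \<open>Q P\<close>, which is \<open>\<ell>\<^sup>q\<close>-bounded, and convolved with another decaying kernel, so \<open>T\<close> is
  bounded in the Triebel-Lizorkin norm. If \<open>u\<^sub>n \<rightarrow> x\<close> and \<open>(A + B) u\<^sub>n \<rightarrow> y\<close> in this norm, then
  \<open>A u\<^sub>n = T (A + B) u\<^sub>n \<rightarrow> T y\<close>, and closedness follows from that of \<open>A\<close> and \<open>B\<close>.\<close>


text \<open>Three obstacles shape the construction. First, the values of the curve t -> \<Phi>_t y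
  are equivalence classes, while the norm integrates in t for fixed w; hence jointly measurable
  versions, and bounds phrased as domination by an element of X, which survive limits by the Fatou
  property. Second, \<ell>^q-bounds for resolvents hold only outside sectors of angle above
  \<open>\<omega>q\<^sub>A\<close> and \<open>\<omega>q\<^sub>B\<close>. The contour angle \<beta>
  is chosen with \<open>\<omega>q\<^sub>A < \<beta> < pi - \<omega>q\<^sub>B\<close>, so that on the
  contour z is usable for A and -z for B. Third, \<phi> is arbitrary, so \<phi>(e^t A) is no product
  of \<ell>^q-bounded operators. The auxiliary \<eta>(e^t A) is one, being a polynomial in J = (1 +
  e^t A)^-1, and it equals e^-t A^-1 times another such polynomial. With 0 < \<theta> < 1 this makes
  the weighted Calderon integral converge in X at both ends. The exponent m is left free because the
  pairing of \<phi> with a single \<eta> may vanish, whereas all of these pairings together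
  cannot.\<close>

lemma bounded_bilinear_scaleC:
  "bounded_bilinear (scaleC :: complex \<Rightarrow> 'x::complex_banach \<Rightarrow> 'x)"
proof
  show "(r *\<^sub>R a) *\<^sub>C b = r *\<^sub>R a *\<^sub>C b" for r a and b :: 'x
    by (metis scaleC_of_real scaleC_scaleC scaleR_conv_of_real)
  show "a *\<^sub>C r *\<^sub>R b = r *\<^sub>R a *\<^sub>C b" for r a and b :: 'x
    by (metis scaleC_of_real scaleC_scaleC mult.commute)
  show "\<exists>K. \<forall>a. \<forall>b::'x. norm (a *\<^sub>C b) \<le> norm a * norm b * K"
    by (rule exI[of _ 1]) (simp add: norm_scaleC)
qed (simp_all add: scaleC_add_left scaleC_add_right)

interpretation scaleC: bounded_bilinear "scaleC :: complex \<Rightarrow> 'x::complex_banach \<Rightarrow> 'x"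
  by (rule bounded_bilinear_scaleC)

lemma scaleC_one [simp]: "1 *\<^sub>C x = (x::'x::complex_banach)"
  using scaleC_of_real[of 1 x] by simp

lemmas scaleC_zero [simp] = scaleC.zero_left scaleC.zero_right

lemma bounded_linear_scaleC_right: "bounded_linear (\<lambda>x::'x::complex_banach. c *\<^sub>C x)"
  by (rule scaleC.bounded_linear_right)

lemma scaleC_eq_0_iff [simp]: "c *\<^sub>C x = 0 \<longleftrightarrow> c = 0 \<or> x = (0::'x::complex_banach)"
  by (metis norm_scaleC mult_eq_0_iff norm_eq_zero)

section \<open>Bounded complex-linear operators\<close>

definition bounded_clin :: "('x::complex_banach \<Rightarrow> 'x) \<Rightarrow> bool" where
  "bounded_clin L \<longleftrightarrow> bounded_linear L \<and> (\<forall>c x. L (c *\<^sub>C x) = c *\<^sub>C L x)"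

lemma bounded_clin_bounded_linear: "bounded_clin L \<Longrightarrow> bounded_linear L"
  and bounded_clin_scaleC: "bounded_clin L \<Longrightarrow> L (c *\<^sub>C x) = c *\<^sub>C L x"
  and bounded_clin_add: "bounded_clin L \<Longrightarrow> L (x + y) = L x + L y"
  and bounded_clin_diff: "bounded_clin L \<Longrightarrow> L (x - y) = L x - L y"
  and bounded_clin_minus: "bounded_clin L \<Longrightarrow> L (- x) = - L x"
  and bounded_clin_0: "bounded_clin L \<Longrightarrow> L 0 = 0"
  unfolding bounded_clin_def by (auto simp: bounded_linear.linear linear_add linear_diff linear_0 linear_neg)

lemma cblI:
  assumes "\<And>x y. L (x + y) = L x + L y" "\<And>c x. L (c *\<^sub>C x) = c *\<^sub>C L x"
    and "\<And>x. norm (L x) \<le> C * norm x"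
  shows "bounded_clin L"
proof -
  have "L (r *\<^sub>R x) = r *\<^sub>R L x" for r x
    by (metis assms(2) scaleC_of_real)
  then show ?thesis
    unfolding bounded_clin_def using assms
    by (auto intro!: bounded_linear_intro[where K=C] simp: mult.commute)
qed

lemma bounded_clin_compose: "bounded_clin L \<Longrightarrow> bounded_clin K \<Longrightarrow> bounded_clin (\<lambda>x. L (K x))"
  unfolding bounded_clin_def by (auto intro: bounded_linear_compose)

lemma bounded_clin_ident: "bounded_clin (\<lambda>x. x)"
  unfolding bounded_clin_def by auto

lemma bounded_clin_sub: "bounded_clin L \<Longrightarrow> bounded_clin K \<Longrightarrow> bounded_clin (\<lambda>x. L x - K x)"
  unfolding bounded_clin_def by (auto intro: bounded_linear_sub simp: scaleC.diff_right)

lemma bounded_clin_scale: "bounded_clin L \<Longrightarrow> bounded_clin (\<lambda>x. c *\<^sub>C L x)"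
  unfolding bounded_clin_def
  by (auto intro: bounded_linear_compose[OF bounded_linear_scaleC_right] simp: scaleC_scaleC mult.commute)

lemma bounded_clin_bound: "bounded_clin L \<Longrightarrow> \<exists>C\<ge>0. \<forall>x. norm (L x) \<le> C * norm x"
  using bounded_linear.nonneg_bounded[of L] unfolding bounded_clin_def by (auto simp: mult.commute)


section \<open>Integrals over the real line\<close>

text \<open>The contour integrands below are dominated by this function: with z = e^(s + ia), decay
  of order |z|^e at 0 and |z|^-e at infinity reads exp(-e|s|), and the shift c is a dilation by
  e^c.\<close>

lemma exp_abs_has_integral:
  fixes e c :: real
  assumes "e > 0"
  shows "((\<lambda>s. exp (- e * \<bar>s + c\<bar>)) has_integral 2 / e) UNIV"
proof -
  have A: "((\<lambda>s. exp (- e * \<bar>s\<bar>)) has_integral 1 / e) {0..}"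
    by (rule has_integral_eq[OF _ has_integral_exp_minus_to_infinity[OF assms, of 0, simplified]]) simp
  have B: "has_bochner_integral lborel (\<lambda>s. indicator {0..} s * exp (- e * \<bar>s\<bar>)) (1 / e)"
  proof -
    have "((\<lambda>s. indicator {0..} s * exp (- e * \<bar>s\<bar>)) has_integral 1 / e) UNIV"
      by (rule has_integral_eq[OF _ A[unfolded has_integral_restrict_UNIV[symmetric, where s="{0..}"]]]) (auto simp: indicator_def)
    then show ?thesis
      by (intro has_bochner_integral_nn_integral nn_integral_has_integral_lborel) (auto simp: assms less_imp_le)
  qed
  \<comment> \<open>Reflection gives the left half-line; the two halves overlap only at 0.\<close>
  have C: "has_bochner_integral lborel (\<lambda>s. indicator {0..} (-s) * exp (- e * \<bar>s\<bar>)) (1 / e)"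
    using B lborel_has_bochner_integral_real_affine_iff[of "-1" "\<lambda>s. indicator {0..} s * exp (- e * \<bar>s\<bar>)" "1/e" 0]
    by simp
  have D: "has_bochner_integral lborel (\<lambda>s. exp (- e * \<bar>s\<bar>)) (2 / e)"
  proof (rule has_bochner_integral_cong_AE[THEN iffD1])
    show "has_bochner_integral lborel (\<lambda>s. indicator {0..} s * exp (- e * \<bar>s\<bar>) + indicator {0..} (-s) * exp (- e * \<bar>s\<bar>)) (2 / e)"
      using has_bochner_integral_add[OF B C] by simp
    have "AE s in lborel. s \<noteq> (0::real)"
      by (rule AE_lborel_singleton)
    then show "AE s in lborel. indicator {0..} s * exp (- e * \<bar>s\<bar>) + indicator {0..} (-s) * exp (- e * \<bar>s\<bar>) = exp (- e * \<bar>s\<bar>)"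
      by (auto elim!: eventually_mono simp: indicator_def)
  qed auto
  have "has_bochner_integral lborel (\<lambda>s. exp (- e * \<bar>s + c\<bar>)) (2 / e)"
    using D lborel_has_bochner_integral_real_affine_iff[of 1 "\<lambda>s. exp (- e * \<bar>s\<bar>)" "2/e" c]
    by (simp add: add.commute)
  then show ?thesis
    using has_integral_integral_lborel[of "\<lambda>s. exp (- e * \<bar>s + c\<bar>)"] by (simp add: has_bochner_integral_iff)
qed

lemma exp_abs_nn_integral:
  fixes e c :: real
  assumes "e > 0"
  shows "(\<integral>\<^sup>+s. ennreal (exp (- e * \<bar>s + c\<bar>)) \<partial>lborel) = ennreal (2 / e)"
  by (rule nn_integral_has_integral_lborel[OF _ _ exp_abs_has_integral[OF assms]]) auto

text \<open>Continuity gives integrability on compact intervals, and the integrable majorant extends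
  it to the line. This works for values in an arbitrary Banach space.\<close>

lemma exp_dec_integrable:
  fixes f :: "real \<Rightarrow> 'b::banach"
  assumes "continuous_on UNIV f" "e > 0" "\<And>s. norm (f s) \<le> C * exp (- e * \<bar>s + c\<bar>)"
  shows "f integrable_on UNIV" and "norm (integral UNIV f) \<le> C * (2 / e)"
proof -
  have g: "((\<lambda>s. C * exp (- e * \<bar>s + c\<bar>)) has_integral C * (2 / e)) UNIV"
    using exp_abs_has_integral[OF assms(2)] by (rule has_integral_mult_right)
  show i: "f integrable_on UNIV"
  proof (rule integrable_on_all_intervals_integrable_bound[where g="\<lambda>s. C * exp (- e * \<bar>s + c\<bar>)"])
    show "(\<lambda>x. if x \<in> UNIV then f x else 0) integrable_on cbox a b" for a b
      using integrable_continuous[OF continuous_on_subset[OF assms(1)], of a b] by simp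
  qed (use assms g in auto)
  show "norm (integral UNIV f) \<le> C * (2 / e)"
    using integral_norm_bound_integral[OF i has_integral_integrable[OF g]] assms(3)
    unfolding integral_unique[OF g] by blast
qed

text \<open>Outside [a, b] half of the decay is spent on the factor exp(-e m/2), and the other half
  remains as a majorant of mass 4/e.\<close>

lemma exp_dec_tail:
  fixes f :: "real \<Rightarrow> 'b::banach"
  assumes f: "continuous_on UNIV f" "e > 0" "\<And>s. norm (f s) \<le> C * exp (- e * \<bar>s\<bar>)"
    and ab: "a \<le> - m" "m \<le> b"
  shows "norm (integral UNIV f - integral {a..b} f) \<le> 4 * C / e * exp (- e * m / 2)"
proof -
  have C: "C \<ge> 0" using f(3)[of 0] norm_ge_zero[of "f 0"] by (simp del: norm_ge_zero)
  have g: "((\<lambda>s. C * exp (- e * m / 2) * exp (- (e/2) * \<bar>s + 0\<bar>)) has_integral C * exp (- e * m / 2) * (2 / (e/2))) UNIV"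
    using exp_abs_has_integral[of "e/2" 0] f(2) by (intro has_integral_mult_right) auto
  have i: "f integrable_on UNIV" using exp_dec_integrable(1)[of f e C 0] f by auto
  have i2: "(\<lambda>s. if s \<in> {a..b} then f s else 0) integrable_on UNIV"
    unfolding integrable_restrict_UNIV
    by (intro integrable_continuous_real continuous_on_subset[OF f(1)]) auto
  have "integral UNIV f - integral {a..b} f = integral UNIV (\<lambda>s. f s - (if s \<in> {a..b} then f s else 0))"
    by (subst integral_diff[OF i i2]) (simp only: Henstock_Kurzweil_Integration.integral_restrict_UNIV)
  also have "norm \<dots> \<le> integral UNIV (\<lambda>s. C * exp (- e * m / 2) * exp (- (e/2) * \<bar>s + 0\<bar>))"
  proof (rule integral_norm_bound_integral)
    show "norm (f s - (if s \<in> {a..b} then f s else 0)) \<le> C * exp (- e * m / 2) * exp (- (e/2) * \<bar>s + 0\<bar>)" for s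
    proof (cases "s \<in> {a..b}")
      case False
      then have "m \<le> \<bar>s\<bar>" using ab by auto
      then have "e * m \<le> e * \<bar>s\<bar>" using f(2) by simp
      then have "exp (- e * \<bar>s\<bar>) \<le> exp (- e * m / 2) * exp (- (e/2) * \<bar>s + 0\<bar>)"
        by (simp add: exp_add[symmetric])
      then have "C * exp (- e * \<bar>s\<bar>) \<le> C * (exp (- e * m / 2) * exp (- (e/2) * \<bar>s + 0\<bar>))"
        using C by (intro mult_left_mono)
      with f(3)[of s] False show ?thesis by (auto simp: mult.assoc)
    qed (use C in auto)
  qed (use i i2 g in \<open>auto intro: integrable_diff has_integral_integrable\<close>)
  also have "\<dots> = 4 * C / e * exp (- e * m / 2)"
    using integral_unique[OF g] by simp
  finally show ?thesis .
qed

lemma exp_neg_half_tendsto_0: "e > 0 \<Longrightarrow> (\<lambda>n::nat. K * exp (- e * real n / 2)) \<longlonglongrightarrow> 0"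
proof -
  assume e: "e > 0"
  have "filterlim (\<lambda>n::nat. e/2 * real n) at_top sequentially"
    using e by (intro filterlim_tendsto_pos_mult_at_top[OF tendsto_const] filterlim_real_sequentially) auto
  then have "(\<lambda>n::nat. exp (- (e/2 * real n))) \<longlonglongrightarrow> 0"
    by (intro filterlim_compose[OF exp_at_bot]) (simp add: filterlim_uminus_at_top)
  from tendsto_mult_left[OF this, of K] show ?thesis by (simp add: algebra_simps)
qed

lemma exp_dec_integral_limit:
  fixes f :: "real \<Rightarrow> 'b::banach"
  assumes f: "continuous_on UNIV f" "e > 0" "\<And>s. norm (f s) \<le> C * exp (- e * \<bar>s\<bar>)"
  shows "(\<lambda>n::nat. integral {- real n..real n} f) \<longlonglongrightarrow> integral UNIV f"
proof -
  have "(\<lambda>n::nat. integral UNIV f - integral {- real n..real n} f) \<longlonglongrightarrow> 0"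
    by (rule Lim_null_comparison[OF always_eventually exp_neg_half_tendsto_0[OF f(2), of "4*C/e"]], rule allI,
      rule exp_dec_tail[OF f]) auto
  from tendsto_diff[OF tendsto_const[of "integral UNIV f"] this] show ?thesis by simp
qed

lemma integral_param_continuous:
  fixes g :: "real \<Rightarrow> real \<Rightarrow> 'b::banach"
  assumes "continuous_on UNIV (\<lambda>(s,t). g s t)"
  shows "continuous_on U (\<lambda>s. integral {a..b} (g s))"
  using integral_continuous_on_param[of U a b g] continuous_on_subset[OF assms] by auto

text \<open>The truncated integrals are continuous and converge locally uniformly in s. The constant
  may grow with the bound k on s, since a parameter that acts by dilation moves the peak of the
  majorant.\<close>

lemma exp_dec_param_continuous:
  fixes g :: "real \<Rightarrow> real \<Rightarrow> 'b::banach"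
  assumes g: "continuous_on UNIV (\<lambda>(s,t). g s t)" and e: "e > 0"
    and bd: "\<And>k s t. \<bar>s\<bar> \<le> k \<Longrightarrow> norm (g s t) \<le> C k * exp (- e * \<bar>t\<bar>)"
  shows "continuous_on UNIV (\<lambda>s. integral UNIV (g s))"
proof -
  have gs: "continuous_on UNIV (g s)" for s
    by (rule continuous_on_compose2[OF g, of UNIV "\<lambda>t. (s,t)", unfolded prod.case]) (auto intro!: continuous_intros)
  have "continuous_on {-k..k} (\<lambda>s. integral UNIV (g s))" for k :: real
  proof (rule uniform_limit_theorem[where F=sequentially and f="\<lambda>n s. integral {- real n..real n} (g s)"])
    show "\<forall>\<^sub>F n in sequentially. continuous_on {- k..k} (\<lambda>s. integral {- real n..real n} (g s))"
      by (intro always_eventually allI integral_param_continuous g)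
    show "uniform_limit {- k..k} (\<lambda>n s. integral {- real n..real n} (g s)) (\<lambda>s. integral UNIV (g s)) sequentially"
    proof (rule uniform_limitI)
      fix \<epsilon> :: real assume "\<epsilon> > 0"
      with exp_neg_half_tendsto_0[OF e, of "4 * C k / e"]
      have "\<forall>\<^sub>F n in sequentially. 4 * C k / e * exp (- e * real n / 2) < \<epsilon>"
        by (rule order_tendstoD)
      then show "\<forall>\<^sub>F n in sequentially. \<forall>s\<in>{- k..k}. dist (integral {- real n..real n} (g s)) (integral UNIV (g s)) < \<epsilon>"
      proof eventually_elim
        case (elim n)
        show ?case
        proof
          fix s assume "s \<in> {- k..k}"
          then have "norm (g s t) \<le> C k * exp (- e * \<bar>t\<bar>)" for t
            by (intro bd) auto
          from exp_dec_tail[OF gs e this, of "- real n" "real n" "real n"] elim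
          show "dist (integral {- real n..real n} (g s)) (integral UNIV (g s)) < \<epsilon>"
            by (simp add: dist_norm norm_minus_commute)
        qed
      qed
    qed
  qed simp
  then have "isCont (\<lambda>s. integral UNIV (g s)) s" for s
    by (rule continuous_on_interior[of "{-(\<bar>s\<bar>+1)..\<bar>s\<bar>+1}"]) (auto simp: interior_atLeastAtMost_real)
  then show ?thesis by (simp add: continuous_at_imp_continuous_on)
qed

text \<open>Fubini for a compact interval times the line: the integrals are swapped on rectangles,
  where continuity suffices, and the uniform tail bound lets the rectangles grow.\<close>

lemma exp_dec_integral_swap:
  fixes g :: "real \<Rightarrow> real \<Rightarrow> 'b::banach"
  assumes g: "continuous_on UNIV (\<lambda>(s,t). g s t)" and e: "e > 0" and ab: "a \<le> b"
    and bd: "\<And>s t. s \<in> {a..b} \<Longrightarrow> norm (g s t) \<le> C * exp (- e * \<bar>t\<bar>)"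
    and cont: "continuous_on UNIV (\<lambda>s. integral UNIV (g s))"
  shows "integral {a..b} (\<lambda>s. integral UNIV (g s)) = integral UNIV (\<lambda>t. integral {a..b} (\<lambda>s. g s t))"
    and "continuous_on UNIV (\<lambda>t. integral {a..b} (\<lambda>s. g s t))"
    and "norm (integral {a..b} (\<lambda>s. g s t)) \<le> C * (b - a) * exp (- e * \<bar>t\<bar>)"
proof -
  have gs: "continuous_on UNIV (g s)" for s
    by (rule continuous_on_compose2[OF g, of UNIV "\<lambda>t. (s,t)", unfolded prod.case]) (auto intro!: continuous_intros)
  have gt: "continuous_on UNIV (\<lambda>s. g s t)" for t
    by (rule continuous_on_compose2[OF g, of UNIV "\<lambda>s. (s,t)", unfolded prod.case]) (auto intro!: continuous_intros)
  have g': "continuous_on UNIV (\<lambda>(t,s). g s t)"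
    unfolding case_prod_unfold
    by (rule continuous_on_compose2[OF g[unfolded case_prod_unfold], of UNIV "\<lambda>p. (snd p,fst p)", unfolded fst_conv snd_conv])
      (auto intro!: continuous_intros)
  show c: "continuous_on UNIV (\<lambda>t. integral {a..b} (\<lambda>s. g s t))"
    by (rule integral_param_continuous[OF g'])
  show bb: "norm (integral {a..b} (\<lambda>s. g s t)) \<le> C * (b - a) * exp (- e * \<bar>t\<bar>)" for t
  proof -
    have "norm (integral {a..b} (\<lambda>s. g s t)) \<le> (C * exp (- e * \<bar>t\<bar>)) * (b - a)"
      by (rule integral_bound[OF ab continuous_on_subset[OF gt] bd]) auto
    then show ?thesis by (simp only: mult_ac)
  qed
  have C: "C \<ge> 0" using bd[of a 0] ab norm_ge_zero[of "g a 0"] by (simp del: norm_ge_zero)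
  have L1: "(\<lambda>n::nat. integral {- real n..real n} (\<lambda>t. integral {a..b} (\<lambda>s. g s t)))
      \<longlonglongrightarrow> integral UNIV (\<lambda>t. integral {a..b} (\<lambda>s. g s t))"
    by (rule exp_dec_integral_limit[OF c e bb])
  have sw: "integral {- real n..real n} (\<lambda>t. integral {a..b} (\<lambda>s. g s t))
      = integral {a..b} (\<lambda>s. integral {- real n..real n} (g s))" for n
    using integral_swap_continuous[of "-real n" a "real n" b "\<lambda>t s. g s t"]
      continuous_on_subset[OF g'] by auto
  have ci: "continuous_on UNIV (\<lambda>s. integral {- real n..real n} (g s))" for n
    by (rule integral_param_continuous[OF g])
  have "(\<lambda>n::nat. integral {a..b} (\<lambda>s. integral UNIV (g s)) - integral {a..b} (\<lambda>s. integral {- real n..real n} (g s))) \<longlonglongrightarrow> 0"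
  proof (rule Lim_null_comparison[OF _ exp_neg_half_tendsto_0[OF e, of "4*C/e*(b-a)"]], rule always_eventually, rule allI)
    fix n :: nat
    have "integral {a..b} (\<lambda>s. integral UNIV (g s)) - integral {a..b} (\<lambda>s. integral {- real n..real n} (g s))
      = integral {a..b} (\<lambda>s. integral UNIV (g s) - integral {- real n..real n} (g s))"
      by (rule integral_diff[symmetric]) (auto intro!: integrable_continuous_real continuous_on_subset[OF cont] continuous_on_subset[OF ci])
    also have "norm \<dots> \<le> (4 * C / e * exp (- e * real n / 2)) * (b - a)"
      by (intro integral_bound[OF ab] continuous_on_diff continuous_on_subset[OF cont] continuous_on_subset[OF ci]
          exp_dec_tail[OF gs e bd]) auto
    finally show "norm (integral {a..b} (\<lambda>s. integral UNIV (g s)) - integral {a..b} (\<lambda>s. integral {- real n..real n} (g s)))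
       \<le> 4 * C / e * (b - a) * exp (- e * real n / 2)" by (simp add: algebra_simps)
  qed
  from tendsto_diff[OF tendsto_const[of "integral {a..b} (\<lambda>s. integral UNIV (g s))"] this]
  have "(\<lambda>n::nat. integral {a..b} (\<lambda>s. integral {- real n..real n} (g s))) \<longlonglongrightarrow> integral {a..b} (\<lambda>s. integral UNIV (g s))"
    by simp
  with L1 show "integral {a..b} (\<lambda>s. integral UNIV (g s)) = integral UNIV (\<lambda>t. integral {a..b} (\<lambda>s. g s t))"
    unfolding sw by (rule LIMSEQ_unique[symmetric])
qed

section \<open>Rotating rays\<close>

text \<open>Logarithmic polar coordinates z = e^s e^(ia): dilation by e^t becomes translation in s,
  and dz/z becomes ds.\<close>

definition ray :: "real \<Rightarrow> real \<Rightarrow> complex" where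
  "ray s a = exp (Complex s a)"

lemma ray_continuous: "continuous_on S (\<lambda>(s,a). ray s a)"
  unfolding ray_def case_prod_unfold Complex_eq by (intro continuous_intros)

lemma norm_ray [simp]: "cmod (ray s a) = exp s"
  by (simp add: ray_def)

lemma ray_nonzero [simp]: "ray s a \<noteq> 0"
  by (simp add: ray_def)

lemma ray_add: "complex_of_real (exp s) * ray t a = ray (s + t) a"
  by (simp add: ray_def exp_of_real[symmetric] exp_add[symmetric] Complex_eq algebra_simps)

lemma ray_deriv_s: "((\<lambda>s. ray s a) has_vector_derivative ray s a) (at s within S)"
  unfolding ray_def Complex_eq
  by (rule has_vector_derivative_real_field) (auto intro!: derivative_eq_intros)

lemma ray_deriv_a: "((\<lambda>a. ray s a) has_vector_derivative (\<i> * ray s a)) (at a within S)"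
  unfolding ray_def Complex_eq
  by (rule has_vector_derivative_real_field) (auto intro!: derivative_eq_intros)

lemma ray_deriv_compose:
  fixes G :: "complex \<Rightarrow> 'x::complex_banach"
  assumes "(G has_derivative (\<lambda>h. h *\<^sub>C d)) (at (ray s a))"
  shows "((\<lambda>s. G (ray s a)) has_vector_derivative (ray s a *\<^sub>C d)) (at s within S)"
    and "((\<lambda>a. G (ray s a)) has_vector_derivative (\<i> *\<^sub>C ray s a *\<^sub>C d)) (at a within T)"
proof -
  have G: "(G has_derivative (\<lambda>h. h *\<^sub>C d)) (at (ray s a) within R)" for R
    using assms by (rule has_derivative_at_withinI)
  show "((\<lambda>s. G (ray s a)) has_vector_derivative (ray s a *\<^sub>C d)) (at s within S)"
    using has_derivative_in_compose[OF ray_deriv_s[unfolded has_vector_derivative_def] G]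
    by (simp add: has_vector_derivative_def scaleC.scaleR_left)
  show "((\<lambda>a. G (ray s a)) has_vector_derivative (\<i> *\<^sub>C ray s a *\<^sub>C d)) (at a within T)"
    using has_derivative_in_compose[OF ray_deriv_a[unfolded has_vector_derivative_def] G]
    by (simp add: has_vector_derivative_def scaleC.scaleR_left scaleC_scaleC)
qed

text \<open>In logarithmic coordinates the Cauchy-Riemann equations say that the derivative in the
  angle is \<i> times the derivative in s. Differentiation under the integral therefore leaves only
  the end values.\<close>

lemma ray_integral_deriv:
  fixes G G' :: "complex \<Rightarrow> 'x::complex_banach"
  assumes d: "\<And>s \<alpha>. \<alpha> \<in> {a..b} \<Longrightarrow> (G has_derivative (\<lambda>h. h *\<^sub>C G' (ray s \<alpha>))) (at (ray s \<alpha>))"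
    and c: "continuous_on (UNIV \<times> {a..b}) (\<lambda>(s,\<alpha>). G' (ray s \<alpha>))"
    and \<alpha>: "\<alpha> \<in> {a..b}" and n: "0 \<le> n"
  shows "((\<lambda>\<alpha>. integral {-n..n} (\<lambda>s. G (ray s \<alpha>))) has_vector_derivative
           \<i> *\<^sub>C (G (ray n \<alpha>) - G (ray (-n) \<alpha>))) (at \<alpha> within {a..b})"
proof -
  have c': "continuous_on ({a..b} \<times> UNIV) (\<lambda>(\<alpha>,s). ray s \<alpha> *\<^sub>C G' (ray s \<alpha>))"
  proof -
    have 1: "continuous_on ({a..b} \<times> UNIV) (\<lambda>p. G' (ray (snd p) (fst p)))"
      by (rule continuous_on_compose2[OF c, of "{a..b} \<times> UNIV" "\<lambda>p. (snd p, fst p)", unfolded prod.case])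
        (auto intro!: continuous_intros)
    have 2: "continuous_on ({a..b} \<times> UNIV) (\<lambda>p. ray (snd p) (fst p))"
      by (rule continuous_on_compose2[OF ray_continuous[of UNIV], of "{a..b} \<times> UNIV" "\<lambda>p. (snd p, fst p)", unfolded prod.case])
        (auto intro!: continuous_intros)
    show ?thesis unfolding case_prod_unfold
      by (rule scaleC.continuous_on[OF 2 1])
  qed
  have Gc: "continuous_on UNIV (\<lambda>s. G (ray s \<alpha>))" if "\<alpha> \<in> {a..b}" for \<alpha>
  proof -
    have "isCont (\<lambda>s. G (ray s \<alpha>)) s" for s
      using ray_deriv_compose(1)[OF d[OF that], where S=UNIV]
      using has_vector_derivative_continuous by blast
    then show ?thesis by (simp add: continuous_at_imp_continuous_on)
  qed
  have "((\<lambda>\<alpha>. integral (cbox (-n) n) (\<lambda>s. G (ray s \<alpha>))) has_vector_derivative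
           integral (cbox (-n) n) (\<lambda>s. \<i> *\<^sub>C ray s \<alpha> *\<^sub>C G' (ray s \<alpha>))) (at \<alpha> within {a..b})"
  proof (rule leibniz_rule_vector_derivative)
    show "((\<lambda>\<alpha>. G (ray s \<alpha>)) has_vector_derivative \<i> *\<^sub>C ray s \<alpha> *\<^sub>C G' (ray s \<alpha>)) (at \<alpha> within {a..b})"
      if "\<alpha> \<in> {a..b}" for \<alpha> s
      by (rule ray_deriv_compose(2)[OF d[OF that]])
    show "(\<lambda>s. G (ray s \<alpha>)) integrable_on cbox (- n) n" if "\<alpha> \<in> {a..b}" for \<alpha>
      by (rule integrable_continuous, rule continuous_on_subset[OF Gc[OF that]]) auto
    show "continuous_on ({a..b} \<times> cbox (- n) n) (\<lambda>(\<alpha>,s). \<i> *\<^sub>C ray s \<alpha> *\<^sub>C G' (ray s \<alpha>))"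
      unfolding case_prod_unfold
      by (rule scaleC.continuous_on[OF continuous_on_const continuous_on_subset[OF c'[unfolded case_prod_unfold]]]) auto
  qed (use \<alpha> in auto)
  moreover have "((\<lambda>s. ray s \<alpha> *\<^sub>C G' (ray s \<alpha>)) has_integral (G (ray n \<alpha>) - G (ray (-n) \<alpha>))) {-n..n}"
    using n by (intro fundamental_theorem_of_calculus ray_deriv_compose(1) d \<alpha>) auto
  then have "((\<lambda>s. \<i> *\<^sub>C ray s \<alpha> *\<^sub>C G' (ray s \<alpha>)) has_integral \<i> *\<^sub>C (G (ray n \<alpha>) - G (ray (-n) \<alpha>))) {-n..n}"
    using has_integral_linear[OF _ bounded_linear_scaleC_right[of \<i>]] by (auto simp: o_def)
  ultimately show ?thesis by (simp add: integral_unique)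
qed

text \<open>The vector y is the limit of the difference of end values. It is 0 for integrands that
  decay at both ends; y nonzero serves P(z) y, which tends to 0 at 0 and to y at infinity.\<close>

lemma ray_integral_diff_bound:
  fixes G G' :: "complex \<Rightarrow> 'x::complex_banach"
  assumes d: "\<And>s \<alpha>. \<alpha> \<in> {a..b} \<Longrightarrow> (G has_derivative (\<lambda>h. h *\<^sub>C G' (ray s \<alpha>))) (at (ray s \<alpha>))"
    and c: "continuous_on (UNIV \<times> {a..b}) (\<lambda>(s,\<alpha>). G' (ray s \<alpha>))"
    and n: "0 \<le> n" and ab: "a \<le> b"
    and bd: "\<And>\<alpha>. \<alpha> \<in> {a..b} \<Longrightarrow> norm (G (ray n \<alpha>) - G (ray (-n) \<alpha>) - y) \<le> \<delta>"
  shows "norm (integral {-n..n} (\<lambda>s. G (ray s b)) - integral {-n..n} (\<lambda>s. G (ray s a)) - (\<i> * (b - a)) *\<^sub>C y) \<le> \<delta> * (b - a)"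
proof -
  \<comment> \<open>Subtracting the expected linear motion in the angle leaves a function with small
    derivative, to which the mean value inequality applies.\<close>
  define K where "K \<alpha> = integral {-n..n} (\<lambda>s. G (ray s \<alpha>)) - \<alpha> *\<^sub>R \<i> *\<^sub>C y" for \<alpha>
  have K: "(K has_derivative (\<lambda>h. h *\<^sub>R \<i> *\<^sub>C (G (ray n \<alpha>) - G (ray (-n) \<alpha>) - y))) (at \<alpha> within {a..b})"
    if "\<alpha> \<in> {a..b}" for \<alpha>
    using has_derivative_diff[OF ray_integral_deriv[OF d c that n, unfolded has_vector_derivative_def]
        bounded_linear_imp_has_derivative[OF bounded_linear_scaleR_left, of "\<i> *\<^sub>C y"]]
    unfolding K_def scaleC.diff_right[of _ _ y] scaleR_diff_right[of _ _ "\<i> *\<^sub>C y"] .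
  have "norm (K b - K a) \<le> \<delta> * norm (b - a)"
  proof (rule differentiable_bound[of "{a..b}" K])
    show "onorm (\<lambda>h. h *\<^sub>R \<i> *\<^sub>C (G (ray n \<alpha>) - G (ray (-n) \<alpha>) - y)) \<le> \<delta>" if "\<alpha> \<in> {a..b}" for \<alpha>
    proof (rule onorm_le)
      fix h :: real
      show "norm (h *\<^sub>R \<i> *\<^sub>C (G (ray n \<alpha>) - G (ray (-n) \<alpha>) - y)) \<le> \<delta> * norm h"
        using mult_right_mono[OF bd[OF that] abs_ge_zero[of h]] unfolding norm_scaleR norm_scaleC by (simp add: mult.commute)
    qed
  qed (simp_all add: K ab)
  moreover have "K b - K a = integral {-n..n} (\<lambda>s. G (ray s b)) - integral {-n..n} (\<lambda>s. G (ray s a)) - (\<i> * (b - a)) *\<^sub>C y"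
  proof -
    have "(\<i> * (complex_of_real b - complex_of_real a)) *\<^sub>C y = b *\<^sub>R \<i> *\<^sub>C y - a *\<^sub>R \<i> *\<^sub>C y"
      unfolding scaleC_of_real[symmetric] scaleC_scaleC scaleC.diff_left[symmetric]
      by (simp add: algebra_simps)
    then show ?thesis unfolding K_def by (simp add: algebra_simps)
  qed
  ultimately show ?thesis using ab by simp
qed

text \<open>Cauchy's theorem for a sector, applied to \<open>G(z)/z\<close>.\<close>

lemma ray_integral_rotate:
  fixes G G' :: "complex \<Rightarrow> 'x::complex_banach"
  assumes d: "\<And>s \<alpha>. \<alpha> \<in> {a..b} \<Longrightarrow> (G has_derivative (\<lambda>h. h *\<^sub>C G' (ray s \<alpha>))) (at (ray s \<alpha>))"
    and c: "continuous_on (UNIV \<times> {a..b}) (\<lambda>(s,\<alpha>). G' (ray s \<alpha>))"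
    and ab: "a \<le> b" and e: "e > 0"
    and bd: "\<And>s \<alpha>. \<alpha> \<in> {a..b} \<Longrightarrow> norm (G (ray s \<alpha>)) \<le> C * exp (- e * \<bar>s\<bar>)"
  shows "integral UNIV (\<lambda>s. G (ray s a)) = integral UNIV (\<lambda>s. G (ray s b))"
proof -
  have Gc: "continuous_on UNIV (\<lambda>s. G (ray s \<alpha>))" if "\<alpha> \<in> {a..b}" for \<alpha>
  proof -
    have "isCont (\<lambda>s. G (ray s \<alpha>)) s" for s
      using ray_deriv_compose(1)[OF d[OF that], where S=UNIV]
      using has_vector_derivative_continuous by blast
    then show ?thesis by (simp add: continuous_at_imp_continuous_on)
  qed
  have L: "(\<lambda>n::nat. integral {-real n..real n} (\<lambda>s. G (ray s \<alpha>))) \<longlonglongrightarrow> integral UNIV (\<lambda>s. G (ray s \<alpha>))"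
    if "\<alpha> \<in> {a..b}" for \<alpha>
    by (rule exp_dec_integral_limit[OF Gc[OF that] e bd[OF that]])
  have "(\<lambda>n::nat. integral {-real n..real n} (\<lambda>s. G (ray s b)) - integral {-real n..real n} (\<lambda>s. G (ray s a))) \<longlonglongrightarrow> 0"
  proof (rule Lim_null_comparison)
    show "\<forall>\<^sub>F n in sequentially. norm (integral {-real n..real n} (\<lambda>s. G (ray s b)) - integral {-real n..real n} (\<lambda>s. G (ray s a))) \<le> (2 * C * (b - a)) * exp (- (2 * e) * real n / 2)"
    proof (rule always_eventually, rule allI)
      fix n :: nat
      have "norm (G (ray (real n) \<alpha>) - G (ray (- real n) \<alpha>) - 0) \<le> 2 * C * exp (- e * real n)" if "\<alpha> \<in> {a..b}" for \<alpha>
        using bd[OF that, of "real n"] bd[OF that, of "- real n"] norm_triangle_ineq4[of "G (ray (real n) \<alpha>)" "G (ray (- real n) \<alpha>)"]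
        by simp
      from ray_integral_diff_bound[OF d c _ ab this]
      show "norm (integral {-real n..real n} (\<lambda>s. G (ray s b)) - integral {-real n..real n} (\<lambda>s. G (ray s a))) \<le> (2 * C * (b - a)) * exp (- (2 * e) * real n / 2)"
        by (simp add: algebra_simps)
    qed
    show "(\<lambda>n. (2 * C * (b - a)) * exp (- (2 * e) * real n / 2)) \<longlonglongrightarrow> 0"
      using e by (intro exp_neg_half_tendsto_0) auto
  qed
  then have "integral UNIV (\<lambda>s. G (ray s b)) - integral UNIV (\<lambda>s. G (ray s a)) = 0"
    using ab by (intro LIMSEQ_unique[OF tendsto_diff[OF L[of b] L[of a]]]) auto
  then show ?thesis by simp
qed


section \<open>Banach function spaces with the Fatou property\<close>

text \<open>Hypothesis \<open>ex\<close> says that the lower limit of r is at most S, in the form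
  that a supremum of infima delivers; monotonicity and continuity of the power carry it
  over.\<close>

lemma liminf_powr_le:
  fixes r :: "nat \<Rightarrow> real"
  assumes r: "\<And>k. r k \<ge> 0" and S: "S \<ge> 0" and p: "p > 0"
    and ex: "\<And>n \<delta>. \<delta> > 0 \<Longrightarrow> \<exists>k\<ge>n. r k < S + \<delta>"
  shows "liminf (\<lambda>k. ennreal (r k powr p)) \<le> ennreal (S powr p)"
proof -
  have A: "liminf (\<lambda>k. ennreal (r k powr p)) \<le> ennreal ((S + 1 / (real j + 1)) powr p)" for j
  proof -
    have "(INF k\<in>{n..}. ennreal (r k powr p)) \<le> ennreal ((S + 1 / (real j + 1)) powr p)" for n
    proof -
      obtain k where "k \<ge> n" "r k < S + 1 / (real j + 1)" using ex[of "1 / (real j + 1)" n] by auto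
      then show ?thesis using r[of k] p
        by (intro INF_lower2[of k] ennreal_leI powr_mono2) auto
    qed
    then show ?thesis unfolding liminf_SUP_INF by (rule SUP_least)
  qed
  have "(\<lambda>j. S + 1 / (real j + 1)) \<longlonglongrightarrow> S + 0"
    using LIMSEQ_inverse_real_of_nat by (intro tendsto_add tendsto_const) (simp add: inverse_eq_divide add.commute)
  then have "(\<lambda>j. (S + 1 / (real j + 1)) powr p) \<longlonglongrightarrow> S powr p"
    using p S by (intro tendsto_powr') auto
  then have "(\<lambda>j. ennreal ((S + 1 / (real j + 1)) powr p)) \<longlonglongrightarrow> ennreal (S powr p)"
    by (rule tendsto_ennrealI)
  then show ?thesis by (rule LIMSEQ_le_const) (use A in auto)
qed

text \<open>Makes \<open>bfn p\<close> additive: |y|^p + |z|^p is dominated by (|y| + |z|)^p, and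
  the triangle inequality of the space does the rest.\<close>

lemma powr_add_superadditive:
  fixes a b p :: real
  assumes "a \<ge> 0" "b \<ge> 0" "p \<ge> 1"
  shows "a powr p + b powr p \<le> (a + b) powr p"
proof (cases "a + b = 0")
  case False
  then have ab: "a + b > 0" using assms by auto
  have "x powr p = x * x powr (p - 1)" if "x \<ge> 0" for x :: real
    using that powr_mult_base[of x "p - 1"] by simp
  note P = this
  have "a powr p + b powr p = a * a powr (p-1) + b * b powr (p-1)"
    using assms by (simp add: P)
  also have "\<dots> \<le> a * (a + b) powr (p-1) + b * (a + b) powr (p-1)"
    using assms by (intro add_mono mult_left_mono powr_mono2) auto
  also have "\<dots> = (a + b) powr p" using P[of "a+b"] ab by (simp add: algebra_simps)
  finally show ?thesis .
next
  case True
  then have "a = 0" "b = 0" using assms by auto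
  then show ?thesis by simp
qed

text \<open>The convex function h^q lies above its tangent at a; this is Young's inequality with the
  weights 1/q and 1 - 1/q, a form that includes q = 1.\<close>

lemma powr_tangent:
  fixes a h q :: real
  assumes "a > 0" "h \<ge> 0" "q \<ge> 1"
  shows "q * a powr (q - 1) * h \<le> h powr q + (q - 1) * a powr q"
proof (cases "h = 0")
  case False
  have "(h powr q) powr (1/q) * (a powr q) powr (1 - 1/q) \<le> 1/q * h powr q + (1 - 1/q) * a powr q"
    using assms False by (intro Youngs_inequality_0) auto
  moreover have "(h powr q) powr (1/q) = h" using assms False by (simp add: powr_powr)
  moreover have "(a powr q) powr (1 - 1/q) = a powr (q - 1)"
    using assms by (simp add: powr_powr right_diff_distrib)
  ultimately have "h * a powr (q - 1) \<le> 1/q * h powr q + (1 - 1/q) * a powr q" by simp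
  then have "q * (h * a powr (q - 1)) \<le> q * (1/q * h powr q + (1 - 1/q) * a powr q)"
    using assms by (intro mult_left_mono) auto
  then show ?thesis using assms by (simp add: algebra_simps)
qed (use assms in auto)

text \<open>Jensen's inequality for the measure k dN of mass at most L, obtained by integrating the
  tangent inequality against k. As r is only a lower bound for the integral of k h, it can be the
  modulus of a complex integral.\<close>

lemma nn_integral_powr_jensen:
  fixes k h :: "'b \<Rightarrow> real"
  assumes [measurable]: "k \<in> borel_measurable N" "h \<in> borel_measurable N"
    and pos: "\<And>s. k s \<ge> 0" "\<And>s. h s \<ge> 0" and q: "q \<ge> 1" and r: "r \<ge> 0" and L: "L > 0"
    and le: "ennreal r \<le> (\<integral>\<^sup>+s. ennreal (k s * h s) \<partial>N)"
    and kL: "(\<integral>\<^sup>+s. ennreal (k s) \<partial>N) \<le> ennreal L"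
  shows "ennreal (r powr q) \<le> ennreal (L powr (q - 1)) * (\<integral>\<^sup>+s. ennreal (k s * h s powr q) \<partial>N)"
proof (cases "r = 0 \<or> (\<integral>\<^sup>+s. ennreal (k s * h s powr q) \<partial>N) = top")
  case True
  then show ?thesis using L by (auto simp: ennreal_mult_top)
next
  case False
  then obtain I where I: "(\<integral>\<^sup>+s. ennreal (k s * h s powr q) \<partial>N) = ennreal I" "I \<ge> 0"
    using ennreal_cases by blast
  \<comment> \<open>With the tangent point r / L the term (q - 1) a^q L equals (q - 1) a^(q - 1) r,
    which leaves one copy of a^(q - 1) r on the left.\<close>
  define a where "a = r / L"
  have a: "a > 0" using False r L by (auto simp: a_def)
  have "ennreal (q * a powr (q-1) * r) \<le> ennreal (q * a powr (q-1)) * (\<integral>\<^sup>+s. ennreal (k s * h s) \<partial>N)"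
    using le q r by (simp add: ennreal_mult mult_left_mono)
  also have "\<dots> = (\<integral>\<^sup>+s. ennreal (q * a powr (q-1)) * ennreal (k s * h s) \<partial>N)"
    by (rule nn_integral_cmult[symmetric]) simp
  also have "\<dots> \<le> (\<integral>\<^sup>+s. ennreal (k s * h s powr q) + ennreal ((q - 1) * a powr q) * ennreal (k s) \<partial>N)"
  proof (rule nn_integral_mono)
    fix s
    have "k s * (q * a powr (q - 1) * h s) \<le> k s * (h s powr q + (q - 1) * a powr q)"
      by (intro mult_left_mono powr_tangent a q pos)
    then have "ennreal (q * a powr (q-1) * (k s * h s)) \<le> ennreal (k s * h s powr q + (q - 1) * a powr q * k s)"
      by (intro ennreal_leI) (simp add: algebra_simps)
    moreover have "ennreal (k s * h s powr q + (q - 1) * a powr q * k s) = ennreal (k s * h s powr q) + ennreal ((q - 1) * a powr q) * ennreal (k s)"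
      using q pos[of s] by (subst ennreal_plus) (auto simp: ennreal_mult)
    moreover have "ennreal (q * a powr (q-1) * (k s * h s)) = ennreal (q * a powr (q-1)) * ennreal (k s * h s)"
      using q pos[of s] by (intro ennreal_mult) auto
    ultimately show "ennreal (q * a powr (q-1)) * ennreal (k s * h s) \<le> ennreal (k s * h s powr q) + ennreal ((q - 1) * a powr q) * ennreal (k s)"
      by simp
  qed
  also have "\<dots> = ennreal I + ennreal ((q - 1) * a powr q) * (\<integral>\<^sup>+s. ennreal (k s) \<partial>N)"
    by (subst nn_integral_add) (auto simp: nn_integral_cmult I)
  also have "\<dots> \<le> ennreal I + ennreal ((q - 1) * a powr q) * ennreal L"
    by (intro add_mono mult_left_mono kL) auto
  also have "\<dots> = ennreal (I + (q - 1) * a powr q * L)"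
    using q I L by (simp add: ennreal_mult[symmetric] ennreal_plus[symmetric] del: ennreal_plus)
  finally have "q * a powr (q-1) * r \<le> I + (q - 1) * a powr q * L"
    using I q L by (subst (asm) ennreal_le_iff) auto
  moreover have aq: "a powr q * L = a powr (q-1) * r"
    using a L powr_mult_base[of a "q-1"] by (simp add: a_def field_simps)
  then have "(q - 1) * a powr q * L = (q - 1) * (a powr (q-1) * r)" by simp
  ultimately have "a powr (q-1) * r \<le> I" by (simp add: algebra_simps)
  then have "L powr (q - 1) * (a powr (q-1) * r) \<le> L powr (q - 1) * I"
    by (intro mult_left_mono) auto
  moreover have "L powr (q - 1) * (a powr (q-1) * r) = r powr q"
    using L r powr_mult_base[of r "q-1"] by (simp add: a_def powr_divide mult.commute)
  ultimately show ?thesis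
    using I by (simp add: ennreal_mult[symmetric] ennreal_leI)
qed

locale fatou_bfs = banach_function_space M emb
  for M :: "'a measure" and emb :: "'x::complex_banach \<Rightarrow> 'a \<Rightarrow> complex" +
  assumes fatou: "fatou_property M emb"
begin

declare emb_measurable [measurable]

sublocale LM: pair_sigma_finite lborel M ..

lemma emb_0: "AE w in M. emb 0 w = 0"
  using emb_scaleC[of 0 0] by simp

lemma emb_diff: "AE w in M. emb (x - y) w = emb x w - emb y w"
  using emb_add[of "x - y" y] by (auto elim!: eventually_mono)

lemma emb_scaleR: "AE w in M. emb (r *\<^sub>R x) w = of_real r * emb x w"
  using emb_scaleC[of "of_real r" x] by (simp add: scaleC_of_real)

lemma norm_mono_AE:
  assumes "AE w in M. cmod (emb x w) \<le> cmod (emb y w)"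
  shows "norm x \<le> norm y"
  using ideal[OF emb_measurable assms] emb_inj by blast

text \<open>\<open>bfn p g K\<close> says that \<open>g\<^sup>1\<^sup>/\<^sup>p\<close> is dominated by an element of norm at most \<open>K\<close>.\<close>

definition bfn :: "real \<Rightarrow> ('a \<Rightarrow> ennreal) \<Rightarrow> real \<Rightarrow> bool" where
  "bfn p g K \<longleftrightarrow> (\<exists>y. (AE w in M. g w \<le> ennreal (cmod (emb y w) powr p)) \<and> norm y \<le> K)"

lemma bfn_mono:
  assumes "bfn p g K" "AE w in M. h w \<le> g w" "K \<le> L"
  shows "bfn p h L"
proof -
  obtain y where "AE w in M. g w \<le> ennreal (cmod (emb y w) powr p)" "norm y \<le> K"
    using assms(1) by (auto simp: bfn_def)
  moreover from this(1) assms(2) have "AE w in M. h w \<le> ennreal (cmod (emb y w) powr p)"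
    by eventually_elim auto
  ultimately show ?thesis using assms(3) by (auto simp: bfn_def)
qed

lemma bfn_emb: "norm x \<le> K \<Longrightarrow> bfn p (\<lambda>w. ennreal (cmod (emb x w) powr p)) K"
  by (auto simp: bfn_def)

lemma bfn_normD:
  assumes "bfn p (\<lambda>w. ennreal (cmod (emb x w) powr p)) K" "p > 0"
  shows "norm x \<le> K"
proof -
  obtain y where y: "AE w in M. ennreal (cmod (emb x w) powr p) \<le> ennreal (cmod (emb y w) powr p)" "norm y \<le> K"
    using assms(1) by (auto simp: bfn_def)
  from y(1) have "AE w in M. cmod (emb x w) \<le> cmod (emb y w)"
    by eventually_elim (metis assms(2) ennreal_le_iff norm_ge_zero powr_ge_zero powr_less_mono2 not_less)
  then show ?thesis using norm_mono_AE y(2) by fastforce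
qed

lemma bfn_AE_finite:
  assumes "bfn p g K"
  shows "AE w in M. g w < \<infinity>"
proof -
  obtain y where "AE w in M. g w \<le> ennreal (cmod (emb y w) powr p)"
    using assms by (auto simp: bfn_def)
  then show ?thesis by eventually_elim (auto simp: order_le_less_trans)
qed

lemma bfn_scale:
  assumes "bfn p g K" "c \<ge> 0"
  shows "bfn p (\<lambda>w. ennreal (c powr p) * g w) (c * K)"
proof -
  obtain y where y: "AE w in M. g w \<le> ennreal (cmod (emb y w) powr p)" "norm y \<le> K"
    using assms(1) by (auto simp: bfn_def)
  from y(1) emb_scaleR[of c y]
  have "AE w in M. ennreal (c powr p) * g w \<le> ennreal (cmod (emb (c *\<^sub>R y) w) powr p)"
  proof eventually_elim
    case (elim w)
    then have "ennreal (c powr p) * g w \<le> ennreal (c powr p) * ennreal (cmod (emb y w) powr p)"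
      by (intro mult_left_mono) auto
    with elim assms(2) show ?case by (simp add: norm_mult powr_mult ennreal_mult)
  qed
  moreover have "norm (c *\<^sub>R y) \<le> c * K" using y(2) assms(2) by (simp add: mult_left_mono)
  ultimately show ?thesis by (auto simp: bfn_def)
qed

lemma abs_exists: "\<exists>y. (AE w in M. emb y w = complex_of_real (cmod (emb x w))) \<and> norm y \<le> norm x"
  by (rule ideal) auto

lemma bfn_add:
  assumes "bfn p g K" "bfn p h L" "p \<ge> 1"
  shows "bfn p (\<lambda>w. g w + h w) (K + L)"
proof -
  obtain y z where y: "AE w in M. g w \<le> ennreal (cmod (emb y w) powr p)" "norm y \<le> K"
    and z: "AE w in M. h w \<le> ennreal (cmod (emb z w) powr p)" "norm z \<le> L"
    using assms by (auto simp: bfn_def)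
  \<comment> \<open>The moduli are added instead of y and z, whose sum could cancel.\<close>
  obtain y' z' where y': "AE w in M. emb y' w = complex_of_real (cmod (emb y w))" "norm y' \<le> norm y"
    and z': "AE w in M. emb z' w = complex_of_real (cmod (emb z w))" "norm z' \<le> norm z"
    using abs_exists by meson
  from y(1) z(1) y'(1) z'(1) emb_add[of y' z']
  have "AE w in M. g w + h w \<le> ennreal (cmod (emb (y' + z') w) powr p)"
  proof eventually_elim
    case (elim w)
    have "cmod (emb (y' + z') w) = cmod (emb y w) + cmod (emb z w)"
      using elim by (simp add: of_real_add[symmetric] del: of_real_add)
    moreover have "g w + h w \<le> ennreal (cmod (emb y w) powr p + cmod (emb z w) powr p)"
      using elim by (subst ennreal_plus) (auto intro: add_mono)
    moreover have "ennreal (cmod (emb y w) powr p + cmod (emb z w) powr p) \<le> ennreal ((cmod (emb y w) + cmod (emb z w)) powr p)"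
      by (intro ennreal_leI powr_add_superadditive assms(3)) auto
    ultimately show ?case by simp
  qed
  moreover have "norm (y' + z') \<le> K + L"
    using y(2) z(2) y'(2) z'(2) norm_triangle_ineq[of y' z'] by linarith
  ultimately show ?thesis by (auto simp: bfn_def)
qed

lemma bfn_0: "K \<ge> 0 \<Longrightarrow> bfn p (\<lambda>w. 0) K"
  unfolding bfn_def by (rule exI[of _ 0]) auto

lemma bfn_sum:
  assumes "finite J" "\<And>j. j \<in> J \<Longrightarrow> bfn p (g j) (K j)" "p \<ge> 1"
  shows "bfn p (\<lambda>w. \<Sum>j\<in>J. g j w) (\<Sum>j\<in>J. K j)"
  using assms(1,2) by (induction J rule: finite_induct) (auto intro: bfn_0 bfn_add assms(3))

text \<open>Fatou's lemma for the function space: the dominating elements are replaced by the infima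
  of |y k| over k >= n. These lie in the space by the ideal property, increase with n and keep the
  bound K, so the Fatou property supplies their supremum.\<close>

lemma bfn_liminf:
  assumes "\<And>n. bfn p (g n) K" "p > 0"
  shows "bfn p (\<lambda>w. liminf (\<lambda>n. g n w)) K"
proof -
  obtain y where y: "\<And>n. AE w in M. g n w \<le> ennreal (cmod (emb (y n) w) powr p)" "\<And>n. norm (y n) \<le> K"
    using assms(1) unfolding bfn_def by metis
  define m where "m n w = (INF k\<in>{n..}. cmod (emb (y k) w))" for n w
  have bdd: "bdd_below ((\<lambda>k. cmod (emb (y k) w)) ` {n..})" for n w
    by (rule bdd_belowI[of _ 0]) auto
  have m0: "m n w \<ge> 0" for n w unfolding m_def by (rule cINF_greatest) auto
  have mle: "m n w \<le> cmod (emb (y k) w)" if "k \<ge> n" for n k w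
    unfolding m_def using that bdd by (intro cINF_lower) auto
  have mmono: "m n w \<le> m (Suc n) w" for n w
    unfolding m_def by (rule cINF_superset_mono) (use bdd in auto)
  have [measurable]: "m n \<in> borel_measurable M" for n
    unfolding m_def by measurable
  have "\<exists>z. (AE w in M. emb z w = complex_of_real (m n w)) \<and> norm z \<le> norm (y n)" for n
    by (rule ideal) (auto simp: m0 mle)
  then obtain z where z: "\<And>n. AE w in M. emb (z n) w = complex_of_real (m n w)" "\<And>n. norm (z n) \<le> norm (y n)"
    by metis
  have zK: "norm (z n) \<le> K" for n using z(2)[of n] y(2)[of n] by simp
  have "\<exists>f. (AE w in M. bdd_above (range (\<lambda>n. Re (emb (z n) w))) \<and>
                            emb f w = complex_of_real (SUP n. Re (emb (z n) w))) \<and>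
                 norm f = (SUP n. norm (z n))"
    using fatou unfolding fatou_property_def
  proof (elim allE[of _ z] impE, intro conjI allI)
    show "AE w in M. emb (z n) w \<in> \<real>\<^sub>\<ge>\<^sub>0 \<and> emb (z (Suc n)) w \<in> \<real>\<^sub>\<ge>\<^sub>0 \<and> Re (emb (z n) w) \<le> Re (emb (z (Suc n)) w)" for n
      using z(1)[of n] z(1)[of "Suc n"] by eventually_elim (auto simp: m0 mmono nonneg_Reals_of_real_iff)
    show "bdd_above (range (\<lambda>n. norm (z n)))" by (rule bdd_aboveI[of _ K]) (use zK in auto)
  qed
  then obtain f where f: "AE w in M. bdd_above (range (\<lambda>n. Re (emb (z n) w))) \<and>
                            emb f w = complex_of_real (SUP n. Re (emb (z n) w))" "norm f = (SUP n. norm (z n))"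
    by blast
  have "AE w in M. \<forall>n. emb (z n) w = complex_of_real (m n w)" "AE w in M. \<forall>n. g n w \<le> ennreal (cmod (emb (y n) w) powr p)"
    using z(1) y(1) by (simp_all add: AE_all_countable)
  with f(1) have "AE w in M. liminf (\<lambda>n. g n w) \<le> ennreal (cmod (emb f w) powr p)"
  proof eventually_elim
    case (elim w)
    define S where "S = (SUP n. m n w)"
    have b: "bdd_above (range (\<lambda>n. m n w))" using elim by simp
    have Sn: "m n w \<le> S" for n unfolding S_def by (rule cSUP_upper[OF _ b]) auto
    have S0: "S \<ge> 0" using Sn[of 0] m0[of 0 w] by simp
    have "liminf (\<lambda>n. g n w) \<le> liminf (\<lambda>n. ennreal (cmod (emb (y n) w) powr p))"
      using elim by (intro Liminf_mono always_eventually) auto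
    also have "\<dots> \<le> ennreal (S powr p)"
    proof (rule liminf_powr_le)
      fix n and \<delta> :: real assume "\<delta> > 0"
      show "\<exists>k\<ge>n. cmod (emb (y k) w) < S + \<delta>"
      proof (rule ccontr)
        assume "\<not> ?thesis"
        then have "S + \<delta> \<le> m n w" unfolding m_def by (intro cINF_greatest) (auto simp: not_less)
        with Sn[of n] \<open>\<delta> > 0\<close> show False by simp
      qed
    qed (use S0 assms in auto)
    also have "S = cmod (emb f w)" using elim S0 by (simp add: S_def)
    finally show ?case .
  qed
  moreover have "norm f \<le> K" unfolding f(2) by (rule cSUP_least) (auto simp: zK)
  ultimately show ?thesis by (auto simp: bfn_def)
qed

lemma bfn_suminf:
  assumes "\<And>n. bfn 1 (g n) (K n)" "\<And>n. (\<Sum>k<n. K k) \<le> L"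
  shows "bfn 1 (\<lambda>w. \<Sum>n. g n w) L"
proof -
  have "bfn 1 (\<lambda>w. \<Sum>k<n. g k w) L" for n
    by (rule bfn_mono[OF bfn_sum[OF finite_lessThan assms(1)]]) (auto intro: assms(2))
  then have "bfn 1 (\<lambda>w. liminf (\<lambda>n. \<Sum>k<n. g k w)) L"
    by (rule bfn_liminf) simp
  moreover have "liminf (\<lambda>n. \<Sum>k<n. g k w) = (\<Sum>n. g n w)" for w
    by (rule lim_imp_Liminf) (auto intro: summable_LIMSEQ)
  ultimately show ?thesis by simp
qed

text \<open>The series of the g n is dominated by an element of the space, hence finite almost
  everywhere, so its terms tend to 0.\<close>

lemma bfn_geometric_tendsto_0:
  assumes "\<And>n. bfn 1 (g n) (C * (1/2) ^ n)"
  shows "AE w in M. (\<lambda>n. g n w) \<longlonglongrightarrow> 0"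
proof -
  obtain y :: 'x where "norm y \<le> C" using assms[of 0] by (auto simp: bfn_def)
  then have C: "C \<ge> 0" by (rule order_trans[OF norm_ge_zero])
  have "bfn 1 (\<lambda>w. \<Sum>n. g n w) (C * 2)"
  proof (rule bfn_suminf[OF assms])
    fix n
    have "(\<Sum>k<n. (1/2::real) ^ k) \<le> (\<Sum>k. (1/2) ^ k)" by (intro sum_le_suminf) (auto simp: summable_geometric)
    then have "(\<Sum>k<n. (1/2::real) ^ k) \<le> 2" by (simp add: suminf_geometric)
    then show "(\<Sum>k<n. C * (1/2) ^ k) \<le> C * 2"
      unfolding sum_distrib_left[symmetric] using C by (intro mult_left_mono)
  qed
  from bfn_AE_finite[OF this] show ?thesis
  proof eventually_elim
    case (elim w)
    then have fin: "g n w < top" for n using ennreal_suminf_lessD by auto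
    have e: "g n w = ennreal (enn2real (g n w))" for n using fin by (simp add: ennreal_enn2real)
    have "(\<Sum>n. ennreal (enn2real (g n w))) \<noteq> top" using elim e by simp
    then have "summable (\<lambda>n. enn2real (g n w))" by (intro summable_suminf_not_top) auto
    then have "(\<lambda>n. ennreal (enn2real (g n w))) \<longlonglongrightarrow> ennreal 0"
      by (intro tendsto_ennrealI summable_LIMSEQ_zero)
    with e show ?case by simp
  qed
qed

text \<open>Norm convergence at a geometric rate implies convergence almost everywhere along the
  whole sequence; this is why approximations below have error (1/2)^n. The bound is asked only from
  some N on, since estimates on [-n, n] reach a given s eventually.\<close>

lemma emb_fast_tendsto:
  assumes "\<And>n. n \<ge> N \<Longrightarrow> norm (x n - y) \<le> (1/2) ^ n"
  shows "AE w in M. (\<lambda>n. emb (x n) w) \<longlonglongrightarrow> emb y w"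
proof -
  have "AE w in M. (\<lambda>n. ennreal (cmod (emb (x (n + N) - y) w) powr 1)) \<longlonglongrightarrow> 0"
  proof (rule bfn_geometric_tendsto_0[of _ 1])
    show "bfn 1 (\<lambda>w. ennreal (cmod (emb (x (n + N) - y) w) powr 1)) (1 * (1/2) ^ n)" for n
      using order_trans[OF assms[of "n + N"] power_decreasing[of n "n+N" "1/2::real"]] by (intro bfn_emb) auto
  qed
  moreover have "AE w in M. \<forall>n. emb (x (n + N) - y) w = emb (x (n + N)) w - emb y w"
    by (simp add: AE_all_countable emb_diff)
  ultimately show ?thesis
  proof eventually_elim
    case (elim w)
    then have "(\<lambda>n. ennreal (cmod (emb (x (n + N)) w - emb y w))) \<longlonglongrightarrow> ennreal 0" by simp
    then have "(\<lambda>n. cmod (emb (x (n + N)) w - emb y w)) \<longlonglongrightarrow> 0"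
      by (subst (asm) tendsto_ennreal_iff) auto
    then have "(\<lambda>n. emb (x (n + N)) w - emb y w) \<longlonglongrightarrow> 0" by (simp add: tendsto_norm_zero_iff)
    then have "(\<lambda>n. emb (x (n + N)) w) \<longlonglongrightarrow> emb y w" by (rule LIM_zero_cancel)
    then show ?case by (rule LIMSEQ_offset)
  qed
qed

lemma bfn_small_AE_0:
  assumes "\<And>\<epsilon>. \<epsilon> > 0 \<Longrightarrow> bfn 1 g \<epsilon>"
  shows "AE w in M. g w = 0"
proof -
  have "AE w in M. (\<lambda>n::nat. g w) \<longlonglongrightarrow> 0"
    by (rule bfn_geometric_tendsto_0[of "\<lambda>n. g" 1]) (auto intro: assms)
  then show ?thesis by eventually_elim (auto simp: LIMSEQ_const_iff)
qed

section \<open>Jointly measurable versions\<close>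

text \<open>Fubini in (s, w) needs a jointly measurable function, whereas \<open>emb (f s)\<close>
  is chosen separately for each s.\<close>

definition version :: "(real \<times> 'a \<Rightarrow> complex) \<Rightarrow> (real \<Rightarrow> 'x) \<Rightarrow> bool" where
  "version F f \<longleftrightarrow> F \<in> borel_measurable (lborel \<Otimes>\<^sub>M M) \<and> (AE s in lborel. AE w in M. F (s, w) = emb (f s) w)"

lemma version_measurable [measurable_dest]: "version F f \<Longrightarrow> F \<in> borel_measurable (lborel \<Otimes>\<^sub>M M)"
  by (simp add: version_def)

definition step :: "nat \<Rightarrow> (real \<Rightarrow> 'x) \<Rightarrow> real \<Rightarrow> 'x" where
  "step n f s = f (of_int \<lfloor>s * 2 ^ n\<rfloor> / 2 ^ n)"

text \<open>Only countably many elements v j occur, so the arbitrary choice of their representatives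
  does not harm joint measurability.\<close>

lemma floor_family_measurable:
  "(\<lambda>p::real \<times> 'a. emb (v \<lfloor>fst p * c\<rfloor>) (snd p)) \<in> borel_measurable (lborel \<Otimes>\<^sub>M M)" for v :: "int \<Rightarrow> 'x"
proof (rule measurable_compose_countable[where g="\<lambda>p. \<lfloor>fst p * c\<rfloor>" and f="\<lambda>j p. emb (v j) (snd p)"])
  show "(\<lambda>p::real \<times> 'a. \<lfloor>fst p * c\<rfloor>) \<in> lborel \<Otimes>\<^sub>M M \<rightarrow>\<^sub>M count_space UNIV"
    by (rule measurable_compose[OF _ measurable_real_floor]) measurable
qed measurable

lemma step_version:
  "(\<lambda>p. emb (step n f (fst p)) (snd p)) \<in> borel_measurable (lborel \<Otimes>\<^sub>M M)"
  unfolding step_def by (rule floor_family_measurable[of "\<lambda>j. f (of_int j / 2 ^ n)"])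

lemma step_fast:
  assumes "continuous_on UNIV f"
  obtains r where "\<And>n s. \<bar>s\<bar> \<le> real n \<Longrightarrow> norm (step (r n) f s - f s) \<le> (1/2) ^ n"
proof -
  have "\<exists>r. \<forall>s. \<bar>s\<bar> \<le> real n \<longrightarrow> norm (step r f s - f s) \<le> (1/2) ^ n" for n
  proof -
    \<comment> \<open>The sample point lies at most 2^-r <= 1 to the left of s, hence the extra unit
      on the left.\<close>
    have "uniformly_continuous_on {- (real n + 1)..real n} f"
      by (rule compact_uniformly_continuous[OF continuous_on_subset[OF assms]]) auto
    then obtain d where d: "d > 0" "\<And>s t. s \<in> {- (real n + 1)..real n} \<Longrightarrow> t \<in> {- (real n + 1)..real n} \<Longrightarrow>
        dist t s < d \<Longrightarrow> dist (f t) (f s) < (1/2) ^ n"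
      unfolding uniformly_continuous_on_def by (metis zero_less_power half_gt_zero_iff zero_less_one)
    obtain r where r: "(1/2::real) ^ r < d" using real_arch_pow_inv[of d "1/2"] d(1) by auto
    show ?thesis
    proof (intro exI[of _ r] allI impI)
      fix s :: real assume s: "\<bar>s\<bar> \<le> real n"
      define t where "t = of_int \<lfloor>s * 2 ^ r\<rfloor> / (2::real) ^ r"
      have "of_int \<lfloor>s * 2 ^ r\<rfloor> \<le> s * 2 ^ r" "s * 2 ^ r < of_int \<lfloor>s * 2 ^ r\<rfloor> + 1" by linarith+
      then have t: "t \<le> s" "s < t + (1/2) ^ r"
        by (auto simp: t_def field_simps power_one_over)
      moreover have "(1/2::real) ^ r \<le> 1" by (simp add: power_le_one)
      ultimately have "dist (f t) (f s) < (1/2) ^ n" using s r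
        by (intro d(2)) (auto simp: dist_real_def)
      then show "norm (step r f s - f s) \<le> (1/2) ^ n" by (simp add: step_def t_def dist_norm)
    qed
  qed
  then show ?thesis using that by metis
qed

text \<open>The version is the pointwise limit of fast step approximations. It represents f s for
  every single s, not just almost every one.\<close>

lemma version_exists:
  assumes "continuous_on UNIV f"
  obtains F where "version F f" "\<And>s. AE w in M. F (s, w) = emb (f s) w"
proof -
  obtain r where r: "\<And>n s. \<bar>s\<bar> \<le> real n \<Longrightarrow> norm (step (r n) f s - f s) \<le> (1/2) ^ n"
    using step_fast[OF assms] by blast
  define F where "F p = lim (\<lambda>n. emb (step (r n) f (fst p)) (snd p))" for p
  have m: "F \<in> borel_measurable (lborel \<Otimes>\<^sub>M M)"
    unfolding F_def by (intro borel_measurable_lim_metric step_version)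
  have "AE w in M. F (s, w) = emb (f s) w" for s
  proof -
    obtain N :: nat where N: "\<bar>s\<bar> \<le> real N" using real_arch_simple by blast
    have "AE w in M. (\<lambda>n. emb (step (r n) f s) w) \<longlonglongrightarrow> emb (f s) w"
      by (rule emb_fast_tendsto[of N]) (use N r in force)
    then show ?thesis by eventually_elim (auto simp: F_def limI)
  qed
  with m that show ?thesis unfolding version_def by auto
qed

lemma AE_swap:
  assumes "{p \<in> space (lborel \<Otimes>\<^sub>M M). P p} \<in> sets (lborel \<Otimes>\<^sub>M M)" "AE s in lborel. AE w in M. P (s, w)"
  shows "AE w in M. AE s in lborel. P (s, w)"
  using LM.AE_commute[of "\<lambda>s w. P (s, w)"] assms by simp

lemma version_unique:
  assumes "version F f" "version G f"
  shows "AE w in M. AE s in lborel. F (s, w) = G (s, w)"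
proof (rule AE_swap)
  have [measurable]: "F \<in> borel_measurable (lborel \<Otimes>\<^sub>M M)" "G \<in> borel_measurable (lborel \<Otimes>\<^sub>M M)"
    using assms by (auto simp: version_def)
  show "{p \<in> space (lborel \<Otimes>\<^sub>M M). F p = G p} \<in> sets (lborel \<Otimes>\<^sub>M M)" by measurable
  have "AE s in lborel. AE w in M. F (s, w) = emb (f s) w" "AE s in lborel. AE w in M. G (s, w) = emb (f s) w"
    using assms by (auto simp: version_def)
  then show "AE s in lborel. AE w in M. F (s, w) = G (s, w)"
  proof eventually_elim
    case (elim s) then show ?case by eventually_elim simp
  qed
qed

abbreviation LQ :: "real \<Rightarrow> (real \<times> 'a \<Rightarrow> complex) \<Rightarrow> 'a \<Rightarrow> ennreal" where
  "LQ q F w \<equiv> \<integral>\<^sup>+s. ennreal (cmod (F (s, w)) powr q) \<partial>lborel"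

text \<open>Fatou's lemma twice: for the integral in s at fixed w, then for the function
  space.\<close>

lemma bfn_LQ_liminf:
  assumes m: "\<And>n. G n \<in> borel_measurable (lborel \<Otimes>\<^sub>M M)" "F \<in> borel_measurable (lborel \<Otimes>\<^sub>M M)"
    and conv: "AE s in lborel. AE w in M. ennreal (cmod (F (s, w)) powr q) \<le> liminf (\<lambda>n. ennreal (cmod (G n (s, w)) powr q))"
    and p: "p > 0" and bd: "\<And>n. bfn p (LQ q (G n)) K"
  shows "bfn p (LQ q F) K"
proof (rule bfn_mono[OF bfn_liminf[OF bd p]])
  note [measurable] = m
  have "AE w in M. AE s in lborel. ennreal (cmod (F (s, w)) powr q) \<le> liminf (\<lambda>n. ennreal (cmod (G n (s, w)) powr q))"
    by (rule AE_swap[OF _ conv]) measurable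
  with AE_space show "AE w in M. LQ q F w \<le> liminf (\<lambda>n. LQ q (G n) w)"
  proof eventually_elim
    case (elim w)
    note [measurable] = elim(1)
    have "LQ q F w \<le> (\<integral>\<^sup>+s. liminf (\<lambda>n. ennreal (cmod (G n (s, w)) powr q)) \<partial>lborel)"
      using elim(2) by (rule nn_integral_mono_AE)
    also have "\<dots> \<le> liminf (\<lambda>n. LQ q (G n) w)"
      by (rule nn_integral_liminf) measurable
    finally show ?case .
  qed
qed simp

end


text \<open>On [e^-n, e^n] this is the substitution rule on a compact interval; monotone convergence
  removes the truncation.\<close>

lemma nn_integral_exp_substitution:
  fixes f :: "real \<Rightarrow> real"
  assumes [measurable]: "f \<in> borel_measurable borel"
  shows "(\<integral>\<^sup>+t\<in>{0<..}. ennreal (f t) \<partial>lborel) = (\<integral>\<^sup>+s. ennreal (f (exp s) * exp s) \<partial>lborel)"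
proof -
  define u where "u n t = ennreal (f t) * indicator {exp (- real n)..exp (real n)} t" for n t
  define v where "v n s = ennreal (f (exp s) * exp s) * indicator {- real n..real n} s" for n s
  have eq: "integral\<^sup>N lborel (u n) = integral\<^sup>N lborel (v n)" for n
  proof -
    have "u n = (\<lambda>t. ennreal (f t * indicator {exp (- real n)..exp (real n)} t))"
      "v n = (\<lambda>s. ennreal (f (exp s) * exp s * indicator {- real n..real n} s))"
      by (auto simp: u_def v_def fun_eq_iff indicator_def)
    then show ?thesis
      using nn_integral_substitution[of exp "- real n" "real n" f exp]
      by (simp add: set_borel_measurable_def DERIV_exp continuous_on_exp continuous_on_id)
  qed
  have 1: "(\<lambda>n. integral\<^sup>N lborel (u n)) \<longlonglongrightarrow> (\<integral>\<^sup>+t\<in>{0<..}. ennreal (f t) \<partial>lborel)"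
  proof (rule nn_integral_LIMSEQ)
    show "incseq u" unfolding u_def incseq_def le_fun_def
      by (auto intro!: mult_left_mono simp: indicator_def) (meson exp_le_cancel_iff le_minus_iff of_nat_mono order_trans neg_le_iff_le)+
    show "(\<lambda>n. u n t) \<longlonglongrightarrow> ennreal (f t) * indicator {0<..} t" for t
    proof (cases "t > 0")
      case True
      obtain N :: nat where N: "\<bar>ln t\<bar> \<le> real N" using real_arch_simple by blast
      have "t \<in> {exp (- real n)..exp (real n)}" if "n \<ge> N" for n
      proof -
        have "\<bar>ln t\<bar> \<le> real n" using N that by simp
        then have "exp (- real n) \<le> exp (ln t)" "exp (ln t) \<le> exp (real n)" by (auto simp: abs_le_iff)
        then show ?thesis using True by simp
      qed
      then show ?thesis using True
        by (intro tendsto_eventually) (auto simp: eventually_sequentially u_def indicator_def)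
    next
      case False
      then have "t \<notin> {exp (- real n)..exp (real n)}" for n using exp_gt_zero[of "- real n"] unfolding atLeastAtMost_iff by linarith
      then show ?thesis using False by (simp add: u_def)
    qed
  next
    show "u n \<in> borel_measurable lborel" for n unfolding u_def by measurable
  qed
  have 2: "(\<lambda>n. integral\<^sup>N lborel (v n)) \<longlonglongrightarrow> (\<integral>\<^sup>+s. ennreal (f (exp s) * exp s) \<partial>lborel)"
  proof (rule nn_integral_LIMSEQ)
    show "incseq v" unfolding v_def incseq_def le_fun_def
      by (auto intro!: mult_left_mono simp: indicator_def)
    show "(\<lambda>n. v n s) \<longlonglongrightarrow> ennreal (f (exp s) * exp s)" for s
    proof -
      obtain N :: nat where N: "\<bar>s\<bar> \<le> real N" using real_arch_simple by blast
      have "s \<in> {- real n..real n}" if "n \<ge> N" for n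
        using N that by (auto simp: abs_le_iff)
      then show ?thesis
        by (intro tendsto_eventually) (auto simp: eventually_sequentially v_def indicator_def)
    qed
  next
    show "v n \<in> borel_measurable lborel" for n unfolding v_def by measurable
  qed
  show ?thesis using LIMSEQ_unique[OF 1 2[folded eq]] .
qed

text \<open>For a non-integrable f the integral is 0 by convention, so the bound holds for every
  f.\<close>

lemma norm_set_lebesgue_integral_le:
  fixes f :: "real \<Rightarrow> complex"
  shows "ennreal (cmod (LINT s:S|lborel. f s)) \<le> (\<integral>\<^sup>+s. ennreal (indicator S s * cmod (f s)) \<partial>lborel)"
proof (cases "set_integrable lborel S f")
  case True
  then show ?thesis
    using integral_norm_bound_ennreal[of lborel "\<lambda>s. indicator S s *\<^sub>R f s"]
    unfolding set_integrable_def set_lebesgue_integral_def by (simp add: abs_mult)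
next
  case False
  then show ?thesis
    unfolding set_integrable_def set_lebesgue_integral_def by (simp add: not_integrable_integral_eq)
qed

section \<open>Limits and integrals of curves in the function space\<close>

context fatou_bfs begin

lemma step_version': "version (\<lambda>p. emb (step n f (fst p)) (snd p)) (step n f)"
  unfolding version_def using step_version by auto

lemma bfn_LQ_limit:
  assumes G: "\<And>n. version (G n) (g n)" and F: "version F f" and q: "q > 0"
    and conv: "\<And>s. \<exists>N. \<forall>n\<ge>N. norm (g n s - f s) \<le> (1/2) ^ n"
    and bd: "\<And>n. bfn q (LQ q (G n)) K"
  shows "bfn q (LQ q F) K"
proof (rule bfn_LQ_liminf[OF _ _ _ q bd])
  have "AE s in lborel. \<forall>n. AE w in M. G n (s, w) = emb (g n s) w"
    unfolding AE_all_countable using G by (auto simp: version_def)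
  moreover have "AE s in lborel. AE w in M. F (s, w) = emb (f s) w" using F by (auto simp: version_def)
  ultimately show "AE s in lborel. AE w in M. ennreal (cmod (F (s, w)) powr q) \<le> liminf (\<lambda>n. ennreal (cmod (G n (s, w)) powr q))"
  proof eventually_elim
    case (elim s)
    from elim(1) have "AE w in M. \<forall>n. G n (s, w) = emb (g n s) w" by (simp add: AE_all_countable)
    moreover obtain N where "\<forall>n\<ge>N. norm (g n s - f s) \<le> (1/2) ^ n" using conv by blast
    then have "AE w in M. (\<lambda>n. emb (g n s) w) \<longlonglongrightarrow> emb (f s) w" by (intro emb_fast_tendsto[of N]) auto
    ultimately show ?case using elim(2)
    proof eventually_elim
      case (elim w)
      then have "(\<lambda>n. cmod (G n (s, w)) powr q) \<longlonglongrightarrow> cmod (F (s, w)) powr q"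
        using q by (intro tendsto_powr' tendsto_norm) auto
      then have "(\<lambda>n. ennreal (cmod (G n (s, w)) powr q)) \<longlonglongrightarrow> ennreal (cmod (F (s, w)) powr q)"
        by (rule tendsto_ennrealI)
      then have "liminf (\<lambda>n. ennreal (cmod (G n (s, w)) powr q)) = ennreal (cmod (F (s, w)) powr q)"
        by (rule lim_imp_Liminf[OF trivial_limit_sequentially])
      then show ?case by simp
    qed
  qed
qed (use G F in \<open>auto simp: version_def\<close>)

text \<open>One index for each interval and accuracy suffices: indices with error (1/2)^k on [-k, k]
  form a sequence that converges fast enough at every s.\<close>

lemma bfn_LQ_locally_uniform:
  assumes G: "\<And>n. version (G n) (g n)" and F: "version F f" and q: "q > 0"
    and conv: "\<And>k \<epsilon>. \<epsilon> > 0 \<Longrightarrow> \<exists>n. \<forall>s. \<bar>s\<bar> \<le> real k \<longrightarrow> norm (g n s - f s) \<le> \<epsilon>"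
    and bd: "\<And>n. bfn q (LQ q (G n)) K"
  shows "bfn q (LQ q F) K"
proof -
  have "\<exists>n. \<forall>s. \<bar>s\<bar> \<le> real k \<longrightarrow> norm (g n s - f s) \<le> (1/2) ^ k" for k
    by (rule conv) simp
  then obtain r where r: "\<And>k s. \<bar>s\<bar> \<le> real k \<Longrightarrow> norm (g (r k) s - f s) \<le> (1/2) ^ k" by metis
  show ?thesis
  proof (rule bfn_LQ_limit[of "\<lambda>n. G (r n)" "\<lambda>n. g (r n)" F f])
    fix s
    obtain N :: nat where "\<bar>s\<bar> \<le> real N" using real_arch_simple by blast
    then show "\<exists>N. \<forall>n\<ge>N. norm (g (r n) s - f s) \<le> (1/2) ^ n"
      by (intro exI[of _ N]) (auto intro: r)
  qed (use assms in auto)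
qed

text \<open>Versions of one curve agree at almost every s for almost every w, so mixed-norm bounds
  do not depend on the version.\<close>

lemma bfn_LQ_cong:
  assumes "version F f" "version G f" "bfn q (LQ q F) K"
  shows "bfn q (LQ q G) K"
proof (rule bfn_mono[OF assms(3) _ order_refl])
  show "AE w in M. LQ q G w \<le> LQ q F w"
    using version_unique[OF assms(1,2)]
    by eventually_elim (auto intro!: nn_integral_mono_AE elim!: eventually_mono)
qed

lemma version_mult:
  assumes "version F f" and [measurable]: "g \<in> borel_measurable borel"
  shows "version (\<lambda>(s,w). g s * F (s,w)) (\<lambda>s. g s *\<^sub>C f s)"
proof -
  have [measurable]: "F \<in> borel_measurable (lborel \<Otimes>\<^sub>M M)" using assms by (simp add: version_def)
  have "AE s in lborel. AE w in M. g s * F (s,w) = emb (g s *\<^sub>C f s) w"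
  proof -
    have "AE s in lborel. AE w in M. F (s, w) = emb (f s) w" using assms by (simp add: version_def)
    then show ?thesis
    proof eventually_elim
      case (elim s)
      with emb_scaleC[of "g s" "f s"] show ?case by eventually_elim simp
    qed
  qed
  then show ?thesis unfolding version_def by auto
qed

text \<open>On (a, b] the step function takes finitely many values, so its pointwise absolute
  integral is a finite sum of |v j| weighted by the lengths of the cells, and the triangle
  inequality applies.\<close>

lemma step_integral_bound:
  assumes "a \<le> b" and bd: "\<And>s. a < s \<Longrightarrow> s \<le> b \<Longrightarrow> norm (step n f s) \<le> B"
  shows "bfn 1 (\<lambda>w. \<integral>\<^sup>+s. ennreal (indicator {a<..b} s * cmod (emb (step n f s) w)) \<partial>lborel) ((b - a) * B)"
proof -
  define J where "J = {\<lfloor>a * 2 ^ n\<rfloor>..\<lfloor>b * 2 ^ n\<rfloor>}"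
  define E where "E j = {s\<in>{a<..b}. \<lfloor>s * 2 ^ n\<rfloor> = j}" for j :: int
  define v where "v j = f (of_int j / 2 ^ n)" for j :: int
  have [measurable]: "E j \<in> sets borel" for j unfolding E_def by measurable
  have J: "\<lfloor>s * 2 ^ n\<rfloor> \<in> J" if "a < s" "s \<le> b" for s
    using that unfolding J_def by (auto intro!: floor_mono mult_right_mono)
  have Eab: "E j \<subseteq> {a<..b}" for j by (auto simp: E_def)
  have fin: "emeasure lborel (E j) < \<infinity>" for j
    using emeasure_mono[OF Eab[of j], of lborel] assms(1) by (auto simp: order_le_less_trans)
  define c where "c j = measure lborel (E j)" for j
  have c: "emeasure lborel (E j) = ennreal (c j)" for j
    using fin[of j] by (simp add: c_def emeasure_eq_ennreal_measure)
  have pt: "ennreal (indicator {a<..b} s * cmod (emb (step n f s) w)) = (\<Sum>j\<in>J. ennreal (cmod (emb (v j) w)) * indicator (E j) s)" for s w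
  proof (cases "s \<in> {a<..b}")
    case True
    have "(\<Sum>j\<in>J. ennreal (cmod (emb (v j) w)) * indicator (E j) s) = (\<Sum>j\<in>J. if j = \<lfloor>s * 2 ^ n\<rfloor> then ennreal (cmod (emb (v j) w)) else 0)"
      using True by (intro sum.cong) (auto simp: E_def indicator_def)
    also have "\<dots> = ennreal (cmod (emb (v \<lfloor>s * 2 ^ n\<rfloor>) w))"
      using J True by (subst sum.delta) (auto simp: J_def)
    finally show ?thesis using True by (simp add: step_def v_def)
  next
    case False
    then have "s \<notin> E j" for j using Eab by blast
    then show ?thesis using False by simp
  qed
  have "bfn 1 (\<lambda>w. \<Sum>j\<in>J. ennreal (c j powr 1) * ennreal (cmod (emb (v j) w) powr 1)) (\<Sum>j\<in>J. c j * norm (v j))"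
    by (intro bfn_sum bfn_scale bfn_emb) (auto simp: J_def c_def)
  moreover have "(\<integral>\<^sup>+s. ennreal (indicator {a<..b} s * cmod (emb (step n f s) w)) \<partial>lborel) = (\<Sum>j\<in>J. ennreal (c j powr 1) * ennreal (cmod (emb (v j) w) powr 1))" for w
  proof -
    have "(\<integral>\<^sup>+s. ennreal (cmod (emb (v j) w)) * indicator (E j) s \<partial>lborel) = ennreal (c j powr 1) * ennreal (cmod (emb (v j) w) powr 1)" for j
      by (subst nn_integral_cmult_indicator) (auto simp: c mult.commute c_def)
    then show ?thesis unfolding pt by (subst nn_integral_sum) auto
  qed
  moreover have "(\<Sum>j\<in>J. c j * norm (v j)) \<le> (b - a) * B"
  proof -
    \<comment> \<open>A cell that misses (a, b] has length 0, so B only has to bound the values that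
      are attained there.\<close>
    have "c j * norm (v j) \<le> c j * B" for j
    proof (cases "E j = {}")
      case False
      then obtain s where "s \<in> {a<..b}" "\<lfloor>s * 2 ^ n\<rfloor> = j" by (auto simp: E_def)
      then have "norm (v j) \<le> B" using bd[of s] by (auto simp: step_def v_def)
      then show ?thesis by (simp add: c_def mult_left_mono)
    qed (simp add: c_def)
    then have "(\<Sum>j\<in>J. c j * norm (v j)) \<le> (\<Sum>j\<in>J. c j * B)" by (intro sum_mono)
    also have "\<dots> = (\<Sum>j\<in>J. measure lborel (E j)) * B" by (simp add: c_def sum_distrib_right)
    also have "(\<Sum>j\<in>J. measure lborel (E j)) = measure lborel (\<Union>j\<in>J. E j)"
    proof (rule measure_finite_Union[symmetric])
      show "disjoint_family_on E J" by (auto simp: disjoint_family_on_def E_def)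
      show "emeasure lborel (E j) \<noteq> \<infinity>" for j using fin[of j] by simp
    qed (auto simp: J_def)
    also have "(\<Union>j\<in>J. E j) = {a<..b}" using J by (auto simp: E_def)
    finally show ?thesis using assms(1) by simp
  qed
  ultimately show ?thesis by (simp add: bfn_mono)
qed

text \<open>Minkowski's integral inequality with a uniform bound on the norm. It holds for step
  functions and passes to the limit; the slack B < B' pays for the approximation error.\<close>

lemma bfn_integral_norm:
  assumes f: "continuous_on UNIV f" and F: "version F f" and ab: "a \<le> b"
    and bd: "\<And>s. a < s \<Longrightarrow> s \<le> b \<Longrightarrow> norm (f s) \<le> B" and B: "B < B'"
  shows "bfn 1 (\<lambda>w. \<integral>\<^sup>+s. ennreal (indicator {a<..b} s * cmod (F (s, w))) \<partial>lborel) ((b - a) * B')"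
proof -
  obtain r where r: "\<And>n s. \<bar>s\<bar> \<le> real n \<Longrightarrow> norm (step (r n) f s - f s) \<le> (1/2) ^ n"
    using step_fast[OF f] by blast
  obtain N1 :: nat where N1: "(1/2::real) ^ N1 < B' - B" using real_arch_pow_inv[of "B' - B" "1/2"] B by auto
  obtain N2 :: nat where N2: "max \<bar>a\<bar> \<bar>b\<bar> \<le> real N2" using real_arch_simple by blast
  define N where "N = max N1 N2"
  have N: "(1/2::real) ^ N \<le> B' - B" "max \<bar>a\<bar> \<bar>b\<bar> \<le> real N"
  proof -
    have "(1/2::real) ^ N \<le> (1/2) ^ N1" by (intro power_decreasing) (auto simp: N_def)
    with N1 show "(1/2::real) ^ N \<le> B' - B" by linarith
    have "real N2 \<le> real N" by (simp add: N_def)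
    with N2 show "max \<bar>a\<bar> \<bar>b\<bar> \<le> real N" by linarith
  qed
  let ?g = "indicator {a<..b} :: real \<Rightarrow> complex"
  have cmi: "cmod (?g s * z) powr 1 = indicator {a<..b} s * cmod z" for s z
    by (auto simp: indicator_def)
  have v1: "version (\<lambda>(s,w). ?g s * (\<lambda>p. emb (step (r (n + N)) f (fst p)) (snd p)) (s,w)) (\<lambda>s. ?g s *\<^sub>C step (r (n + N)) f s)" for n
    by (rule version_mult[OF step_version']) measurable
  have v2: "version (\<lambda>(s,w). ?g s * F (s,w)) (\<lambda>s. ?g s *\<^sub>C f s)"
    by (rule version_mult[OF F]) measurable
  have "bfn 1 (LQ 1 (\<lambda>(s,w). ?g s * F (s,w))) ((b - a) * B')"
  proof (rule bfn_LQ_limit[OF v1 v2])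
    show "\<exists>N'. \<forall>n\<ge>N'. norm (?g s *\<^sub>C step (r (n + N)) f s - ?g s *\<^sub>C f s) \<le> (1/2) ^ n" for s
    proof -
      obtain N' :: nat where N': "\<bar>s\<bar> \<le> real N'" using real_arch_simple by blast
      have "norm (?g s *\<^sub>C step (r (n + N)) f s - ?g s *\<^sub>C f s) \<le> (1/2) ^ n" if "n \<ge> N'" for n
      proof -
        have "norm (step (r (n + N)) f s - f s) \<le> (1/2) ^ (n + N)" using N' that by (intro r) auto
        also have "\<dots> \<le> (1/2) ^ n" by (intro power_decreasing) auto
        finally show ?thesis by (cases "s \<in> {a<..b}") auto
      qed
      then show ?thesis by blast
    qed
    show "bfn 1 (LQ 1 (\<lambda>(s, w). ?g s * (\<lambda>p. emb (step (r (n + N)) f (fst p)) (snd p)) (s, w))) ((b - a) * B')" for n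
      unfolding split_conv cmi fst_conv snd_conv
    proof (rule step_integral_bound[OF ab])
      fix s assume s: "a < s" "s \<le> b"
      then have "\<bar>s\<bar> \<le> real (n + N)" using N(2) by auto
      then have "norm (step (r (n + N)) f s - f s) \<le> (1/2) ^ (n + N)" by (rule r)
      moreover have "(1/2::real) ^ (n + N) \<le> (1/2) ^ N" by (intro power_decreasing) auto
      ultimately show "norm (step (r (n + N)) f s) \<le> B'"
        using N(1) bd[OF s] norm_triangle_sub[of "step (r (n + N)) f s" "f s"] by linarith
    qed
  qed auto
  then show ?thesis unfolding split_conv cmi .
qed

text \<open>The absolute integral over (-n, n] has finite norm and is therefore finite almost
  everywhere. Restricting to integers n keeps the exceptional set independent of a and b.\<close>

lemma version_set_integrable:
  assumes f: "continuous_on UNIV f" and F: "version F f"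
  shows "AE w in M. \<forall>a b. set_integrable lborel {a<..b} (\<lambda>s. F (s, w))"
proof -
  have one: "AE w in M. set_integrable lborel {- real n<..real n} (\<lambda>s. F (s, w))" for n :: nat
  proof -
    have "bounded (f ` {- real n..real n})"
      by (intro compact_imp_bounded compact_continuous_image continuous_on_subset[OF f]) auto
    then obtain B where B: "\<And>s. s \<in> {- real n..real n} \<Longrightarrow> norm (f s) \<le> B"
      unfolding bounded_iff by blast
    have "bfn 1 (\<lambda>w. \<integral>\<^sup>+s. ennreal (indicator {- real n<..real n} s * cmod (F (s, w))) \<partial>lborel) ((real n - - real n) * (B + 1))"
      by (rule bfn_integral_norm[OF f F, where B=B]) (use B in auto)
    from bfn_AE_finite[OF this] AE_space show ?thesis
    proof eventually_elim
      case (elim w)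
      note [measurable] = version_measurable[OF F] elim(2)
      show ?case unfolding set_integrable_def
      proof (rule integrableI_bounded)
        show "(\<lambda>s. indicator {- real n<..real n} s *\<^sub>R F (s, w)) \<in> borel_measurable lborel" by measurable
        show "(\<integral>\<^sup>+s. ennreal (norm (indicator {- real n<..real n} s *\<^sub>R F (s, w))) \<partial>lborel) < \<infinity>"
          using elim(1) by (simp add: norm_mult)
      qed
    qed
  qed
  then have "AE w in M. \<forall>n::nat. set_integrable lborel {- real n<..real n} (\<lambda>s. F (s, w))"
    by (simp add: AE_all_countable)
  then show "AE w in M. \<forall>a b. set_integrable lborel {a<..b} (\<lambda>s. F (s, w))"
  proof eventually_elim
    case (elim w)
    show ?case
    proof (intro allI)
      fix a b
      obtain n :: nat where "max \<bar>a\<bar> \<bar>b\<bar> \<le> real n" using real_arch_simple by blast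
      then have "{a<..b} \<subseteq> {- real n<..real n}" by auto
      with elim show "set_integrable lborel {a<..b} (\<lambda>s. F (s, w))"
        by (rule_tac set_integrable_subset[of lborel "{- real n<..real n}"]) auto
    qed
  qed
qed

text \<open>On short intervals both sides are close to \<open>(b - a) f a\<close>; the general case adds up short ones.\<close>

lemma emb_integral:
  assumes f: "continuous_on UNIV f" and F: "version F f" and ab: "a \<le> b"
  shows "AE w in M. emb (integral {a..b} f) w = (LINT s:{a<..b}|lborel. F (s, w))"
proof -
  define D where "D a b w = ennreal (cmod (emb (integral {a..b} f) w - (LINT s:{a<..b}|lborel. F (s, w))))" for a b w
  note intF = version_set_integrable[OF f F]
  have fi: "f integrable_on {c..d}" for c d
    by (rule integrable_continuous_real, rule continuous_on_subset[OF f]) auto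
  \<comment> \<open>One \<epsilon> comes from the integral in X, two from
    \<open>bfn_integral_norm\<close>, whose strict bound is met with 2 * \<epsilon>.\<close>
  have cell: "bfn 1 (D c d) (3 * \<epsilon> * (d - c))"
    if cd: "c \<le> d" and e: "\<epsilon> > 0" and bd: "\<And>s. s \<in> {c..d} \<Longrightarrow> norm (f s - f c) \<le> \<epsilon>" for c d \<epsilon>
  proof -
    let ?x = "integral {c..d} f - (d - c) *\<^sub>R f c"
    have "?x = integral {c..d} (\<lambda>s. f s - f c)"
      using cd by (subst integral_diff[OF fi]) auto
    also have "norm \<dots> \<le> \<epsilon> * (d - c)"
      by (rule integral_bound[OF cd]) (auto intro!: continuous_intros continuous_on_subset[OF f] bd)
    finally have 1: "bfn 1 (\<lambda>w. ennreal (cmod (emb ?x w) powr 1)) (\<epsilon> * (d - c))" by (rule bfn_emb)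
    have vF: "version (\<lambda>(s,w). F (s,w) - emb (f c) w) (\<lambda>s. f s - f c)"
    proof -
      have [measurable]: "F \<in> borel_measurable (lborel \<Otimes>\<^sub>M M)" using F by (rule version_measurable)
      have "AE s in lborel. AE w in M. F (s, w) = emb (f s) w" using F by (simp add: version_def)
      then have "AE s in lborel. AE w in M. F (s,w) - emb (f c) w = emb (f s - f c) w"
      proof eventually_elim
        case (elim s)
        with emb_diff[of "f s" "f c"] show ?case by eventually_elim simp
      qed
      then show ?thesis unfolding version_def by auto
    qed
    have 2: "bfn 1 (\<lambda>w. \<integral>\<^sup>+s. ennreal (indicator {c<..d} s * cmod ((\<lambda>(s,w). F (s,w) - emb (f c) w) (s, w))) \<partial>lborel) ((d - c) * (2 * \<epsilon>))"
      by (rule bfn_integral_norm[OF _ vF cd, where B=\<epsilon>]) (use e bd in \<open>auto intro!: continuous_intros f\<close>)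
    have "AE w in M. D c d w \<le> ennreal (cmod (emb ?x w) powr 1) + (\<integral>\<^sup>+s. ennreal (indicator {c<..d} s * cmod ((\<lambda>(s,w). F (s,w) - emb (f c) w) (s, w))) \<partial>lborel)"
      using intF emb_diff[of "integral {c..d} f" "(d - c) *\<^sub>R f c"] emb_scaleR[of "d - c" "f c"]
    proof eventually_elim
      case (elim w)
      have ci: "set_integrable lborel {c<..d} (\<lambda>s. emb (f c) w)"
        unfolding set_integrable_def by (intro integrable_scaleR_left integrable_real_indicator) (use cd in auto)
      have "(LINT s:{c<..d}|lborel. F (s, w) - emb (f c) w) = (LINT s:{c<..d}|lborel. F (s, w)) - (LINT s:{c<..d}|lborel. emb (f c) w)"
        using elim ci by (intro set_integral_diff) auto
      also have "(LINT s:{c<..d}|lborel. emb (f c) w) = of_real (d - c) * emb (f c) w"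
        using cd unfolding set_lebesgue_integral_def by (subst integral_scaleR_left) (auto simp: scaleR_conv_of_real)
      finally have "emb (integral {c..d} f) w - (LINT s:{c<..d}|lborel. F (s, w)) = emb ?x w - (LINT s:{c<..d}|lborel. F (s, w) - emb (f c) w)"
        using elim by simp
      then have "D c d w \<le> ennreal (cmod (emb ?x w) + cmod (LINT s:{c<..d}|lborel. F (s, w) - emb (f c) w))"
        unfolding D_def by (intro ennreal_leI) (simp add: norm_triangle_ineq4)
      also have "\<dots> = ennreal (cmod (emb ?x w) powr 1) + ennreal (cmod (LINT s:{c<..d}|lborel. F (s, w) - emb (f c) w))"
        by simp
      also have "\<dots> \<le> ennreal (cmod (emb ?x w) powr 1) + (\<integral>\<^sup>+s. ennreal (indicator {c<..d} s * cmod (F (s, w) - emb (f c) w)) \<partial>lborel)"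
        by (intro add_left_mono norm_set_lebesgue_integral_le)
      finally show ?case by simp
    qed
    from bfn_mono[OF bfn_add[OF 1 2] this, of "3 * \<epsilon> * (d - c)"] show ?thesis by (simp add: algebra_simps)
  qed
  have "bfn 1 (D a b) \<epsilon>" if "\<epsilon> > 0" for \<epsilon>
  proof -
    \<comment> \<open>The summand 1 keeps the denominator positive when a = b.\<close>
    define \<epsilon>' where "\<epsilon>' = \<epsilon> / (3 * (b - a + 1))"
    have e': "\<epsilon>' > 0" using that ab by (auto simp: \<epsilon>'_def)
    have "uniformly_continuous_on {a..b} f"
      by (rule compact_uniformly_continuous[OF continuous_on_subset[OF f]]) auto
    then obtain \<delta> where d: "\<delta> > 0" "\<And>s t. s \<in> {a..b} \<Longrightarrow> t \<in> {a..b} \<Longrightarrow> dist t s < \<delta> \<Longrightarrow> dist (f t) (f s) < \<epsilon>'"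
      using e' unfolding uniformly_continuous_on_def by metis
    \<comment> \<open>Induction on the number of cells of length \<delta>/2, split off from the
      left; half of \<delta> meets the strict inequality of uniform continuity also at the right end
      of a cell.\<close>
    have "\<forall>c d. a \<le> c \<and> c \<le> d \<and> d \<le> b \<and> d - c \<le> real n * (\<delta>/2) \<longrightarrow> bfn 1 (D c d) (3 * \<epsilon>' * (d - c))" for n
    proof (induction n)
      case 0
      show ?case
      proof (intro allI impI)
        fix c d assume "a \<le> c \<and> c \<le> d \<and> d \<le> b \<and> d - c \<le> real 0 * (\<delta>/2)"
        then have "c = d" by simp
        then show "bfn 1 (D c d) (3 * \<epsilon>' * (d - c))" using e' by (intro cell) auto
      qed
    next
      case (Suc n)
      show ?case
      proof (intro allI impI)
        fix c d assume cd: "a \<le> c \<and> c \<le> d \<and> d \<le> b \<and> d - c \<le> real (Suc n) * (\<delta>/2)"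
        have small: "bfn 1 (D c' d') (3 * \<epsilon>' * (d' - c'))" if "a \<le> c'" "c' \<le> d'" "d' \<le> b" "d' - c' \<le> \<delta>/2" for c' d'
        proof (rule cell[OF that(2) e'])
          fix s assume "s \<in> {c'..d'}"
          then show "norm (f s - f c') \<le> \<epsilon>'" using d(2)[of c' s] that d(1) by (auto simp: dist_norm less_imp_le)
        qed
        show "bfn 1 (D c d) (3 * \<epsilon>' * (d - c))"
        proof (cases "d - c \<le> \<delta>/2")
          case False
          define m where "m = c + \<delta>/2"
          have m: "c \<le> m" "m \<le> d" using False d(1) by (auto simp: m_def)
          have 1: "bfn 1 (D c m) (3 * \<epsilon>' * (m - c))" using cd m by (intro small) (auto simp: m_def)
          have 2: "bfn 1 (D m d) (3 * \<epsilon>' * (d - m))" using Suc.IH[rule_format, of m d] cd m by (simp add: m_def algebra_simps)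
          have "AE w in M. D c d w \<le> D c m w + D m d w"
            using intF emb_add[of "integral {c..m} f" "integral {m..d} f"]
          proof eventually_elim
            case (elim w)
            have "(LINT s:{c<..d}|lborel. F (s, w)) = (LINT s:{c<..m}|lborel. F (s, w)) + (LINT s:{m<..d}|lborel. F (s, w))"
              using set_integral_Un[of "{c<..m}" "{m<..d}" lborel "\<lambda>s. F (s, w)"] elim m by (simp add: ivl_disj_un disjoint_iff)
            moreover have "integral {c..m} f + integral {m..d} f = integral {c..d} f"
              using m fi by (intro Henstock_Kurzweil_Integration.integral_combine) auto
            ultimately have "emb (integral {c..d} f) w - (LINT s:{c<..d}|lborel. F (s, w))
               = (emb (integral {c..m} f) w - (LINT s:{c<..m}|lborel. F (s, w))) + (emb (integral {m..d} f) w - (LINT s:{m<..d}|lborel. F (s, w)))"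
              using elim by simp
            then have "D c d w \<le> ennreal (cmod (emb (integral {c..m} f) w - (LINT s:{c<..m}|lborel. F (s, w))) + cmod (emb (integral {m..d} f) w - (LINT s:{m<..d}|lborel. F (s, w))))"
              unfolding D_def by (intro ennreal_leI) (metis norm_triangle_ineq)
            then show ?case by (simp add: D_def)
          qed
          from bfn_mono[OF bfn_add[OF 1 2] this, of "3 * \<epsilon>' * (d - c)"] show ?thesis by (simp add: algebra_simps)
        qed (use small cd in auto)
      qed
    qed
    moreover obtain n where "b - a \<le> real n * (\<delta>/2)"
      using reals_Archimedean3[of "\<delta>/2"] d(1) by (meson half_gt_zero less_imp_le)
    ultimately have "bfn 1 (D a b) (3 * \<epsilon>' * (b - a))" using ab by blast
    moreover have "3 * \<epsilon>' * (b - a) \<le> \<epsilon>" using that ab unfolding \<epsilon>'_def by (simp add: field_simps)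
    ultimately show ?thesis using bfn_mono[OF _ AE_I2[OF order_refl]] by blast
  qed
  then have "AE w in M. D a b w = 0" by (rule bfn_small_AE_0)
  then show ?thesis by eventually_elim (simp add: D_def)
qed

end


text \<open>Splitting the increment at S_t (f s0) requires only strong continuity in t: the uniform
  bound C controls the part where f moves.\<close>

lemma strong_continuous_apply:
  assumes S: "\<And>t. bounded_linear (S t)" "\<And>t x. norm (S t x) \<le> C * norm (x::'y::real_normed_vector)"
    and c: "\<And>x. continuous_on UNIV (\<lambda>t. S t x)" and f: "continuous_on UNIV f"
  shows "continuous_on UNIV (\<lambda>(t::real,s::real). S t (f s) :: 'y)"
proof -
  have "(\<lambda>p. S (fst p) (f (snd p))) \<midarrow>p0\<rightarrow> S (fst p0) (f (snd p0))" for p0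
  proof (rule LIM_zero_cancel, rule Lim_null_comparison)
    show "\<forall>\<^sub>F p in at p0. norm (S (fst p) (f (snd p)) - S (fst p0) (f (snd p0)))
        \<le> C * norm (f (snd p) - f (snd p0)) + norm (S (fst p) (f (snd p0)) - S (fst p0) (f (snd p0)))"
    proof (rule always_eventually, rule allI)
      fix p
      have "S (fst p) (f (snd p)) - S (fst p0) (f (snd p0)) = S (fst p) (f (snd p) - f (snd p0)) + (S (fst p) (f (snd p0)) - S (fst p0) (f (snd p0)))"
        by (simp add: linear_diff[OF bounded_linear.linear[OF S(1)]])
      then have "norm (S (fst p) (f (snd p)) - S (fst p0) (f (snd p0)))
        = norm (S (fst p) (f (snd p) - f (snd p0)) + (S (fst p) (f (snd p0)) - S (fst p0) (f (snd p0))))"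
        by (rule arg_cong)
      also have "\<dots> \<le> C * norm (f (snd p) - f (snd p0)) + norm (S (fst p) (f (snd p0)) - S (fst p0) (f (snd p0)))"
        by (rule order_trans[OF norm_triangle_ineq add_right_mono[OF S(2)]])
      finally show "norm (S (fst p) (f (snd p)) - S (fst p0) (f (snd p0)))
        \<le> C * norm (f (snd p) - f (snd p0)) + norm (S (fst p) (f (snd p0)) - S (fst p0) (f (snd p0)))" .
    qed
    have 1: "((\<lambda>p. f (snd p)) \<longlongrightarrow> f (snd p0)) (at p0)"
      using f by (intro isCont_tendsto_compose[OF _ tendsto_snd[OF tendsto_ident_at]]) (simp add: continuous_on_eq_continuous_at)
    have 2: "((\<lambda>p. S (fst p) (f (snd p0))) \<longlongrightarrow> S (fst p0) (f (snd p0))) (at p0)"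
      using c[of "f (snd p0)"] by (intro isCont_tendsto_compose[OF _ tendsto_fst[OF tendsto_ident_at]]) (simp add: continuous_on_eq_continuous_at)
    have "((\<lambda>p. C * norm (f (snd p) - f (snd p0)) + norm (S (fst p) (f (snd p0)) - S (fst p0) (f (snd p0)))) \<longlongrightarrow>
        C * norm (f (snd p0) - f (snd p0)) + norm (S (fst p0) (f (snd p0)) - S (fst p0) (f (snd p0)))) (at p0)"
      by (intro tendsto_intros 1 2)
    then show "((\<lambda>p. C * norm (f (snd p) - f (snd p0)) + norm (S (fst p) (f (snd p0)) - S (fst p0) (f (snd p0)))) \<longlongrightarrow> 0) (at p0)" by simp
  qed
  then show ?thesis by (simp add: continuous_on_eq_continuous_at isCont_def case_prod_unfold)
qed

section \<open>Convolution with decaying kernels in the mixed norm\<close>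

context fatou_bfs begin

text \<open>Young's inequality: Jensen in s for fixed t, then Fubini. The majorant C exp(-e|s + t|)
  has mass 2 C / e in either variable, so the same constant enters both times. Truncation to [-m, m]
  lets \<open>emb_integral\<close> evaluate the integral pointwise.\<close>

lemma bfn_convolution:
  assumes f: "continuous_on UNIV f" and F: "version F f" and q: "q \<ge> 1" and e: "e > 0" and C: "C > 0"
    and a: "continuous_on UNIV (\<lambda>(t,s). a t s)" and ab: "\<And>t s. cmod (a t s) \<le> C * exp (- e * \<bar>s + t\<bar>)"
    and bd: "bfn q (LQ q F) K" and m: "m \<ge> 0"
    and G: "version G (\<lambda>t. integral {- m..m} (\<lambda>s. a t s *\<^sub>C f s))"
  shows "bfn q (LQ q G) (C * (2 / e) * K)"
proof -
  define L where "L = C * (2 / e)"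
  have L: "L > 0" using C e by (simp add: L_def)
  have Fm[measurable]: "F \<in> borel_measurable (lborel \<Otimes>\<^sub>M M)" using F by (rule version_measurable)
  have am[measurable]: "(\<lambda>(t,s). a t s) \<in> borel_measurable (borel \<Otimes>\<^sub>M borel)"
    using borel_measurable_continuous_onI[OF a] by (simp add: borel_prod)
  have at: "continuous_on UNIV (a t)" for t
    by (rule continuous_on_compose2[OF a, of UNIV "\<lambda>s. (t,s)", unfolded prod.case]) (auto intro!: continuous_intros)
  define G0 where "G0 = (\<lambda>(t,w). LINT s:{-m<..m}|lborel. a t s * F (s,w))"
  have G0m[measurable]: "G0 \<in> borel_measurable (lborel \<Otimes>\<^sub>M M)"
    unfolding G0_def set_lebesgue_integral_def by measurable
  have "AE w in M. G0 (t, w) = emb (integral {- m..m} (\<lambda>s. a t s *\<^sub>C f s)) w" for t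
  proof -
    have v: "version (\<lambda>(s,w). a t s * F (s,w)) (\<lambda>s. a t s *\<^sub>C f s)"
      by (rule version_mult[OF F borel_measurable_continuous_onI[OF at]])
    have c: "continuous_on UNIV (\<lambda>s. a t s *\<^sub>C f s)"
      by (rule scaleC.continuous_on[OF at f])
    from emb_integral[OF c v, of "-m" m] m show ?thesis by (auto simp: G0_def elim!: eventually_mono)
  qed
  then have G0: "version G0 (\<lambda>t. integral {- m..m} (\<lambda>s. a t s *\<^sub>C f s))"
    unfolding version_def by auto
  have kint: "(\<integral>\<^sup>+s. ennreal (C * exp (- e * \<bar>s + t\<bar>)) \<partial>lborel) = ennreal L" for t
  proof -
    have "(\<integral>\<^sup>+s. ennreal C * ennreal (exp (- e * \<bar>s + t\<bar>)) \<partial>lborel) = ennreal C * ennreal (2 / e)"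
      by (subst nn_integral_cmult) (auto simp: exp_abs_nn_integral[OF e, simplified])
    then show ?thesis using C e by (simp add: ennreal_mult[symmetric] L_def)
  qed
  have main: "LQ q G0 w \<le> ennreal (L powr q) * LQ q F w" if w[measurable]: "w \<in> space M" for w
  proof -
    have [measurable]: "(\<lambda>s. F (s, w)) \<in> borel_measurable borel" by measurable
    have pt: "ennreal (cmod (G0 (t, w)) powr q) \<le> ennreal (L powr (q - 1)) * (\<integral>\<^sup>+s. ennreal (C * exp (- e * \<bar>s + t\<bar>) * cmod (F (s, w)) powr q) \<partial>lborel)" for t
    proof (rule nn_integral_powr_jensen)
      have "ennreal (cmod (G0 (t, w))) \<le> (\<integral>\<^sup>+s. ennreal (indicator {-m<..m} s * cmod (a t s * F (s,w))) \<partial>lborel)"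
        unfolding G0_def split_conv by (rule norm_set_lebesgue_integral_le)
      also have "\<dots> \<le> (\<integral>\<^sup>+s. ennreal (C * exp (- e * \<bar>s + t\<bar>) * cmod (F (s, w))) \<partial>lborel)"
        using ab C by (intro nn_integral_mono ennreal_leI) (auto simp: indicator_def norm_mult intro!: mult_right_mono)
      finally show "ennreal (cmod (G0 (t, w))) \<le> (\<integral>\<^sup>+s. ennreal (C * exp (- e * \<bar>s + t\<bar>) * cmod (F (s, w))) \<partial>lborel)" .
    qed (use C q L kint in auto)
    have "LQ q G0 w \<le> (\<integral>\<^sup>+t. ennreal (L powr (q - 1)) * (\<integral>\<^sup>+s. ennreal (C * exp (- e * \<bar>s + t\<bar>) * cmod (F (s, w)) powr q) \<partial>lborel) \<partial>lborel)"
      by (intro nn_integral_mono pt)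
    also have "\<dots> = ennreal (L powr (q - 1)) * (\<integral>\<^sup>+t. (\<integral>\<^sup>+s. ennreal (C * exp (- e * \<bar>s + t\<bar>) * cmod (F (s, w)) powr q) \<partial>lborel) \<partial>lborel)"
      by (rule nn_integral_cmult) measurable
    also have "(\<integral>\<^sup>+t. (\<integral>\<^sup>+s. ennreal (C * exp (- e * \<bar>s + t\<bar>) * cmod (F (s, w)) powr q) \<partial>lborel) \<partial>lborel)
       = (\<integral>\<^sup>+s. (\<integral>\<^sup>+t. ennreal (C * exp (- e * \<bar>s + t\<bar>) * cmod (F (s, w)) powr q) \<partial>lborel) \<partial>lborel)"
      by (rule lborel_pair.Fubini') measurable
    also have "\<dots> = (\<integral>\<^sup>+s. ennreal L * ennreal (cmod (F (s, w)) powr q) \<partial>lborel)"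
    proof (rule nn_integral_cong)
      fix s
      have "(\<integral>\<^sup>+t. ennreal (C * exp (- e * \<bar>s + t\<bar>) * cmod (F (s, w)) powr q) \<partial>lborel)
         = (\<integral>\<^sup>+t. ennreal (C * exp (- e * \<bar>t + s\<bar>)) * ennreal (cmod (F (s, w)) powr q) \<partial>lborel)"
        using C by (intro nn_integral_cong) (simp add: ennreal_mult'' add.commute)
      also have "\<dots> = (\<integral>\<^sup>+t. ennreal (C * exp (- e * \<bar>t + s\<bar>)) \<partial>lborel) * ennreal (cmod (F (s, w)) powr q)"
        by (rule nn_integral_multc) measurable
      finally show "(\<integral>\<^sup>+t. ennreal (C * exp (- e * \<bar>s + t\<bar>) * cmod (F (s, w)) powr q) \<partial>lborel) = ennreal L * ennreal (cmod (F (s, w)) powr q)"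
        by (simp only: kint)
    qed
    also have "\<dots> = ennreal L * LQ q F w" by (rule nn_integral_cmult) measurable
    also have "ennreal (L powr (q - 1)) * (ennreal L * LQ q F w) = ennreal (L powr q) * LQ q F w"
      using L powr_mult_base[of L "q-1"] by (simp add: mult.assoc[symmetric] ennreal_mult[symmetric] mult.commute)
    finally show ?thesis .
  qed
  have "bfn q (LQ q G0) (L * K)"
    by (rule bfn_mono[OF bfn_scale[OF bd, of L]]) (use L main in \<open>auto intro!: AE_I2\<close>)
  then show ?thesis unfolding L_def by (rule bfn_LQ_cong[OF G0 G])
qed

text \<open>A Hoelder inequality without the dual exponent: for a weight whose supremum and mass are
  both at most Mx, Jensen contributes Mx^(q - 1) and the supremum one more factor Mx. This includes
  q = 1.\<close>

lemma norm_weighted_integral_le: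
  assumes h: "continuous_on UNIV h" and H: "version H h" and q: "q \<ge> 1" and bd: "bfn q (LQ q H) K"
    and g: "continuous_on UNIV g" and ab: "a \<le> b" and Mx: "Mx > 0"
    and g1: "\<And>s. s \<in> {a..b} \<Longrightarrow> cmod (g s) \<le> Mx"
    and g2: "(\<integral>\<^sup>+s. ennreal (indicator {a<..b} s * cmod (g s)) \<partial>lborel) \<le> ennreal Mx"
  shows "norm (integral {a..b} (\<lambda>s. g s *\<^sub>C h s)) \<le> Mx * K"
proof -
  let ?x = "integral {a..b} (\<lambda>s. g s *\<^sub>C h s)"
  have Hm[measurable]: "H \<in> borel_measurable (lborel \<Otimes>\<^sub>M M)" using H by (rule version_measurable)
  have gm[measurable]: "g \<in> borel_measurable borel" by (rule borel_measurable_continuous_onI[OF g])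
  have v: "version (\<lambda>(s,w). g s * H (s,w)) (\<lambda>s. g s *\<^sub>C h s)"
    by (rule version_mult[OF H]) measurable
  have c: "continuous_on UNIV (\<lambda>s. g s *\<^sub>C h s)" by (rule scaleC.continuous_on[OF g h])
  from emb_integral[OF c v ab] AE_space
  have "AE w in M. ennreal (cmod (emb ?x w) powr q) \<le> ennreal (Mx powr q) * LQ q H w"
  proof eventually_elim
    case (elim w)
    have [measurable]: "(\<lambda>s. H (s, w)) \<in> borel_measurable borel" using elim(2) by measurable
    have "ennreal (cmod (emb ?x w) powr q) \<le> ennreal (Mx powr (q-1)) * (\<integral>\<^sup>+s. ennreal (indicator {a<..b} s * cmod (g s) * cmod (H (s, w)) powr q) \<partial>lborel)"
    proof (rule nn_integral_powr_jensen)
      have "ennreal (cmod (emb ?x w)) \<le> (\<integral>\<^sup>+s. ennreal (indicator {a<..b} s * cmod (g s * H (s, w))) \<partial>lborel)"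
        using norm_set_lebesgue_integral_le[of "{a<..b}" "\<lambda>s. g s * H (s, w)"] elim by simp
      then show "ennreal (cmod (emb ?x w)) \<le> (\<integral>\<^sup>+s. ennreal (indicator {a<..b} s * cmod (g s) * cmod (H (s, w))) \<partial>lborel)"
        by (simp add: norm_mult mult.assoc)
    qed (use q Mx g2 in auto)
    also have "\<dots> \<le> ennreal (Mx powr (q-1)) * (\<integral>\<^sup>+s. ennreal Mx * ennreal (cmod (H (s, w)) powr q) \<partial>lborel)"
    proof (intro mult_left_mono nn_integral_mono)
      fix s
      have "indicator {a<..b} s * cmod (g s) \<le> Mx" using g1[of s] Mx by (auto simp: indicator_def)
      then show "ennreal (indicator {a<..b} s * cmod (g s) * cmod (H (s, w)) powr q) \<le> ennreal Mx * ennreal (cmod (H (s, w)) powr q)"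
        using Mx by (subst ennreal_mult[symmetric]) (auto intro!: ennreal_leI mult_right_mono)
    qed simp
    also have "(\<integral>\<^sup>+s. ennreal Mx * ennreal (cmod (H (s, w)) powr q) \<partial>lborel) = ennreal Mx * LQ q H w"
      by (rule nn_integral_cmult) measurable
    also have "ennreal (Mx powr (q - 1)) * (ennreal Mx * LQ q H w) = ennreal (Mx powr q) * LQ q H w"
      using Mx powr_mult_base[of Mx "q-1"] by (simp add: mult.assoc[symmetric] ennreal_mult[symmetric] mult.commute)
    finally show ?case .
  qed
  from bfn_mono[OF bfn_scale[OF bd] this, of "Mx * K"] Mx q show ?thesis
    by (auto intro: bfn_normD[of q])
qed

section \<open>Function norms\<close>

lemma fun_normE:
  assumes "fun_norm M emb g < \<infinity>"
  obtains y where "AE w in M. g w < \<infinity> \<and> emb y w = complex_of_real (enn2real (g w))"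
    "fun_norm M emb g = ennreal (norm y)"
proof -
  define Y where "Y = {y. AE w in M. g w < \<infinity> \<and> emb y w = complex_of_real (enn2real (g w))}"
  have fY: "fun_norm M emb g = (INF y\<in>Y. ennreal (norm y))" by (simp add: fun_norm_def Y_def)
  have "Y \<noteq> {}" using assms by (auto simp: fY)
  then obtain y where y: "y \<in> Y" by blast
  have "y' = y" if "y' \<in> Y" for y'
  proof (rule emb_inj)
    have "AE w in M. g w < \<infinity> \<and> emb y w = complex_of_real (enn2real (g w))"
      "AE w in M. g w < \<infinity> \<and> emb y' w = complex_of_real (enn2real (g w))"
      using y that by (auto simp: Y_def)
    then show "AE w in M. emb y' w = emb y w" by eventually_elim simp
  qed
  then have "Y = {y}" using y by blast
  then have "fun_norm M emb g = ennreal (norm y)" by (simp add: fY)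
  with y show ?thesis unfolding Y_def mem_Collect_eq by (intro that[of y])
qed

lemma bfn_fun_norm:
  assumes "fun_norm M emb g \<le> ennreal K" "K \<ge> 0"
  shows "bfn 1 g K"
proof -
  have "fun_norm M emb g < \<infinity>" using assms(1) by (simp add: order_le_less_trans)
  then obtain y where y: "AE w in M. g w < \<infinity> \<and> emb y w = complex_of_real (enn2real (g w))"
    "fun_norm M emb g = ennreal (norm y)" by (rule fun_normE)
  have "bfn 1 (\<lambda>w. ennreal (cmod (emb y w) powr 1)) K"
    by (rule bfn_emb) (use y(2) assms in simp)
  moreover from y(1) have "AE w in M. g w \<le> ennreal (cmod (emb y w) powr 1)"
    by eventually_elim simp
  ultimately show ?thesis by (rule bfn_mono) simp
qed

lemma fun_norm_le:
  assumes "bfn 1 g K" and [measurable]: "g \<in> borel_measurable M"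
  shows "fun_norm M emb g \<le> ennreal K"
proof -
  obtain y0 where y0: "AE w in M. g w \<le> ennreal (cmod (emb y0 w) powr 1)" "norm y0 \<le> K"
    using assms(1) by (auto simp: bfn_def)
  from y0(1) have "AE w in M. cmod (complex_of_real (enn2real (g w))) \<le> cmod (emb y0 w)"
    by eventually_elim (simp add: enn2real_leI)
  then obtain y where y: "AE w in M. emb y w = complex_of_real (enn2real (g w))" "norm y \<le> norm y0"
    using ideal[of "\<lambda>w. complex_of_real (enn2real (g w))" y0] by auto
  have "AE w in M. g w < \<infinity> \<and> emb y w = complex_of_real (enn2real (g w))"
    using y(1) y0(1) by eventually_elim (auto simp: order_le_less_trans)
  then have "fun_norm M emb g \<le> ennreal (norm y)"
    unfolding fun_norm_def by (intro INF_lower) auto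
  also have "\<dots> \<le> ennreal K" using y(2) y0(2) by (intro ennreal_leI) simp
  finally show ?thesis .
qed

text \<open>The case split copies \<open>Lq_star_norm\<close>, because \<open>enn2real\<close> sends
  infinity to 0.\<close>

definition enn_root :: "real \<Rightarrow> ennreal \<Rightarrow> ennreal" where
  "enn_root q I = (if I = \<infinity> then \<infinity> else ennreal (enn2real I powr (1 / q)))"

lemma enn_root_measurable [measurable]:
  assumes "f \<in> borel_measurable M"
  shows "(\<lambda>w. enn_root q (f w)) \<in> borel_measurable M"
  using assms unfolding enn_root_def by measurable

lemma enn_root_le_iff:
  assumes "q > 0" "r \<ge> 0"
  shows "enn_root q I \<le> ennreal r \<longleftrightarrow> I \<le> ennreal (r powr q)"
proof (cases I)
  case (real i)
  have "i powr (1/q) \<le> r \<longleftrightarrow> i \<le> r powr q"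
  proof
    assume "i powr (1/q) \<le> r"
    then have "(i powr (1/q)) powr q \<le> r powr q" using assms by (intro powr_mono2) auto
    then show "i \<le> r powr q" using assms real by (simp add: powr_powr)
  next
    assume "i \<le> r powr q"
    then have "i powr (1/q) \<le> (r powr q) powr (1/q)" using assms real by (intro powr_mono2) auto
    then show "i powr (1/q) \<le> r" using assms by (simp add: powr_powr)
  qed
  then show ?thesis using real assms by (simp add: enn_root_def)
qed (use assms in \<open>simp add: enn_root_def top_unique\<close>)

lemma bfn_enn_root: "q > 0 \<Longrightarrow> bfn 1 (\<lambda>w. enn_root q (g w)) K \<longleftrightarrow> bfn q g K"
  unfolding bfn_def by (simp add: enn_root_le_iff)

section \<open>\<open>\<ell>\<^sup>q\<close>-bounded families\<close>

lemma ellq_bounded_bfn: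
  assumes "ellq_bounded M emb q \<T>" and q: "q \<ge> 1"
  obtains C where "C > 0"
    "\<And>n x T K. (\<And>j. j < (n::nat) \<Longrightarrow> T j \<in> \<T>) \<Longrightarrow> bfn q (\<lambda>w. \<Sum>j<n. ennreal (cmod (emb (x j) w) powr q)) K \<Longrightarrow>
       bfn q (\<lambda>w. \<Sum>j<n. ennreal (cmod (emb (T j (x j)) w) powr q)) (C * K)"
proof -
  obtain C where C: "C > 0" and le: "\<And>(n::nat) (x :: nat \<Rightarrow> 'x) T. (\<forall>j<n. T j \<in> \<T>) \<Longrightarrow>
        fun_norm M emb (\<lambda>w. ennreal ((\<Sum>j<n. cmod (emb (T j (x j)) w) powr q) powr (1 / q)))
        \<le> ennreal C * fun_norm M emb (\<lambda>w. ennreal ((\<Sum>j<n. cmod (emb (x j) w) powr q) powr (1 / q)))"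
    using assms(1) unfolding ellq_bounded_def by blast
  have root: "ennreal ((\<Sum>j<n. cmod (emb (x j) w) powr q) powr (1 / q)) = enn_root q (\<Sum>j<n. ennreal (cmod (emb (x j) w) powr q))"
    for n :: nat and x :: "nat \<Rightarrow> 'x" and w
    by (simp add: enn_root_def sum_nonneg)
  show ?thesis
  proof (rule that[OF C])
    fix n x T K assume T: "\<And>j. j < (n::nat) \<Longrightarrow> T j \<in> \<T>" and bd: "bfn q (\<lambda>w. \<Sum>j<n. ennreal (cmod (emb (x j) w) powr q)) K"
    obtain y :: 'x where "norm y \<le> K" using bd by (auto simp: bfn_def)
    then have K: "K \<ge> 0" by (rule order_trans[OF norm_ge_zero])
    have "bfn 1 (\<lambda>w. enn_root q (\<Sum>j<n. ennreal (cmod (emb (x j) w) powr q))) K"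
      using bd q by (simp add: bfn_enn_root)
    then have "fun_norm M emb (\<lambda>w. enn_root q (\<Sum>j<n. ennreal (cmod (emb (x j) w) powr q))) \<le> ennreal K"
      by (rule fun_norm_le) measurable
    then have "ennreal C * fun_norm M emb (\<lambda>w. enn_root q (\<Sum>j<n. ennreal (cmod (emb (x j) w) powr q))) \<le> ennreal C * ennreal K"
      by (rule mult_left_mono) simp
    with le[of n T x] T C K have "fun_norm M emb (\<lambda>w. enn_root q (\<Sum>j<n. ennreal (cmod (emb (T j (x j)) w) powr q))) \<le> ennreal (C * K)"
      unfolding root[symmetric] by (simp add: ennreal_mult)
    then have "bfn 1 (\<lambda>w. enn_root q (\<Sum>j<n. ennreal (cmod (emb (T j (x j)) w) powr q))) (C * K)"
      by (rule bfn_fun_norm) (use C K in simp)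
    then show "bfn q (\<lambda>w. \<Sum>j<n. ennreal (cmod (emb (T j (x j)) w) powr q)) (C * K)"
      using q by (simp add: bfn_enn_root)
  qed
qed

text \<open>The case n = 1 of \<ell>^q-boundedness.\<close>

lemma ellq_bounded_norm:
  assumes "ellq_bounded M emb q \<T>" and q: "q \<ge> 1"
  obtains C where "C > 0" "\<And>T x. T \<in> \<T> \<Longrightarrow> norm (T x) \<le> C * norm x"
proof -
  obtain C where C: "C > 0"
    "\<And>n x T K. (\<And>j. j < (n::nat) \<Longrightarrow> T j \<in> \<T>) \<Longrightarrow> bfn q (\<lambda>w. \<Sum>j<n. ennreal (cmod (emb (x j) w) powr q)) K \<Longrightarrow>
       bfn q (\<lambda>w. \<Sum>j<n. ennreal (cmod (emb (T j (x j)) w) powr q)) (C * K)"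
    using ellq_bounded_bfn[OF assms] by blast
  show ?thesis
  proof (rule that[OF C(1)])
    fix T x assume "T \<in> \<T>"
    then show "norm (T x) \<le> C * norm x"
      using C(2)[of 1 "\<lambda>_. T" "\<lambda>_. x" "norm x"] bfn_emb[of x "norm x" q] bfn_normD[of q "T x"] q by simp
  qed
qed

text \<open>The family acts on the cell averages of \<open>f\<close>, which Jensen's inequality controls.\<close>

lemma ellq_bounded_family:
  assumes ellq: "ellq_bounded M emb q \<T>" and q: "q \<ge> 1"
  obtains C where "C > 0"
    "\<And>S f F G K. (\<And>t. S t \<in> \<T>) \<Longrightarrow> (\<And>x. continuous_on UNIV (\<lambda>t::real. S t x)) \<Longrightarrow> continuous_on UNIV f \<Longrightarrow>
        version F f \<Longrightarrow> bfn q (LQ q F) K \<Longrightarrow> version G (\<lambda>t. S t (f t)) \<Longrightarrow> bfn q (LQ q G) (C * K)"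
proof -
  obtain C where C: "C > 0"
    "\<And>n x T K. (\<And>j. j < (n::nat) \<Longrightarrow> T j \<in> \<T>) \<Longrightarrow> bfn q (\<lambda>w. \<Sum>j<n. ennreal (cmod (emb (x j) w) powr q)) K \<Longrightarrow>
       bfn q (\<lambda>w. \<Sum>j<n. ennreal (cmod (emb (T j (x j)) w) powr q)) (C * K)"
    using ellq_bounded_bfn[OF assms] by blast
  obtain C0 where C0: "C0 > 0" "\<And>T x. T \<in> \<T> \<Longrightarrow> norm (T x) \<le> C0 * norm x"
    using ellq_bounded_norm[OF assms] by blast
  show ?thesis
  proof (rule that[OF C(1)])
    fix S :: "real \<Rightarrow> 'x \<Rightarrow> 'x" and f F G K
    assume S: "\<And>t. S t \<in> \<T>" and Sc: "\<And>x. continuous_on UNIV (\<lambda>t::real. S t x)" and f: "continuous_on UNIV f"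
      and F: "version F f" and bd: "bfn q (LQ q F) K" and G: "version G (\<lambda>t. S t (f t))"
    have Sl: "bounded_linear (S t)" for t using S ellq by (auto simp: ellq_bounded_def)
    have Sn: "norm (S t x) \<le> C0 * norm x" for t x using C0(2) S by blast
    have Fm[measurable]: "F \<in> borel_measurable (lborel \<Otimes>\<^sub>M M)" using F by (rule version_measurable)
    \<comment> \<open>Mesh 2^-n and 2 n 2^n cells, which cover [-n, n): the cells shrink while their
      union exhausts the line.\<close>
    define h where "h n = (1 / 2 ^ n :: real)" for n :: nat
    define N where "N n = n * 2 ^ n" for n :: nat
    define \<tau> where "\<tau> n k = (real k - real (N n)) * h n" for n k
    \<comment> \<open>Averages are used because point values of f are not controlled by its L^q
      norm. The operator is taken at the left end of the cell.\<close>
    define xx where "xx n k = (1 / h n) *\<^sub>R integral {\<tau> n k..\<tau> n k + h n} f" for n k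
    define y where "y n k = S (\<tau> n k) (xx n k)" for n k
    define v where "v n j = (if - int (N n) \<le> j \<and> j < int (N n) then y n (nat (j + int (N n))) else 0)" for n j
    define g where "g n s = v n \<lfloor>s * 2 ^ n\<rfloor>" for n and s :: real
    define Gn where "Gn n p = emb (g n (fst p)) (snd p)" for n p
    have h: "h n > 0" for n by (simp add: h_def)
    have Gv: "version (Gn n) (g n)" for n
      unfolding version_def Gn_def g_def using floor_family_measurable[of "v n" "2 ^ n"] by auto
    have "bfn q (LQ q (Gn n)) (C * K)" for n
    proof -
      have "AE w in M. \<forall>k. emb (integral {\<tau> n k..\<tau> n k + h n} f) w = (LINT s:{\<tau> n k<..\<tau> n k + h n}|lborel. F (s, w))"
        unfolding AE_all_countable using h[of n] by (auto intro!: emb_integral f F)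
      moreover have "AE w in M. \<forall>k. emb (xx n k) w = of_real (1 / h n) * emb (integral {\<tau> n k..\<tau> n k + h n} f) w"
        unfolding AE_all_countable xx_def by (intro allI emb_scaleR)
      ultimately have "AE w in M. (\<Sum>k<2 * N n. ennreal (cmod (emb (xx n k) w) powr q)) \<le> ennreal (((2 ^ n) powr (1/q)) powr q) * LQ q F w"
        using AE_space
      proof eventually_elim
        case (elim w)
        have [measurable]: "(\<lambda>s. F (s, w)) \<in> borel_measurable borel" using elim(3) by measurable
        have 1: "ennreal (cmod (emb (xx n k) w) powr q) \<le> (\<integral>\<^sup>+s. ennreal (indicator {\<tau> n k<..\<tau> n k + h n} s * 2 ^ n * cmod (F (s, w)) powr q) \<partial>lborel)" for k
        proof -
          have "ennreal (cmod (emb (xx n k) w) powr q) \<le> ennreal (1 powr (q - 1)) * (\<integral>\<^sup>+s. ennreal (indicator {\<tau> n k<..\<tau> n k + h n} s * 2 ^ n * cmod (F (s, w)) powr q) \<partial>lborel)"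
          proof (rule nn_integral_powr_jensen)
            have "emb (xx n k) w = 2 ^ n * (LINT s:{\<tau> n k<..\<tau> n k + h n}|lborel. F (s, w))"
              using elim(1,2) by (simp add: h_def)
            also have "\<dots> = (LINT s:{\<tau> n k<..\<tau> n k + h n}|lborel. 2 ^ n * F (s, w))" by simp
            finally have "ennreal (cmod (emb (xx n k) w)) \<le> (\<integral>\<^sup>+s. ennreal (indicator {\<tau> n k<..\<tau> n k + h n} s * cmod (2 ^ n * F (s, w))) \<partial>lborel)"
              using norm_set_lebesgue_integral_le by metis
            then show "ennreal (cmod (emb (xx n k) w)) \<le> (\<integral>\<^sup>+s. ennreal (indicator {\<tau> n k<..\<tau> n k + h n} s * 2 ^ n * cmod (F (s, w))) \<partial>lborel)"
              by (simp add: norm_mult norm_power mult.assoc)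
            have "(\<integral>\<^sup>+s. ennreal (indicator {\<tau> n k<..\<tau> n k + h n} s * 2 ^ n) \<partial>lborel) = (\<integral>\<^sup>+s. ennreal (2 ^ n) * indicator {\<tau> n k<..\<tau> n k + h n} s \<partial>lborel)"
              by (intro nn_integral_cong) (auto simp: indicator_def)
            also have "\<dots> = ennreal (2 ^ n) * ennreal (h n)"
              using h[of n] by (subst nn_integral_cmult_indicator) auto
            also have "\<dots> = ennreal 1" using h[of n] by (subst ennreal_mult[symmetric]) (auto simp: h_def)
            finally show "(\<integral>\<^sup>+s. ennreal (indicator {\<tau> n k<..\<tau> n k + h n} s * 2 ^ n) \<partial>lborel) \<le> ennreal 1" by simp
          qed (use q in auto)
          then show ?thesis by simp
        qed
        have 2: "(\<Sum>k<2 * N n. ennreal (indicator {\<tau> n k<..\<tau> n k + h n} s * 2 ^ n * cmod (F (s, w)) powr q)) \<le> ennreal (2 ^ n * cmod (F (s, w)) powr q)" for s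
        proof -
          \<comment> \<open>These cells are open on the left, so the index is a ceiling minus 1. The
            sampled curve g has cells closed on the left and uses a floor.\<close>
          define k0 where "k0 = nat (\<lceil>s * 2 ^ n\<rceil> + int (N n) - 1)"
          have k0: "k = k0" if "s \<in> {\<tau> n k<..\<tau> n k + h n}" for k
          proof -
            have "real k - real (N n) < s * 2 ^ n" "s * 2 ^ n \<le> real k - real (N n) + 1"
              using that by (auto simp: \<tau>_def h_def field_simps)
            then have "\<lceil>s * 2 ^ n\<rceil> = int k - int (N n) + 1" by (simp add: ceiling_eq_iff)
            then show ?thesis by (simp add: k0_def)
          qed
          have "(\<Sum>k<2 * N n. ennreal (indicator {\<tau> n k<..\<tau> n k + h n} s * 2 ^ n * cmod (F (s, w)) powr q))
             \<le> (\<Sum>k<2 * N n. if k = k0 then ennreal (2 ^ n * cmod (F (s, w)) powr q) else 0)"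
          proof (rule sum_mono)
            fix k
            show "ennreal (indicator {\<tau> n k<..\<tau> n k + h n} s * 2 ^ n * cmod (F (s, w)) powr q)
              \<le> (if k = k0 then ennreal (2 ^ n * cmod (F (s, w)) powr q) else 0)"
            proof (cases "s \<in> {\<tau> n k<..\<tau> n k + h n}")
              case True
              with k0[OF True] show ?thesis by simp
            next
              case False
              then show ?thesis by simp
            qed
          qed
          also have "\<dots> \<le> ennreal (2 ^ n * cmod (F (s, w)) powr q)" by (subst sum.delta) auto
          finally show ?thesis .
        qed
        have "(\<Sum>k<2 * N n. ennreal (cmod (emb (xx n k) w) powr q)) \<le> (\<Sum>k<2 * N n. \<integral>\<^sup>+s. ennreal (indicator {\<tau> n k<..\<tau> n k + h n} s * 2 ^ n * cmod (F (s, w)) powr q) \<partial>lborel)"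
          by (intro sum_mono 1)
        also have "\<dots> = (\<integral>\<^sup>+s. (\<Sum>k<2 * N n. ennreal (indicator {\<tau> n k<..\<tau> n k + h n} s * 2 ^ n * cmod (F (s, w)) powr q)) \<partial>lborel)"
          by (rule nn_integral_sum[symmetric]) measurable
        also have "\<dots> \<le> (\<integral>\<^sup>+s. ennreal (2 ^ n) * ennreal (cmod (F (s, w)) powr q) \<partial>lborel)"
          using 2 by (intro nn_integral_mono) (simp add: ennreal_mult)
        also have "\<dots> = ennreal (2 ^ n) * LQ q F w" by (rule nn_integral_cmult) measurable
        also have "(2 ^ n :: real) = ((2 ^ n) powr (1/q)) powr q" using q by (simp add: powr_powr)
        finally show ?case .
      qed
      from bfn_mono[OF bfn_scale[OF bd, of "(2 ^ n) powr (1/q)"] this order_refl]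
      have "bfn q (\<lambda>w. \<Sum>k<2 * N n. ennreal (cmod (emb (xx n k) w) powr q)) ((2 ^ n) powr (1/q) * K)" by simp
      then have "bfn q (\<lambda>w. \<Sum>k<2 * N n. ennreal (cmod (emb (S (\<tau> n k) (xx n k)) w) powr q)) (C * ((2 ^ n) powr (1/q) * K))"
        by (intro C(2)[where T="\<lambda>k. S (\<tau> n k)"] S)
      from bfn_scale[OF this, of "h n powr (1/q)"]
      have b: "bfn q (\<lambda>w. ennreal ((h n powr (1/q)) powr q) * (\<Sum>k<2 * N n. ennreal (cmod (emb (y n k) w) powr q))) (h n powr (1/q) * (C * ((2 ^ n) powr (1/q) * K)))"
        unfolding y_def using h[of n] by simp
      \<comment> \<open>The factor 2^n from averaging and the cell length cancel, so the bound C K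
        is independent of the mesh. Both travel as q-th roots because \<open>bfn_scale\<close>
        raises its constant to the power q.\<close>
      have "h n powr (1/q) * (2 ^ n) powr (1/q) = 1"
        using h[of n] by (simp add: powr_mult[symmetric] h_def)
      then have e1: "h n powr (1/q) * (C * ((2 ^ n) powr (1/q) * K)) = C * K"
        by (metis mult.assoc mult.commute mult.left_neutral)
      have e2: "(h n powr (1/q)) powr q = h n" using h[of n] q by (simp add: powr_powr)
      have "AE w in M. LQ q (Gn n) w \<le> ennreal (h n) * (\<Sum>k<2 * N n. ennreal (cmod (emb (y n k) w) powr q))"
        using emb_0
      proof eventually_elim
        case (elim w)
        define E where "E k = {s::real. \<lfloor>s * 2 ^ n\<rfloor> = int k - int (N n)}" for k
        have E: "E k = {\<tau> n k..<\<tau> n k + h n}" for k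
        proof -
          have "s \<in> E k \<longleftrightarrow> s \<in> {\<tau> n k..<\<tau> n k + h n}" for s
          proof -
            have "s \<in> E k \<longleftrightarrow> real k - real (N n) \<le> s * 2 ^ n \<and> s * 2 ^ n < real k - real (N n) + 1"
              unfolding E_def mem_Collect_eq floor_eq_iff by simp
            then show ?thesis by (simp add: \<tau>_def h_def field_simps)
          qed
          then show ?thesis by blast
        qed
        have pt: "ennreal (cmod (Gn n (s, w)) powr q) = (\<Sum>k<2 * N n. ennreal (cmod (emb (y n k) w) powr q) * indicator (E k) s)" for s
        proof (cases "- int (N n) \<le> \<lfloor>s * 2 ^ n\<rfloor> \<and> \<lfloor>s * 2 ^ n\<rfloor> < int (N n)")
          case True
          define k0 where "k0 = nat (\<lfloor>s * 2 ^ n\<rfloor> + int (N n))"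
          have k0: "s \<in> E k \<longleftrightarrow> k = k0" for k using True by (auto simp: E_def k0_def)
          have "(\<Sum>k<2 * N n. ennreal (cmod (emb (y n k) w) powr q) * indicator (E k) s) = (\<Sum>k<2 * N n. if k = k0 then ennreal (cmod (emb (y n k) w) powr q) else 0)"
            using k0 by (intro sum.cong) (auto simp: indicator_def)
          also have "\<dots> = ennreal (cmod (emb (y n k0) w) powr q)" using True by (subst sum.delta) (auto simp: k0_def)
          finally show ?thesis using True by (simp add: Gn_def g_def v_def k0_def)
        next
          case False
          then have "s \<notin> E k" if "k < 2 * N n" for k using that by (auto simp: E_def)
          then have "(\<Sum>k<2 * N n. ennreal (cmod (emb (y n k) w) powr q) * indicator (E k) s) = 0" by (intro sum.neutral) auto
          moreover have "g n s = 0" using False by (auto simp: g_def v_def)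
          ultimately show ?thesis using elim by (simp add: Gn_def)
        qed
        have [measurable]: "E k \<in> sets borel" for k by (simp add: E)
        have "LQ q (Gn n) w = (\<Sum>k<2 * N n. ennreal (h n) * ennreal (cmod (emb (y n k) w) powr q))"
          unfolding pt using h[of n] by (subst nn_integral_sum) (auto simp: nn_integral_cmult_indicator E mult.commute)
        then show ?case by (simp only: sum_distrib_left order_refl)
      qed
      from bfn_mono[OF b[unfolded e1 e2] this order_refl] show ?thesis .
    qed
    \<comment> \<open>The error is split at S (\<tau> n i) (f s): averaging costs at most C0
      \<epsilon>1 = \<epsilon>/2, and moving the operator from \<tau> n i to s costs less than
      \<epsilon>/2 by joint continuity on a compact square.\<close>
    moreover have "\<exists>n. \<forall>s. \<bar>s\<bar> \<le> real k \<longrightarrow> norm (g n s - S s (f s)) \<le> \<epsilon>" if eps: "\<epsilon> > 0" for k \<epsilon>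
    proof -
      define I where "I = {- (real k + 1)..real k + 1}"
      define \<epsilon>1 where "\<epsilon>1 = \<epsilon> / (2 * C0)"
      have e1: "\<epsilon>1 > 0" using eps C0 by (simp add: \<epsilon>1_def)
      have "uniformly_continuous_on I f"
        unfolding I_def by (rule compact_uniformly_continuous[OF continuous_on_subset[OF f]]) auto
      then obtain d1 where d1: "d1 > 0" "\<And>s t. s \<in> I \<Longrightarrow> t \<in> I \<Longrightarrow> dist t s < d1 \<Longrightarrow> dist (f t) (f s) < \<epsilon>1"
        using e1 unfolding uniformly_continuous_on_def by metis
      have "uniformly_continuous_on (I \<times> I) (\<lambda>(t,s). S t (f s))"
        by (rule compact_uniformly_continuous[OF continuous_on_subset[OF strong_continuous_apply[OF Sl Sn Sc f]]])
          (auto intro!: compact_Times simp: I_def)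
      then obtain d2 where d2: "d2 > 0" "\<And>p p'. p \<in> I \<times> I \<Longrightarrow> p' \<in> I \<times> I \<Longrightarrow> dist p' p < d2 \<Longrightarrow>
          dist (S (fst p') (f (snd p'))) (S (fst p) (f (snd p))) < \<epsilon> / 2"
        using half_gt_zero[OF eps] unfolding uniformly_continuous_on_def case_prod_unfold by metis
      obtain n1 where n1: "(1/2::real) ^ n1 < min d1 d2" using real_arch_pow_inv[of "min d1 d2" "1/2"] d1 d2 by auto
      \<comment> \<open>At least k + 1, so that [-k, k] lies inside the range [-n, n) of the
        cells.\<close>
      define n where "n = max n1 (k + 1)"
      have hn: "h n < min d1 d2"
      proof -
        have "(1/2::real) ^ n \<le> (1/2) ^ n1" by (intro power_decreasing) (auto simp: n_def)
        then show ?thesis using n1 by (simp add: h_def power_one_over)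
      qed
      have hn1: "h n \<le> 1" by (simp add: h_def)
      show ?thesis
      proof (intro exI[of _ n] allI impI)
        fix s assume s: "\<bar>s\<bar> \<le> real k"
        have "real k + 1 \<le> real n" by (simp add: n_def)
        then have "- real n \<le> s" "s < real n" using s by linarith+
        then have "- real n * 2 ^ n \<le> s * 2 ^ n" "s * 2 ^ n < real n * 2 ^ n"
          by (intro mult_right_mono mult_strict_right_mono; simp)+
        then have "- real (N n) \<le> s * 2 ^ n" "s * 2 ^ n < real (N n)" by (simp_all add: N_def)
        then have in_range: "- int (N n) \<le> \<lfloor>s * 2 ^ n\<rfloor> \<and> \<lfloor>s * 2 ^ n\<rfloor> < int (N n)"
          by (auto simp: le_floor_iff floor_less_iff)
        define i where "i = nat (\<lfloor>s * 2 ^ n\<rfloor> + int (N n))"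
        have \<tau>: "\<tau> n i = of_int \<lfloor>s * 2 ^ n\<rfloor> * h n" using in_range by (simp add: \<tau>_def i_def)
        have "of_int \<lfloor>s * 2 ^ n\<rfloor> \<le> s * 2 ^ n" "s * 2 ^ n < of_int \<lfloor>s * 2 ^ n\<rfloor> + 1" by linarith+
        then have ts: "\<tau> n i \<le> s" "s < \<tau> n i + h n" unfolding \<tau> by (auto simp: h_def field_simps)
        have xf: "norm (xx n i - f s) \<le> \<epsilon>1"
        proof -
          have "xx n i - f s = (1 / h n) *\<^sub>R integral {\<tau> n i..\<tau> n i + h n} (\<lambda>t. f t - f s)"
            using h[of n] unfolding xx_def
            by (subst integral_diff) (auto intro!: integrable_continuous_real continuous_on_subset[OF f] simp: scaleR_diff_right)
          also have "norm \<dots> \<le> (1 / h n) * (\<epsilon>1 * (\<tau> n i + h n - \<tau> n i))"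
          proof -
            have "norm (integral {\<tau> n i..\<tau> n i + h n} (\<lambda>t. f t - f s)) \<le> \<epsilon>1 * (\<tau> n i + h n - \<tau> n i)"
            proof (rule integral_bound)
              fix t assume t: "t \<in> {\<tau> n i..\<tau> n i + h n}"
              then have "dist t s < d1" "t \<in> I" "s \<in> I" using ts hn hn1 s by (auto simp: dist_real_def I_def)
              then show "norm (f t - f s) \<le> \<epsilon>1" using d1(2)[of s t] by (simp add: dist_norm)
            qed (use h[of n] in \<open>auto intro!: continuous_intros continuous_on_subset[OF f]\<close>)
            then show ?thesis using h[of n] by (simp add: field_simps)
          qed
          also have "\<dots> = \<epsilon>1" using h[of n] by simp
          finally show ?thesis .
        qed
        have gs: "g n s = S (\<tau> n i) (xx n i)" using in_range by (simp add: g_def v_def y_def i_def)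
        have "norm (g n s - S s (f s)) \<le> norm (S (\<tau> n i) (xx n i - f s)) + norm (S (\<tau> n i) (f s) - S s (f s))"
          unfolding gs linear_diff[OF bounded_linear.linear[OF Sl]]
          using norm_triangle_ineq[of "S (\<tau> n i) (xx n i) - S (\<tau> n i) (f s)" "S (\<tau> n i) (f s) - S s (f s)"] by simp
        moreover have "norm (S (\<tau> n i) (xx n i - f s)) \<le> C0 * \<epsilon>1"
          using Sn[of "\<tau> n i" "xx n i - f s"] mult_left_mono[OF xf, of C0] C0 by linarith
        moreover have "norm (S (\<tau> n i) (f s) - S s (f s)) < \<epsilon> / 2"
        proof -
          have "dist (\<tau> n i, s) (s, s) < d2" "\<tau> n i \<in> I" "s \<in> I"
            using ts hn hn1 s by (auto simp: dist_Pair_Pair dist_real_def I_def)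
          then show ?thesis using d2(2)[of "(s,s)" "(\<tau> n i, s)"] by (simp add: dist_norm)
        qed
        moreover have "C0 * \<epsilon>1 = \<epsilon> / 2" using C0 by (simp add: \<epsilon>1_def)
        ultimately show "norm (g n s - S s (f s)) \<le> \<epsilon>" by linarith
      qed
    qed
    ultimately show "bfn q (LQ q G) (C * K)"
      using q by (intro bfn_LQ_locally_uniform[OF Gv G]) auto
  qed
qed

section \<open>Triebel-Lizorkin norms\<close>

lemma Lq_star_norm_eq:
  assumes [measurable]: "(\<lambda>t. F (t, w)) \<in> borel_measurable borel"
  shows "Lq_star_norm q (\<lambda>t. t powr (- \<theta>) * cmod (F (t, w)))
    = enn_root q (\<integral>\<^sup>+s. ennreal (cmod (of_real (exp (- \<theta> * s)) * F (exp s, w)) powr q) \<partial>lborel)"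
proof -
  have "(\<integral>\<^sup>+t\<in>{0<..}. ennreal (\<bar>t powr (- \<theta>) * cmod (F (t, w))\<bar> powr q / t) \<partial>lborel)
    = (\<integral>\<^sup>+s. ennreal (\<bar>exp s powr (- \<theta>) * cmod (F (exp s, w))\<bar> powr q / exp s * exp s) \<partial>lborel)"
    by (rule nn_integral_exp_substitution) measurable
  also have "\<dots> = (\<integral>\<^sup>+s. ennreal (cmod (of_real (exp (- \<theta> * s)) * F (exp s, w)) powr q) \<partial>lborel)"
    by (intro nn_integral_cong) (simp add: abs_mult norm_mult powr_def)
  finally show ?thesis by (simp add: Lq_star_norm_def enn_root_def Let_def)
qed

text \<open>The exponential pulls null sets back to null sets, by the substitution rule for the
  indicator of N divided by t.\<close>

lemma AE_exp:
  assumes "AE t in lborel. t > 0 \<longrightarrow> P (t::real)"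
  shows "AE s in lborel. P (exp s)"
proof -
  obtain N where N: "{t\<in>space lborel. \<not> (t > 0 \<longrightarrow> P t)} \<subseteq> N" "emeasure lborel N = 0" "N \<in> sets lborel"
    by (rule AE_E[OF assms])
  have [measurable]: "N \<in> sets borel" using N(3) by simp
  have "(\<integral>\<^sup>+s. ennreal (indicator N (exp s) / exp s * exp s) \<partial>lborel) = (\<integral>\<^sup>+t\<in>{0<..}. ennreal (indicator N t / t) \<partial>lborel)"
    by (rule nn_integral_exp_substitution[symmetric]) measurable
  also have "\<dots> = (\<integral>\<^sup>+t. 0 \<partial>(lborel :: real measure))"
  proof (rule nn_integral_cong_AE)
    have "AE t in lborel. t \<notin> N" using N by (intro AE_not_in null_setsI) auto
    then show "AE t in lborel. ennreal (indicator N t / t) * indicator {0<..} t = 0"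
      by eventually_elim simp
  qed
  finally have "(\<integral>\<^sup>+s. indicator N (exp s) \<partial>(lborel :: real measure)) = 0"
    by (simp add: ennreal_indicator)
  then have "AE s in lborel. (indicator N (exp s) :: ennreal) = 0"
    by (subst (asm) nn_integral_0_iff_AE) auto
  then show ?thesis
  proof eventually_elim
    case (elim s)
    then have "exp s \<notin> N" by (simp add: indicator_eq_0_iff)
    then have "exp s \<notin> {t \<in> space lborel. \<not> (t > 0 \<longrightarrow> P t)}" using N(1) by blast
    then show ?case by simp
  qed
qed

text \<open>\<open>TL_ennorm\<close> is an infimum over versions; the slack \<epsilon> selects one
  of them.\<close>

lemma TL_ennorm_finiteE:
  assumes fin: "TL_ennorm M emb q \<theta> \<nu> \<phi> A x < \<infinity>" and \<epsilon>: "\<epsilon> > 0" and q: "q \<ge> 1"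
  obtains G where "version G (\<lambda>s. exp (- \<theta> * s) *\<^sub>R dunford \<nu> (\<lambda>z. \<phi> (complex_of_real (exp s) * z)) A x)"
    "bfn q (LQ q G) (TL_norm M emb q \<theta> \<nu> \<phi> A x + \<epsilon>)"
proof -
  have "TL_ennorm M emb q \<theta> \<nu> \<phi> A x < ennreal (TL_norm M emb q \<theta> \<nu> \<phi> A x + \<epsilon>)"
    using fin \<epsilon> unfolding TL_norm_def
    by (metis enn2real_nonneg ennreal_enn2real ennreal_lessI infinity_ennreal_def less_add_same_cancel1 add_nonneg_pos)
  then obtain F where F: "F \<in> joint_versions M emb \<nu> \<phi> A x"
    "fun_norm M emb (\<lambda>w. Lq_star_norm q (\<lambda>t. t powr (- \<theta>) * cmod (F (t, w)))) < ennreal (TL_norm M emb q \<theta> \<nu> \<phi> A x + \<epsilon>)"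
    unfolding TL_ennorm_def INF_less_iff by auto
  have Fm[measurable]: "F \<in> borel_measurable (lborel \<Otimes>\<^sub>M M)"
    and Fv: "AE t in lborel. t > 0 \<longrightarrow> (AE w in M. F (t, w) = emb (dunford \<nu> (\<lambda>z. \<phi> (complex_of_real t * z)) A x) w)"
    using F(1) by (auto simp: joint_versions_def)
  define G where "G = (\<lambda>(s,w). complex_of_real (exp (- \<theta> * s)) * F (exp s, w))"
  have "G \<in> borel_measurable (lborel \<Otimes>\<^sub>M M)" unfolding G_def by measurable
  moreover have "AE s in lborel. AE w in M. G (s, w) = emb (exp (- \<theta> * s) *\<^sub>R dunford \<nu> (\<lambda>z. \<phi> (complex_of_real (exp s) * z)) A x) w"
    using AE_exp[OF Fv]
  proof eventually_elim
    case (elim s)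
    with emb_scaleR[of "exp (- \<theta> * s)" "dunford \<nu> (\<lambda>z. \<phi> (complex_of_real (exp s) * z)) A x"]
    show ?case by eventually_elim (simp add: G_def)
  qed
  ultimately have v: "version G (\<lambda>s. exp (- \<theta> * s) *\<^sub>R dunford \<nu> (\<lambda>z. \<phi> (complex_of_real (exp s) * z)) A x)"
    by (simp add: version_def)
  have "bfn 1 (\<lambda>w. Lq_star_norm q (\<lambda>t. t powr (- \<theta>) * cmod (F (t, w)))) (TL_norm M emb q \<theta> \<nu> \<phi> A x + \<epsilon>)"
    by (rule bfn_fun_norm) (use F(2) \<epsilon> in \<open>auto simp: TL_norm_def less_imp_le intro: add_nonneg_nonneg\<close>)
  moreover have "AE w in M. enn_root q (LQ q G w) \<le> Lq_star_norm q (\<lambda>t. t powr (- \<theta>) * cmod (F (t, w)))"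
  proof (rule AE_I2)
    fix w assume [measurable]: "w \<in> space M"
    have "(\<lambda>t. F (t, w)) \<in> borel_measurable borel" by measurable
    from Lq_star_norm_eq[of F w q \<theta>, OF this]
    show "enn_root q (LQ q G w) \<le> Lq_star_norm q (\<lambda>t. t powr (- \<theta>) * cmod (F (t, w)))" by (simp add: G_def)
  qed
  ultimately have "bfn 1 (\<lambda>w. enn_root q (LQ q G w)) (TL_norm M emb q \<theta> \<nu> \<phi> A x + \<epsilon>)"
    by (rule bfn_mono) simp
  with v that q show ?thesis by (simp add: bfn_enn_root)
qed

text \<open>Asking the identity for G at every s avoids pulling null sets back along the
  logarithm.\<close>

lemma TL_ennorm_le:
  assumes G: "G \<in> borel_measurable (lborel \<Otimes>\<^sub>M M)"
    "\<And>s. AE w in M. G (s, w) = emb (exp (- \<theta> * s) *\<^sub>R dunford \<nu> (\<lambda>z. \<phi> (complex_of_real (exp s) * z)) A x) w"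
    and bd: "bfn q (LQ q G) K" and q: "q \<ge> 1"
  shows "TL_ennorm M emb q \<theta> \<nu> \<phi> A x \<le> ennreal K"
proof -
  note [measurable] = G(1)
  define F where "F = (\<lambda>(t,w). complex_of_real (exp (\<theta> * ln t)) * G (ln t, w))"
  have Fm[measurable]: "F \<in> borel_measurable (lborel \<Otimes>\<^sub>M M)" unfolding F_def by measurable
  have "AE w in M. F (t, w) = emb (dunford \<nu> (\<lambda>z. \<phi> (complex_of_real t * z)) A x) w" if t: "t > 0" for t
  proof -
    let ?d = "dunford \<nu> (\<lambda>z. \<phi> (complex_of_real t * z)) A x"
    from G(2)[of "ln t"] emb_scaleR[of "exp (- \<theta> * ln t)" ?d]
    show ?thesis
    proof eventually_elim
      case (elim w)
      then have "F (t, w) = complex_of_real (exp (\<theta> * ln t) * exp (- \<theta> * ln t)) * emb ?d w"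
        using t by (simp add: F_def)
      also have "exp (\<theta> * ln t) * exp (- \<theta> * ln t) = 1" by (simp add: exp_add[symmetric])
      finally show ?case by simp
    qed
  qed
  then have "F \<in> joint_versions M emb \<nu> \<phi> A x" by (auto simp: joint_versions_def)
  then have "TL_ennorm M emb q \<theta> \<nu> \<phi> A x \<le> fun_norm M emb (\<lambda>w. Lq_star_norm q (\<lambda>t. t powr (- \<theta>) * cmod (F (t, w))))"
    unfolding TL_ennorm_def by (rule INF_lower)
  also have "\<dots> \<le> ennreal K"
  proof (rule fun_norm_le)
    have eq: "Lq_star_norm q (\<lambda>t. t powr (- \<theta>) * cmod (F (t, w))) = enn_root q (LQ q G w)" if "w \<in> space M" for w
    proof -
      note [measurable] = that
      have "(\<lambda>t. F (t, w)) \<in> borel_measurable borel" by measurable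
      from Lq_star_norm_eq[of F w q \<theta>, OF this]
      show ?thesis by (simp add: F_def mult.assoc[symmetric] exp_add[symmetric] flip: of_real_mult)
    qed
    have "bfn 1 (\<lambda>w. enn_root q (LQ q G w)) K" using bd q by (simp add: bfn_enn_root)
    then show "bfn 1 (\<lambda>w. Lq_star_norm q (\<lambda>t. t powr (- \<theta>) * cmod (F (t, w)))) K"
      by (rule bfn_mono) (auto simp: eq)
    show "(\<lambda>w. Lq_star_norm q (\<lambda>t. t powr (- \<theta>) * cmod (F (t, w)))) \<in> borel_measurable M"
      by (subst measurable_cong[OF eq]) auto
  qed
  finally show ?thesis .
qed

end


section \<open>Sectors\<close>

lemma Re_eq_cos_Arg: "Re z = cmod z * cos (Arg z)"
proof (cases "z = 0")
  case False
  then show ?thesis by (subst Arg_eq[OF False]) (simp add: Re_exp del: exp_of_real flip: cis_conv_exp)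
qed simp

text \<open>Without \<open>Arg\<close>, openness, invariance under dilation and membership of rays
  all become inequalities between continuous functions.\<close>

lemma sector_eq:
  assumes "0 < \<sigma>" "\<sigma> < pi"
  shows "sector \<sigma> = {z. cos \<sigma> * cmod z < Re z}"
proof -
  have "\<bar>Arg z\<bar> < \<sigma> \<longleftrightarrow> cos \<sigma> * cmod z < Re z" if "z \<noteq> 0" for z
  proof -
    have "\<bar>Arg z\<bar> \<le> pi" using Arg_bounded[of z] by auto
    then have "\<bar>Arg z\<bar> < \<sigma> \<longleftrightarrow> cos \<sigma> < cos \<bar>Arg z\<bar>"
      using assms by (intro cos_mono_less_eq[symmetric]) auto
    also have "\<dots> \<longleftrightarrow> cos \<sigma> * cmod z < Re z"
      using that unfolding Re_eq_cos_Arg[of z] by (simp add: mult.commute)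
    finally show ?thesis .
  qed
  note N = this
  show ?thesis
  proof (rule set_eqI)
    fix z show "z \<in> sector \<sigma> \<longleftrightarrow> z \<in> {z. cos \<sigma> * cmod z < Re z}"
      using N[of z] assms by (cases "z = 0") (auto simp: sector_def)
  qed
qed

lemma open_sector: "0 < \<sigma> \<Longrightarrow> \<sigma> < pi \<Longrightarrow> open (sector \<sigma>)"
  unfolding sector_eq by (intro open_Collect_less continuous_intros)

lemma closure_sector_subset:
  assumes "0 \<le> \<sigma>" "\<sigma> < pi"
  shows "closure (sector \<sigma>) \<subseteq> {z. cos \<sigma> * cmod z \<le> Re z}"
proof (rule closure_minimal)
  show "closed {z. cos \<sigma> * cmod z \<le> Re z}" by (intro closed_Collect_le continuous_intros)
  show "sector \<sigma> \<subseteq> {z. cos \<sigma> * cmod z \<le> Re z}"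
  proof (cases "\<sigma> = 0")
    case True
    then show ?thesis by (auto simp: sector_def cmod_eq_Re)
  next
    case False
    then show ?thesis using assms by (subst sector_eq) (auto simp: less_imp_le)
  qed
qed

text \<open>The exterior of the closed sector, described by cosines as in
  \<open>sector_eq\<close>.\<close>

definition outer :: "real \<Rightarrow> complex set" where
  "outer \<sigma> = {z. Re z < cos \<sigma> * cmod z}"

lemma open_outer: "open (outer \<sigma>)"
  unfolding outer_def by (intro open_Collect_less continuous_intros)

lemma outer_nonzero: "z \<in> outer \<sigma> \<Longrightarrow> z \<noteq> 0"
  by (auto simp: outer_def)

lemma outer_closure: "0 \<le> \<sigma> \<Longrightarrow> \<sigma> < pi \<Longrightarrow> outer \<sigma> \<subseteq> - closure (sector \<sigma>)"
  using closure_sector_subset[of \<sigma>] by (auto simp: outer_def)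

lemma Re_ray: "Re (ray s a) = exp s * cos a"
  by (simp add: ray_def Re_exp)

lemma ray_in_sector: "\<bar>a\<bar> < \<sigma> \<Longrightarrow> \<sigma> < pi \<Longrightarrow> ray s a \<in> sector \<sigma>"
  using cos_monotone_0_pi[of "\<bar>a\<bar>" \<sigma>] by (subst sector_eq) (auto simp: Re_ray mult.commute)

lemma ray_in_outer: "0 \<le> \<sigma> \<Longrightarrow> \<sigma> < \<bar>a\<bar> \<Longrightarrow> \<bar>a\<bar> \<le> pi \<Longrightarrow> ray s a \<in> outer \<sigma>"
  using cos_monotone_0_pi[of \<sigma> "\<bar>a\<bar>"] by (auto simp: outer_def Re_ray mult.commute)

text \<open>By the law of cosines: with r = |z| and c = cos(\<sigma>/2), the quantity 1 + 2 r cos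
  \<sigma> + r^2 exceeds (1 + r)^2 c^2 by (1 - c^2) (1 - r)^2.\<close>

lemma norm_one_plus_sector:
  assumes "0 < \<sigma>" "\<sigma> < pi" "z \<in> sector \<sigma>"
  shows "(1 + cmod z) * cos (\<sigma>/2) \<le> cmod (1 + z)"
proof -
  let ?r = "cmod z"
  have c: "cos \<sigma> = 2 * (cos (\<sigma>/2))\<^sup>2 - 1" using cos_double_cos[of "\<sigma>/2"] by simp
  have "(cos (\<sigma>/2))\<^sup>2 \<le> 1" by (simp add: power_le_one_iff abs_square_le_1)
  then have "((1 + ?r) * cos (\<sigma>/2))\<^sup>2 \<le> 1 + 2 * (cos \<sigma> * ?r) + ?r\<^sup>2"
  proof -
    have "1 + 2 * (cos \<sigma> * ?r) + ?r\<^sup>2 - ((1 + ?r) * cos (\<sigma>/2))\<^sup>2 = (1 - (cos (\<sigma>/2))\<^sup>2) * (1 - ?r)\<^sup>2"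
      unfolding c by (simp add: power2_eq_square algebra_simps)
    moreover have "\<dots> \<ge> 0" using \<open>(cos (\<sigma>/2))\<^sup>2 \<le> 1\<close> by simp
    ultimately show ?thesis by linarith
  qed
  also have "\<dots> \<le> 1 + 2 * Re z + ?r\<^sup>2" using assms by (simp add: sector_eq less_imp_le)
  also have "\<dots> = (cmod (1 + z))\<^sup>2" by (simp add: cmod_power2) (simp add: power2_eq_square algebra_simps)
  finally show ?thesis by (rule power2_le_imp_le) simp
qed

lemma cos_half_pos: "0 < \<sigma> \<Longrightarrow> \<sigma> < pi \<Longrightarrow> cos (\<sigma>/2) > 0"
  by (intro cos_gt_zero_pi) auto

section \<open>The class \<open>H_infty_0\<close>\<close>

lemma min_powr_eq: "r > 0 \<Longrightarrow> e > 0 \<Longrightarrow> min (r powr e) (r powr (- e)) = exp (- e * \<bar>ln r\<bar>)" for r e :: real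
  by (cases "ln r \<ge> 0") (auto simp: powr_def min_def mult_le_0_iff zero_le_mult_iff)

text \<open>The minimum of the two powers is exp(-e |ln |z||), the form that matches the coordinate
  s of a ray.\<close>

lemma H_infty_0_iff:
  assumes "0 < \<sigma>" "\<sigma> < pi"
  shows "f \<in> H_infty_0 \<sigma> \<longleftrightarrow> f holomorphic_on sector \<sigma> \<and>
    (\<exists>C>0. \<exists>e>0. \<forall>z\<in>sector \<sigma>. cmod (f z) \<le> C * exp (- e * \<bar>ln (cmod z)\<bar>))"
proof -
  have "z \<in> sector \<sigma> \<Longrightarrow> cmod z > 0" for z using assms by (auto simp: sector_def)
  then have "(\<forall>z\<in>sector \<sigma>. cmod (f z) \<le> C * min (cmod z powr e) (cmod z powr - e)) \<longleftrightarrow>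
      (\<forall>z\<in>sector \<sigma>. cmod (f z) \<le> C * exp (- e * \<bar>ln (cmod z)\<bar>))" if "e > 0" for C e
    using min_powr_eq[OF _ that] by simp
  then show ?thesis by (simp add: H_infty_0_def cong: conj_cong)
qed

lemma H_infty_0_holo: "f \<in> H_infty_0 \<sigma> \<Longrightarrow> f holomorphic_on sector \<sigma>"
  by (simp add: H_infty_0_def)

lemma H_infty_0_ray:
  assumes "0 < \<sigma>" "\<sigma> < pi" "f \<in> H_infty_0 \<sigma>"
  obtains C e where "C > 0" "e > 0" "\<And>s a. \<bar>a\<bar> < \<sigma> \<Longrightarrow> cmod (f (ray s a)) \<le> C * exp (- e * \<bar>s\<bar>)"
proof -
  obtain C e where "C > 0" "e > 0" "\<And>z. z \<in> sector \<sigma> \<Longrightarrow> cmod (f z) \<le> C * exp (- e * \<bar>ln (cmod z)\<bar>)"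
    using assms by (auto simp: H_infty_0_iff)
  then show ?thesis using that[of C e] ray_in_sector[OF _ assms(2)] by fastforce
qed

lemma H_infty_0_mult:
  assumes s: "0 < \<sigma>" "\<sigma> < pi" and f: "f \<in> H_infty_0 \<sigma>" and g: "g holomorphic_on sector \<sigma>"
    and B: "\<And>z. z \<in> sector \<sigma> \<Longrightarrow> cmod (g z) \<le> B"
  shows "(\<lambda>z. f z * g z) \<in> H_infty_0 \<sigma>"
proof -
  obtain C e where C: "C > 0" "e > 0" "\<And>z. z \<in> sector \<sigma> \<Longrightarrow> cmod (f z) \<le> C * exp (- e * \<bar>ln (cmod z)\<bar>)"
    using s f by (auto simp: H_infty_0_iff)
  have "cmod (f z * g z) \<le> (C * (\<bar>B\<bar> + 1)) * exp (- e * \<bar>ln (cmod z)\<bar>)" if "z \<in> sector \<sigma>" for z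
  proof -
    have "cmod (f z) * cmod (g z) \<le> (C * exp (- e * \<bar>ln (cmod z)\<bar>)) * (\<bar>B\<bar> + 1)"
      using C B[OF that] that by (intro mult_mono) auto
    then show ?thesis by (simp add: norm_mult mult_ac)
  qed
  moreover have "C * (\<bar>B\<bar> + 1) > 0" using C by simp
  ultimately show ?thesis using s C(2) H_infty_0_holo[OF f] g
    by (subst H_infty_0_iff) (auto intro!: holomorphic_on_mult)
qed

lemma sector_scale: "r > 0 \<Longrightarrow> 0 < \<sigma> \<Longrightarrow> \<sigma> < pi \<Longrightarrow> of_real r * z \<in> sector \<sigma> \<longleftrightarrow> z \<in> sector \<sigma>"
  by (simp add: sector_eq norm_mult mult.left_commute)

lemma H_infty_0_scale:
  assumes s: "0 < \<sigma>" "\<sigma> < pi" and f: "f \<in> H_infty_0 \<sigma>" and r: "r > 0"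
  shows "(\<lambda>z. f (of_real r * z)) \<in> H_infty_0 \<sigma>"
proof -
  obtain C e where C: "C > 0" "e > 0" "\<And>z. z \<in> sector \<sigma> \<Longrightarrow> cmod (f z) \<le> C * exp (- e * \<bar>ln (cmod z)\<bar>)"
    using s f by (auto simp: H_infty_0_iff)
  have "cmod (f (of_real r * z)) \<le> (C * exp (e * \<bar>ln r\<bar>)) * exp (- e * \<bar>ln (cmod z)\<bar>)" if z: "z \<in> sector \<sigma>" for z
  proof -
    have "cmod z > 0" using z s by (auto simp: sector_def)
    then have "ln (cmod (of_real r * z)) = ln r + ln (cmod z)" using r by (simp add: norm_mult ln_mult)
    then have "- \<bar>ln (cmod (of_real r * z))\<bar> \<le> \<bar>ln r\<bar> - \<bar>ln (cmod z)\<bar>" by linarith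
    then have "e * - \<bar>ln (cmod (of_real r * z))\<bar> \<le> e * (\<bar>ln r\<bar> - \<bar>ln (cmod z)\<bar>)" using C by (intro mult_left_mono) auto
    then have "exp (- e * \<bar>ln (cmod (of_real r * z))\<bar>) \<le> exp (e * \<bar>ln r\<bar>) * exp (- e * \<bar>ln (cmod z)\<bar>)"
      by (simp add: exp_add[symmetric] algebra_simps)
    then show ?thesis using C(3)[of "of_real r * z"] z r s C(1)
      by (simp add: sector_scale) (smt (verit) mult.assoc mult_left_mono)
  qed
  moreover have "C * exp (e * \<bar>ln r\<bar>) > 0" using C by simp
  moreover have "(\<lambda>z. f (of_real r * z)) holomorphic_on sector \<sigma>"
    using holomorphic_on_compose_gen[of "\<lambda>z. of_real r * z" "sector \<sigma>" f "sector \<sigma>"] H_infty_0_holo[OF f] sector_scale[OF r s]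
    by (auto simp: o_def intro!: holomorphic_intros)
  ultimately show ?thesis using s C(2) by (subst H_infty_0_iff) auto
qed

section \<open>Resolvents\<close>

text \<open>Sectoriality frozen at one angle \<sigma> together with its constant; the region is
  open, so the resolvent can be differentiated on it.\<close>

locale outer_resolvent =
  fixes A :: "'x::complex_banach unbounded_op" and \<sigma> C :: real
  assumes lin: "linear_op A" and \<sigma>: "0 \<le> \<sigma>" "\<sigma> < pi" and C: "C \<ge> 0"
    and outer_res: "outer \<sigma> \<subseteq> resolvent_set A"
    and bound: "z \<in> outer \<sigma> \<Longrightarrow> norm (z *\<^sub>C resolvent A z x) \<le> C * norm x"

lemma resolvent_right:
  assumes "l \<in> resolvent_set A"
  shows "resolvent A l x \<in> op_dom A" and "l *\<^sub>C resolvent A l x - op_app A (resolvent A l x) = x"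
proof -
  have b: "bij_betw (\<lambda>x. l *\<^sub>C x - op_app A x) (op_dom A) UNIV" using assms by (simp add: resolvent_set_def)
  then have "x \<in> (\<lambda>x. l *\<^sub>C x - op_app A x) ` op_dom A" by (simp add: bij_betw_def)
  then show "resolvent A l x \<in> op_dom A" "l *\<^sub>C resolvent A l x - op_app A (resolvent A l x) = x"
    unfolding resolvent_def by (rule inv_into_into, rule f_inv_into_f)
qed

lemma resolvent_left:
  assumes "l \<in> resolvent_set A" "x \<in> op_dom A"
  shows "resolvent A l (l *\<^sub>C x - op_app A x) = x"
  using assms unfolding resolvent_def resolvent_set_def bij_betw_def by (auto intro: inv_into_f_f)

lemma resolvent_bounded_clin:
  assumes "l \<in> resolvent_set A" "linear_op A"
  shows "bounded_clin (resolvent A l)"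
proof -
  have "resolvent A l (c *\<^sub>C x) = c *\<^sub>C resolvent A l x" for c x
  proof -
    let ?y = "resolvent A l x"
    have y: "?y \<in> op_dom A" and e: "l *\<^sub>C ?y - op_app A ?y = x" using resolvent_right[OF assms(1)] by auto
    have cy: "c *\<^sub>C ?y \<in> op_dom A" and "op_app A (c *\<^sub>C ?y) = c *\<^sub>C op_app A ?y"
      using assms(2) y by (auto simp: linear_op_def csubspace_def clinear_on_def)
    then have "l *\<^sub>C (c *\<^sub>C ?y) - op_app A (c *\<^sub>C ?y) = c *\<^sub>C (l *\<^sub>C ?y - op_app A ?y)"
      by (simp add: scaleC_scaleC scaleC.diff_right mult.commute)
    then show ?thesis using resolvent_left[OF assms(1) cy] e by simp
  qed
  then show ?thesis using assms(1) by (auto simp: bounded_clin_def resolvent_set_def)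
qed

lemma resolvent_identity:
  assumes "a \<in> resolvent_set A" "b \<in> resolvent_set A" "linear_op A"
  shows "resolvent A a x - resolvent A b x = (b - a) *\<^sub>C resolvent A a (resolvent A b x)"
proof -
  let ?y = "resolvent A b x"
  note ca = resolvent_bounded_clin[OF assms(1,3)]
  have y: "?y \<in> op_dom A" and e: "b *\<^sub>C ?y - op_app A ?y = x" using resolvent_right[OF assms(2)] by auto
  have "x = (a *\<^sub>C ?y - op_app A ?y) + (b - a) *\<^sub>C ?y" using e by (simp add: scaleC.diff_left)
  then have "resolvent A a x = resolvent A a ((a *\<^sub>C ?y - op_app A ?y) + (b - a) *\<^sub>C ?y)" by simp
  also have "\<dots> = ?y + (b - a) *\<^sub>C resolvent A a ?y"
    using resolvent_left[OF assms(1) y] by (simp add: bounded_clin_add[OF ca] bounded_clin_scaleC[OF ca])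
  finally show ?thesis by simp
qed

lemma resolvent_commute:
  assumes "a \<in> resolvent_set A" "b \<in> resolvent_set A" "linear_op A"
  shows "resolvent A a (resolvent A b x) = resolvent A b (resolvent A a x)"
proof (cases "a = b")
  case False
  have "(b - a) *\<^sub>C resolvent A a (resolvent A b x) = - ((a - b) *\<^sub>C resolvent A b (resolvent A a x))"
    using resolvent_identity[OF assms(1,2,3), of x] resolvent_identity[OF assms(2,1,3), of x] by (metis minus_diff_eq)
  also have "\<dots> = (b - a) *\<^sub>C resolvent A b (resolvent A a x)"
    by (metis minus_diff_eq scaleC.minus_left)
  finally have "(b - a) *\<^sub>C (resolvent A a (resolvent A b x) - resolvent A b (resolvent A a x)) = 0"
    by (simp add: scaleC.diff_right)
  then show ?thesis using False by simp
qed simp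

lemma sectorial_outer_resolvent:
  assumes "sectorial A \<omega>" "\<omega> < \<sigma>" "\<sigma> < pi"
  obtains C where "outer_resolvent A \<sigma> C"
proof -
  have w: "0 \<le> \<omega>" "linear_op A" "spectrum A \<subseteq> closure (sector \<omega>)" and
    b: "bdd_above ((\<lambda>l. onorm (\<lambda>x. l *\<^sub>C resolvent A l x)) ` (- closure (sector \<sigma>)))"
    using assms by (auto simp: sectorial_def)
  have cos: "cos \<sigma> \<le> cos \<omega>" using w assms by (intro cos_monotone_0_pi_le) auto
  have o1: "outer \<sigma> \<subseteq> outer \<omega>"
  proof
    fix z assume "z \<in> outer \<sigma>"
    then show "z \<in> outer \<omega>" using mult_right_mono[OF cos norm_ge_zero[of z]] by (auto simp: outer_def)
  qed
  then have o2: "outer \<sigma> \<subseteq> resolvent_set A" using outer_closure[of \<omega>] w assms by fastforce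
  obtain C where C: "\<And>l. l \<in> - closure (sector \<sigma>) \<Longrightarrow> onorm (\<lambda>x. l *\<^sub>C resolvent A l x) \<le> C"
    using b by (auto simp: bdd_above_def)
  show ?thesis
  proof (rule that[of "max C 0"], unfold_locales)
    fix z x assume z: "z \<in> outer \<sigma>"
    have bl: "bounded_linear (\<lambda>x. z *\<^sub>C resolvent A z x)"
      using bounded_clin_bounded_linear[OF bounded_clin_scale[OF resolvent_bounded_clin[of z A]]] o2 z w by blast
    have "norm (z *\<^sub>C resolvent A z x) \<le> onorm (\<lambda>x. z *\<^sub>C resolvent A z x) * norm x" by (rule onorm[OF bl])
    also have "\<dots> \<le> max C 0 * norm x"
      using C[of z] outer_closure[of \<sigma>] z w assms by (intro mult_right_mono) auto
    finally show "norm (z *\<^sub>C resolvent A z x) \<le> max C 0 * norm x" .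
  qed (use w assms o2 in auto)
qed

context outer_resolvent begin

lemma res: "z \<in> outer \<sigma> \<Longrightarrow> z \<in> resolvent_set A"
  using outer_res by blast

lemma norm_resolvent: "z \<in> outer \<sigma> \<Longrightarrow> norm (resolvent A z x) \<le> C / cmod z * norm x"
  using bound[of z x] outer_nonzero[of z \<sigma>] by (simp add: norm_scaleC field_simps)

lemma resolvent_isCont:
  assumes z: "z \<in> outer \<sigma>"
  shows "isCont (\<lambda>z. resolvent A z x) z"
  unfolding isCont_def
proof (rule LIM_zero_cancel, rule Lim_null_comparison)
  have "\<forall>\<^sub>F w in at z. w \<in> outer \<sigma>" using eventually_at_topological open_outer z by blast
  then show "\<forall>\<^sub>F w in at z. norm (resolvent A w x - resolvent A z x) \<le> cmod (z - w) * (C / cmod w * norm (resolvent A z x))"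
  proof eventually_elim
    case (elim w)
    show ?case unfolding resolvent_identity[OF res[OF elim] res[OF z] lin] norm_scaleC
      by (rule mult_left_mono[OF norm_resolvent[OF elim]]) simp
  qed
  have "((\<lambda>w. cmod (z - w) * (C / cmod w * norm (resolvent A z x))) \<longlongrightarrow> cmod (z - z) * (C / cmod z * norm (resolvent A z x))) (at z)"
    using outer_nonzero[OF z] by (intro tendsto_intros) auto
  then show "((\<lambda>w. cmod (z - w) * (C / cmod w * norm (resolvent A z x))) \<longlongrightarrow> 0) (at z)" by simp
qed

lemma resolvent_isCont2:
  assumes z: "z \<in> outer \<sigma>"
  shows "isCont (\<lambda>z. resolvent A z (resolvent A z x)) z"
  unfolding isCont_def
proof (rule LIM_zero_cancel, rule Lim_null_comparison)
  have "\<forall>\<^sub>F w in at z. w \<in> outer \<sigma>" using eventually_at_topological open_outer z by blast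
  then show "\<forall>\<^sub>F w in at z. norm (resolvent A w (resolvent A w x) - resolvent A z (resolvent A z x))
     \<le> C / cmod w * norm (resolvent A w x - resolvent A z x) + norm (resolvent A w (resolvent A z x) - resolvent A z (resolvent A z x))"
  proof eventually_elim
    case (elim w)
    have eq: "resolvent A w (resolvent A w x) - resolvent A z (resolvent A z x)
      = resolvent A w (resolvent A w x - resolvent A z x) + (resolvent A w (resolvent A z x) - resolvent A z (resolvent A z x))"
      by (simp add: bounded_clin_diff[OF resolvent_bounded_clin[OF res[OF elim] lin]])
    show ?case
      by (subst eq)
        (rule order_trans[OF norm_triangle_ineq add_right_mono[OF norm_resolvent[OF elim]]])
  qed
  have "((\<lambda>w. C / cmod w * norm (resolvent A w x - resolvent A z x) + norm (resolvent A w (resolvent A z x) - resolvent A z (resolvent A z x)))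
     \<longlongrightarrow> C / cmod z * norm (resolvent A z x - resolvent A z x) + norm (resolvent A z (resolvent A z x) - resolvent A z (resolvent A z x))) (at z)"
    using outer_nonzero[OF z] resolvent_isCont[OF z] by (intro tendsto_intros) (auto simp: isCont_def)
  then show "((\<lambda>w. C / cmod w * norm (resolvent A w x - resolvent A z x) + norm (resolvent A w (resolvent A z x) - resolvent A z (resolvent A z x))) \<longlongrightarrow> 0) (at z)"
    by simp
qed

text \<open>By the resolvent identity the difference quotient is -R(z) and R(w) applied to x in
  turn, so strong continuity of the resolvent suffices.\<close>

lemma resolvent_has_derivative:
  assumes z: "z \<in> outer \<sigma>"
  shows "((\<lambda>z. resolvent A z x) has_derivative (\<lambda>h. h *\<^sub>C (- resolvent A z (resolvent A z x)))) (at z)"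
  unfolding has_derivative_iff_norm
proof (intro conjI)
  show "bounded_linear (\<lambda>h. h *\<^sub>C (- resolvent A z (resolvent A z x)))" by (rule scaleC.bounded_linear_left)
  let ?v = "resolvent A z x"
  show "((\<lambda>w. norm (resolvent A w x - resolvent A z x - (w - z) *\<^sub>C (- resolvent A z ?v)) / norm (w - z)) \<longlongrightarrow> 0) (at z)"
  proof (rule Lim_null_comparison)
    have "\<forall>\<^sub>F w in at z. w \<in> outer \<sigma> \<and> w \<noteq> z" using eventually_at_topological open_outer z by blast
    then show "\<forall>\<^sub>F w in at z. norm (norm (resolvent A w x - resolvent A z x - (w - z) *\<^sub>C (- resolvent A z ?v)) / norm (w - z))
       \<le> norm (resolvent A z ?v - resolvent A w ?v)"
    proof eventually_elim
      case (elim w)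
      have "resolvent A w x - resolvent A z x - (w - z) *\<^sub>C (- resolvent A z ?v) = (w - z) *\<^sub>C (resolvent A z ?v - resolvent A w ?v)"
        using resolvent_identity[of w A z x] elim res z lin
        by (simp add: scaleC.diff_right scaleC.diff_left scaleC.minus_right algebra_simps)
      then show ?case using elim by (simp add: norm_scaleC)
    qed
    have "((\<lambda>w. norm (resolvent A z ?v - resolvent A w ?v)) \<longlongrightarrow> norm (resolvent A z ?v - resolvent A z ?v)) (at z)"
      using resolvent_isCont[OF z] by (intro tendsto_intros) (auto simp: isCont_def)
    then show "((\<lambda>w. norm (resolvent A z ?v - resolvent A w ?v)) \<longlongrightarrow> 0) (at z)" by simp
  qed
qed

definition P :: "complex \<Rightarrow> 'x \<Rightarrow> 'x" where "P z x = z *\<^sub>C resolvent A z x"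

definition P' :: "complex \<Rightarrow> 'x \<Rightarrow> 'x" where
  "P' z x = resolvent A z x - z *\<^sub>C resolvent A z (resolvent A z x)"

lemma P_bounded_clin: "z \<in> outer \<sigma> \<Longrightarrow> bounded_clin (P z)"
  unfolding P_def[abs_def] by (intro bounded_clin_scale resolvent_bounded_clin res lin)

lemma P_bound: "z \<in> outer \<sigma> \<Longrightarrow> norm (P z x) \<le> C * norm x"
  unfolding P_def by (rule bound)

lemma P_has_derivative:
  assumes z: "z \<in> outer \<sigma>"
  shows "((\<lambda>z. P z x) has_derivative (\<lambda>h. h *\<^sub>C P' z x)) (at z)"
proof -
  have "((\<lambda>z. z *\<^sub>C resolvent A z x) has_derivative (\<lambda>h. z *\<^sub>C (h *\<^sub>C (- resolvent A z (resolvent A z x))) + h *\<^sub>C resolvent A z x)) (at z)"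
    by (rule scaleC.FDERIV[OF has_derivative_ident resolvent_has_derivative[OF z]])
  moreover have "(\<lambda>h. z *\<^sub>C (h *\<^sub>C (- resolvent A z (resolvent A z x))) + h *\<^sub>C resolvent A z x) = (\<lambda>h. h *\<^sub>C P' z x)"
    by (auto simp: P'_def scaleC.diff_right scaleC.minus_right scaleC_scaleC mult.commute)
  ultimately show ?thesis by (simp add: P_def)
qed

lemma P'_continuous: "continuous_on (outer \<sigma>) (\<lambda>z. P' z x)"
proof -
  have "isCont (\<lambda>z. P' z x) z" if "z \<in> outer \<sigma>" for z
    unfolding P'_def using resolvent_isCont[OF that] resolvent_isCont2[OF that]
    by (intro continuous_diff scaleC.continuous continuous_ident) auto
  then show ?thesis by (simp add: continuous_at_imp_continuous_on)
qed

lemma P_continuous: "continuous_on (outer \<sigma>) (\<lambda>z. P z x)"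
  using P_has_derivative by (meson continuous_at_imp_continuous_on has_derivative_continuous)

text \<open>For u in the domain this gives P(z) u = u + O(1/|z|) at infinity, a rate that general
  vectors do not have.\<close>

lemma P_dom:
  assumes z: "z \<in> outer \<sigma>" and u: "u \<in> op_dom A"
  shows "z *\<^sub>C P z u = z *\<^sub>C u + P z (op_app A u)"
proof -
  have c: "bounded_clin (resolvent A z)" using resolvent_bounded_clin[OF res[OF z] lin] .
  have "z *\<^sub>C resolvent A z u - resolvent A z (op_app A u) = u"
    using resolvent_left[OF res[OF z] u] by (simp add: bounded_clin_diff[OF c] bounded_clin_scaleC[OF c])
  then have "z *\<^sub>C (z *\<^sub>C resolvent A z u) = z *\<^sub>C (u + resolvent A z (op_app A u))" by (metis diff_add_cancel)
  then show ?thesis by (simp add: P_def scaleC.add_right)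
qed

end


section \<open>Contour integrals\<close>

text \<open>The integral of f(z) K(z) x dz/z over the boundary of the sector of angle \<beta>,
  divided by 2 pi \<i>. For K(z) = z R(z, A) it is the Dunford integral; other kernels give
  \<Psi>.\<close>

definition cint :: "real \<Rightarrow> (complex \<Rightarrow> complex) \<Rightarrow> (complex \<Rightarrow> 'x \<Rightarrow> 'x) \<Rightarrow> 'x \<Rightarrow> 'x::complex_banach" where
  "cint \<beta> f K x = (1 / (2 * complex_of_real pi * \<i>)) *\<^sub>C
     (integral UNIV (\<lambda>s. f (ray s (- \<beta>)) *\<^sub>C K (ray s (- \<beta>)) x) - integral UNIV (\<lambda>s. f (ray s \<beta>) *\<^sub>C K (ray s \<beta>) x))"

definition admissible :: "real \<Rightarrow> (complex \<Rightarrow> 'x \<Rightarrow> 'x::complex_banach) \<Rightarrow> bool" where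
  "admissible \<beta> K \<longleftrightarrow> (\<forall>a\<in>{-\<beta>,\<beta>}. (\<forall>s. bounded_clin (K (ray s a))) \<and> (\<forall>x. continuous_on UNIV (\<lambda>s. K (ray s a) x))) \<and>
     (\<exists>C\<ge>0. \<forall>a\<in>{-\<beta>,\<beta>}. \<forall>s x. norm (K (ray s a) x) \<le> C * norm x)"

text \<open>Strong holomorphy on the closed sector, bounding rays included, with a uniform bound.
  Such a kernel contributes nothing to a contour integral.\<close>

definition sector_holo :: "real \<Rightarrow> (complex \<Rightarrow> 'x \<Rightarrow> 'x::complex_banach) \<Rightarrow> (complex \<Rightarrow> 'x \<Rightarrow> 'x) \<Rightarrow> bool" where
  "sector_holo \<beta> K K' \<longleftrightarrow> (\<forall>x. (\<forall>s. \<forall>a\<in>{-\<beta>..\<beta>}. ((\<lambda>z. K z x) has_derivative (\<lambda>h. h *\<^sub>C K' (ray s a) x)) (at (ray s a))) \<and>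
      continuous_on (UNIV \<times> {-\<beta>..\<beta>}) (\<lambda>(s,a). K' (ray s a) x)) \<and>
     (\<exists>C\<ge>0. \<forall>a\<in>{-\<beta>..\<beta>}. \<forall>s x. norm (K (ray s a) x) \<le> C * norm x)"

definition dil :: "(complex \<Rightarrow> complex) \<Rightarrow> real \<Rightarrow> complex \<Rightarrow> complex" where
  "dil f t z = f (of_real (exp t) * z)"

lemma dil_ray: "dil f t (ray s a) = f (ray (t + s) a)"
  by (simp add: dil_def ray_add)

lemma admissible_bounded_clin: "admissible \<beta> K \<Longrightarrow> a \<in> {-\<beta>,\<beta>} \<Longrightarrow> bounded_clin (K (ray s a))"
  and admissible_continuous: "admissible \<beta> K \<Longrightarrow> a \<in> {-\<beta>,\<beta>} \<Longrightarrow> continuous_on UNIV (\<lambda>s. K (ray s a) x)"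
  unfolding admissible_def by (elim conjE, drule (1) bspec, simp)+

lemma admissible_compose:
  assumes "admissible \<beta> K" "admissible \<beta> L"
  shows "admissible \<beta> (\<lambda>z x. K z (L z x))"
proof -
  obtain C D where C: "C \<ge> 0" "\<forall>a\<in>{-\<beta>,\<beta>}. \<forall>s x. norm (K (ray s a) x) \<le> C * norm x"
    and D: "D \<ge> 0" "\<forall>a\<in>{-\<beta>,\<beta>}. \<forall>s x. norm (L (ray s a) x) \<le> D * norm x"
    using assms unfolding admissible_def by blast
  show ?thesis unfolding admissible_def
  proof (intro conjI ballI allI)
    fix a assume a: "a \<in> {-\<beta>,\<beta>}"
    show "bounded_clin (\<lambda>x. K (ray s a) (L (ray s a) x))" for s
      by (rule bounded_clin_compose[OF admissible_bounded_clin[OF assms(1) a] admissible_bounded_clin[OF assms(2) a]])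
    fix x
    have c: "continuous_on UNIV (\<lambda>(t,s). K (ray t a) (L (ray s a) x))"
    proof (rule strong_continuous_apply[of _ C])
      show "bounded_linear (K (ray t a))" for t by (rule bounded_clin_bounded_linear[OF admissible_bounded_clin[OF assms(1) a]])
      show "norm (K (ray t a) x) \<le> C * norm x" for t x using C a by blast
    qed (rule admissible_continuous[OF assms(1) a] admissible_continuous[OF assms(2) a])+
    show "continuous_on UNIV (\<lambda>s. K (ray s a) (L (ray s a) x))"
      by (rule continuous_on_compose2[OF c, of UNIV "\<lambda>s. (s,s)", unfolded prod.case]) (auto intro!: continuous_intros)
  next
    show "\<exists>C\<ge>0. \<forall>a\<in>{-\<beta>,\<beta>}. \<forall>s x. norm (K (ray s a) (L (ray s a) x)) \<le> C * norm x"
    proof (intro exI[of _ "C * D"] conjI ballI allI)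
      fix a s x assume a: "a \<in> {-\<beta>,\<beta>}"
      have "norm (K (ray s a) (L (ray s a) x)) \<le> C * norm (L (ray s a) x)" using C a by blast
      also have "\<dots> \<le> C * (D * norm x)" using D a C by (intro mult_left_mono) auto
      finally show "norm (K (ray s a) (L (ray s a) x)) \<le> C * D * norm x" by (simp add: mult.assoc)
    qed (use C D in auto)
  qed
qed

lemma admissible_const:
  assumes "bounded_clin L" shows "admissible \<beta> (\<lambda>z. L)"
  using assms bounded_clin_bound[OF assms] by (auto simp: admissible_def)

lemma sector_holo_const: "bounded_clin L \<Longrightarrow> sector_holo \<beta> (\<lambda>z. L) (\<lambda>z x. 0)"
  using bounded_clin_bound[of L] by (auto simp: sector_holo_def)

lemma sector_holo_apply:
  assumes "sector_holo \<beta> K K'" "bounded_clin L"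
  shows "sector_holo \<beta> (\<lambda>z x. K z (L x)) (\<lambda>z x. K' z (L x))"
proof -
  obtain C where C: "C \<ge> 0" "\<forall>a\<in>{-\<beta>..\<beta>}. \<forall>s x. norm (K (ray s a) x) \<le> C * norm x"
    using assms(1) unfolding sector_holo_def by blast
  obtain D where D: "D \<ge> 0" "\<forall>x. norm (L x) \<le> D * norm x" using bounded_clin_bound[OF assms(2)] by blast
  have "norm (K (ray s a) (L x)) \<le> C * D * norm x" if "a \<in> {-\<beta>..\<beta>}" for a s x
  proof -
    have "norm (K (ray s a) (L x)) \<le> C * norm (L x)" using C that by blast
    also have "\<dots> \<le> C * (D * norm x)" using D C by (intro mult_left_mono) auto
    finally show ?thesis by (simp add: mult.assoc)
  qed
  moreover have "C * D \<ge> 0" using C D by simp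
  ultimately show ?thesis using assms(1) unfolding sector_holo_def by blast
qed

locale contour =
  fixes \<beta> \<omega> :: real
  assumes \<beta>0: "0 < \<beta>" and \<beta>\<omega>: "\<beta> < \<omega>" and \<omega>pi: "\<omega> < pi"
begin

lemma \<omega>0: "0 < \<omega>" using \<beta>0 \<beta>\<omega> by simp

abbreviation "H \<equiv> H_infty_0 \<omega>"

lemma dil_H: "f \<in> H \<Longrightarrow> dil f t \<in> H"
  using H_infty_0_scale[OF \<omega>0 \<omega>pi, of f "exp t"] by (simp add: dil_def[abs_def])

lemma H_ray_continuous:
  assumes "f \<in> H" "\<bar>a\<bar> < \<omega>"
  shows "continuous_on UNIV (\<lambda>(t,s). f (ray (t + s) a))"
proof -
  have "continuous_on UNIV (\<lambda>p. ray (fst p + snd p) a)"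
    by (rule continuous_on_compose2[OF ray_continuous[of UNIV], of UNIV "\<lambda>p. (fst p + snd p, a)", unfolded prod.case]) (auto intro!: continuous_intros)
  then show ?thesis unfolding case_prod_unfold
    by (rule continuous_on_compose2[OF holomorphic_on_imp_continuous_on[OF H_infty_0_holo[OF assms(1)]]])
      (use assms(2) \<omega>pi in \<open>auto intro: ray_in_sector\<close>)
qed

lemma H_ray_bound:
  assumes "f \<in> H" and "admissible \<beta> K"
  obtains C e where "C > 0" "e > 0"
    "\<And>a t s x. a \<in> {-\<beta>,\<beta>} \<Longrightarrow> norm (f (ray (t + s) a) *\<^sub>C K (ray s a) x) \<le> C * norm x * exp (- e * \<bar>s + t\<bar>)"
proof -
  obtain C e where C: "C > 0" "e > 0" "\<And>s a. \<bar>a\<bar> < \<omega> \<Longrightarrow> cmod (f (ray s a)) \<le> C * exp (- e * \<bar>s\<bar>)"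
    using H_infty_0_ray[OF \<omega>0 \<omega>pi assms(1)] by blast
  obtain D where D: "D \<ge> 0" "\<forall>a\<in>{-\<beta>,\<beta>}. \<forall>s x. norm (K (ray s a) x) \<le> D * norm x"
    using assms(2) unfolding admissible_def by blast
  show ?thesis
  proof (rule that[of "C * (D + 1)" e])
    fix a t s x assume a: "a \<in> {-\<beta>,\<beta>}"
    have "norm (K (ray s a) x) \<le> D * norm x" using D a by blast
    also have "\<dots> \<le> (D + 1) * norm x" by (simp add: algebra_simps)
    finally have 1: "norm (K (ray s a) x) \<le> (D + 1) * norm x" .
    have "\<bar>a\<bar> < \<omega>" using a \<beta>0 \<beta>\<omega> by auto
    then have "norm (f (ray (t + s) a) *\<^sub>C K (ray s a) x) \<le> (C * exp (- e * \<bar>t + s\<bar>)) * ((D + 1) * norm x)"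
      unfolding norm_scaleC using C D 1 by (intro mult_mono) auto
    then show "norm (f (ray (t + s) a) *\<^sub>C K (ray s a) x) \<le> C * (D + 1) * norm x * exp (- e * \<bar>s + t\<bar>)"
      by (simp add: mult_ac add.commute)
  qed (use C D in auto)
qed

lemma H_ray_K_continuous:
  assumes "f \<in> H" "admissible \<beta> K" "a \<in> {-\<beta>,\<beta>}"
  shows "continuous_on UNIV (\<lambda>(t,s). f (ray (t + s) a) *\<^sub>C K (ray s a) x)"
    and "continuous_on UNIV (\<lambda>s. f (ray s a) *\<^sub>C K (ray s a) x)"
proof -
  have a: "\<bar>a\<bar> < \<omega>" using assms(3) \<beta>0 \<beta>\<omega> by auto
  have K: "continuous_on UNIV (\<lambda>s. K (ray s a) x)" using assms by (auto simp: admissible_def)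
  have "continuous_on UNIV (\<lambda>p::real\<times>real. K (ray (snd p) a) x)"
    by (rule continuous_on_compose2[OF K]) (auto intro!: continuous_intros)
  then show c: "continuous_on UNIV (\<lambda>(t,s). f (ray (t + s) a) *\<^sub>C K (ray s a) x)"
    using H_ray_continuous[OF assms(1) a] unfolding case_prod_unfold by (intro scaleC.continuous_on)
  have "continuous_on UNIV (\<lambda>s. case (0,s) of (t,s) \<Rightarrow> f (ray (t + s) a) *\<^sub>C K (ray s a) x)"
    by (rule continuous_on_compose2[OF c]) (auto intro!: continuous_intros)
  then show "continuous_on UNIV (\<lambda>s. f (ray s a) *\<^sub>C K (ray s a) x)" by simp
qed

lemma cint_integrable:
  assumes "f \<in> H" "admissible \<beta> K" "a \<in> {-\<beta>,\<beta>}"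
  shows "(\<lambda>s. f (ray s a) *\<^sub>C K (ray s a) x) integrable_on UNIV"
proof -
  obtain C e where C: "C > 0" "e > 0"
    "\<And>a t s x. a \<in> {-\<beta>,\<beta>} \<Longrightarrow> norm (f (ray (t + s) a) *\<^sub>C K (ray s a) x) \<le> C * norm x * exp (- e * \<bar>s + t\<bar>)"
    using H_ray_bound[OF assms(1,2)] by blast
  show ?thesis
    using exp_dec_integrable(1)[OF H_ray_K_continuous(2)[OF assms] C(2), of x "C * norm x" 0] C(3)[OF assms(3), of 0] by auto
qed

lemma cint_cong:
  assumes "\<And>s a. a \<in> {-\<beta>,\<beta>} \<Longrightarrow> f (ray s a) *\<^sub>C K (ray s a) x = g (ray s a) *\<^sub>C L (ray s a) y"
  shows "cint \<beta> f K x = cint \<beta> g L y"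
  unfolding cint_def using assms by simp

text \<open>Operator identities hold pointwise on the two rays and are integrated here. Scalar
  functions, kernels and vectors may all differ between the terms.\<close>

lemma cint_split:
  assumes "g \<in> H" "admissible \<beta> L" "h \<in> H" "admissible \<beta> N"
    and "\<And>s a. a \<in> {-\<beta>,\<beta>} \<Longrightarrow> f (ray s a) *\<^sub>C K (ray s a) x = g (ray s a) *\<^sub>C L (ray s a) y + h (ray s a) *\<^sub>C N (ray s a) z"
  shows "cint \<beta> f K x = cint \<beta> g L y + cint \<beta> h N z"
proof -
  have "integral UNIV (\<lambda>s. f (ray s a) *\<^sub>C K (ray s a) x) = integral UNIV (\<lambda>s. g (ray s a) *\<^sub>C L (ray s a) y) + integral UNIV (\<lambda>s. h (ray s a) *\<^sub>C N (ray s a) z)"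
    if "a \<in> {-\<beta>,\<beta>}" for a
    using that by (simp add: assms(5) integral_add[OF cint_integrable[OF assms(1,2)] cint_integrable[OF assms(3,4)]])
  then show ?thesis unfolding cint_def by (simp add: scaleC.diff_right scaleC.add_right)
qed

text \<open>The bound is uniform in t because a dilation only translates the majorant
  exp(-e|s|).\<close>

lemma cint_bound:
  assumes "f \<in> H" "admissible \<beta> K"
  obtains C where "C \<ge> 0" "\<And>t x. norm (cint \<beta> (dil f t) K x) \<le> C * norm x"
proof -
  obtain C e where C: "C > 0" "e > 0"
    "\<And>a t s x. a \<in> {-\<beta>,\<beta>} \<Longrightarrow> norm (f (ray (t + s) a) *\<^sub>C K (ray s a) x) \<le> C * norm x * exp (- e * \<bar>s + t\<bar>)"
    using H_ray_bound[OF assms] by blast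
  have i: "norm (integral UNIV (\<lambda>s. dil f t (ray s a) *\<^sub>C K (ray s a) x)) \<le> C * norm x * (2 / e)" if "a \<in> {-\<beta>,\<beta>}" for a t x
    using exp_dec_integrable(2)[OF H_ray_K_continuous(2)[OF dil_H[OF assms(1)] assms(2) that] C(2), of t x "C * norm x" t] C(3)[OF that]
    by (simp add: dil_ray)
  show ?thesis
  proof (rule that[of "(C * (2 / e) + C * (2 / e)) / (2 * pi)"])
    fix t x
    have n: "cmod (1 / (2 * complex_of_real pi * \<i>)) = 1 / (2 * pi)" by (simp add: norm_divide norm_mult)
    have "norm (cint \<beta> (dil f t) K x) \<le> 1 / (2 * pi) * (C * norm x * (2 / e) + C * norm x * (2 / e))"
      unfolding cint_def norm_scaleC n
      by (intro mult_left_mono order_trans[OF norm_triangle_ineq4 add_mono[OF i i]]) auto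
    then have "norm (cint \<beta> (dil f t) K x) \<le> (C * norm x * (2 / e) + C * norm x * (2 / e)) / (2 * pi)" by simp
    also have "\<dots> = (C * (2 / e) + C * (2 / e)) / (2 * pi) * norm x" by (simp add: field_simps)
    finally show "norm (cint \<beta> (dil f t) K x) \<le> (C * (2 / e) + C * (2 / e)) / (2 * pi) * norm x" .
  qed (use C in auto)
qed

lemma cint_bounded_clin:
  assumes "f \<in> H" "admissible \<beta> K"
  shows "bounded_clin (cint \<beta> f K)"
proof -
  obtain C where C: "\<And>t x. norm (cint \<beta> (dil f t) K x) \<le> C * norm x" using cint_bound[OF assms] by metis
  have K: "a \<in> {-\<beta>,\<beta>} \<Longrightarrow> bounded_clin (K (ray s a))" for s a using assms(2) unfolding admissible_def by blast
  show ?thesis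
  proof (rule cblI)
    show "cint \<beta> f K (x + y) = cint \<beta> f K x + cint \<beta> f K y" for x y
      by (rule cint_split[OF assms assms]) (simp add: bounded_clin_add[OF K] scaleC.add_right)
    show "norm (cint \<beta> f K x) \<le> C * norm x" for x using C[of 0 x] by (simp add: dil_def[abs_def])
    show "cint \<beta> f K (c *\<^sub>C x) = c *\<^sub>C cint \<beta> f K x" for c x
    proof -
      have "integral UNIV (\<lambda>s. f (ray s a) *\<^sub>C K (ray s a) (c *\<^sub>C x)) = c *\<^sub>C integral UNIV (\<lambda>s. f (ray s a) *\<^sub>C K (ray s a) x)"
        if "a \<in> {-\<beta>,\<beta>}" for a
        using integral_linear[OF cint_integrable[OF assms that, of x] bounded_linear_scaleC_right[of c]]
        by (simp add: o_def bounded_clin_scaleC[OF K[OF that]] scaleC_scaleC mult.commute)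
      then show ?thesis by (simp add: cint_def scaleC_scaleC scaleC.diff_right mult.commute)
    qed
  qed
qed

lemma cint_continuous:
  assumes "f \<in> H" "admissible \<beta> K"
  shows "continuous_on UNIV (\<lambda>t. cint \<beta> (dil f t) K x)"
proof -
  obtain C e where C: "C > 0" "e > 0"
    "\<And>a t s x. a \<in> {-\<beta>,\<beta>} \<Longrightarrow> norm (f (ray (t + s) a) *\<^sub>C K (ray s a) x) \<le> C * norm x * exp (- e * \<bar>s + t\<bar>)"
    using H_ray_bound[OF assms] by blast
  have "continuous_on UNIV (\<lambda>t. integral UNIV (\<lambda>s. f (ray (t + s) a) *\<^sub>C K (ray s a) x))" if a: "a \<in> {-\<beta>,\<beta>}" for a
  proof (rule exp_dec_param_continuous[OF H_ray_K_continuous(1)[OF assms a] C(2), where C="\<lambda>k. C * norm x * exp (e * k)"])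
    fix k t s :: real assume k: "\<bar>t\<bar> \<le> k"
    have "\<bar>s\<bar> \<le> \<bar>s + t\<bar> + k" using k by linarith
    then have "e * \<bar>s\<bar> \<le> e * (\<bar>s + t\<bar> + k)" using C(2) by (intro mult_left_mono) auto
    then have "exp (- e * \<bar>s + t\<bar>) \<le> exp (e * k) * exp (- e * \<bar>s\<bar>)" by (simp add: exp_add[symmetric] algebra_simps)
    then have "C * norm x * exp (- e * \<bar>s + t\<bar>) \<le> C * norm x * (exp (e * k) * exp (- e * \<bar>s\<bar>))"
      using C(1) by (intro mult_left_mono) auto
    then show "norm (f (ray (t + s) a) *\<^sub>C K (ray s a) x) \<le> C * norm x * exp (e * k) * exp (- e * \<bar>s\<bar>)"
      using C(3)[OF a, of t s x] by (simp add: mult.assoc)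
  qed
  then have "continuous_on UNIV (\<lambda>t. (1 / (2 * complex_of_real pi * \<i>)) *\<^sub>C
     (integral UNIV (\<lambda>s. f (ray (t + s) (-\<beta>)) *\<^sub>C K (ray s (-\<beta>)) x) - integral UNIV (\<lambda>s. f (ray (t + s) \<beta>) *\<^sub>C K (ray s \<beta>) x)))"
    by (intro scaleC.continuous_on continuous_on_const continuous_on_diff) auto
  then show ?thesis by (simp add: cint_def dil_ray)
qed

lemma cint_apply:
  assumes "f \<in> H" "admissible \<beta> K" "bounded_clin L"
  shows "L (cint \<beta> f K x) = cint \<beta> f (\<lambda>z y. L (K z y)) x"
proof -
  have "L (integral UNIV (\<lambda>s. f (ray s a) *\<^sub>C K (ray s a) x)) = integral UNIV (\<lambda>s. f (ray s a) *\<^sub>C L (K (ray s a) x))"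
    if "a \<in> {-\<beta>,\<beta>}" for a
    using integral_linear[OF cint_integrable[OF assms(1,2) that] bounded_clin_bounded_linear[OF assms(3)], of x]
    by (simp add: o_def bounded_clin_scaleC[OF assms(3)])
  then show ?thesis by (simp add: cint_def bounded_clin_scaleC[OF assms(3)] bounded_clin_diff[OF assms(3)])
qed

lemma cint_commute:
  assumes "f \<in> H" "admissible \<beta> K" "bounded_clin L" "\<And>s a y. a \<in> {-\<beta>,\<beta>} \<Longrightarrow> L (K (ray s a) y) = K (ray s a) (L y)"
  shows "L (cint \<beta> f K x) = cint \<beta> f K (L x)"
  unfolding cint_apply[OF assms(1-3)] using assms(4) by (intro cint_cong) auto

text \<open>The lower ray is rotated through the sector onto the upper one.\<close>

lemma cint_sector_holo:
  assumes f: "f \<in> H" and K: "sector_holo \<beta> K K'"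
  shows "cint \<beta> f K x = 0"
proof -
  have ray: "ray s a \<in> sector \<omega>" if "a \<in> {-\<beta>..\<beta>}" for s a using that \<beta>\<omega> \<omega>pi by (intro ray_in_sector) auto
  obtain C e where C: "C > 0" "e > 0" "\<And>s a. \<bar>a\<bar> < \<omega> \<Longrightarrow> cmod (f (ray s a)) \<le> C * exp (- e * \<bar>s\<bar>)"
    using H_infty_0_ray[OF \<omega>0 \<omega>pi f] by blast
  obtain D where D: "D \<ge> 0" "\<forall>a\<in>{-\<beta>..\<beta>}. \<forall>s x. norm (K (ray s a) x) \<le> D * norm x"
    using K unfolding sector_holo_def by blast
  have Kd: "((\<lambda>z. K z x) has_derivative (\<lambda>h. h *\<^sub>C K' (ray s a) x)) (at (ray s a))" if "a \<in> {-\<beta>..\<beta>}" for s a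
    using K that unfolding sector_holo_def by blast
  have K'c: "continuous_on (UNIV \<times> {-\<beta>..\<beta>}) (\<lambda>(s,a). K' (ray s a) x)" using K unfolding sector_holo_def by blast
  have rayc: "continuous_on (UNIV \<times> {-\<beta>..\<beta>}) (\<lambda>p. ray (fst p) (snd p))"
    using ray_continuous[of "UNIV \<times> {-\<beta>..\<beta>}"] by (simp add: case_prod_unfold)
  have Kc: "continuous_on (UNIV \<times> {-\<beta>..\<beta>}) (\<lambda>p. K (ray (fst p) (snd p)) x)"
  proof -
    have "continuous_on ((\<lambda>p. ray (fst p) (snd p)) ` (UNIV \<times> {-\<beta>..\<beta>})) (\<lambda>z. K z x)"
    proof (rule continuous_at_imp_continuous_on, rule ballI)
      fix z assume "z \<in> (\<lambda>p. ray (fst p) (snd p)) ` (UNIV \<times> {-\<beta>..\<beta>})"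
      then obtain s a where "z = ray s a" "a \<in> {-\<beta>..\<beta>}" by auto
      then show "isCont (\<lambda>z. K z x) z" using has_derivative_continuous[OF Kd] by blast
    qed
    then show ?thesis by (rule continuous_on_compose2[OF _ rayc]) auto
  qed
  have hol: "f holomorphic_on sector \<omega>" "deriv f holomorphic_on sector \<omega>"
    using H_infty_0_holo[OF f] holomorphic_deriv[OF _ open_sector[OF \<omega>0 \<omega>pi]] by auto
  have fc: "continuous_on (UNIV \<times> {-\<beta>..\<beta>}) (\<lambda>p. g (ray (fst p) (snd p)))" if "g holomorphic_on sector \<omega>" for g
    by (rule continuous_on_compose2[OF holomorphic_on_imp_continuous_on[OF that] rayc]) (use ray in auto)
  have "integral UNIV (\<lambda>s. f (ray s (-\<beta>)) *\<^sub>C K (ray s (-\<beta>)) x) = integral UNIV (\<lambda>s. f (ray s \<beta>) *\<^sub>C K (ray s \<beta>) x)"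
  proof (rule ray_integral_rotate[where G="\<lambda>z. f z *\<^sub>C K z x" and G'="\<lambda>z. f z *\<^sub>C K' z x + deriv f z *\<^sub>C K z x" and e=e and C="C * D * norm x"])
    fix s a assume a: "a \<in> {-\<beta>..\<beta>}"
    have "(f has_field_derivative deriv f (ray s a)) (at (ray s a))"
      using holomorphic_derivI[OF hol(1) open_sector[OF \<omega>0 \<omega>pi] ray[OF a]] .
    then have "(f has_derivative (\<lambda>h. deriv f (ray s a) * h)) (at (ray s a))" by (simp add: has_field_derivative_def)
    from scaleC.FDERIV[OF this Kd[OF a]]
    show "((\<lambda>z. f z *\<^sub>C K z x) has_derivative (\<lambda>h. h *\<^sub>C (f (ray s a) *\<^sub>C K' (ray s a) x + deriv f (ray s a) *\<^sub>C K (ray s a) x))) (at (ray s a))"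
      by (simp add: scaleC.add_right scaleC_scaleC mult.commute)
    have "\<bar>a\<bar> < \<omega>" using a \<beta>0 \<beta>\<omega> by auto
    then have "norm (f (ray s a) *\<^sub>C K (ray s a) x) \<le> (C * exp (- e * \<bar>s\<bar>)) * (D * norm x)"
      unfolding norm_scaleC using C D a by (intro mult_mono) auto
    then show "norm (f (ray s a) *\<^sub>C K (ray s a) x) \<le> C * D * norm x * exp (- e * \<bar>s\<bar>)" by (simp add: mult_ac)
  next
    show "continuous_on (UNIV \<times> {-\<beta>..\<beta>}) (\<lambda>(s,a). f (ray s a) *\<^sub>C K' (ray s a) x + deriv f (ray s a) *\<^sub>C K (ray s a) x)"
      using K'c unfolding case_prod_unfold
      by (intro continuous_on_add scaleC.continuous_on fc hol Kc)
  qed (use C \<beta>0 in auto)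
  then show ?thesis by (simp add: cint_def)
qed

text \<open>The scalar function that corresponds to the resolvent \<open>(1 + e\<^sup>t A)\<^sup>-\<^sup>1\<close>.\<close>

definition jfun :: "real \<Rightarrow> complex \<Rightarrow> complex" where
  "jfun t z = 1 / (1 + of_real (exp t) * z)"

lemma jfun_bound:
  assumes z: "z \<in> sector \<omega>"
  shows "cmod (jfun t z) \<le> 1 / cos (\<omega>/2)" "cmod (1 - jfun t z) \<le> 1 / cos (\<omega>/2)" "1 + of_real (exp t) * z \<noteq> 0"
proof -
  let ?w = "of_real (exp t) * z"
  have w: "?w \<in> sector \<omega>" using z by (simp add: sector_scale \<omega>0 \<omega>pi)
  have c: "cos (\<omega>/2) > 0" by (rule cos_half_pos[OF \<omega>0 \<omega>pi])
  have b: "(1 + cmod ?w) * cos (\<omega>/2) \<le> cmod (1 + ?w)" by (rule norm_one_plus_sector[OF \<omega>0 \<omega>pi w])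
  have pos: "0 < (1 + cmod ?w) * cos (\<omega>/2)" by (intro mult_pos_pos c) (simp add: add_pos_nonneg)
  with b have p: "0 < cmod (1 + ?w)" by linarith
  then show nz: "1 + ?w \<noteq> 0" by auto
  have "1 * cos (\<omega>/2) \<le> (1 + cmod ?w) * cos (\<omega>/2)" "cmod ?w * cos (\<omega>/2) \<le> (1 + cmod ?w) * cos (\<omega>/2)"
    using c by (intro mult_right_mono; simp)+
  then have b1: "cos (\<omega>/2) \<le> cmod (1 + ?w)" and b2: "cmod ?w * cos (\<omega>/2) \<le> cmod (1 + ?w)" using b by linarith+
  show "cmod (jfun t z) \<le> 1 / cos (\<omega>/2)"
    unfolding jfun_def norm_divide norm_one using b1 c by (intro divide_left_mono mult_pos_pos p) auto
  have "1 - jfun t z = ?w / (1 + ?w)" using nz by (simp add: jfun_def field_simps)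
  then have "cmod (1 - jfun t z) = cmod ?w / cmod (1 + ?w)" by (simp only: norm_divide)
  also have "\<dots> \<le> (cmod (1 + ?w) / cos (\<omega>/2)) / cmod (1 + ?w)"
    using b2 c p by (intro divide_right_mono) (simp_all only: pos_le_divide_eq norm_ge_zero)
  also have "\<dots> = 1 / cos (\<omega>/2)" using p by simp
  finally show "cmod (1 - jfun t z) \<le> 1 / cos (\<omega>/2)" .
qed

lemma jfun_holo: "jfun t holomorphic_on sector \<omega>"
  unfolding jfun_def[abs_def] using jfun_bound(3) by (intro holomorphic_intros) auto

lemma H_jfun: "f \<in> H \<Longrightarrow> (\<lambda>z. f z * jfun t z) \<in> H"
  by (rule H_infty_0_mult[OF \<omega>0 \<omega>pi _ jfun_holo jfun_bound(1)])

lemma H_jfun': "f \<in> H \<Longrightarrow> (\<lambda>z. f z * (1 - jfun t z)) \<in> H"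
  by (rule H_infty_0_mult[OF \<omega>0 \<omega>pi _ _ jfun_bound(2)]) (auto intro!: holomorphic_intros jfun_holo)

lemma H_jfun_power: "f \<in> H \<Longrightarrow> (\<lambda>z. f z * jfun t z ^ k) \<in> H"
  by (induction k) (simp_all add: mult.assoc[symmetric] H_jfun power_commutes[symmetric] flip: mult.assoc)

end

section \<open>Operational calculus for a pair of operators\<close>

locale op_calculus = contour \<beta> \<omega> + A: outer_resolvent A \<sigma>A CA
  for \<beta> \<omega> and A :: "'x::complex_banach unbounded_op" and \<sigma>A CA +
  assumes \<sigma>A: "\<sigma>A < \<beta>" and inv: "0 \<in> resolvent_set A"
begin

lemma ray_outer: "\<beta> \<le> \<bar>a\<bar> \<Longrightarrow> \<bar>a\<bar> \<le> pi \<Longrightarrow> ray s a \<in> outer \<sigma>A"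
  using \<sigma>A by (intro ray_in_outer A.\<sigma>) auto

lemma \<beta>_ray_outer: "a \<in> {-\<beta>,\<beta>} \<Longrightarrow> ray s a \<in> outer \<sigma>A"
  using \<beta>0 \<beta>\<omega> \<omega>pi by (intro ray_outer) auto

lemma admissible_P: "admissible \<beta> A.P"
  unfolding admissible_def
proof (intro conjI ballI allI)
  fix a assume a: "a \<in> {-\<beta>,\<beta>}"
  show "bounded_clin (A.P (ray s a))" for s by (rule A.P_bounded_clin[OF \<beta>_ray_outer[OF a]])
  have rc: "continuous_on UNIV (\<lambda>s. ray s a)"
    by (rule continuous_on_compose2[OF ray_continuous[of UNIV], of UNIV "\<lambda>s. (s, a)", unfolded prod.case]) (auto intro!: continuous_intros)
  show "continuous_on UNIV (\<lambda>s. A.P (ray s a) x)" for x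
    by (rule continuous_on_compose2[OF A.P_continuous rc]) (use \<beta>_ray_outer[OF a] in auto)
next
  show "\<exists>C\<ge>0. \<forall>a\<in>{-\<beta>,\<beta>}. \<forall>s x. norm (A.P (ray s a) x) \<le> C * norm x"
    using A.C A.P_bound \<beta>_ray_outer by blast
qed

text \<open>With m = -e^-t this is m R(m, A) = (1 + e^t A)^-1, so it belongs to the \<ell>^q-bounded
  family of A.\<close>

definition J :: "real \<Rightarrow> 'x \<Rightarrow> 'x" where "J t = A.P (ray (- t) pi)"

lemma ray_pi: "ray s pi = - of_real (exp s)"
  by (simp add: ray_def exp_eq_polar cis_pi)

lemma ray_pi_outer: "ray s pi \<in> outer \<sigma>A"
  using \<beta>\<omega> \<omega>pi by (intro ray_outer) auto

lemma J_bounded_clin: "bounded_clin (J t)"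
  unfolding J_def by (rule A.P_bounded_clin[OF ray_pi_outer])

text \<open>The resolvent identity as a partial fraction decomposition: next to P(z), J acts as the
  scalar j(z) = \<open>jfun t z\<close>, up to a term that depends on z only through a scalar
  function holomorphic in the sector.\<close>

lemma P_J:
  assumes z: "z \<in> outer \<sigma>A" and nz: "1 + of_real (exp t) * z \<noteq> 0"
  shows "A.P z (J t x) = jfun t z *\<^sub>C A.P z x + (1 - jfun t z) *\<^sub>C J t x"
proof -
  define m where "m = ray (- t) pi"
  have m: "m \<in> outer \<sigma>A" "m = - of_real (exp (- t))" using ray_pi_outer by (auto simp: m_def ray_pi)
  have et: "complex_of_real (exp t) * complex_of_real (exp (- t)) = 1"
    by (simp add: exp_add[symmetric] flip: of_real_mult)
  have e: "m = - inverse (complex_of_real (exp t))" by (simp add: m(2) exp_minus)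
  have mz: "m - z \<noteq> 0"
  proof
    assume "m - z = 0"
    then have "z = - of_real (exp (- t))" using m(2) by simp
    then have "1 + of_real (exp t) * z = 1 - of_real (exp t) * of_real (exp (- t))" by simp
    with nz et show False by simp
  qed
  have j: "jfun t z = m / (m - z)"
    using nz mz unfolding jfun_def e by (simp add: field_simps)
  have j': "1 - jfun t z = - z / (m - z)" using mz by (simp add: j field_simps)
  note cz = resolvent_bounded_clin[OF A.res[OF z] A.lin]
  have "resolvent A z x - resolvent A m x = (m - z) *\<^sub>C resolvent A z (resolvent A m x)"
    by (rule resolvent_identity[OF A.res[OF z] A.res[OF m(1)] A.lin])
  then have "resolvent A z (resolvent A m x) = (1 / (m - z)) *\<^sub>C (resolvent A z x - resolvent A m x)"
    using mz by (simp add: scaleC_scaleC)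
  then have "A.P z (J t x) = (z * m / (m - z)) *\<^sub>C resolvent A z x - (z * m / (m - z)) *\<^sub>C resolvent A m x"
    by (simp add: J_def A.P_def m_def[symmetric] bounded_clin_scaleC[OF cz] scaleC_scaleC scaleC.diff_right)
  also have "\<dots> = jfun t z *\<^sub>C A.P z x + (1 - jfun t z) *\<^sub>C J t x"
    unfolding j' unfolding j by (simp add: J_def A.P_def m_def[symmetric] scaleC_scaleC scaleC.minus_left mult.commute)
  finally show ?thesis .
qed

lemma P_sector_J: "a \<in> {-\<beta>,\<beta>} \<Longrightarrow> A.P (ray s a) (J t x) = jfun t (ray s a) *\<^sub>C A.P (ray s a) x + (1 - jfun t (ray s a)) *\<^sub>C J t x"
  using \<beta>0 \<beta>\<omega> \<omega>pi by (intro P_J \<beta>_ray_outer jfun_bound(3) ray_in_sector) auto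

text \<open>Multiplicativity of the calculus for the factor J. The second term of \<open>P_J\<close>
  contains no P(z), so behind a kernel K holomorphic in the sector its integral vanishes. K =
  identity serves \<Phi>, and K = Q serves \<Psi>.\<close>

lemma cint_KP_J:
  assumes f: "f \<in> H" and K: "sector_holo \<beta> K K'" "admissible \<beta> K"
  shows "cint \<beta> f (\<lambda>z x. K z (A.P z x)) (J t x) = cint \<beta> (\<lambda>z. f z * jfun t z) (\<lambda>z x. K z (A.P z x)) x"
proof -
  have KP: "admissible \<beta> (\<lambda>z x. K z (A.P z x))" by (rule admissible_compose[OF K(2) admissible_P])
  have "cint \<beta> f (\<lambda>z x. K z (A.P z x)) (J t x) = cint \<beta> (\<lambda>z. f z * jfun t z) (\<lambda>z x. K z (A.P z x)) x + cint \<beta> (\<lambda>z. f z * (1 - jfun t z)) K (J t x)"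
  proof (rule cint_split[OF H_jfun[OF f] KP H_jfun'[OF f] K(2)])
    fix s a assume a: "a \<in> {-\<beta>,\<beta>}"
    note c = admissible_bounded_clin[OF K(2) a]
    show "f (ray s a) *\<^sub>C K (ray s a) (A.P (ray s a) (J t x)) =
       (f (ray s a) * jfun t (ray s a)) *\<^sub>C K (ray s a) (A.P (ray s a) x) + (f (ray s a) * (1 - jfun t (ray s a))) *\<^sub>C K (ray s a) (J t x)"
      unfolding P_sector_J[OF a] bounded_clin_add[OF c] bounded_clin_scaleC[OF c] scaleC.add_right scaleC_scaleC ..
  qed
  then show ?thesis by (simp add: cint_sector_holo[OF H_jfun'[OF f] K(1)])
qed

text \<open>\<eta>(e^t A) is written as a product of resolvents instead of a contour integral, so
  that its \<ell>^q-bounds come from those of J.\<close>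

definition eta :: "nat \<Rightarrow> real \<Rightarrow> 'x \<Rightarrow> 'x" where
  "eta m t x = (J t ^^ (m + 1)) (x - J t x)"

definition etaf :: "nat \<Rightarrow> real \<Rightarrow> complex \<Rightarrow> complex" where
  "etaf m t z = jfun t z ^ (m + 1) * (1 - jfun t z)"

lemma funpow_bounded_clin: "bounded_clin L \<Longrightarrow> bounded_clin (L ^^ k)"
  by (induction k) (auto simp: bounded_clin_ident id_def bounded_clin_compose o_def)

lemma eta_bounded_clin: "bounded_clin (eta m t)"
  unfolding eta_def by (intro bounded_clin_compose[OF funpow_bounded_clin[OF J_bounded_clin]] bounded_clin_sub bounded_clin_ident J_bounded_clin)

lemma etaf_dil: "etaf m t z = dil (etaf m 0) t z"
  by (simp add: etaf_def dil_def jfun_def)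

lemma H_etaf: "f \<in> H \<Longrightarrow> (\<lambda>z. f z * etaf m t z) \<in> H"
  using H_jfun'[OF H_jfun_power[of f t "m+1"], of t] by (simp add: etaf_def mult.assoc)

lemma cint_KP_eta:
  assumes f: "f \<in> H" and K: "sector_holo \<beta> K K'" "admissible \<beta> K"
  shows "cint \<beta> f (\<lambda>z x. K z (A.P z x)) (eta m t x) = cint \<beta> (\<lambda>z. f z * etaf m t z) (\<lambda>z x. K z (A.P z x)) x"
proof -
  let ?c = "\<lambda>f. cint \<beta> f (\<lambda>z x. K z (A.P z x))"
  have KP: "admissible \<beta> (\<lambda>z x. K z (A.P z x))" by (rule admissible_compose[OF K(2) admissible_P])
  have pow: "?c f ((J t ^^ k) y) = ?c (\<lambda>z. f z * jfun t z ^ k) y" for k y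
  proof (induction k arbitrary: y)
    case (Suc k)
    have "?c f ((J t ^^ Suc k) y) = ?c f ((J t ^^ k) (J t y))" by (simp only: funpow_Suc_right o_def)
    also have "\<dots> = ?c (\<lambda>z. f z * jfun t z ^ k) (J t y)" by (rule Suc)
    also have "\<dots> = ?c (\<lambda>z. f z * jfun t z ^ k * jfun t z) y" by (rule cint_KP_J[OF H_jfun_power[OF f] K])
    finally show ?case by (simp only: power_Suc2 mult.assoc)
  qed simp
  have h: "(\<lambda>z. f z * jfun t z ^ (m+1)) \<in> H" by (rule H_jfun_power[OF f])
  have "?c f (eta m t x) = ?c (\<lambda>z. f z * jfun t z ^ (m+1)) (x - J t x)"
    unfolding eta_def by (rule pow)
  also have "\<dots> = ?c (\<lambda>z. f z * jfun t z ^ (m+1)) x - ?c (\<lambda>z. f z * jfun t z ^ (m+1) * jfun t z) x"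
    unfolding bounded_clin_diff[OF cint_bounded_clin[OF h KP]] cint_KP_J[OF h K] ..
  also have "?c (\<lambda>z. f z * jfun t z ^ (m+1)) x = ?c (\<lambda>z. f z * etaf m t z) x + ?c (\<lambda>z. f z * jfun t z ^ (m+1) * jfun t z) x"
    by (rule cint_split[OF H_etaf[OF f] KP H_jfun[OF h] KP])
      (simp add: etaf_def scaleC.add_left[symmetric] algebra_simps)
  finally show ?thesis by simp
qed

subsection \<open>The Calderon reproducing formula\<close>

lemma P_ray_commute_J:
  assumes "a \<in> {-\<beta>,\<beta>}" shows "J t (A.P (ray s a) y) = A.P (ray s a) (J t y)"
proof -
  note r = A.res[OF \<beta>_ray_outer[OF assms, of s]] A.res[OF ray_pi_outer[of "-t"]]
  note c = resolvent_bounded_clin[OF r(1) A.lin] resolvent_bounded_clin[OF r(2) A.lin]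
  show ?thesis
    by (simp add: J_def A.P_def bounded_clin_scaleC[OF c(1)] bounded_clin_scaleC[OF c(2)] scaleC_scaleC mult.commute resolvent_commute[OF r A.lin])
qed

lemma commute_funpow: "(\<And>y. L (K y) = K (L y)) \<Longrightarrow> (L ^^ k) (K y) = K ((L ^^ k) y)"
  by (induction k arbitrary: y) auto

lemma P_ray_commute_eta:
  assumes "a \<in> {-\<beta>,\<beta>}" shows "eta m t (A.P (ray s a) y) = A.P (ray s a) (eta m t y)"
proof -
  have "A.P (ray s a) y - J t (A.P (ray s a) y) = A.P (ray s a) (y - J t y)"
    by (simp only: P_ray_commute_J[OF assms] bounded_clin_diff[OF A.P_bounded_clin[OF \<beta>_ray_outer[OF assms]]])
  then show ?thesis unfolding eta_def by (simp only: commute_funpow[of "J t" "A.P (ray s a)", OF P_ray_commute_J[OF assms]])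
qed

abbreviation Phi :: "(complex \<Rightarrow> complex) \<Rightarrow> 'x \<Rightarrow> 'x" where "Phi f \<equiv> cint \<beta> f A.P"

lemma Phi_commute_eta: "f \<in> H \<Longrightarrow> eta m t (Phi f y) = Phi f (eta m t y)"
  by (rule cint_commute[OF _ admissible_P eta_bounded_clin P_ray_commute_eta])

lemma Phi_eta: "f \<in> H \<Longrightarrow> Phi f (eta m t x) = Phi (\<lambda>z. f z * etaf m t z) x"
  by (rule cint_KP_eta[OF _ sector_holo_const[OF bounded_clin_ident] admissible_const[OF bounded_clin_ident]])

text \<open>This is A^-1, since R(0, A) = -A^-1.\<close>

definition Ai :: "'x \<Rightarrow> 'x" where "Ai x = - resolvent A 0 x"

lemma Ai_bounded_clin: "bounded_clin Ai"
  using bounded_clin_scale[OF resolvent_bounded_clin[OF inv A.lin], of "-1"] by (simp add: Ai_def[abs_def] scaleC.minus_left)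

lemma Ai_dom: "Ai x \<in> op_dom A" and A_Ai: "op_app A (Ai x) = x"
proof -
  have d: "resolvent A 0 x \<in> op_dom A" and e: "- op_app A (resolvent A 0 x) = x"
    using resolvent_right[OF inv, of x] by auto
  have m: "Ai x = (-1) *\<^sub>C resolvent A 0 x" by (simp add: Ai_def scaleC.minus_left)
  have "(-1) *\<^sub>C resolvent A 0 x \<in> op_dom A" "op_app A ((-1) *\<^sub>C resolvent A 0 x) = (-1) *\<^sub>C op_app A (resolvent A 0 x)"
    using d A.lin unfolding linear_op_def csubspace_def clinear_on_def by blast+
  then show "Ai x \<in> op_dom A" "op_app A (Ai x) = x"
    unfolding m using e by (simp_all add: scaleC.minus_left)
qed

lemma Ai_A: "x \<in> op_dom A \<Longrightarrow> Ai (op_app A x) = x"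
  using resolvent_left[OF inv, of x] bounded_clin_minus[OF resolvent_bounded_clin[OF inv A.lin]] by (simp add: Ai_def)

lemma Ai_inj: "Ai x = 0 \<Longrightarrow> x = 0"
proof -
  assume "Ai x = 0"
  then have "x = op_app A 0" using A_Ai[of x] by simp
  also have "op_app A 0 = op_app A (0 *\<^sub>C 0)" by simp
  also have "\<dots> = 0" using A.lin by (simp only: linear_op_def csubspace_def clinear_on_def scaleC_zero) (metis scaleC_zero(1))
  finally show "x = 0" .
qed

text \<open>The sectorial bound C/|z| blows up at 0. Since R(z) = R(0) - P(z) R(0) and P is bounded,
  the resolvent stays bounded.\<close>

lemma resolvent_near_0:
  obtains D where "D \<ge> 0" "\<And>z x. z \<in> outer \<sigma>A \<Longrightarrow> norm (resolvent A z x) \<le> D * norm x"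
proof -
  obtain D where D: "D \<ge> 0" "\<And>x. norm (resolvent A 0 x) \<le> D * norm x"
    using bounded_clin_bound[OF resolvent_bounded_clin[OF inv A.lin]] by blast
  show ?thesis
  proof (rule that[of "D + CA * D"])
    fix z x assume z: "z \<in> outer \<sigma>A"
    have "resolvent A z x - resolvent A 0 x = (0 - z) *\<^sub>C resolvent A z (resolvent A 0 x)"
      by (rule resolvent_identity[OF A.res[OF z] inv A.lin])
    then have "resolvent A z x = resolvent A 0 x - A.P z (resolvent A 0 x)"
      by (simp add: A.P_def scaleC.minus_left algebra_simps)
    then have "norm (resolvent A z x) \<le> norm (resolvent A 0 x) + norm (A.P z (resolvent A 0 x))"
      by (simp add: norm_triangle_ineq4)
    also have "\<dots> \<le> D * norm x + CA * (D * norm x)"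
      using D A.P_bound[OF z, of "resolvent A 0 x"] A.C mult_left_mono[OF D(2)[of x] A.C] by (intro add_mono) auto
    finally show "norm (resolvent A z x) \<le> (D + CA * D) * norm x" by (simp add: algebra_simps)
  qed (use D A.C in simp)
qed

text \<open>P(z) y tends to y at infinity for y in the domain, so P(z) y dz/z is not integrable.
  Subtracting z/(1 + z) times y, which is holomorphic in the sector, produces decay at both
  ends.\<close>

definition V :: "complex \<Rightarrow> 'x \<Rightarrow> 'x" where "V z y = A.P z y - (1 - jfun 0 z) *\<^sub>C y"

text \<open>For large |z|, V(z) y = P(z) A y / z + y/(1 + z), which uses that y is in the domain.
  For small |z|, P(z) y = z R(z) y with R bounded near 0, and the subtracted function is of order
  |z| as well.\<close>

lemma V_bound:
  assumes y: "y \<in> op_dom A"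
  obtains D where "D \<ge> 0" "\<And>s a. a \<in> {-\<beta>,\<beta>} \<Longrightarrow> norm (V (ray s a) y) \<le> D * exp (- 1 * \<bar>s\<bar>)"
proof -
  obtain D where D: "D \<ge> 0" "\<And>z x. z \<in> outer \<sigma>A \<Longrightarrow> norm (resolvent A z x) \<le> D * norm x"
    using resolvent_near_0 by blast
  define c where "c = 1 / cos (\<omega>/2)"
  have c: "c > 0" using cos_half_pos[OF \<omega>0 \<omega>pi] by (simp add: c_def)
  define E where "E = CA * norm (op_app A y) + D * norm y + c * norm y"
  have E: "E \<ge> 0" using D c A.C by (simp add: E_def)
  have jb: "cmod (jfun 0 z) * cmod z \<le> c" "cmod (1 - jfun 0 z) \<le> c * cmod z" if z: "z \<in> sector \<omega>" for z
  proof -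
    have "1 + z \<noteq> 0" using jfun_bound(3)[OF z, of 0] by simp
    then have e: "1 - jfun 0 z = jfun 0 z * z" by (simp add: jfun_def field_simps)
    show "cmod (jfun 0 z) * cmod z \<le> c" using jfun_bound(2)[OF z, of 0] by (simp add: e norm_mult c_def)
    show "cmod (1 - jfun 0 z) \<le> c * cmod z" unfolding e norm_mult
      using jfun_bound(1)[OF z, of 0] by (intro mult_right_mono) (auto simp: c_def)
  qed
  show ?thesis
  proof (rule that[OF E])
    fix s a assume a: "a \<in> {-\<beta>,\<beta>}"
    let ?z = "ray s a"
    have z: "?z \<in> outer \<sigma>A" by (rule \<beta>_ray_outer[OF a])
    have zs: "?z \<in> sector \<omega>" using a \<beta>0 \<beta>\<omega> \<omega>pi by (intro ray_in_sector) auto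
    show "norm (V ?z y) \<le> E * exp (- 1 * \<bar>s\<bar>)"
    proof (cases "s \<ge> 0")
      case True
      have "V ?z y = (1 / ?z) *\<^sub>C A.P ?z (op_app A y) + jfun 0 ?z *\<^sub>C y"
      proof -
        have "A.P ?z y = (1 / ?z) *\<^sub>C (?z *\<^sub>C A.P ?z y)" by (simp add: scaleC_scaleC)
        also have "\<dots> = y + (1 / ?z) *\<^sub>C A.P ?z (op_app A y)"
          unfolding A.P_dom[OF z y] by (simp add: scaleC.add_right scaleC_scaleC)
        finally show ?thesis by (simp add: V_def scaleC.diff_left)
      qed
      then have "norm (V ?z y) \<le> norm ((1 / ?z) *\<^sub>C A.P ?z (op_app A y)) + norm (jfun 0 ?z *\<^sub>C y)"
        by (simp only: norm_triangle_ineq)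
      then have "norm (V ?z y) \<le> exp (- s) * norm (A.P ?z (op_app A y)) + cmod (jfun 0 ?z) * norm y"
        by (simp add: norm_scaleC norm_divide exp_minus inverse_eq_divide)
      also have "\<dots> \<le> exp (- s) * (CA * norm (op_app A y)) + (c * exp (- s)) * norm y"
      proof (intro add_mono mult_left_mono mult_right_mono A.P_bound[OF z])
        have "cmod (jfun 0 ?z) * exp s * exp (- s) \<le> c * exp (- s)" using jb(1)[OF zs] by (intro mult_right_mono) auto
        then show "cmod (jfun 0 ?z) \<le> c * exp (- s)" by (simp add: mult.assoc exp_add[symmetric])
      qed auto
      also have "\<dots> = (CA * norm (op_app A y) + c * norm y) * exp (- 1 * \<bar>s\<bar>)" using True by (simp add: algebra_simps)
      also have "\<dots> \<le> E * exp (- 1 * \<bar>s\<bar>)" using D by (intro mult_right_mono) (auto simp: E_def)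
      finally show ?thesis .
    next
      case False
      have "norm (V ?z y) \<le> norm (A.P ?z y) + norm ((1 - jfun 0 ?z) *\<^sub>C y)" unfolding V_def by (rule norm_triangle_ineq4)
      also have "\<dots> \<le> exp s * (D * norm y) + (c * exp s) * norm y"
        unfolding A.P_def norm_scaleC norm_ray
        using D(2)[OF z, of y] jb(2)[OF zs] by (intro add_mono mult_left_mono mult_right_mono) auto
      also have "\<dots> = (D * norm y + c * norm y) * exp (- 1 * \<bar>s\<bar>)" using False by (simp add: algebra_simps)
      also have "\<dots> \<le> E * exp (- 1 * \<bar>s\<bar>)" using A.C by (intro mult_right_mono) (auto simp: E_def)
      finally show ?thesis .
    qed
  qed
qed

lemma V_continuous:
  assumes "a \<in> {-\<beta>,\<beta>}" shows "continuous_on UNIV (\<lambda>s. V (ray s a) y)"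
proof -
  have rc: "continuous_on UNIV (\<lambda>s. ray s a)"
    by (rule continuous_on_compose2[OF ray_continuous[of UNIV], of UNIV "\<lambda>s. (s, a)", unfolded prod.case]) (auto intro!: continuous_intros)
  have "continuous_on UNIV (\<lambda>s. jfun 0 (ray s a))"
    by (rule continuous_on_compose2[OF holomorphic_on_imp_continuous_on[OF jfun_holo] rc])
      (use assms \<beta>0 \<beta>\<omega> \<omega>pi in \<open>auto intro!: ray_in_sector\<close>)
  then show ?thesis unfolding V_def
    by (intro continuous_on_diff admissible_continuous[OF admissible_P assms] scaleC.continuous_on continuous_on_const) auto
qed

end

lemma admissible_diff: "admissible \<beta> K \<Longrightarrow> admissible \<beta> L \<Longrightarrow> admissible \<beta> (\<lambda>z x. K z x - L z x)"
proof -
  assume K: "admissible \<beta> K" and L: "admissible \<beta> L"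
  obtain C D where C: "C \<ge> 0" "\<forall>a\<in>{-\<beta>,\<beta>}. \<forall>s x. norm (K (ray s a) x) \<le> C * norm x"
    and D: "D \<ge> 0" "\<forall>a\<in>{-\<beta>,\<beta>}. \<forall>s x. norm (L (ray s a) x) \<le> D * norm x"
    using K L unfolding admissible_def by blast
  have b: "norm (K (ray s a) x - L (ray s a) x) \<le> (C + D) * norm x"
    if a: "a \<in> {-\<beta>,\<beta>}" for a s x
  proof -
    have "norm (K (ray s a) x) + norm (L (ray s a) x) \<le> C * norm x + D * norm x"
      using C D a by (intro add_mono) blast+
    then show ?thesis
      using norm_triangle_ineq4[of "K (ray s a) x" "L (ray s a) x"] by (simp add: distrib_right)
  qed
  have CD: "C + D \<ge> 0" using C D by simp
  have cb: "bounded_clin (\<lambda>x. K (ray s a) x - L (ray s a) x)"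
    if "a \<in> {-\<beta>,\<beta>}" for s a
    using admissible_bounded_clin[OF K that, of s] admissible_bounded_clin[OF L that, of s]
    by (auto simp: bounded_clin_def scaleC.diff_right intro: bounded_linear_sub)
  show "admissible \<beta> (\<lambda>z x. K z x - L z x)"
    unfolding admissible_def
    by (intro conjI ballI allI cb continuous_on_diff admissible_continuous[OF K] admissible_continuous[OF L] exI[of _ "C + D"] CD b)
qed

text \<open>End values of the primitive Ln(1 + z) of 1/(1 + z). The divergent summand n does not
  depend on the angle and drops out when the two rays are subtracted.\<close>

lemma Ln_one_plus_ray:
  assumes "\<bar>a\<bar> < pi"
  shows "(\<lambda>n::nat. Ln (1 + ray (real n) a) - of_real (real n)) \<longlonglongrightarrow> \<i> * of_real a"
    and "(\<lambda>n::nat. Ln (1 + ray (- real n) a)) \<longlonglongrightarrow> 0"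
proof -
  have e0: "(\<lambda>n::nat. exp (- real n)) \<longlonglongrightarrow> 0"
    using exp_neg_half_tendsto_0[of 2 1] by simp
  have ray: "ray s a = of_real (exp s) * cis a" for s
    by (simp add: ray_def exp_eq_polar)
  have cnR: "cis a \<notin> \<real>\<^sub>\<le>\<^sub>0"
  proof
    assume "cis a \<in> \<real>\<^sub>\<le>\<^sub>0"
    then have "sin a = 0" "cos a \<le> 0" by (auto simp: complex_nonpos_Reals_iff)
    then show False using sin_zero_pi_iff[OF assms] by auto
  qed
  have "(\<lambda>n::nat. Ln (of_real (exp (- real n)) + cis a)) \<longlonglongrightarrow> Ln (of_real 0 + cis a)"
    by (intro tendsto_Ln tendsto_add tendsto_of_real e0 tendsto_const) (use cnR in simp)
  moreover have "Ln (of_real 0 + cis a) = \<i> * of_real a"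
    using assms Ln_exp[of "\<i> * of_real a"] by (simp add: cis_conv_exp)
  moreover have "Ln (1 + ray (real n) a) - of_real (real n) = Ln (of_real (exp (- real n)) + cis a)"
    if nz: "of_real (exp (- real n)) + cis a \<noteq> 0" for n :: nat
  proof -
    have "1 + ray (real n) a = of_real (exp (real n)) * (of_real (exp (- real n)) + cis a)"
      by (simp add: ray distrib_left exp_minus field_simps flip: of_real_mult)
    then show ?thesis using Ln_times_of_real[OF exp_gt_zero nz, of "real n"] by (simp add: Ln_of_real)
  qed
  moreover have "of_real (exp (- real n)) + cis a \<noteq> 0" for n :: nat
  proof
    assume "of_real (exp (- real n)) + cis a = 0"
    then have "cis a = of_real (- exp (- real n))" by (simp add: eq_neg_iff_add_eq_0 add.commute)
    then have "cis a \<in> \<real>\<^sub>\<le>\<^sub>0" by (simp only: nonpos_Reals_of_real_iff) simp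
    with cnR show False by simp
  qed
  ultimately show "(\<lambda>n::nat. Ln (1 + ray (real n) a) - of_real (real n)) \<longlonglongrightarrow> \<i> * of_real a" by simp
  have "(\<lambda>n::nat. Ln (1 + of_real (exp (- real n)) * cis a)) \<longlonglongrightarrow> Ln (1 + of_real 0 * cis a)"
    by (intro tendsto_Ln tendsto_add tendsto_mult tendsto_of_real e0 tendsto_const) simp
  then show "(\<lambda>n::nat. Ln (1 + ray (- real n) a)) \<longlonglongrightarrow> 0" by (simp add: ray)
qed

context op_calculus begin

lemma \<beta>pi: "\<beta> < pi" using \<beta>\<omega> \<omega>pi by simp

lemma integral_one_minus_jfun:
  assumes a: "a \<in> {-\<beta>,\<beta>}" and n: "n \<ge> 0"
  shows "((\<lambda>s. 1 - jfun 0 (ray s a)) has_integral (Ln (1 + ray n a) - Ln (1 + ray (- n) a))) {-n..n}"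
proof (rule fundamental_theorem_of_calculus)
  fix s :: real
  \<comment> \<open>The rays are not real, so 1 + z avoids the branch cut of
    \<open>Ln\<close>.\<close>
  have sin: "sin a \<noteq> 0" using a \<beta>0 \<beta>pi sin_gt_zero[of \<beta>] by auto
  then have "Im (1 + ray s a) \<noteq> 0" by (simp add: ray_def Im_exp)
  then have nR: "1 + ray s a \<notin> \<real>\<^sub>\<le>\<^sub>0" by (auto simp: complex_nonpos_Reals_iff)
  then have nz: "1 + ray s a \<noteq> 0" by auto
  have "((\<lambda>z. Ln (1 + z)) has_field_derivative inverse (1 + ray s a)) (at (ray s a) within range (\<lambda>s. ray s a))"
    using nR by (auto intro!: derivative_eq_intros simp: inverse_eq_divide)
  from field_vector_diff_chain_within[OF ray_deriv_s[of a s "{-n..n}"] has_field_derivative_subset[OF this]]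
  have "((\<lambda>s. Ln (1 + ray s a)) has_vector_derivative ray s a * inverse (1 + ray s a)) (at s within {-n..n})"
    by (auto simp: o_def)
  moreover have "ray s a * inverse (1 + ray s a) = 1 - jfun 0 (ray s a)"
    using nz by (simp add: jfun_def field_simps)
  ultimately show "((\<lambda>s. Ln (1 + ray s a)) has_vector_derivative 1 - jfun 0 (ray s a)) (at s within {-n..n})" by simp
qed (use n in auto)

text \<open>Both rays are rotated outwards to the negative axis, where the angles pi and -pi give
  the same ray and cancel. During each rotation the difference of the end values of P(z) y tends to
  y, which contributes \<i> (pi - \<beta>) y.\<close>

lemma P_outer_integral:
  assumes y: "y \<in> op_dom A"
  shows "(\<lambda>n::nat. integral {- real n..real n} (\<lambda>s. A.P (ray s (-\<beta>)) y) - integral {- real n..real n} (\<lambda>s. A.P (ray s \<beta>) y))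
    \<longlonglongrightarrow> (2 * \<i> * (pi - \<beta>)) *\<^sub>C y"
proof -
  obtain D where D: "D \<ge> 0" "\<And>z x. z \<in> outer \<sigma>A \<Longrightarrow> norm (resolvent A z x) \<le> D * norm x"
    using resolvent_near_0 by blast
  define E where "E = CA * norm (op_app A y) + D * norm y"
  define Jn where "Jn n a = integral {- real n..real n} (\<lambda>s. A.P (ray s a) y)" for n a
  have bd: "norm (A.P (ray (real n) a) y - A.P (ray (- real n) a) y - y) \<le> E * exp (- real n)"
    if "\<beta> \<le> \<bar>a\<bar>" "\<bar>a\<bar> \<le> pi" for n a
  proof -
    let ?z = "ray (real n) a" and ?w = "ray (- real n) a"
    have z: "?z \<in> outer \<sigma>A" and w: "?w \<in> outer \<sigma>A" using that by (auto intro: ray_outer)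
    have "A.P ?z y = (1 / ?z) *\<^sub>C (?z *\<^sub>C A.P ?z y)" by (simp add: scaleC_scaleC)
    also have "\<dots> = y + (1 / ?z) *\<^sub>C A.P ?z (op_app A y)"
      unfolding A.P_dom[OF z y] by (simp add: scaleC.add_right scaleC_scaleC)
    finally have "A.P ?z y - A.P ?w y - y = (1 / ?z) *\<^sub>C A.P ?z (op_app A y) - ?w *\<^sub>C resolvent A ?w y"
      by (simp add: A.P_def)
    also have "norm \<dots> \<le> norm ((1 / ?z) *\<^sub>C A.P ?z (op_app A y)) + norm (?w *\<^sub>C resolvent A ?w y)" by (rule norm_triangle_ineq4)
    also have "\<dots> = exp (- real n) * norm (A.P ?z (op_app A y)) + exp (- real n) * norm (resolvent A ?w y)"
      by (simp add: norm_scaleC norm_divide exp_minus inverse_eq_divide)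
    also have "\<dots> \<le> exp (- real n) * (CA * norm (op_app A y)) + exp (- real n) * (D * norm y)"
      by (intro add_mono mult_left_mono A.P_bound[OF z] D(2)[OF w]) auto
    finally show ?thesis by (simp add: E_def algebra_simps)
  qed
  have rc: "continuous_on S (\<lambda>p. ray (fst p) (snd p))" for S
    using ray_continuous[of S] by (simp add: case_prod_unfold)
  have arc: "norm (Jn n b - Jn n a - (\<i> * (b - a)) *\<^sub>C y) \<le> E * exp (- real n) * (b - a)"
    if ab: "a \<le> b" "\<And>\<alpha>. \<alpha> \<in> {a..b} \<Longrightarrow> \<beta> \<le> \<bar>\<alpha>\<bar> \<and> \<bar>\<alpha>\<bar> \<le> pi" for n a b
    unfolding Jn_def
  proof (rule ray_integral_diff_bound[where G="\<lambda>z. A.P z y" and G'="\<lambda>z. A.P' z y"])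
    show "((\<lambda>z. A.P z y) has_derivative (\<lambda>h. h *\<^sub>C A.P' (ray s \<alpha>) y)) (at (ray s \<alpha>))" if "\<alpha> \<in> {a..b}" for s \<alpha>
      using ab(2)[OF that] by (intro A.P_has_derivative ray_outer) auto
    show "continuous_on (UNIV \<times> {a..b}) (\<lambda>(s, \<alpha>). A.P' (ray s \<alpha>) y)"
      unfolding case_prod_unfold
      by (rule continuous_on_compose2[OF A.P'_continuous rc]) (use ab(2) in \<open>auto intro!: ray_outer\<close>)
  qed (use ab bd in auto)
  have e0: "(\<lambda>n::nat. K * exp (- real n)) \<longlonglongrightarrow> 0" for K
    using exp_neg_half_tendsto_0[of 2 K] by simp
  have a1: "(\<lambda>n. Jn n pi - Jn n \<beta> - (\<i> * (pi - \<beta>)) *\<^sub>C y) \<longlonglongrightarrow> 0"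
    by (rule Lim_null_comparison[OF always_eventually e0[of "E * (pi - \<beta>)"]])
      (use arc[of \<beta> pi] \<beta>0 \<beta>pi in \<open>auto simp: mult_ac\<close>)
  have a2: "(\<lambda>n. Jn n (-\<beta>) - Jn n (-pi) - (\<i> * (pi - \<beta>)) *\<^sub>C y) \<longlonglongrightarrow> 0"
    by (rule Lim_null_comparison[OF always_eventually e0[of "E * (pi - \<beta>)"]])
      (use arc[of "-pi" "-\<beta>"] \<beta>0 \<beta>pi in \<open>auto simp: mult_ac\<close>)
  have "ray s (-pi) = ray s pi" for s by (simp add: ray_def exp_eq_polar complex_eq_iff)
  then have "Jn n (-pi) = Jn n pi" for n by (simp add: Jn_def)
  then have "(\<lambda>n. Jn n (-\<beta>) - Jn n \<beta> - (2 * \<i> * (pi - \<beta>)) *\<^sub>C y) \<longlonglongrightarrow> 0 + 0"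
    using tendsto_add[OF a1 a2] by (simp add: scaleC.add_left[symmetric] algebra_simps)
  then show ?thesis unfolding Jn_def by (simp add: LIM_zero_iff)
qed

text \<open>The outer rotation contributes 2 \<i> (pi - \<beta>) y and the subtracted scalar part 2
  \<i> \<beta> y; together they make the full 2 pi \<i> y of Cauchy's formula.\<close>

lemma V_contour:
  assumes y: "y \<in> op_dom A"
  shows "(1 / (2 * complex_of_real pi * \<i>)) *\<^sub>C (integral UNIV (\<lambda>s. V (ray s (-\<beta>)) y) - integral UNIV (\<lambda>s. V (ray s \<beta>) y)) = y"
proof -
  obtain D where D: "D \<ge> 0" "\<And>s a. a \<in> {-\<beta>,\<beta>} \<Longrightarrow> norm (V (ray s a) y) \<le> D * exp (- 1 * \<bar>s\<bar>)"
    using V_bound[OF y] by blast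
  have lim: "(\<lambda>n::nat. integral {- real n..real n} (\<lambda>s. V (ray s a) y)) \<longlonglongrightarrow> integral UNIV (\<lambda>s. V (ray s a) y)"
    if "a \<in> {-\<beta>,\<beta>}" for a
    by (rule exp_dec_integral_limit[OF V_continuous[OF that] _ D(2)[OF that]]) simp
  define Sn where "Sn n a = Ln (1 + ray (real n) a) - Ln (1 + ray (- real n) a)" for n a
  have split: "integral {- real n..real n} (\<lambda>s. V (ray s a) y) = integral {- real n..real n} (\<lambda>s. A.P (ray s a) y) - Sn n a *\<^sub>C y"
    if a: "a \<in> {-\<beta>,\<beta>}" for n a
  proof -
    have "((\<lambda>s. (1 - jfun 0 (ray s a)) *\<^sub>C y) has_integral Sn n a *\<^sub>C y) {- real n..real n}"
      using has_integral_linear[OF integral_one_minus_jfun[OF a, of "real n"] scaleC.bounded_linear_left[of y]] by (simp add: o_def Sn_def)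
    moreover have "(\<lambda>s. A.P (ray s a) y) integrable_on {- real n..real n}"
      by (rule integrable_continuous_real, rule continuous_on_subset[OF admissible_continuous[OF admissible_P a]]) simp
    ultimately show ?thesis unfolding V_def
      by (simp add: integral_diff has_integral_integrable integral_unique)
  qed
  have S: "(\<lambda>n. Sn n a - of_real (real n)) \<longlonglongrightarrow> \<i> * of_real a" if "a \<in> {-\<beta>,\<beta>}" for a
    using tendsto_diff[OF Ln_one_plus_ray[of a]] that \<beta>0 \<beta>pi by (auto simp: Sn_def algebra_simps)
  have "(\<lambda>n. Sn n (-\<beta>) - Sn n \<beta>) \<longlonglongrightarrow> \<i> * of_real (-\<beta>) - \<i> * of_real \<beta>"
    using tendsto_diff[OF S[of "-\<beta>"] S[of \<beta>]] by simp
  then have S': "(\<lambda>n. (Sn n (-\<beta>) - Sn n \<beta>) *\<^sub>C y) \<longlonglongrightarrow> (\<i> * of_real (-\<beta>) - \<i> * of_real \<beta>) *\<^sub>C y"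
    by (intro scaleC.tendsto tendsto_const)
  have "(\<lambda>n::nat. integral {- real n..real n} (\<lambda>s. V (ray s (-\<beta>)) y) - integral {- real n..real n} (\<lambda>s. V (ray s \<beta>) y))
    \<longlonglongrightarrow> (2 * \<i> * (pi - \<beta>)) *\<^sub>C y - (\<i> * of_real (-\<beta>) - \<i> * of_real \<beta>) *\<^sub>C y"
    using tendsto_diff[OF P_outer_integral[OF y] S'] by (simp add: split scaleC.diff_left algebra_simps)
  moreover have "(2 * \<i> * (pi - \<beta>)) *\<^sub>C y - (\<i> * of_real (-\<beta>) - \<i> * of_real \<beta>) *\<^sub>C y = (2 * complex_of_real pi * \<i>) *\<^sub>C y"
    by (simp add: scaleC.diff_left[symmetric] algebra_simps)
  ultimately have "integral UNIV (\<lambda>s. V (ray s (-\<beta>)) y) - integral UNIV (\<lambda>s. V (ray s \<beta>) y) = (2 * complex_of_real pi * \<i>) *\<^sub>C y"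
    using LIMSEQ_unique[OF tendsto_diff[OF lim[of "-\<beta>"] lim[of \<beta>]]] by simp
  then show ?thesis by (simp add: scaleC_scaleC)
qed

lemma admissible_V: "admissible \<beta> V"
proof -
  have "admissible \<beta> (\<lambda>z x. (1 - jfun 0 z) *\<^sub>C (x::'x))"
    unfolding admissible_def
  proof (intro conjI ballI allI)
    fix a assume a: "a \<in> {-\<beta>,\<beta>}"
    show "bounded_clin (\<lambda>x. (1 - jfun 0 (ray s a)) *\<^sub>C x)" for s by (rule bounded_clin_scale[OF bounded_clin_ident])
    fix x
    have "continuous_on UNIV (\<lambda>s. A.P (ray s a) x - V (ray s a) x)"
      by (intro continuous_on_diff V_continuous a admissible_continuous[OF admissible_P a])
    then show "continuous_on UNIV (\<lambda>s. (1 - jfun 0 (ray s a)) *\<^sub>C x)" by (simp add: V_def)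
  next
    have "norm ((1 - jfun 0 (ray s a)) *\<^sub>C x) \<le> 1 / cos (\<omega>/2) * norm x" if "a \<in> {-\<beta>,\<beta>}" for a s and x :: 'x
      unfolding norm_scaleC
      by (intro mult_right_mono jfun_bound(2) ray_in_sector) (use that \<beta>0 \<beta>\<omega> \<omega>pi in auto)
    moreover have "1 / cos (\<omega>/2) \<ge> 0" using cos_half_pos[OF \<omega>0 \<omega>pi] by simp
    ultimately show "\<exists>C\<ge>0. \<forall>a\<in>{- \<beta>, \<beta>}. \<forall>s x. norm ((1 - jfun 0 (ray s a)) *\<^sub>C (x::'x)) \<le> C * norm x" by blast
  qed
  from admissible_diff[OF admissible_P this] show ?thesis by (simp add: V_def[abs_def])
qed

text \<open>Integrals of f dz/z do not depend on the ray, so both rays share the constant computed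
  on the positive axis.\<close>

lemma H_integral_rotate:
  fixes v :: 'x
  assumes f: "f \<in> H" and a: "a \<in> {-\<beta>,\<beta>}"
  shows "integral UNIV (\<lambda>s. f (ray s a) *\<^sub>C v) = integral UNIV (\<lambda>s. f (ray s 0)) *\<^sub>C v"
proof -
  obtain C e where C: "C > 0" "e > 0" "\<And>s a. \<bar>a\<bar> < \<omega> \<Longrightarrow> cmod (f (ray s a)) \<le> C * exp (- e * \<bar>s\<bar>)"
    using H_infty_0_ray[OF \<omega>0 \<omega>pi f] by blast
  have hol: "f holomorphic_on sector \<omega>" "deriv f holomorphic_on sector \<omega>"
    using H_infty_0_holo[OF f] holomorphic_deriv[OF _ open_sector[OF \<omega>0 \<omega>pi]] by auto
  have rc: "continuous_on S (\<lambda>p. ray (fst p) (snd p))" for S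
    using ray_continuous[of S] by (simp add: case_prod_unfold)
  have rot: "integral UNIV (\<lambda>s. f (ray s a1) *\<^sub>C v) = integral UNIV (\<lambda>s. f (ray s a2) *\<^sub>C v)"
    if ab: "a1 \<le> a2" "-\<beta> \<le> a1" "a2 \<le> \<beta>" for a1 a2
  proof (rule ray_integral_rotate[where G="\<lambda>z. f z *\<^sub>C v" and G'="\<lambda>z. deriv f z *\<^sub>C v" and C="C * norm v" and e=e])
    fix s \<alpha> assume \<alpha>: "\<alpha> \<in> {a1..a2}"
    have al: "\<bar>\<alpha>\<bar> < \<omega>" using \<alpha> ab \<beta>\<omega> \<beta>0 by auto
    have "(f has_derivative (\<lambda>h. deriv f (ray s \<alpha>) * h)) (at (ray s \<alpha>))"
      using holomorphic_derivI[OF hol(1) open_sector[OF \<omega>0 \<omega>pi] ray_in_sector[OF al \<omega>pi]] by (simp add: has_field_derivative_def)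
    from bounded_linear.has_derivative[OF scaleC.bounded_linear_left this, of v]
    show "((\<lambda>z. f z *\<^sub>C v) has_derivative (\<lambda>h. h *\<^sub>C deriv f (ray s \<alpha>) *\<^sub>C v)) (at (ray s \<alpha>))"
      by (simp add: scaleC_scaleC mult.commute)
    show "norm (f (ray s \<alpha>) *\<^sub>C v) \<le> C * norm v * exp (- e * \<bar>s\<bar>)"
      using mult_right_mono[OF C(3)[OF al, of s] norm_ge_zero[of v]] by (simp add: norm_scaleC mult_ac)
  next
    show "continuous_on (UNIV \<times> {a1..a2}) (\<lambda>(s, \<alpha>). deriv f (ray s \<alpha>) *\<^sub>C v)"
      unfolding case_prod_unfold
      by (intro scaleC.continuous_on continuous_on_const continuous_on_compose2[OF holomorphic_on_imp_continuous_on[OF hol(2)] rc])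
        (use ab \<beta>\<omega> \<beta>0 \<omega>pi in \<open>auto intro!: ray_in_sector\<close>)
  qed (use ab C in auto)
  have "integral UNIV (\<lambda>s. f (ray s a) *\<^sub>C v) = integral UNIV (\<lambda>s. f (ray s 0) *\<^sub>C v)"
    using rot[of a 0] rot[of 0 a] a \<beta>0 by auto
  moreover have "(\<lambda>s. f (ray s 0)) integrable_on UNIV"
  proof (rule exp_dec_integrable(1)[of _ e C 0])
    have "continuous_on UNIV (\<lambda>s. case (0, s) of (t, s) \<Rightarrow> f (ray (t + s) 0))"
      by (rule continuous_on_compose2[OF H_ray_continuous[OF f]]) (use \<omega>0 in \<open>auto intro!: continuous_intros\<close>)
    then show "continuous_on UNIV (\<lambda>s. f (ray s 0))" by simp
  qed (use C \<omega>0 in auto)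
  ultimately show ?thesis
    using integral_linear[OF _ scaleC.bounded_linear_left[of v], of "\<lambda>s. f (ray s 0)" UNIV] by (simp add: o_def)
qed

text \<open>For fixed s, the integral of f(e^t z) over all t is a constant, by translation and
  rotation to the positive axis. Restricting t to [-n, n] costs a multiple of exp(-e (n - |s|)/2),
  and the growth exp(e|s|/2) is absorbed by the decay of W.\<close>

lemma calderon_ray:
  fixes W :: "real \<Rightarrow> 'x"
  assumes f: "f \<in> H" and a: "a \<in> {-\<beta>,\<beta>}" and W: "continuous_on UNIV W" "\<And>s. norm (W s) \<le> D * exp (- 1 * \<bar>s\<bar>)"
  shows "(\<lambda>n::nat. integral {- real n..real n} (\<lambda>t. integral UNIV (\<lambda>s. f (ray (t + s) a) *\<^sub>C W s)))
     \<longlonglongrightarrow> integral UNIV (\<lambda>s. f (ray s 0)) *\<^sub>C integral UNIV W"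
proof -
  obtain C e0 where C: "C > 0" "e0 > 0" "\<And>s a. \<bar>a\<bar> < \<omega> \<Longrightarrow> cmod (f (ray s a)) \<le> C * exp (- e0 * \<bar>s\<bar>)"
    using H_infty_0_ray[OF \<omega>0 \<omega>pi f] by blast
  \<comment> \<open>At most 1, so that exp(e|s|/2) exp(-|s|) still decays like exp(-|s|/2).\<close>
  define e where "e = min e0 1"
  have e: "e > 0" "e \<le> 1" using C by (auto simp: e_def)
  have a': "\<bar>a\<bar> < \<omega>" using a \<beta>0 \<beta>\<omega> by auto
  have fe: "cmod (f (ray s a)) \<le> C * exp (- e * \<bar>s\<bar>)" for s
  proof -
    have "exp (- e0 * \<bar>s\<bar>) \<le> exp (- e * \<bar>s\<bar>)" by (auto simp: e_def intro: mult_right_mono)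
    then show ?thesis using C(3)[OF a', of s] mult_left_mono[of _ _ C] C(1) by (meson less_imp_le order_trans)
  qed
  have fC: "cmod (f (ray s a)) \<le> C" for s
  proof -
    have "C * exp (- e * \<bar>s\<bar>) \<le> C * 1" using C e by (intro mult_left_mono) auto
    then show ?thesis using fe[of s] by simp
  qed
  have D: "D \<ge> 0" using W(2)[of 0] norm_ge_zero[of "W 0"] by (simp del: norm_ge_zero)
  let ?c = "integral UNIV (\<lambda>s. f (ray s 0))"
  have W2: "continuous_on UNIV (\<lambda>p::real\<times>real. W (snd p))"
    by (rule continuous_on_compose2[OF W(1)]) (auto intro!: continuous_intros)
  have gc: "continuous_on UNIV (\<lambda>(t,s). f (ray (t + s) a) *\<^sub>C W s)"
    using H_ray_continuous[OF f a'] W2 unfolding case_prod_unfold by (intro scaleC.continuous_on)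
  have gb: "norm (f (ray (t + s) a) *\<^sub>C W s) \<le> C * D * exp (- 1 * \<bar>s\<bar>)" for t s
    unfolding norm_scaleC using mult_mono[OF fC[of "t + s"] W(2)[of s]] C D by (simp add: mult_ac)
  have ci: "continuous_on UNIV (\<lambda>t. integral UNIV (\<lambda>s. f (ray (t + s) a) *\<^sub>C W s))"
    by (rule exp_dec_param_continuous[OF gc, of 1 "\<lambda>_. C * D"]) (use gb in auto)
  note swap = exp_dec_integral_swap[OF gc, of 1, where C="C * D", OF _ _ gb ci]
  have fc: "continuous_on UNIV (\<lambda>s. f (ray s a))"
  proof -
    have "continuous_on UNIV (\<lambda>s. case (0, s) of (t, s) \<Rightarrow> f (ray (t + s) a))"
      by (rule continuous_on_compose2[OF H_ray_continuous[OF f a']]) (auto intro!: continuous_intros)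
    then show ?thesis by simp
  qed
  have tail: "norm (?c *\<^sub>C v - integral {- real n..real n} (\<lambda>t. f (ray (t + s) a) *\<^sub>C v)) \<le> 4 * (C * norm v) / e * exp (- e * (real n - \<bar>s\<bar>) / 2)" for n s and v :: 'x
  proof -
    have "integral {- real n..real n} (\<lambda>t. f (ray (t + s) a) *\<^sub>C v) = integral {- real n + s..real n + s} (\<lambda>t. f (ray t a) *\<^sub>C v)"
      using integral_shift_Icc_real[of "- real n" "real n" "\<lambda>t. f (ray t a) *\<^sub>C v" s] by (simp add: o_def add.commute)
    moreover have "norm (integral UNIV (\<lambda>t. f (ray t a) *\<^sub>C v) - integral {- real n + s..real n + s} (\<lambda>t. f (ray t a) *\<^sub>C v)) \<le> 4 * (C * norm v) / e * exp (- e * (real n - \<bar>s\<bar>) / 2)"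
    proof (rule exp_dec_tail)
      show "continuous_on UNIV (\<lambda>t. f (ray t a) *\<^sub>C v)" by (intro scaleC.continuous_on fc continuous_on_const)
      show "norm (f (ray t a) *\<^sub>C v) \<le> C * norm v * exp (- e * \<bar>t\<bar>)" for t
        using mult_right_mono[OF fe[of t] norm_ge_zero[of v]] by (simp add: norm_scaleC mult_ac)
    qed (use e in auto)
    ultimately show ?thesis using H_integral_rotate[OF f a, of v] by simp
  qed
  define h where "h n s = integral {- real n..real n} (\<lambda>t. f (ray (t + s) a) *\<^sub>C W s)" for n s
  have hc: "continuous_on UNIV (h n)" for n unfolding h_def by (rule swap(2)) auto
  have cW: "continuous_on UNIV (\<lambda>s. ?c *\<^sub>C W s)" by (intro scaleC.continuous_on W continuous_on_const)
  have Wi: "W integrable_on UNIV" by (rule exp_dec_integrable(1)[OF W(1), of 1 D 0]) (use W(2) in auto)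
  have cWi: "(\<lambda>s. ?c *\<^sub>C W s) integrable_on UNIV" and cWe: "integral UNIV (\<lambda>s. ?c *\<^sub>C W s) = ?c *\<^sub>C integral UNIV W"
    using integrable_linear[OF Wi bounded_linear_scaleC_right[of ?c]] integral_linear[OF Wi bounded_linear_scaleC_right[of ?c]] by (simp_all add: o_def)
  have hi: "h n integrable_on UNIV" for n
    by (rule exp_dec_integrable(1)[OF hc[of n], of 1 "C * D * (real n - - real n)" 0]) (use swap(3)[of "- real n" "real n"] in \<open>auto simp: h_def\<close>)
  have diff: "norm (?c *\<^sub>C integral UNIV W - integral UNIV (h n)) \<le> (16 * C * D / e) * exp (- e * real n / 2)" for n
  proof -
    have "?c *\<^sub>C integral UNIV W - integral UNIV (h n) = integral UNIV (\<lambda>s. ?c *\<^sub>C W s - h n s)"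
      by (simp add: integral_diff[OF cWi hi] cWe)
    also have "norm \<dots> \<le> (4 * C * D / e * exp (- e * real n / 2)) * (2 / (1/2))"
    proof (rule exp_dec_integrable(2)[where c=0])
      show "continuous_on UNIV (\<lambda>s. ?c *\<^sub>C W s - h n s)" by (intro continuous_on_diff cW hc)
      fix s
      have "norm (?c *\<^sub>C W s - h n s) \<le> 4 * (C * norm (W s)) / e * exp (- e * (real n - \<bar>s\<bar>) / 2)"
        unfolding h_def by (rule tail)
      also have "\<dots> \<le> 4 * (C * (D * exp (- 1 * \<bar>s\<bar>))) / e * exp (- e * (real n - \<bar>s\<bar>) / 2)"
        using W(2)[of s] C e by (intro mult_right_mono divide_right_mono mult_left_mono) auto
      also have "\<dots> = 4 * C * D / e * exp (- e * real n / 2) * exp (e * \<bar>s\<bar> / 2 - \<bar>s\<bar>)"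
        by (simp add: exp_add[symmetric] exp_diff field_simps)
      also have "\<dots> \<le> 4 * C * D / e * exp (- e * real n / 2) * exp (- (1/2) * \<bar>s + 0\<bar>)"
      proof (intro mult_left_mono)
        have "e * \<bar>s\<bar> \<le> 1 * \<bar>s\<bar>" using e by (intro mult_right_mono) auto
        then show "exp (e * \<bar>s\<bar> / 2 - \<bar>s\<bar>) \<le> exp (- (1/2) * \<bar>s + 0\<bar>)" by simp
      qed (use C D e in auto)
      finally show "norm (?c *\<^sub>C W s - h n s) \<le> 4 * C * D / e * exp (- e * real n / 2) * exp (- (1/2) * \<bar>s + 0\<bar>)" .
    qed simp
    finally show ?thesis by simp
  qed
  have "(\<lambda>n. ?c *\<^sub>C integral UNIV W - integral UNIV (h n)) \<longlonglongrightarrow> 0"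
    by (rule Lim_null_comparison[OF always_eventually exp_neg_half_tendsto_0[OF e(1)]]) (use diff in blast)
  from tendsto_diff[OF tendsto_const[of "?c *\<^sub>C integral UNIV W"] this]
  have "(\<lambda>n. integral UNIV (h n)) \<longlonglongrightarrow> ?c *\<^sub>C integral UNIV W" by simp
  moreover have "integral {- real n..real n} (\<lambda>t. integral UNIV (\<lambda>s. f (ray (t + s) a) *\<^sub>C W s)) = integral UNIV (h n)" for n
    unfolding h_def by (rule swap(1)) auto
  ultimately show ?thesis by simp
qed

text \<open>The integral of f(r) \<eta>(r) dr/r over the positive half-line.\<close>

definition calderon_const :: "(complex \<Rightarrow> complex) \<Rightarrow> nat \<Rightarrow> complex" where
  "calderon_const f m = integral UNIV (\<lambda>s. f (ray s 0) * etaf m 0 (ray s 0))"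

text \<open>\<eta>(e^t A) f(e^t A) is \<psi>(e^t A) with \<psi> = f \<eta>. Here V may replace P, as
  the difference is holomorphic in the sector. The decay of V, for which y has to be in the domain,
  allows \<open>calderon_ray\<close> on each ray, and \<open>V_contour\<close> combines the rays to
  y.\<close>

lemma calderon:
  assumes f: "f \<in> H" and y: "y \<in> op_dom A"
  shows "(\<lambda>n::nat. integral {- real n..real n} (\<lambda>t. eta m t (Phi (dil f t) y))) \<longlonglongrightarrow> calderon_const f m *\<^sub>C y"
proof -
  define \<psi> where "\<psi> z = f z * etaf m 0 z" for z
  have \<psi>: "\<psi> \<in> H" unfolding \<psi>_def by (rule H_etaf[OF f])
  obtain D where D: "D \<ge> 0" "\<And>s a. a \<in> {-\<beta>,\<beta>} \<Longrightarrow> norm (V (ray s a) y) \<le> D * exp (- 1 * \<bar>s\<bar>)"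
    using V_bound[OF y] by blast
  let ?I = "\<lambda>a t. integral UNIV (\<lambda>s. \<psi> (ray (t + s) a) *\<^sub>C V (ray s a) y)"
  have Ic: "continuous_on UNIV (?I a)" if "a \<in> {-\<beta>,\<beta>}" for a
  proof -
    obtain C e where C: "C > 0" "e > 0"
      "\<And>a t s x. a \<in> {-\<beta>,\<beta>} \<Longrightarrow> norm (\<psi> (ray (t + s) a) *\<^sub>C V (ray s a) x) \<le> C * norm x * exp (- e * \<bar>s + t\<bar>)"
      using H_ray_bound[OF \<psi> admissible_V] by blast
    obtain C' e' where C': "C' > 0" "e' > 0" "\<And>s a. \<bar>a\<bar> < \<omega> \<Longrightarrow> cmod (\<psi> (ray s a)) \<le> C' * exp (- e' * \<bar>s\<bar>)"
      using H_infty_0_ray[OF \<omega>0 \<omega>pi \<psi>] by blast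
    show ?thesis
    proof (rule exp_dec_param_continuous[OF H_ray_K_continuous(1)[OF \<psi> admissible_V that, of y], of 1 "\<lambda>_. C' * D"])
      fix k t s :: real
      have "\<bar>a\<bar> < \<omega>" using that \<beta>0 \<beta>\<omega> by auto
      then have "cmod (\<psi> (ray (t + s) a)) \<le> C' * exp (- e' * \<bar>t + s\<bar>)" by (rule C'(3))
      also have "\<dots> \<le> C' * 1" using C' by (intro mult_left_mono) auto
      finally show "norm (\<psi> (ray (t + s) a) *\<^sub>C V (ray s a) y) \<le> C' * D * exp (- 1 * \<bar>s\<bar>)"
        unfolding norm_scaleC using mult_mono[OF _ D(2)[OF that], of "cmod (\<psi> (ray (t + s) a))" C' s] C' D by (simp add: mult_ac)
    qed simp
  qed
  have cal: "eta m t (Phi (dil f t) y) = (1 / (2 * complex_of_real pi * \<i>)) *\<^sub>C (?I (-\<beta>) t - ?I \<beta> t)" for t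
  proof -
    have e: "(\<lambda>z. dil f t z * etaf m t z) = dil \<psi> t"
      by (rule ext) (simp add: \<psi>_def etaf_dil[of m t], simp add: dil_def \<psi>_def)
    have "eta m t (Phi (dil f t) y) = Phi (dil \<psi> t) y"
      unfolding Phi_commute_eta[OF dil_H[OF f]] Phi_eta[OF dil_H[OF f]] e ..
    also have "\<dots> = cint \<beta> (dil \<psi> t) V y + cint \<beta> (\<lambda>z. dil \<psi> t z * (1 - jfun 0 z)) (\<lambda>z x. x) y"
      by (rule cint_split[OF dil_H[OF \<psi>] admissible_V H_jfun'[OF dil_H[OF \<psi>]] admissible_const[OF bounded_clin_ident]])
        (simp add: V_def scaleC.diff_right scaleC_scaleC)
    also have "cint \<beta> (\<lambda>z. dil \<psi> t z * (1 - jfun 0 z)) (\<lambda>z x. x) y = 0"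
      by (rule cint_sector_holo[OF H_jfun'[OF dil_H[OF \<psi>]] sector_holo_const[OF bounded_clin_ident]])
    finally show ?thesis by (simp add: cint_def dil_ray)
  qed
  have eq: "integral {- real n..real n} (\<lambda>t. eta m t (Phi (dil f t) y)) =
     (1 / (2 * complex_of_real pi * \<i>)) *\<^sub>C (integral {- real n..real n} (?I (-\<beta>)) - integral {- real n..real n} (?I \<beta>))" for n
  proof -
    have i: "?I a integrable_on {- real n..real n}" if "a \<in> {-\<beta>,\<beta>}" for a
      by (rule integrable_continuous_real, rule continuous_on_subset[OF Ic[OF that]]) simp
    have d: "(\<lambda>t. ?I (-\<beta>) t - ?I \<beta> t) integrable_on {- real n..real n}" by (intro integrable_diff i) auto
    show ?thesis
      unfolding cal
      using integral_linear[OF d bounded_linear_scaleC_right[of "1 / (2 * complex_of_real pi * \<i>)"]]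
      by (simp add: o_def integral_diff[OF i i])
  qed
  have "calderon_const f m = integral UNIV (\<lambda>s. \<psi> (ray s 0))" by (simp add: calderon_const_def \<psi>_def)
  then have L: "(\<lambda>n::nat. integral {- real n..real n} (?I a)) \<longlonglongrightarrow> calderon_const f m *\<^sub>C integral UNIV (\<lambda>s. V (ray s a) y)" if "a \<in> {-\<beta>,\<beta>}" for a
    using calderon_ray[OF \<psi> that V_continuous[OF that] D(2)[OF that]] by simp
  have "(\<lambda>n. integral {- real n..real n} (\<lambda>t. eta m t (Phi (dil f t) y))) \<longlonglongrightarrow> (1 / (2 * complex_of_real pi * \<i>)) *\<^sub>C
      (calderon_const f m *\<^sub>C integral UNIV (\<lambda>s. V (ray s (-\<beta>)) y) - calderon_const f m *\<^sub>C integral UNIV (\<lambda>s. V (ray s \<beta>) y))"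
    unfolding eq by (intro scaleC.tendsto tendsto_const tendsto_diff L) auto
  moreover have "(1 / (2 * complex_of_real pi * \<i>)) *\<^sub>C
      (calderon_const f m *\<^sub>C integral UNIV (\<lambda>s. V (ray s (-\<beta>)) y) - calderon_const f m *\<^sub>C integral UNIV (\<lambda>s. V (ray s \<beta>) y)) = calderon_const f m *\<^sub>C y"
    by (subst (3) V_contour[OF y, symmetric]) (simp add: scaleC_scaleC scaleC.diff_right mult.commute)
  ultimately show ?thesis by simp
qed

end

section \<open>Pairs of operators with commuting resolvents\<close>

text \<open>The condition \<beta> < pi - \<sigma>B puts -z into the exterior region of B for every z
  on rays of angle at most \<beta>, so that z (z + B)^-1 exists and is holomorphic inside the
  contour.\<close>

locale op_pair = op_calculus \<beta> \<omega> A \<sigma>A CA + B: outer_resolvent B \<sigma>B CB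
  for \<beta> \<omega> and A B :: "'x::complex_banach unbounded_op" and \<sigma>A CA \<sigma>B CB +
  assumes \<sigma>B: "\<beta> < pi - \<sigma>B" and comm: "resolvents_commute A B"
begin

lemma minus_ray_outer: "\<bar>a\<bar> \<le> \<beta> \<Longrightarrow> - ray s a \<in> outer \<sigma>B"
proof -
  assume a: "\<bar>a\<bar> \<le> \<beta>"
  have "cos (pi - \<sigma>B) < cos \<bar>a\<bar>" using a \<sigma>B B.\<sigma> by (intro cos_monotone_0_pi) auto
  then have "- cos a < cos \<sigma>B" by simp
  then have "exp s * - cos a < exp s * cos \<sigma>B" by (intro mult_strict_left_mono) auto
  then show ?thesis by (simp add: outer_def Re_ray mult.commute)
qed

definition Q :: "complex \<Rightarrow> 'x \<Rightarrow> 'x" where "Q z = B.P (- z)"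

lemma Q_holo: "sector_holo \<beta> Q (\<lambda>z x. - B.P' (- z) x)"
  unfolding sector_holo_def
proof (intro conjI allI ballI)
  fix x s a assume a: "a \<in> {-\<beta>..\<beta>}"
  have "(uminus has_derivative uminus) (at (ray s a))" by (auto intro!: derivative_eq_intros)
  from has_derivative_compose[OF this B.P_has_derivative[OF minus_ray_outer[of a s], of x]] a
  show "((\<lambda>z. Q z x) has_derivative (\<lambda>h. h *\<^sub>C - B.P' (- ray s a) x)) (at (ray s a))"
    by (auto simp: Q_def scaleC.minus_left scaleC.minus_right)
next
  fix x
  have rc: "continuous_on S (\<lambda>p. ray (fst p) (snd p))" for S
    using ray_continuous[of S] by (simp add: case_prod_unfold)
  show "continuous_on (UNIV \<times> {-\<beta>..\<beta>}) (\<lambda>(s,a). - B.P' (- ray s a) x)"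
    unfolding case_prod_unfold
    by (intro continuous_on_minus continuous_on_compose2[OF B.P'_continuous] rc) (auto intro!: minus_ray_outer)
next
  have "\<forall>a\<in>{-\<beta>..\<beta>}. \<forall>s x. norm (Q (ray s a) x) \<le> CB * norm x"
    unfolding Q_def by (auto intro!: B.P_bound minus_ray_outer)
  then show "\<exists>C\<ge>0. \<forall>a\<in>{-\<beta>..\<beta>}. \<forall>s x. norm (Q (ray s a) x) \<le> C * norm x"
    using B.C by blast
qed

lemma Q_admissible: "admissible \<beta> Q"
  unfolding admissible_def
proof (intro conjI ballI allI)
  fix a assume a: "a \<in> {-\<beta>,\<beta>}"
  then have a': "\<bar>a\<bar> \<le> \<beta>" using \<beta>0 by auto
  show "bounded_clin (Q (ray s a))" for s unfolding Q_def by (rule B.P_bounded_clin[OF minus_ray_outer[OF a']])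
  have rc: "continuous_on UNIV (\<lambda>s. - ray s a)"
    by (intro continuous_on_minus continuous_on_compose2[OF ray_continuous[of UNIV], of UNIV "\<lambda>s. (s, a)", unfolded prod.case]) (auto intro!: continuous_intros)
  show "continuous_on UNIV (\<lambda>s. Q (ray s a) x)" for x
    unfolding Q_def by (rule continuous_on_compose2[OF B.P_continuous rc]) (use minus_ray_outer[OF a'] in auto)
next
  have "\<forall>a\<in>{-\<beta>,\<beta>}. \<forall>s x. norm (Q (ray s a) x) \<le> CB * norm x"
    unfolding Q_def using \<beta>0 by (auto intro!: B.P_bound minus_ray_outer)
  then show "\<exists>C\<ge>0. \<forall>a\<in>{-\<beta>,\<beta>}. \<forall>s x. norm (Q (ray s a) x) \<le> C * norm x"
    using B.C by blast
qed

definition QP :: "complex \<Rightarrow> 'x \<Rightarrow> 'x" where "QP z x = Q z (A.P z x)"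

lemma QP_admissible: "admissible \<beta> QP"
  unfolding QP_def[abs_def] by (rule admissible_compose[OF Q_admissible admissible_P])

definition Psi :: "(complex \<Rightarrow> complex) \<Rightarrow> 'x \<Rightarrow> 'x" where "Psi f = cint \<beta> f QP"

lemma Psi_eta: "f \<in> H \<Longrightarrow> Psi f (eta m t x) = Psi (\<lambda>z. f z * etaf m t z) x"
  using cint_KP_eta[OF _ Q_holo Q_admissible] by (simp add: Psi_def QP_def[abs_def])

lemma A_B_commute:
  assumes "l \<in> resolvent_set A" "m \<in> resolvent_set B"
  shows "resolvent A l (resolvent B m x) = resolvent B m (resolvent A l x)"
  using comm assms by (auto simp: resolvents_commute_def)

lemma P_Q_commute:
  assumes z: "z \<in> outer \<sigma>A" and w: "- w \<in> outer \<sigma>B"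
  shows "A.P z (Q w x) = Q w (A.P z x)"
proof -
  note r = A.res[OF z] B.res[OF w]
  note c = resolvent_bounded_clin[OF r(1) A.lin] resolvent_bounded_clin[OF r(2) B.lin]
  show ?thesis
    by (simp add: Q_def A.P_def B.P_def bounded_clin_scaleC[OF c(1)] bounded_clin_scaleC[OF c(2)] scaleC_scaleC A_B_commute[OF r]
        mult.commute scaleC.minus_left bounded_clin_minus[OF c(1)] bounded_clin_minus[OF c(2)] scaleC.minus_right)
qed

lemma \<beta>_minus_ray_outer: "a \<in> {-\<beta>,\<beta>} \<Longrightarrow> - ray s a \<in> outer \<sigma>B"
  using \<beta>0 by (intro minus_ray_outer) auto

lemma QP_commute_eta:
  assumes "a \<in> {-\<beta>,\<beta>}" shows "eta m t (QP (ray s a) y) = QP (ray s a) (eta m t y)"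
proof -
  note c = admissible_bounded_clin[OF Q_admissible assms, of s]
  have J: "J t (Q (ray s a) y) = Q (ray s a) (J t y)" for y
    unfolding J_def by (rule P_Q_commute[OF ray_pi_outer \<beta>_minus_ray_outer[OF assms]])
  have "eta m t (Q (ray s a) y) = Q (ray s a) (eta m t y)" for y
  proof -
    have "Q (ray s a) y - J t (Q (ray s a) y) = Q (ray s a) (y - J t y)" by (simp only: J bounded_clin_diff[OF c])
    then show ?thesis unfolding eta_def by (simp only: commute_funpow[of "J t" "Q (ray s a)", OF J])
  qed
  then show ?thesis by (simp add: QP_def P_ray_commute_eta[OF assms])
qed

lemma Psi_commute_eta: "f \<in> H \<Longrightarrow> eta m t (Psi f y) = Psi f (eta m t y)"
  unfolding Psi_def by (rule cint_commute[OF _ QP_admissible eta_bounded_clin QP_commute_eta])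

lemma Ai_commute_P: "z \<in> outer \<sigma>A \<Longrightarrow> Ai (A.P z x) = A.P z (Ai x)"
proof -
  assume z: "z \<in> outer \<sigma>A"
  note c = resolvent_bounded_clin[OF A.res[OF z] A.lin] resolvent_bounded_clin[OF inv A.lin]
  show ?thesis
    by (simp add: Ai_def A.P_def bounded_clin_scaleC[OF c(2)] bounded_clin_minus[OF c(1)] scaleC.minus_right resolvent_commute[OF A.res[OF z] inv A.lin])
qed

lemma Ai_commute_Q: "- z \<in> outer \<sigma>B \<Longrightarrow> Ai (Q z x) = Q z (Ai x)"
proof -
  assume z: "- z \<in> outer \<sigma>B"
  note c = resolvent_bounded_clin[OF B.res[OF z] B.lin] resolvent_bounded_clin[OF inv A.lin]
  show ?thesis
    by (simp add: Ai_def Q_def B.P_def bounded_clin_scaleC[OF c(2)] bounded_clin_minus[OF c(1)] bounded_clin_minus[OF c(2)] scaleC.minus_right scaleC.minus_left A_B_commute[OF inv B.res[OF z]])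
qed

lemma Ai_commute_Phi: "f \<in> H \<Longrightarrow> Ai (Phi f x) = Phi f (Ai x)"
  by (rule cint_commute[OF _ admissible_P Ai_bounded_clin Ai_commute_P[OF \<beta>_ray_outer]])

lemma Psi_sum:
  assumes f: "f \<in> H" and u: "u \<in> op_dom A" "u \<in> op_dom B"
  shows "Psi f (op_app A u + op_app B u) = Phi f (op_app A u)"
proof -
  have "cint \<beta> f QP (op_app A u + op_app B u) = cint \<beta> f A.P (op_app A u) + cint \<beta> f Q (op_app B u)"
  proof (rule cint_split[OF f admissible_P f Q_admissible])
    fix s a assume a: "a \<in> {-\<beta>,\<beta>}"
    let ?z = "ray s a"
    note zA = \<beta>_ray_outer[OF a, of s] and zB = \<beta>_minus_ray_outer[OF a, of s]
    note cP = A.P_bounded_clin[OF zA] and cQ = admissible_bounded_clin[OF Q_admissible a, of s]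
    have PA: "A.P ?z (op_app A u) = ?z *\<^sub>C A.P ?z u - ?z *\<^sub>C u" using A.P_dom[OF zA u(1)] by simp
    have QB: "Q ?z (op_app B u) = ?z *\<^sub>C u - ?z *\<^sub>C Q ?z u"
      using B.P_dom[OF zB u(2)] by (simp add: Q_def scaleC.minus_left algebra_simps)
    have "QP ?z (op_app A u + op_app B u) = Q ?z (A.P ?z (op_app A u)) + A.P ?z (Q ?z (op_app B u))"
      by (simp add: QP_def bounded_clin_add[OF cP] bounded_clin_add[OF cQ] P_Q_commute[OF zA zB])
    \<comment> \<open>The terms z Q P u cancel; the remainder z P u - z Q u is the right-hand side,
      in which the two terms z u cancel.\<close>
    also have "\<dots> = A.P ?z (op_app A u) + Q ?z (op_app B u)"
      unfolding PA QB by (simp add: bounded_clin_diff[OF cQ] bounded_clin_diff[OF cP] bounded_clin_scaleC[OF cQ] bounded_clin_scaleC[OF cP] P_Q_commute[OF zA zB])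
    finally show "f ?z *\<^sub>C QP ?z (op_app A u + op_app B u) = f ?z *\<^sub>C A.P ?z (op_app A u) + f ?z *\<^sub>C Q ?z (op_app B u)"
      by (simp add: scaleC.add_right)
  qed
  then show ?thesis by (simp add: Psi_def cint_sector_holo[OF f Q_holo])
qed

text \<open>With v = A^-1 \<Psi> x this says (A + B) v = \<Phi> x. As B is unbounded it is not taken
  out of the integral; a bounded resolvent of B is moved through it instead, giving v = (m - B)^-1
  (m v - \<Phi> x + \<Psi> x).\<close>

lemma Psi_solves:
  assumes f: "f \<in> H"
  shows "Ai (Psi f x) \<in> op_dom B" and "op_app B (Ai (Psi f x)) = Phi f x - Psi f x"
proof -
  \<comment> \<open>m = -1, a point of the resolvent set of B.\<close>
  define m where "m = ray 0 pi"
  have mB: "m \<in> outer \<sigma>B" using B.\<sigma> \<sigma>B \<beta>0 unfolding m_def by (intro ray_in_outer) auto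
  define RB where "RB = resolvent B m"
  have RB: "bounded_clin RB" unfolding RB_def by (rule resolvent_bounded_clin[OF B.res[OF mB] B.lin])
  define v where "v = Ai (Psi f x)"
  \<comment> \<open>W1 is the integrand of v, W0 its part that is holomorphic in the sector and
    integrates to 0, and W will turn out to be (m - B) applied to W1 - W0.\<close>
  define W1 where "W1 z x = Q z (Ai (A.P z x))" for z x
  define W0 where "W0 z x = Q z (Ai x)" for z x
  define W where "W z x = m *\<^sub>C (W1 z x - W0 z x) - (A.P z x - QP z x)" for z x
  have aA: "admissible \<beta> (\<lambda>z. Ai)" by (rule admissible_const[OF Ai_bounded_clin])
  have W1a: "admissible \<beta> W1" unfolding W1_def[abs_def]
    by (rule admissible_compose[OF Q_admissible admissible_compose[OF aA admissible_P]])
  have W0a: "admissible \<beta> W0" unfolding W0_def[abs_def] by (rule admissible_compose[OF Q_admissible aA])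
  have ma: "admissible \<beta> (\<lambda>z x. m *\<^sub>C (W1 z x - W0 z x))"
    by (rule admissible_compose[OF admissible_const[OF bounded_clin_scale[OF bounded_clin_ident]] admissible_diff[OF W1a W0a]])
  have Wa: "admissible \<beta> W" unfolding W_def[abs_def]
    by (rule admissible_diff[OF ma admissible_diff[OF admissible_P QP_admissible]])
  have W0z: "cint \<beta> f W0 y = 0" for y
    unfolding W0_def[abs_def] by (rule cint_sector_holo[OF f sector_holo_apply[OF Q_holo Ai_bounded_clin]])
  have v1: "v = cint \<beta> f W1 x"
    unfolding v_def Psi_def cint_apply[OF f QP_admissible Ai_bounded_clin]
    by (rule cint_cong) (simp add: QP_def W1_def Ai_commute_Q[OF \<beta>_minus_ray_outer])
  have diff: "cint \<beta> f (\<lambda>z x. K z x - L z x) y = cint \<beta> f K y - cint \<beta> f L y" if "admissible \<beta> K" "admissible \<beta> L" for K L y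
    using cint_split[OF f admissible_diff[OF that] f that(2), of f K y y y] by (simp add: scaleC.diff_right)
  have "cint \<beta> f W x = m *\<^sub>C (cint \<beta> f W1 x - cint \<beta> f W0 x) - (Phi f x - Psi f x)"
    unfolding W_def[abs_def] diff[OF ma admissible_diff[OF admissible_P QP_admissible]] diff[OF admissible_P QP_admissible]
      cint_apply[OF f admissible_diff[OF W1a W0a] bounded_clin_scale[OF bounded_clin_ident], symmetric] diff[OF W1a W0a] Psi_def ..
  then have Wv: "cint \<beta> f W x = m *\<^sub>C v - (Phi f x - Psi f x)" by (simp add: v1 W0z)
  have "cint \<beta> f W1 x = cint \<beta> f W0 x + cint \<beta> f (\<lambda>z x. RB (W z x)) x"
  proof (rule cint_split[OF f W0a f admissible_compose[OF admissible_const[OF RB] Wa]])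
    fix s a assume a: "a \<in> {-\<beta>,\<beta>}"
    let ?z = "ray s a"
    note zA = \<beta>_ray_outer[OF a, of s] and zB = \<beta>_minus_ray_outer[OF a, of s]
    note cQ = admissible_bounded_clin[OF Q_admissible a, of s]
    let ?y = "resolvent A ?z x"
    have "?y - resolvent A 0 x = (0 - ?z) *\<^sub>C resolvent A ?z (resolvent A 0 x)"
      by (rule resolvent_identity[OF A.res[OF zA] inv A.lin])
    then have AP: "Ai (A.P ?z x) = Ai x + ?y"
      unfolding Ai_commute_P[OF zA]
      by (simp add: A.P_def Ai_def bounded_clin_minus[OF resolvent_bounded_clin[OF A.res[OF zA] A.lin]] scaleC.minus_right scaleC.minus_left algebra_simps)
    then have w: "W1 ?z x - W0 ?z x = Q ?z ?y" by (simp add: W1_def W0_def bounded_clin_add[OF cQ])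
    define r where "r = resolvent B (- ?z) ?y"
    have r: "r \<in> op_dom B" "(- ?z) *\<^sub>C r - op_app B r = ?y"
      using resolvent_right[OF B.res[OF zB]] by (auto simp: r_def)
    have Qr: "Q ?z ?y = (- ?z) *\<^sub>C r" by (simp add: Q_def B.P_def r_def)
    have Qd: "Q ?z ?y \<in> op_dom B" and "op_app B (Q ?z ?y) = (- ?z) *\<^sub>C op_app B r"
      unfolding Qr using B.lin r(1) unfolding linear_op_def csubspace_def clinear_on_def by blast+
    moreover have "op_app B r = (- ?z) *\<^sub>C r - ?y" using r(2) by (metis add_diff_cancel_left' diff_add_cancel)
    ultimately have "op_app B (Q ?z ?y) = (- ?z) *\<^sub>C (Q ?z ?y - ?y)" by (simp add: Qr)
    also have "\<dots> = A.P ?z x - QP ?z x"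
      by (simp add: A.P_def QP_def bounded_clin_scaleC[OF cQ] scaleC.diff_right scaleC.minus_left)
    finally have "m *\<^sub>C Q ?z ?y - op_app B (Q ?z ?y) = W ?z x" by (simp add: W_def w)
    then have "RB (W ?z x) = Q ?z ?y" using resolvent_left[OF B.res[OF mB] Qd] by (simp add: RB_def)
    then have "W1 ?z x = W0 ?z x + RB (W ?z x)" using w by (simp add: algebra_simps)
    then show "f ?z *\<^sub>C W1 ?z x = f ?z *\<^sub>C W0 ?z x + f ?z *\<^sub>C RB (W ?z x)" by (simp add: scaleC.add_right)
  qed
  then have "v = RB (m *\<^sub>C v - (Phi f x - Psi f x))"
    by (simp add: v1[symmetric] W0z cint_apply[OF f Wa RB, symmetric] Wv)
  then have "v \<in> op_dom B" and e: "m *\<^sub>C v - op_app B v = m *\<^sub>C v - (Phi f x - Psi f x)"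
    using resolvent_right[OF B.res[OF mB], of "m *\<^sub>C v - (Phi f x - Psi f x)"] by (simp_all add: RB_def)
  moreover have "op_app B v = m *\<^sub>C v - (m *\<^sub>C v - op_app B v)" by simp
  then have "op_app B v = Phi f x - Psi f x" unfolding e by simp
  ultimately show "Ai (Psi f x) \<in> op_dom B" "op_app B (Ai (Psi f x)) = Phi f x - Psi f x" by (simp_all add: v_def)
qed

text \<open>\<open>Psi_sum\<close> is applied to u = A^-1 \<Psi>_f x, for which (A + B) u = \<Phi>_f
  x.\<close>

lemma Phi_Psi_swap:
  assumes "f \<in> H" "g \<in> H"
  shows "Phi g (Psi f x) = Psi g (Phi f x)"
  using Psi_sum[OF assms(2) Ai_dom[of "Psi f x"] Psi_solves(1)[OF assms(1)]]
  by (simp add: A_Ai Psi_solves(2)[OF assms(1)])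

end


section \<open>Nonvanishing of the reproducing constant\<close>

text \<open>The sector is the image of a convex strip under exp.\<close>

lemma connected_sector:
  assumes "0 < \<sigma>" "\<sigma> < pi" shows "connected (sector \<sigma>)"
proof -
  have "sector \<sigma> = exp ` {w. \<bar>Im w\<bar> < \<sigma>}"
  proof
    show "sector \<sigma> \<subseteq> exp ` {w. \<bar>Im w\<bar> < \<sigma>}"
    proof
      fix z assume z: "z \<in> sector \<sigma>"
      then have "z \<noteq> 0" "\<bar>Arg z\<bar> < \<sigma>" using assms by (auto simp: sector_def)
      then have "z = exp (Ln z)" "\<bar>Im (Ln z)\<bar> < \<sigma>" by (auto simp: Arg_eq_Im_Ln)
      then show "z \<in> exp ` {w. \<bar>Im w\<bar> < \<sigma>}" by blast
    qed
    show "exp ` {w. \<bar>Im w\<bar> < \<sigma>} \<subseteq> sector \<sigma>"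
    proof
      fix z assume "z \<in> exp ` {w. \<bar>Im w\<bar> < \<sigma>}"
      then obtain w where w: "z = exp w" "\<bar>Im w\<bar> < \<sigma>" by auto
      then have "z = ray (Re w) (Im w)" by (simp add: ray_def)
      then show "z \<in> sector \<sigma>" using w assms ray_in_sector by simp
    qed
  qed
  moreover have "convex {w. \<bar>Im w\<bar> < \<sigma>}"
  proof -
    have "{w. \<bar>Im w\<bar> < \<sigma>} = {w. Im w < \<sigma>} \<inter> {w. Im w > - \<sigma>}" by auto
    then show ?thesis by (simp add: convex_Int convex_halfspace_Im_lt convex_halfspace_Im_gt)
  qed
  ultimately show ?thesis
    by (simp add: connected_continuous_image continuous_on_exp continuous_on_id convex_connected)
qed

text \<open>Orthogonality to all powers of \<open>x = 1/(1+e\<^sup>s)\<close>, which varies over \<open>(0,1)\<close>, forces a function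
  to vanish, by the Weierstrass approximation theorem.\<close>

lemma moments_zero:
  fixes g :: "real \<Rightarrow> real"
  defines "x \<equiv> \<lambda>s. 1 / (1 + exp s)"
  assumes g: "continuous_on UNIV g" "e > 0" "\<And>s. \<bar>g s\<bar> \<le> C * exp (- e * \<bar>s\<bar>)"
    and mom: "\<And>m. integral UNIV (\<lambda>s. g s * (x s ^ (m + 1) * (1 - x s))) = 0"
  shows "g s = 0"
proof -
  define w where "w s = x s * (1 - x s)" for s
  have x01: "0 < x s" "x s < 1" for s by (simp_all add: x_def add_pos_pos)
  have w01: "0 < w s" "w s \<le> 1" for s
    using x01[of s] mult_le_one[of "x s" "1 - x s"] by (auto simp: w_def)
  have xc: "continuous_on UNIV x"
    unfolding x_def by (intro continuous_intros) (metis add_pos_pos exp_gt_zero less_irrefl zero_less_one)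
  have wc: "continuous_on UNIV w" unfolding w_def by (intro continuous_intros xc)
  have C: "C \<ge> 0" using g(3)[of 0] by simp
  have gC: "\<bar>g s\<bar> \<le> C" for s
  proof -
    have "C * exp (- e * \<bar>s\<bar>) \<le> C * 1" using C g(2) by (intro mult_left_mono) auto
    then show ?thesis using g(3)[of s] by simp
  qed
  \<comment> \<open>The function w g transplanted to [0, 1] by the inverse of x. The factor y (1 -
    y) makes it extend continuously by 0 to the end points, as approximation by polynomials takes
    place on a compact interval.\<close>
  define G where "G y = y * (1 - y) * g (ln ((1 - y) / y))" for y
  have lnx: "ln ((1 - x s) / x s) = s" for s
  proof -
    have "1 + exp s > 0" by (simp add: add_pos_pos)
    then have "(1 - x s) / x s = exp s" by (simp add: x_def field_simps)
    then show ?thesis by simp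
  qed
  have Gx: "G (x s) = w s * g s" for s by (simp add: G_def w_def lnx)
  have "continuous_on {0..1} G"
    unfolding continuous_on_def
  proof
    fix y :: real assume y: "y \<in> {0..1}"
    show "(G \<longlongrightarrow> G y) (at y within {0..1})"
    proof (cases "0 < y \<and> y < 1")
      case True
      have "isCont (\<lambda>y. ln ((1 - y) / y)) y" using True by (intro continuous_intros) auto
      moreover have "isCont g (ln ((1 - y) / y))" using g(1) by (simp add: continuous_on_eq_continuous_at)
      ultimately have "isCont (\<lambda>y. g (ln ((1 - y) / y))) y" by (rule isCont_o2)
      then have "isCont G y" unfolding G_def by (intro continuous_intros)
      then show ?thesis by (simp add: isCont_def tendsto_within_subset[where S=UNIV])
    next
      case False
      \<comment> \<open>At the end points the factor y (1 - y) is 0, whatever values division and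
        \<open>ln\<close> take there, and boundedness of g gives continuity.\<close>
      then have y01: "y = 0 \<or> y = 1" using y by auto
      then have Gy: "G y = 0" by (auto simp: G_def)
      have "((\<lambda>z. \<bar>z * (1 - z)\<bar> * C) \<longlongrightarrow> \<bar>y * (1 - y)\<bar> * C) (at y within {0..1})" by (intro tendsto_intros)
      then have "((\<lambda>z. \<bar>z * (1 - z)\<bar> * C) \<longlongrightarrow> 0) (at y within {0..1})" using y01 by auto
      then show ?thesis unfolding Gy
        by (rule Lim_null_comparison[rotated]) (auto intro!: always_eventually mult_left_mono gC simp: G_def abs_mult)
    qed
  qed
  note Gc = this
  have int: "(\<lambda>s. g s * h s) integrable_on UNIV" if h: "continuous_on UNIV h" "\<And>s. \<bar>h s\<bar> \<le> D" for h D
  proof (rule exp_dec_integrable(1)[OF _ g(2), where c=0 and C="C * D"])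
    show "continuous_on UNIV (\<lambda>s. g s * h s)" by (intro continuous_intros g(1) h(1))
    fix s
    have "\<bar>g s\<bar> * \<bar>h s\<bar> \<le> (C * exp (- e * \<bar>s\<bar>)) * D" using g(3)[of s] h(2)[of s] C by (intro mult_mono) auto
    then show "norm (g s * h s) \<le> C * D * exp (- e * \<bar>s + 0\<bar>)" by (simp add: abs_mult mult_ac)
  qed
  have poly: "integral UNIV (\<lambda>s. g s * (p (x s) * w s)) = 0" if p: "real_polynomial_function p" for p
  proof -
    obtain a n where a: "p = (\<lambda>x. \<Sum>i\<le>n. a i * x ^ i)" using p by (auto simp: real_polynomial_function_iff_sum)
    have i: "(\<lambda>s. a i * (g s * (x s ^ (i + 1) * (1 - x s)))) integrable_on UNIV" for i
    proof -
      have "\<bar>x s ^ (i + 1) * (1 - x s)\<bar> \<le> 1" for s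
        using x01[of s] by (auto simp: abs_mult intro!: mult_le_one power_le_one simp del: power_Suc)
      then have "(\<lambda>s. g s * (x s ^ (i + 1) * (1 - x s))) integrable_on UNIV"
        by (intro int[where D=1]) (auto intro!: continuous_intros xc)
      then show ?thesis by (rule integrable_on_mult_right)
    qed
    have "(\<lambda>s. g s * (p (x s) * w s)) = (\<lambda>s. \<Sum>i\<le>n. a i * (g s * (x s ^ (i + 1) * (1 - x s))))"
      by (simp add: a w_def sum_distrib_left sum_distrib_right mult_ac)
    then have "integral UNIV (\<lambda>s. g s * (p (x s) * w s)) = (\<Sum>i\<le>n. integral UNIV (\<lambda>s. a i * (g s * (x s ^ (i + 1) * (1 - x s)))))"
      using integral_sum[of "{..n}" "\<lambda>i s. a i * (g s * (x s ^ (i + 1) * (1 - x s)))" UNIV] i by simp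
    also have "\<dots> = 0"
    proof (rule sum.neutral, rule ballI)
      fix i
      show "integral UNIV (\<lambda>s. a i * (g s * (x s ^ (i + 1) * (1 - x s)))) = 0"
        by (subst integral_mult_right) (use mom[of i] in auto)
    qed
    finally show ?thesis .
  qed
  \<comment> \<open>To show that g w vanishes, its square is integrated: k is g w times G(x), and
    polynomials in x are orthogonal to g w.\<close>
  define k where "k s = (g s * w s)\<^sup>2" for s
  have ki: "k integrable_on UNIV"
  proof -
    have "(\<lambda>s. g s * (g s * (w s)\<^sup>2)) integrable_on UNIV"
    proof (rule int[where D=C])
      show "continuous_on UNIV (\<lambda>s. g s * (w s)\<^sup>2)" by (intro continuous_intros g wc)
      show "\<bar>g s * (w s)\<^sup>2\<bar> \<le> C" for s
      proof -
        have "\<bar>g s\<bar> * (w s)\<^sup>2 \<le> C * 1" using gC[of s] w01[of s] C by (intro mult_mono) (auto simp: power_le_one less_imp_le)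
        then show ?thesis by (simp add: abs_mult)
      qed
    qed
    then show ?thesis by (simp add: k_def[abs_def] power2_eq_square mult_ac)
  qed
  \<comment> \<open>A polynomial uniformly close to G is subtracted, which does not change the
    integral.\<close>
  have "integral UNIV k \<le> \<epsilon>" if eps: "\<epsilon> > 0" for \<epsilon>
  proof -
    define \<delta> where "\<delta> = \<epsilon> / (C * (2 / e) + 1)"
    have d: "\<delta> > 0" using eps C g(2) by (auto simp: \<delta>_def intro!: divide_pos_pos add_nonneg_pos)
    obtain p where p: "real_polynomial_function p" "\<And>y. y \<in> {0..1} \<Longrightarrow> \<bar>G y - p y\<bar> < \<delta>"
      using Stone_Weierstrass_real_polynomial_function[OF compact_Icc Gc d] by blast
    have pc: "continuous_on UNIV (\<lambda>s. p (x s))"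
      by (rule continuous_on_compose2[OF continuous_on_polymonial_function xc])
        (use p(1) in \<open>auto simp: real_polynomial_function_eq\<close>)
    have pd: "\<bar>G (x s) - p (x s)\<bar> \<le> \<delta>" for s using p(2)[of "x s"] x01[of s] by auto
    have pb: "\<bar>p (x s) * w s\<bar> \<le> C + \<delta>" for s
    proof -
      have "\<bar>w s * g s\<bar> \<le> 1 * C" unfolding abs_mult using w01[of s] gC[of s] by (intro mult_mono) auto
      then have "\<bar>p (x s)\<bar> \<le> C + \<delta>" using pd[of s] unfolding Gx by linarith
      then have "\<bar>p (x s)\<bar> * \<bar>w s\<bar> \<le> (C + \<delta>) * 1" using w01[of s] C d by (intro mult_mono) auto
      then show ?thesis by (simp add: abs_mult)
    qed
    have pi: "(\<lambda>s. g s * (p (x s) * w s)) integrable_on UNIV"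
      by (rule int[OF _ pb]) (intro continuous_intros pc wc)
    have "integral UNIV k = integral UNIV (\<lambda>s. k s - g s * (p (x s) * w s))"
      by (subst integral_diff[OF ki pi]) (simp add: poly[OF p(1)])
    also have "\<dots> \<le> norm \<dots>" by simp
    also have "\<dots> \<le> (C * \<delta>) * (2 / e)"
    proof (rule exp_dec_integrable(2)[OF _ g(2), where c=0])
      show "continuous_on UNIV (\<lambda>s. k s - g s * (p (x s) * w s))" unfolding k_def by (intro continuous_intros g wc pc)
      fix s
      have "k s - g s * (p (x s) * w s) = g s * (w s * (G (x s) - p (x s)))"
        by (simp add: k_def Gx power2_eq_square algebra_simps)
      also have "norm \<dots> \<le> (C * exp (- e * \<bar>s\<bar>)) * (1 * \<delta>)"
        unfolding real_norm_def abs_mult using g(3)[of s] w01[of s] pd[of s] C by (intro mult_mono) auto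
      finally show "norm (k s - g s * (p (x s) * w s)) \<le> C * \<delta> * exp (- e * \<bar>s + 0\<bar>)" by (simp add: mult_ac)
    qed
    also have "\<dots> = (C * (2 / e)) * \<delta>" by simp
    also have "\<dots> \<le> (C * (2 / e) + 1) * \<delta>" using d by (intro mult_right_mono) auto
    also have "\<dots> = \<epsilon>" using C g(2) by (simp add: \<delta>_def add_nonneg_eq_0_iff)
    finally show ?thesis .
  qed
  then have k0: "integral UNIV k \<le> 0" by (metis dense_ge)
  have kc: "continuous_on UNIV k" unfolding k_def by (intro continuous_intros g wc)
  have kI: "k integrable_on {s - 1..s + 1}" by (rule integrable_continuous_real, rule continuous_on_subset[OF kc]) simp
  have "integral {s - 1..s + 1} k \<le> integral UNIV k"
    by (rule integral_subset_le[OF _ kI ki]) (auto simp: k_def)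
  moreover have "integral {s - 1..s + 1} k \<ge> 0" by (rule integral_nonneg[OF kI]) (simp add: k_def)
  ultimately have "(k has_integral 0) (cbox (s - 1) (s + 1))" using k0 kI by (simp add: has_integral_iff)
  then have "k s = 0"
  proof (rule has_integral_0_cbox_imp_0[of "s - 1" "s + 1" k, rotated 2])
    show "continuous_on (cbox (s - 1) (s + 1)) k" by (rule continuous_on_subset[OF kc]) simp
  qed (simp_all add: k_def)
  then show "g s = 0" using w01[of s] by (simp add: k_def)
qed

context op_calculus begin

text \<open>If all constants vanish, \<open>moments_zero\<close> applied to the real and imaginary
  parts makes f vanish on the positive axis, and the identity theorem extends this to the
  sector.\<close>

lemma calderon_const_nonzero:
  assumes f: "f \<in> H" and nz: "\<exists>z\<in>sector \<omega>. f z \<noteq> 0"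
  shows "\<exists>m. calderon_const f m \<noteq> 0"
proof (rule ccontr)
  assume "\<not> ?thesis"
  then have c0: "calderon_const f m = 0" for m by simp
  obtain C e where C: "C > 0" "e > 0" "\<And>s a. \<bar>a\<bar> < \<omega> \<Longrightarrow> cmod (f (ray s a)) \<le> C * exp (- e * \<bar>s\<bar>)"
    using H_infty_0_ray[OF \<omega>0 \<omega>pi f] by blast
  define x where "x s = 1 / (1 + exp s)" for s :: real
  have eta: "etaf m 0 (ray s 0) = of_real (x s ^ (m + 1) * (1 - x s))" for m s
  proof -
    have "ray s 0 = of_real (exp s)" by (simp add: ray_def exp_eq_polar)
    then show ?thesis by (simp add: etaf_def jfun_def x_def)
  qed
  have fc: "continuous_on UNIV (\<lambda>s. f (ray s 0))"
  proof -
    have "continuous_on UNIV (\<lambda>s. case (0, s) of (t, s) \<Rightarrow> f (ray (t + s) 0))"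
      by (rule continuous_on_compose2[OF H_ray_continuous[OF f]]) (use \<omega>0 in \<open>auto intro!: continuous_intros\<close>)
    then show ?thesis by simp
  qed
  have x01: "0 < x s" "x s < 1" for s by (simp_all add: x_def add_pos_pos)
  have xc: "continuous_on UNIV x"
    unfolding x_def by (intro continuous_intros) (metis add_pos_pos exp_gt_zero less_irrefl zero_less_one)
  have fb: "cmod (f (ray s 0)) \<le> C * exp (- e * \<bar>s\<bar>)" for s using C(3)[of 0 s] \<omega>0 by simp
  have int: "(\<lambda>s. f (ray s 0) * etaf m 0 (ray s 0)) integrable_on UNIV" for m
  proof (rule exp_dec_integrable(1)[OF _ C(2), of _ C 0])
    show "continuous_on UNIV (\<lambda>s. f (ray s 0) * etaf m 0 (ray s 0))" unfolding eta by (intro continuous_intros fc xc)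
    fix s
    have "\<bar>x s ^ (m + 1) * (1 - x s)\<bar> \<le> 1"
      using x01[of s] by (auto simp: abs_mult intro!: mult_le_one power_le_one simp del: power_Suc)
    then have "cmod (f (ray s 0)) * cmod (etaf m 0 (ray s 0)) \<le> (C * exp (- e * \<bar>s\<bar>)) * 1"
      unfolding eta norm_of_real using fb[of s] C by (intro mult_mono) auto
    then show "norm (f (ray s 0) * etaf m 0 (ray s 0)) \<le> C * exp (- e * \<bar>s + 0\<bar>)" by (simp add: norm_mult)
  qed
  have "Re (f (ray s 0)) = 0" for s
  proof (rule moments_zero[where g="\<lambda>s. Re (f (ray s 0))" and C=C, OF _ C(2)])
    show "continuous_on UNIV (\<lambda>s. Re (f (ray s 0)))" by (intro continuous_intros fc)
    show "\<bar>Re (f (ray s 0))\<bar> \<le> C * exp (- e * \<bar>s\<bar>)" for s using fb[of s] abs_Re_le_cmod order_trans by blast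
    show "integral UNIV (\<lambda>s. Re (f (ray s 0)) * ((1 / (1 + exp s)) ^ (m + 1) * (1 - 1 / (1 + exp s)))) = 0" for m
    proof -
      have "Re (f (ray s 0) * etaf m 0 (ray s 0)) = Re (f (ray s 0)) * ((1 / (1 + exp s)) ^ (m + 1) * (1 - 1 / (1 + exp s)))" for s
        by (simp only: eta times_complex.sel Re_complex_of_real Im_complex_of_real mult_zero_right diff_zero x_def)
      then show ?thesis using integral_linear[OF int[of m] bounded_linear_Re]
        unfolding o_def c0[of m, unfolded calderon_const_def] by simp
    qed
  qed
  moreover have "Im (f (ray s 0)) = 0" for s
  proof (rule moments_zero[where g="\<lambda>s. Im (f (ray s 0))" and C=C, OF _ C(2)])
    show "continuous_on UNIV (\<lambda>s. Im (f (ray s 0)))" by (intro continuous_intros fc)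
    show "\<bar>Im (f (ray s 0))\<bar> \<le> C * exp (- e * \<bar>s\<bar>)" for s using fb[of s] abs_Im_le_cmod order_trans by blast
    show "integral UNIV (\<lambda>s. Im (f (ray s 0)) * ((1 / (1 + exp s)) ^ (m + 1) * (1 - 1 / (1 + exp s)))) = 0" for m
    proof -
      have "Im (f (ray s 0) * etaf m 0 (ray s 0)) = Im (f (ray s 0)) * ((1 / (1 + exp s)) ^ (m + 1) * (1 - 1 / (1 + exp s)))" for s
        by (simp only: eta times_complex.sel Re_complex_of_real Im_complex_of_real mult_zero_right add_0_left x_def)
      then show ?thesis using integral_linear[OF int[of m] bounded_linear_Im]
        unfolding o_def c0[of m, unfolded calderon_const_def] by simp
    qed
  qed
  ultimately have f0: "f (ray s 0) = 0" for s by (simp add: complex_eq_iff)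
  have "f z = 0" if "z \<in> sector \<omega>" for z
  proof (rule analytic_continuation[of f "sector \<omega>" "of_real ` {0<..}" 1])
    have pos: "complex_of_real r \<in> sector \<omega>" "f (complex_of_real r) = 0" if "r > 0" for r
    proof -
      have "complex_of_real r = ray (ln r) 0" using that by (simp add: ray_def exp_eq_polar)
      then show "complex_of_real r \<in> sector \<omega>" "f (complex_of_real r) = 0"
        using f0 ray_in_sector[of 0 \<omega> "ln r"] \<omega>0 \<omega>pi by auto
    qed
    show "complex_of_real ` {0<..} \<subseteq> sector \<omega>" "1 \<in> sector \<omega>" using pos(1)[of 1] pos(1) by auto
    show "f z = 0" if "z \<in> complex_of_real ` {0<..}" for z using that pos(2) by auto
    show "1 islimpt complex_of_real ` {0<..}"
      unfolding islimpt_approachable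
    proof (intro allI impI)
      fix d :: real assume "d > 0"
      then show "\<exists>x'\<in>complex_of_real ` {0<..}. x' \<noteq> 1 \<and> dist x' 1 < d"
      proof (intro bexI[of _ "complex_of_real (1 + d / 2)"] conjI)
        show "complex_of_real (1 + d / 2) \<in> complex_of_real ` {0<..}" using \<open>d > 0\<close> by (intro imageI) auto
        have "dist (complex_of_real (1 + d / 2)) (complex_of_real 1) = \<bar>d / 2\<bar>"
          unfolding dist_of_real by (simp add: dist_real_def)
        then show "dist (complex_of_real (1 + d / 2)) 1 < d" using \<open>d > 0\<close> by simp
      qed (use \<open>d > 0\<close> in auto)
    qed
  qed (use that f \<omega>0 \<omega>pi in \<open>auto intro: H_infty_0_holo open_sector connected_sector\<close>)
  with nz show False by blast
qed

end

text \<open>The Triebel-Lizorkin norm is defined with the angle \<nu>, which need only exceed the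
  sectoriality angle, while the \<ell>^q-bounds hold at \<beta>. Between the two angles the
  integrand is holomorphic, so the rays can be rotated.\<close>

lemma (in outer_resolvent) dunford_cint:
  assumes \<omega>: "0 < \<omega>" "\<omega> < pi" and f: "f \<in> H_infty_0 \<omega>" and \<nu>: "\<sigma> < \<nu>" "\<nu> < \<omega>" and \<beta>: "\<sigma> < \<beta>" "\<beta> < \<omega>"
  shows "dunford \<nu> f A x = cint \<beta> f P x"
proof -
  obtain C' e where C': "C' > 0" "e > 0" "\<And>s a. \<bar>a\<bar> < \<omega> \<Longrightarrow> cmod (f (ray s a)) \<le> C' * exp (- e * \<bar>s\<bar>)"
    using H_infty_0_ray[OF \<omega> f] by blast
  have hol: "f holomorphic_on sector \<omega>" "deriv f holomorphic_on sector \<omega>"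
    using H_infty_0_holo[OF f] holomorphic_deriv[OF _ open_sector[OF \<omega>]] by auto
  have rc: "continuous_on S (\<lambda>p. ray (fst p) (snd p))" for S
    using ray_continuous[of S] by (simp add: case_prod_unfold)
  have rot: "integral UNIV (\<lambda>s. f (ray s a) *\<^sub>C P (ray s a) x) = integral UNIV (\<lambda>s. f (ray s b) *\<^sub>C P (ray s b) x)"
    if ab: "a \<le> b" "\<And>\<alpha>. \<alpha> \<in> {a..b} \<Longrightarrow> \<sigma> < \<bar>\<alpha>\<bar> \<and> \<bar>\<alpha>\<bar> < \<omega>" for a b
  proof (rule ray_integral_rotate[where G="\<lambda>z. f z *\<^sub>C P z x" and G'="\<lambda>z. f z *\<^sub>C P' z x + deriv f z *\<^sub>C P z x" and e=e and C="C' * (C * norm x)"])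
    fix s \<alpha> assume "\<alpha> \<in> {a..b}"
    then have al: "\<sigma> < \<bar>\<alpha>\<bar>" "\<bar>\<alpha>\<bar> < \<omega>" using ab by auto
    have o: "ray s \<alpha> \<in> outer \<sigma>" using al \<omega> \<sigma> by (intro ray_in_outer) auto
    have "(f has_derivative (\<lambda>h. deriv f (ray s \<alpha>) * h)) (at (ray s \<alpha>))"
      using holomorphic_derivI[OF hol(1) open_sector[OF \<omega>] ray_in_sector[OF al(2) \<omega>(2)]] by (simp add: has_field_derivative_def)
    from scaleC.FDERIV[OF this P_has_derivative[OF o]]
    show "((\<lambda>z. f z *\<^sub>C P z x) has_derivative (\<lambda>h. h *\<^sub>C (f (ray s \<alpha>) *\<^sub>C P' (ray s \<alpha>) x + deriv f (ray s \<alpha>) *\<^sub>C P (ray s \<alpha>) x))) (at (ray s \<alpha>))"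
      by (simp add: scaleC.add_right scaleC_scaleC mult.commute)
    have "norm (f (ray s \<alpha>) *\<^sub>C P (ray s \<alpha>) x) \<le> (C' * exp (- e * \<bar>s\<bar>)) * (C * norm x)"
      unfolding norm_scaleC using C'(3)[OF al(2), of s] C' P_bound[OF o, of x] by (intro mult_mono) auto
    then show "norm (f (ray s \<alpha>) *\<^sub>C P (ray s \<alpha>) x) \<le> C' * (C * norm x) * exp (- e * \<bar>s\<bar>)" by (simp add: mult_ac)
  next
    have sub: "(\<lambda>p. ray (fst p) (snd p)) ` (UNIV \<times> {a..b}) \<subseteq> sector \<omega>" "(\<lambda>p. ray (fst p) (snd p)) ` (UNIV \<times> {a..b}) \<subseteq> outer \<sigma>"
    proof -
      have "ray s \<alpha> \<in> sector \<omega>" "ray s \<alpha> \<in> outer \<sigma>" if "\<alpha> \<in> {a..b}" for s \<alpha>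
        using ab(2)[OF that] \<omega> \<sigma> by (intro ray_in_sector ray_in_outer; simp)+
      then show "(\<lambda>p. ray (fst p) (snd p)) ` (UNIV \<times> {a..b}) \<subseteq> sector \<omega>" "(\<lambda>p. ray (fst p) (snd p)) ` (UNIV \<times> {a..b}) \<subseteq> outer \<sigma>"
        by auto
    qed
    show "continuous_on (UNIV \<times> {a..b}) (\<lambda>(s, \<alpha>). f (ray s \<alpha>) *\<^sub>C P' (ray s \<alpha>) x + deriv f (ray s \<alpha>) *\<^sub>C P (ray s \<alpha>) x)"
      unfolding case_prod_unfold
      by (intro continuous_on_add scaleC.continuous_on
        continuous_on_compose2[OF holomorphic_on_imp_continuous_on[OF hol(1)] rc sub(1)]
        continuous_on_compose2[OF holomorphic_on_imp_continuous_on[OF hol(2)] rc sub(1)]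
        continuous_on_compose2[OF P'_continuous rc sub(2)] continuous_on_compose2[OF P_continuous rc sub(2)])
  qed (use ab C' in auto)
  have "integral UNIV (\<lambda>s. f (ray s \<nu>) *\<^sub>C P (ray s \<nu>) x) = integral UNIV (\<lambda>s. f (ray s \<beta>) *\<^sub>C P (ray s \<beta>) x)"
  proof (cases "\<nu> \<le> \<beta>")
    case True show ?thesis by (rule rot[OF True]) (use \<nu> \<beta> \<sigma> in auto)
  next
    case False show ?thesis by (rule rot[symmetric]) (use False \<nu> \<beta> \<sigma> in auto)
  qed
  moreover have "integral UNIV (\<lambda>s. f (ray s (-\<nu>)) *\<^sub>C P (ray s (-\<nu>)) x) = integral UNIV (\<lambda>s. f (ray s (-\<beta>)) *\<^sub>C P (ray s (-\<beta>)) x)"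
  proof (cases "\<nu> \<le> \<beta>")
    case True show ?thesis by (rule rot[symmetric]) (use True \<nu> \<beta> \<sigma> in auto)
  next
    case False show ?thesis by (rule rot) (use False \<nu> \<beta> \<sigma> in auto)
  qed
  moreover have "ray_integral a f A x = integral UNIV (\<lambda>s. f (ray s a) *\<^sub>C P (ray s a) x)" for a
    by (simp add: ray_integral_def ray_def Let_def P_def scaleC_scaleC)
  ultimately show ?thesis by (simp add: dunford_def cint_def)
qed

section \<open>Sums and scalar multiples in the mixed norm\<close>

context fatou_bfs begin

lemma version_add:
  assumes "version F f" "version G g"
  shows "version (\<lambda>p. F p + G p) (\<lambda>s. f s + g s)"
proof -
  have [measurable]: "F \<in> borel_measurable (lborel \<Otimes>\<^sub>M M)" "G \<in> borel_measurable (lborel \<Otimes>\<^sub>M M)"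
    using assms by (auto simp: version_def)
  have "AE s in lborel. AE w in M. F (s, w) = emb (f s) w" "AE s in lborel. AE w in M. G (s, w) = emb (g s) w"
    using assms by (auto simp: version_def)
  then have "AE s in lborel. AE w in M. F (s,w) + G (s,w) = emb (f s + g s) w"
  proof eventually_elim
    case (elim s)
    with emb_add[of "f s" "g s"] show ?case by eventually_elim simp
  qed
  then show ?thesis unfolding version_def by auto
qed

lemma bfn_LQ_scale:
  assumes F: "version F f" and bd: "bfn q (LQ q F) K" and q: "q \<ge> 1" and G: "version G (\<lambda>s. c *\<^sub>C f s)"
  shows "bfn q (LQ q G) (cmod c * K)"
proof -
  have v: "version (\<lambda>(s,w). c * F (s,w)) (\<lambda>s. c *\<^sub>C f s)" by (rule version_mult[OF F]) simp
  have "bfn q (LQ q (\<lambda>(s,w). c * F (s,w))) (cmod c * K)"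
  proof (rule bfn_mono[OF bfn_scale[OF bd norm_ge_zero[of c]] _ order_refl], rule AE_I2)
    fix w assume [measurable]: "w \<in> space M"
    have [measurable]: "F \<in> borel_measurable (lborel \<Otimes>\<^sub>M M)" using F by (rule version_measurable)
    have "LQ q (\<lambda>(s,w). c * F (s,w)) w = (\<integral>\<^sup>+s. ennreal (cmod c powr q) * ennreal (cmod (F (s, w)) powr q) \<partial>lborel)"
      by (intro nn_integral_cong) (simp add: norm_mult powr_mult ennreal_mult)
    also have "\<dots> = ennreal (cmod c powr q) * LQ q F w" by (rule nn_integral_cmult) measurable
    finally show "LQ q (\<lambda>(s,w). c * F (s,w)) w \<le> ennreal (cmod c powr q) * LQ q F w" by simp
  qed
  then show ?thesis by (rule bfn_LQ_cong[OF v G])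
qed

text \<open>The factor 2 comes from |a + b| <= 2 max(|a|, |b|); only boundedness matters later, not
  the constant.\<close>

lemma bfn_LQ_add:
  assumes F: "version F f" and bF: "bfn q (LQ q F) K" and G: "version G g" and bG: "bfn q (LQ q G) L" and q: "q \<ge> 1"
    and D: "version D (\<lambda>s. f s + g s)"
  shows "bfn q (LQ q D) (2 * (K + L))"
proof -
  have "bfn q (LQ q (\<lambda>p. F p + G p)) (2 * (K + L))"
  proof (rule bfn_mono[OF bfn_scale[OF bfn_add[OF bF bG q], of 2] _ order_refl], simp, rule AE_I2)
    fix w assume [measurable]: "w \<in> space M"
    have [measurable]: "F \<in> borel_measurable (lborel \<Otimes>\<^sub>M M)" "G \<in> borel_measurable (lborel \<Otimes>\<^sub>M M)"
      using F G by (auto simp: version_def)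
    have pt: "cmod (a + b) powr q \<le> 2 powr q * (cmod a powr q + cmod b powr q)" for a b :: complex
    proof -
      have "cmod (a + b) \<le> 2 * max (cmod a) (cmod b)" using norm_triangle_ineq[of a b] by linarith
      then have "cmod (a + b) powr q \<le> (2 * max (cmod a) (cmod b)) powr q" using q by (intro powr_mono2) auto
      also have "\<dots> = 2 powr q * max (cmod a) (cmod b) powr q" by (simp add: powr_mult)
      also have "max (cmod a) (cmod b) powr q \<le> cmod a powr q + cmod b powr q" by (auto simp: max_def)
      finally show ?thesis by (simp add: mult_left_mono)
    qed
    have "LQ q (\<lambda>p. F p + G p) w \<le> (\<integral>\<^sup>+s. ennreal (2 powr q) * (ennreal (cmod (F (s, w)) powr q) + ennreal (cmod (G (s, w)) powr q)) \<partial>lborel)"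
    proof (rule nn_integral_mono)
      fix s
      have "ennreal (cmod (F (s, w) + G (s, w)) powr q) \<le> ennreal (2 powr q * (cmod (F (s, w)) powr q + cmod (G (s, w)) powr q))"
        by (rule ennreal_leI[OF pt])
      then show "ennreal (cmod (F (s, w) + G (s, w)) powr q) \<le> ennreal (2 powr q) * (ennreal (cmod (F (s, w)) powr q) + ennreal (cmod (G (s, w)) powr q))"
        by (simp add: ennreal_mult ennreal_plus)
    qed
    also have "\<dots> = ennreal (2 powr q) * (LQ q F w + LQ q G w)"
      by (subst nn_integral_cmult) (auto simp: nn_integral_add)
    finally show "LQ q (\<lambda>p. F p + G p) w \<le> ennreal (2 powr q) * (LQ q F w + LQ q G w)" .
  qed
  then show ?thesis by (rule bfn_LQ_cong[OF version_add[OF F G] D])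
qed

lemma bfn_LQ_diff:
  assumes F: "version F f" and bF: "bfn q (LQ q F) K" and G: "version G g" and bG: "bfn q (LQ q G) L" and q: "q \<ge> 1"
    and D: "version D (\<lambda>s. f s - g s)"
  shows "bfn q (LQ q D) (2 * (K + L))"
proof -
  have v: "version (\<lambda>(s,w). (-1) * G (s,w)) (\<lambda>s. (-1) *\<^sub>C g s)" by (rule version_mult[OF G]) simp
  have "bfn q (LQ q (\<lambda>(s,w). (-1) * G (s,w))) L" using bfn_LQ_scale[OF G bG q v] by simp
  then show ?thesis using D by (intro bfn_LQ_add[OF F bF v _ q]) (auto simp: scaleC.minus_left)
qed

end


section \<open>Estimates in the Triebel-Lizorkin norm\<close>

lemma continuous_shift:
  fixes k :: "real \<Rightarrow> 'b::topological_space"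
  assumes "continuous_on UNIV k"
  shows "continuous_on UNIV (\<lambda>(t,s). k (s + t))"
  unfolding case_prod_unfold
  by (rule continuous_on_compose2[OF assms, of UNIV "\<lambda>p. snd p + fst p"]) (auto intro!: continuous_intros)

lemma exp_neg_tendsto_0: "e > 0 \<Longrightarrow> (\<lambda>n::nat. K * exp (- e * real n)) \<longlonglongrightarrow> 0"
  using exp_neg_half_tendsto_0[of "2 * e" K] by simp

lemma exp_shift_bound:
  fixes e s t k :: real
  assumes "e > 0" "\<bar>t\<bar> \<le> k"
  shows "exp (- e * \<bar>s + t\<bar>) \<le> exp (e * k) * exp (- e * \<bar>s\<bar>)"
proof -
  have "\<bar>s\<bar> \<le> \<bar>s + t\<bar> + k" using assms by linarith
  then have "e * \<bar>s\<bar> \<le> e * (\<bar>s + t\<bar> + k)" using assms by (intro mult_left_mono) auto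
  then show ?thesis by (simp add: exp_add[symmetric] algebra_simps)
qed

context fatou_bfs begin

lemma bfn_convolution':
  assumes k: "continuous_on UNIV k" "C > 0" "e > 0" "\<And>v. cmod (k v) \<le> C * exp (- e * \<bar>v\<bar>)"
    and h: "continuous_on UNIV h" "version Hv h" and q: "q \<ge> 1" and bd: "bfn q (LQ q Hv) K" and n: "n \<ge> 0"
    and G: "version G (\<lambda>t. integral {- n..n} (\<lambda>s. k (s + t) *\<^sub>C h s))"
  shows "bfn q (LQ q G) (C * (2 / e) * K)"
  by (rule bfn_convolution[OF h q k(3,2) continuous_shift[OF k(1)] k(4) bd n G])

text \<open>Boundedness of h makes the tails of the convolution small locally uniformly in t, so the
  estimate for truncated convolutions passes to the limit.\<close>

lemma bfn_convolution_UNIV: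
  assumes k: "continuous_on UNIV k" "C > 0" "e > 0" "\<And>v. cmod (k v) \<le> C * exp (- e * \<bar>v\<bar>)"
    and h: "continuous_on UNIV h" "version Hv h" "\<And>s. norm (h s) \<le> B" and q: "q \<ge> 1" and bd: "bfn q (LQ q Hv) K"
    and G: "version G (\<lambda>t. integral UNIV (\<lambda>s. k (s + t) *\<^sub>C h s))"
  shows "bfn q (LQ q G) (C * (2 / e) * K)"
proof -
  have B: "B \<ge> 0" using h(3)[of 0] by (meson norm_ge_zero order_trans)
  have gc: "continuous_on UNIV (\<lambda>(t,s). k (s + t) *\<^sub>C h s)"
  proof -
    have "continuous_on UNIV (\<lambda>p::real\<times>real. h (snd p))" by (rule continuous_on_compose2[OF h(1)]) (auto intro!: continuous_intros)
    then show ?thesis using continuous_shift[OF k(1)] unfolding case_prod_unfold by (intro scaleC.continuous_on)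
  qed
  have ex: "\<exists>Gn. version Gn (\<lambda>t. integral {- real n..real n} (\<lambda>s. k (s + t) *\<^sub>C h s))" for n :: nat
    using version_exists[OF integral_param_continuous[OF gc, of UNIV]] by metis
  then obtain Gn where Gn: "\<And>n::nat. version (Gn n) (\<lambda>t. integral {- real n..real n} (\<lambda>s. k (s + t) *\<^sub>C h s))" by metis
  show ?thesis
  proof (rule bfn_LQ_locally_uniform[OF Gn G])
    show "bfn q (LQ q (Gn n)) (C * (2 / e) * K)" for n
      by (rule bfn_convolution'[OF k h(1,2) q bd _ Gn]) simp
    show "\<exists>n. \<forall>s. \<bar>s\<bar> \<le> real j \<longrightarrow> norm (integral {- real n..real n} (\<lambda>sa. k (sa + s) *\<^sub>C h sa) - integral UNIV (\<lambda>sa. k (sa + s) *\<^sub>C h sa)) \<le> \<epsilon>"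
      if eps: "\<epsilon> > 0" for j :: nat and \<epsilon>
    proof -
      define D where "D = C * exp (e * real j) * B"
      have "\<forall>\<^sub>F n in sequentially. 4 * D / e * exp (- e * real n / 2) < \<epsilon>"
        using exp_neg_half_tendsto_0[OF k(3), of "4 * D / e"] eps by (rule order_tendstoD)
      then obtain n where n: "4 * D / e * exp (- e * real n / 2) < \<epsilon>" by (auto simp: eventually_sequentially)
      show ?thesis
      proof (intro exI[of _ n] allI impI)
        fix t :: real assume t: "\<bar>t\<bar> \<le> real j"
        have "norm (integral UNIV (\<lambda>s. k (s + t) *\<^sub>C h s) - integral {- real n..real n} (\<lambda>s. k (s + t) *\<^sub>C h s)) \<le> 4 * D / e * exp (- e * real n / 2)"
        proof (rule exp_dec_tail[OF _ k(3)])
          show "continuous_on UNIV (\<lambda>s. k (s + t) *\<^sub>C h s)"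
            by (rule continuous_on_compose2[OF gc, of UNIV "\<lambda>s. (t,s)", unfolded prod.case]) (auto intro!: continuous_intros)
          fix s
          have "cmod (k (s + t)) \<le> C * (exp (e * real j) * exp (- e * \<bar>s\<bar>))"
            using k(4)[of "s + t"] mult_left_mono[OF exp_shift_bound[OF k(3) t, of s], of C] k(2) by linarith
          then have "cmod (k (s + t)) * norm (h s) \<le> C * (exp (e * real j) * exp (- e * \<bar>s\<bar>)) * B"
            using h(3)[of s] k(2) by (intro mult_mono) auto
          then show "norm (k (s + t) *\<^sub>C h s) \<le> D * exp (- e * \<bar>s\<bar>)" by (simp add: norm_scaleC D_def mult_ac)
        qed auto
        then show "norm (integral {- real n..real n} (\<lambda>sa. k (sa + t) *\<^sub>C h sa) - integral UNIV (\<lambda>sa. k (sa + t) *\<^sub>C h sa)) \<le> \<epsilon>"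
          using n by (simp add: norm_minus_commute)
      qed
    qed
  qed (use q in auto)
qed

end

text \<open>TA and TB stand for the \<ell>^q-bounded families of the two operators at one angle;
  only their members on the contour, and J, are named. The exponent m is one whose Calderon constant
  is nonzero.\<close>

locale tl_pair = op_pair \<beta> \<omega> A B \<sigma>A CA \<sigma>B CB + fatou_bfs M emb
  for \<beta> \<omega> and A B :: "'x::complex_banach unbounded_op" and \<sigma>A CA \<sigma>B CB and M :: "'a measure" and emb :: "'x \<Rightarrow> 'a \<Rightarrow> complex" +
  fixes q \<theta> :: real and \<phi> :: "complex \<Rightarrow> complex" and TA TB :: "('x \<Rightarrow> 'x) set" and m :: nat
  assumes q: "q \<ge> 1" and \<theta>: "0 < \<theta>" "\<theta> < 1" and \<phi>: "\<phi> \<in> H"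
    and \<phi>\<theta>: "(\<lambda>z. z powr (- complex_of_real \<theta>) * \<phi> z) \<in> H"
    and ellqA: "ellq_bounded M emb q TA" and ellqB: "ellq_bounded M emb q TB"
    and TA_P: "a \<in> {-\<beta>,\<beta>} \<Longrightarrow> A.P (ray s a) \<in> TA" and TA_J: "J t \<in> TA" and TB_Q: "a \<in> {-\<beta>,\<beta>} \<Longrightarrow> Q (ray s a) \<in> TB"
    and calderon_const: "calderon_const \<phi> m \<noteq> 0"
begin

lemma q0: "q > 0" using q by simp

definition Phi_at :: "'x \<Rightarrow> real \<Rightarrow> 'x" where "Phi_at y t = Phi (dil \<phi> t) y"
definition Psi_at :: "'x \<Rightarrow> real \<Rightarrow> 'x" where "Psi_at y t = Psi (dil \<phi> t) y"
text \<open>The mixed norm of this curve is the Triebel-Lizorkin norm of y.\<close>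

definition wPhi :: "'x \<Rightarrow> real \<Rightarrow> 'x" where "wPhi y t = exp (- \<theta> * t) *\<^sub>R Phi_at y t"
definition wPsi :: "'x \<Rightarrow> real \<Rightarrow> 'x" where "wPsi y t = exp (- \<theta> * t) *\<^sub>R Psi_at y t"

lemma Phi_at_continuous: "continuous_on UNIV (Phi_at y)"
  unfolding Phi_at_def[abs_def] by (rule cint_continuous[OF \<phi> admissible_P])

lemma Psi_at_continuous: "continuous_on UNIV (Psi_at y)"
  unfolding Psi_at_def[abs_def] Psi_def by (rule cint_continuous[OF \<phi> QP_admissible])

lemma wPhi_continuous: "continuous_on UNIV (wPhi y)"
  unfolding wPhi_def by (intro continuous_intros Phi_at_continuous)

lemma wPsi_continuous: "continuous_on UNIV (wPsi y)"
  unfolding wPsi_def by (intro continuous_intros Psi_at_continuous)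

subsection \<open>Kernels\<close>

text \<open>The weight is distributed as e^(-\<theta> \<tau>) = e^(-\<theta> (s + \<tau>))
  e^(\<theta> (t + s)) e^(-\<theta> t): the first factor goes into \<open>ka\<close>, the second
  into \<open>kb\<close>, the third into \<open>wPhi\<close>.\<close>

definition ka :: "real \<Rightarrow> real \<Rightarrow> complex" where "ka a v = of_real (exp (- \<theta> * v)) * \<phi> (ray v a)"
definition kb :: "real \<Rightarrow> real \<Rightarrow> complex" where "kb a v = of_real (exp (\<theta> * v)) * etaf m 0 (ray v a)"

lemma hol_ray_continuous:
  assumes "f holomorphic_on sector \<omega>" "a \<in> {-\<beta>,\<beta>}"
  shows "continuous_on UNIV (\<lambda>s. f (ray s a))"
proof -
  have rc: "continuous_on UNIV (\<lambda>s. ray s a)"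
    by (rule continuous_on_compose2[OF ray_continuous[of UNIV], of UNIV "\<lambda>s. (s, a)", unfolded prod.case]) (auto intro!: continuous_intros)
  show ?thesis
    by (rule continuous_on_compose2[OF holomorphic_on_imp_continuous_on[OF assms(1)] rc])
      (use assms(2) \<beta>0 \<beta>\<omega> \<omega>pi in \<open>auto intro!: ray_in_sector\<close>)
qed

lemma etaf_holo: "etaf m t holomorphic_on sector \<omega>"
  unfolding etaf_def[abs_def] by (intro holomorphic_intros jfun_holo)

lemma ka_continuous: "a \<in> {-\<beta>,\<beta>} \<Longrightarrow> continuous_on UNIV (ka a)"
  unfolding ka_def[abs_def] by (intro continuous_intros hol_ray_continuous H_infty_0_holo[OF \<phi>]) auto

lemma kb_continuous: "a \<in> {-\<beta>,\<beta>} \<Longrightarrow> continuous_on UNIV (kb a)"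
  unfolding kb_def[abs_def] by (intro continuous_intros hol_ray_continuous etaf_holo) auto

lemma ka_bound:
  obtains C e where "C > 0" "e > 0" "\<And>a v. a \<in> {-\<beta>,\<beta>} \<Longrightarrow> cmod (ka a v) \<le> C * exp (- e * \<bar>v\<bar>)"
proof -
  obtain C e where C: "C > 0" "e > 0"
    "\<And>s a. \<bar>a\<bar> < \<omega> \<Longrightarrow> cmod (ray s a powr (- complex_of_real \<theta>) * \<phi> (ray s a)) \<le> C * exp (- e * \<bar>s\<bar>)"
    using H_infty_0_ray[OF \<omega>0 \<omega>pi \<phi>\<theta>] by blast
  have "cmod (ka a v) \<le> C * exp (- e * \<bar>v\<bar>)" if a: "a \<in> {-\<beta>,\<beta>}" for a v
  proof -
    \<comment> \<open>The angle is in the range of the principal logarithm, so z^(-\<theta>) has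
      modulus e^(-\<theta> v) on the ray, and the hypothesis on z^(-\<theta>) \<phi>(z) bounds the
      kernel.\<close>
    have "- pi < a" "a \<le> pi" using a \<beta>0 \<beta>pi by auto
    then have "Ln (ray v a) = Complex v a" unfolding ray_def by (intro Ln_exp) auto
    then have "cmod (ray v a powr (- complex_of_real \<theta>)) = exp (- \<theta> * v)" by (simp add: powr_def)
    then have "cmod (ka a v) = cmod (ray v a powr (- complex_of_real \<theta>) * \<phi> (ray v a))" by (simp add: ka_def norm_mult)
    also have "\<dots> \<le> C * exp (- e * \<bar>v\<bar>)" using a \<beta>0 \<beta>\<omega> by (intro C(3)) auto
    finally show ?thesis .
  qed
  with C that show ?thesis by blast
qed

text \<open>With j = 1/(1 + z), the product j (1 - j) is of order |z| at 0 and 1/|z| at infinity,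
  and the remaining m factors j are bounded. In the sector |j| and |1 - j| are at most
  1/cos(\<omega>/2).\<close>

lemma etaf_ray_bound:
  obtains D where "D > 0" "\<And>a v. a \<in> {-\<beta>,\<beta>} \<Longrightarrow> cmod (etaf m 0 (ray v a)) \<le> D"
    "\<And>a v. a \<in> {-\<beta>,\<beta>} \<Longrightarrow> cmod (etaf m 0 (ray v a)) \<le> D * exp (- \<bar>v\<bar>)"
proof -
  define c where "c = 1 / cos (\<omega>/2)"
  have c: "c > 0" using cos_half_pos[OF \<omega>0 \<omega>pi] by (simp add: c_def)
  have main: "cmod (etaf m 0 (ray v a)) \<le> c ^ (m + 2) * exp (- \<bar>v\<bar>)" if a: "a \<in> {-\<beta>,\<beta>}" for a v
  proof -
    let ?z = "ray v a"
    have zs: "?z \<in> sector \<omega>" using a \<beta>0 \<beta>\<omega> \<omega>pi by (intro ray_in_sector) auto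
    have j: "cmod (jfun 0 ?z) \<le> c" "cmod (1 - jfun 0 ?z) \<le> c" using jfun_bound(1,2)[OF zs, of 0] by (auto simp: c_def)
    have "1 + ?z \<noteq> 0" using jfun_bound(3)[OF zs, of 0] by simp
    then have e: "1 - jfun 0 ?z = jfun 0 ?z * ?z" by (simp add: jfun_def field_simps)
    have p: "cmod (jfun 0 ?z) ^ m \<le> c ^ m" by (intro power_mono j) auto
    have ex: "cmod (jfun 0 ?z) * cmod (1 - jfun 0 ?z) \<le> c * c * exp (- \<bar>v\<bar>)"
    proof (cases "v \<ge> 0")
      case True
      have "cmod (jfun 0 ?z) * exp v \<le> c" using j(2) by (simp add: e norm_mult)
      then have "cmod (jfun 0 ?z) \<le> c * exp (- v)" by (simp add: exp_minus field_simps)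
      then have "cmod (jfun 0 ?z) * cmod (1 - jfun 0 ?z) \<le> (c * exp (- v)) * c" using j c by (intro mult_mono) auto
      then show ?thesis using True by (simp add: mult_ac)
    next
      case False
      have "cmod (1 - jfun 0 ?z) \<le> c * exp v" unfolding e norm_mult using j by (simp add: mult_right_mono)
      then have "cmod (jfun 0 ?z) * cmod (1 - jfun 0 ?z) \<le> c * (c * exp v)" using j c by (intro mult_mono) auto
      then show ?thesis using False by (simp add: mult_ac)
    qed
    have "cmod (etaf m 0 ?z) = cmod (jfun 0 ?z) ^ m * (cmod (jfun 0 ?z) * cmod (1 - jfun 0 ?z))"
      by (simp add: etaf_def norm_mult norm_power mult_ac)
    also have "\<dots> \<le> c ^ m * (c * c * exp (- \<bar>v\<bar>))" by (rule mult_mono[OF p ex]) (use c in auto)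
    finally show ?thesis by (simp add: power2_eq_square power_add mult_ac)
  qed
  show ?thesis
  proof (rule that[of "c ^ (m + 2)"])
    show "cmod (etaf m 0 (ray v a)) \<le> c ^ (m + 2)" if "a \<in> {-\<beta>,\<beta>}" for a v
    proof -
      have "c ^ (m + 2) * exp (- \<bar>v\<bar>) \<le> c ^ (m + 2) * 1" using c by (intro mult_left_mono) auto
      then show ?thesis using main[OF that, of v] by simp
    qed
  qed (use c main in auto)
qed

text \<open>The decay of \<eta> has exponent 1 at both ends and beats the weight e^(\<theta> v),
  because 0 < \<theta> < 1.\<close>

lemma kb_bound:
  obtains C e where "C > 0" "e > 0" "\<And>a v. a \<in> {-\<beta>,\<beta>} \<Longrightarrow> cmod (kb a v) \<le> C * exp (- e * \<bar>v\<bar>)"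
proof -
  obtain D where D: "D > 0" "\<And>a v. a \<in> {-\<beta>,\<beta>} \<Longrightarrow> cmod (etaf m 0 (ray v a)) \<le> D * exp (- \<bar>v\<bar>)"
    using etaf_ray_bound by metis
  have "cmod (kb a v) \<le> D * exp (- (1 - \<theta>) * \<bar>v\<bar>)" if a: "a \<in> {-\<beta>,\<beta>}" for a v
  proof -
    have "cmod (kb a v) \<le> exp (\<theta> * v) * (D * exp (- \<bar>v\<bar>))"
      unfolding kb_def norm_mult using D(2)[OF a, of v] by simp
    also have "\<dots> \<le> exp (\<theta> * \<bar>v\<bar>) * (D * exp (- \<bar>v\<bar>))" using \<theta> D by (intro mult_right_mono) auto
    also have "\<dots> = D * exp (- (1 - \<theta>) * \<bar>v\<bar>)" by (simp add: exp_add[symmetric] algebra_simps)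
    finally show ?thesis .
  qed
  with D \<theta> that[of D "1 - \<theta>"] show ?thesis by auto
qed

subsection \<open>The operators \<open>eta\<close> as an \<open>\<ell>\<^sup>q\<close>-bounded family\<close>

lemma J_continuous: "continuous_on UNIV (\<lambda>t. J t x)"
proof -
  have rc: "continuous_on UNIV (\<lambda>t. ray (- t) pi)"
    by (rule continuous_on_compose2[OF ray_continuous[of UNIV], of UNIV "\<lambda>t. (- t, pi)", unfolded prod.case]) (auto intro!: continuous_intros)
  show ?thesis unfolding J_def by (rule continuous_on_compose2[OF A.P_continuous rc]) (use ray_pi_outer in auto)
qed

lemma J_bound: "norm (J t x) \<le> CA * norm x"
  unfolding J_def by (rule A.P_bound[OF ray_pi_outer])

lemma J_apply_continuous:
  assumes "continuous_on UNIV h" shows "continuous_on UNIV (\<lambda>t. J t (h t))"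
proof -
  have c: "continuous_on UNIV (\<lambda>(t,s). J t (h s))"
    by (rule strong_continuous_apply[OF bounded_clin_bounded_linear[OF J_bounded_clin] J_bound J_continuous assms])
  show ?thesis by (rule continuous_on_compose2[OF c, of UNIV "\<lambda>s. (s,s)", unfolded prod.case]) (auto intro!: continuous_intros)
qed

lemma J_pow_continuous: "continuous_on UNIV h \<Longrightarrow> continuous_on UNIV (\<lambda>t. (J t ^^ k) (h t))"
  by (induction k) (auto intro: J_apply_continuous)

lemma eta_apply_continuous: "continuous_on UNIV h \<Longrightarrow> continuous_on UNIV (\<lambda>t. eta m t (h t))"
  unfolding eta_def by (intro J_pow_continuous continuous_on_diff J_apply_continuous)

text \<open>The operator \<open>eta\<close> is \<open>e\<^sup>-\<^sup>t A\<^sup>-\<^sup>1\<close> times this one, which gives its decay for \<open>t \<rightarrow> \<infinity>\<close>.\<close>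

definition eta2 :: "real \<Rightarrow> 'x \<Rightarrow> 'x" where
  "eta2 t x = (J t ^^ m) ((x - J t x) - J t (x - J t x))"

text \<open>From e^t A J = 1 - J: a factor e^-t is bought with one A^-1.\<close>

lemma J_Ai: "J t x = exp (- t) *\<^sub>R Ai (x - J t x)"
proof -
  let ?z = "ray (- t) pi"
  let ?r = "resolvent A ?z x"
  have r: "?r \<in> op_dom A" "?z *\<^sub>C ?r - op_app A ?r = x" using resolvent_right[OF A.res[OF ray_pi_outer]] by auto
  have "x - J t x = - op_app A ?r" using r(2) by (simp add: J_def A.P_def algebra_simps)
  then have "Ai (x - J t x) = - ?r" using Ai_A[OF r(1)] by (simp add: bounded_clin_minus[OF Ai_bounded_clin])
  then have "exp (- t) *\<^sub>R Ai (x - J t x) = ?z *\<^sub>C ?r"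
    unfolding ray_pi by (simp add: scaleC.minus_left scaleC_of_real)
  then show ?thesis by (simp add: J_def A.P_def)
qed

lemma Ai_J: "Ai (J t x) = J t (Ai x)"
  unfolding J_def by (rule Ai_commute_P[OF ray_pi_outer])

lemma eta_eta2: "eta m t x = exp (- t) *\<^sub>R Ai (eta2 t x)"
proof -
  have "eta m t x = (J t ^^ m) (J t (x - J t x))" unfolding eta_def by (simp add: funpow_swap1)
  also have "\<dots> = (J t ^^ m) (exp (- t) *\<^sub>R Ai ((x - J t x) - J t (x - J t x)))" by (subst J_Ai[of t "x - J t x"]) simp
  also have "\<dots> = exp (- t) *\<^sub>R (J t ^^ m) (Ai ((x - J t x) - J t (x - J t x)))"
    by (rule linear_cmul[OF bounded_linear.linear[OF bounded_clin_bounded_linear[OF funpow_bounded_clin[OF J_bounded_clin]]]])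
  also have "(J t ^^ m) (Ai ((x - J t x) - J t (x - J t x))) = Ai (eta2 t x)"
    unfolding eta2_def by (rule commute_funpow) (simp add: Ai_J)
  finally show ?thesis .
qed

lemma Ai_eta: "Ai (eta m t x) = eta m t (Ai x)"
proof -
  have "Ai x - J t (Ai x) = Ai (x - J t x)" by (simp add: bounded_clin_diff[OF Ai_bounded_clin] Ai_J)
  then show ?thesis unfolding eta_def by (simp only: commute_funpow[of "J t" Ai, OF Ai_J[symmetric]])
qed

lemma eta2_apply_continuous: "continuous_on UNIV h \<Longrightarrow> continuous_on UNIV (\<lambda>t. eta2 t (h t))"
  unfolding eta2_def by (intro J_pow_continuous continuous_on_diff J_apply_continuous)

text \<open>Both operators are products of factors J and 1 - J, and every J t belongs to the
  \<ell>^q-bounded set TA, so the mixed norm is controlled factor by factor.\<close>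

lemma eta_bfn:
  obtains C where "C > 0"
    "\<And>h Hv K G. continuous_on UNIV h \<Longrightarrow> version Hv h \<Longrightarrow> bfn q (LQ q Hv) K \<Longrightarrow> version G (\<lambda>t. eta m t (h t)) \<Longrightarrow> bfn q (LQ q G) (C * K)"
    "\<And>h Hv K G. continuous_on UNIV h \<Longrightarrow> version Hv h \<Longrightarrow> bfn q (LQ q Hv) K \<Longrightarrow> version G (\<lambda>t. eta2 t (h t)) \<Longrightarrow> bfn q (LQ q G) (C * K)"
proof -
  obtain C where C: "C > 0"
    "\<And>S f F G K. (\<And>t. S t \<in> TA) \<Longrightarrow> (\<And>x. continuous_on UNIV (\<lambda>t::real. S t x)) \<Longrightarrow> continuous_on UNIV f \<Longrightarrow>
        version F f \<Longrightarrow> bfn q (LQ q F) K \<Longrightarrow> version G (\<lambda>t. S t (f t)) \<Longrightarrow> bfn q (LQ q G) (C * K)"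
    using ellq_bounded_family[OF ellqA q] by blast
  have J: "bfn q (LQ q G) (C * K)" if "continuous_on UNIV h" "version Hv h" "bfn q (LQ q Hv) K" "version G (\<lambda>t. J t (h t))" for h Hv G K
    by (rule C(2)[of J, OF TA_J J_continuous that])
  have D: "bfn q (LQ q G) (2 * (1 + C) * K)" if h: "continuous_on UNIV h" "version Hv h" "bfn q (LQ q Hv) K" "version G (\<lambda>t. h t - J t (h t))" for h Hv G K
  proof -
    obtain G1 where G1: "version G1 (\<lambda>t. J t (h t))" using version_exists[OF J_apply_continuous[OF h(1)]] by metis
    have "bfn q (LQ q G) (2 * (K + C * K))" by (rule bfn_LQ_diff[OF h(2,3) G1 J[OF h(1-3) G1] q h(4)])
    then show ?thesis by (simp add: algebra_simps)
  qed
  have P: "bfn q (LQ q G) (C ^ k * K)" if h: "continuous_on UNIV h" "version Hv h" "bfn q (LQ q Hv) K" "version G (\<lambda>t. (J t ^^ k) (h t))" for h Hv G K k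
    using h(4)
  proof (induction k arbitrary: G)
    case 0
    then show ?case using bfn_LQ_cong[OF h(2) _ h(3)] by simp
  next
    case (Suc k)
    obtain G1 where G1: "version G1 (\<lambda>t. (J t ^^ k) (h t))" using version_exists[OF J_pow_continuous[OF h(1)]] by metis
    have "bfn q (LQ q G) (C * (C ^ k * K))"
      by (rule J[OF J_pow_continuous[OF h(1)] G1 Suc.IH[OF G1]]) (use Suc.prems in simp)
    then show ?case by (simp add: mult_ac)
  qed
  \<comment> \<open>One factor C for each J and one factor 2 (1 + C) for each 1 - J.\<close>
  define C1 where "C1 = C ^ (m + 1) * (2 * (1 + C))"
  define C2 where "C2 = C ^ m * (2 * (1 + C) * (2 * (1 + C)))"
  have C12: "C1 > 0" "C2 > 0" using C(1) by (auto simp: C1_def C2_def)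
  have e1: "bfn q (LQ q G) (C1 * K)" if h: "continuous_on UNIV h" "version Hv h" "bfn q (LQ q Hv) K" "version G (\<lambda>t. eta m t (h t))" for h Hv G K
  proof -
    have c1: "continuous_on UNIV (\<lambda>t. h t - J t (h t))" by (intro continuous_on_diff J_apply_continuous h)
    obtain G1 where G1: "version G1 (\<lambda>t. h t - J t (h t))" using version_exists[OF c1] by metis
    have "bfn q (LQ q G) (C ^ (m + 1) * (2 * (1 + C) * K))"
      by (rule P[OF c1 G1 D[OF h(1-3) G1]]) (use h(4) in \<open>simp only: eta_def\<close>)
    then show ?thesis by (simp add: C1_def mult.assoc)
  qed
  have e2: "bfn q (LQ q G) (C2 * K)" if h: "continuous_on UNIV h" "version Hv h" "bfn q (LQ q Hv) K" "version G (\<lambda>t. eta2 t (h t))" for h Hv G K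
  proof -
    have c1: "continuous_on UNIV (\<lambda>t. h t - J t (h t))" by (intro continuous_on_diff J_apply_continuous h)
    obtain G1 where G1: "version G1 (\<lambda>t. h t - J t (h t))" using version_exists[OF c1] by metis
    have c2: "continuous_on UNIV (\<lambda>t. (h t - J t (h t)) - J t (h t - J t (h t)))" by (intro continuous_on_diff J_apply_continuous c1 h)
    obtain G2 where G2: "version G2 (\<lambda>t. (h t - J t (h t)) - J t (h t - J t (h t)))" using version_exists[OF c2] by metis
    have "bfn q (LQ q G) (C ^ m * (2 * (1 + C) * (2 * (1 + C) * K)))"
      by (rule P[OF c2 G2 D[OF c1 G1 D[OF h(1-3) G1] G2]]) (use h(4) in \<open>simp only: eta2_def\<close>)
    then show ?thesis by (simp add: C2_def mult.assoc)
  qed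
  have up: "bfn q g (max C1 C2 * K)" if "bfn q g (C' * K)" "C' \<in> {C1, C2}" "K \<ge> 0" for g C' K
  proof (rule bfn_mono[OF that(1) AE_I2[OF order_refl]])
    show "C' * K \<le> max C1 C2 * K" using that by (intro mult_right_mono) auto
  qed
  have K0: "K \<ge> 0" if "bfn q g K" for g K
  proof -
    obtain y :: 'x where "norm y \<le> K" using \<open>bfn q g K\<close> by (auto simp: bfn_def)
    then show ?thesis by (rule order_trans[OF norm_ge_zero])
  qed
  show ?thesis
  proof (rule that[of "max C1 C2"])
    show "max C1 C2 > 0" using C12 by simp
    show "bfn q (LQ q G) (max C1 C2 * K)" if "continuous_on UNIV h" "version Hv h" "bfn q (LQ q Hv) K" "version G (\<lambda>t. eta m t (h t))" for h Hv K G
      by (rule up[OF e1[OF that]]) (use K0[OF that(3)] in auto)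
    show "bfn q (LQ q G) (max C1 C2 * K)" if "continuous_on UNIV h" "version Hv h" "bfn q (LQ q Hv) K" "version G (\<lambda>t. eta2 t (h t))" for h Hv K G
      by (rule up[OF e2[OF that]]) (use K0[OF that(3)] in auto)
  qed
qed

lemma bfn_nonneg: "bfn p g K \<Longrightarrow> K \<ge> 0"
proof -
  assume "bfn p g K"
  then obtain y :: 'x where "norm y \<le> K" by (auto simp: bfn_def)
  then show "K \<ge> 0" by (rule order_trans[OF norm_ge_zero])
qed

text \<open>On [a, b] the weight is its largest value times exp(-\<delta> r), with r the distance
  from the end point where it is attained. Supremum and mass are then at most 1 + 2/\<delta> times
  that value, as \<open>norm_weighted_integral_le\<close> asks.\<close>

lemma weighted_piece:
  assumes h: "continuous_on UNIV h" "version Hv h" "bfn q (LQ q Hv) K" and ab: "a \<le> b" and d: "\<delta> > 0"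
  shows "norm (integral {a..b} (\<lambda>t. exp (\<delta> * t) *\<^sub>R h t)) \<le> (1 + 2 / \<delta>) * exp (\<delta> * b) * K"
    and "norm (integral {a..b} (\<lambda>t. exp (- \<delta> * t) *\<^sub>R h t)) \<le> (1 + 2 / \<delta>) * exp (- \<delta> * a) * K"
proof -
  have nn: "(\<integral>\<^sup>+s. ennreal (E * exp (- \<delta> * \<bar>s + c\<bar>)) \<partial>lborel) \<le> ennreal ((1 + 2 / \<delta>) * E)" if "E > 0" for E c
  proof -
    have "(\<integral>\<^sup>+s. ennreal E * ennreal (exp (- \<delta> * \<bar>s + c\<bar>)) \<partial>lborel) = ennreal E * ennreal (2 / \<delta>)"
      by (subst nn_integral_cmult) (auto simp: exp_abs_nn_integral[OF d, simplified])
    then have "(\<integral>\<^sup>+s. ennreal (E * exp (- \<delta> * \<bar>s + c\<bar>)) \<partial>lborel) = ennreal (E * (2 / \<delta>))"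
      using that d by (simp add: ennreal_mult[symmetric])
    also have "\<dots> \<le> ennreal ((1 + 2 / \<delta>) * E)" using that by (intro ennreal_leI) (simp add: algebra_simps)
    finally show ?thesis .
  qed
  have Mx: "(1 + 2 / \<delta>) * exp r > 0" for r :: real using d by (intro mult_pos_pos add_pos_pos) auto
  have "norm (integral {a..b} (\<lambda>t. complex_of_real (exp (\<delta> * t)) *\<^sub>C h t)) \<le> ((1 + 2 / \<delta>) * exp (\<delta> * b)) * K"
  proof (rule norm_weighted_integral_le[OF h(1,2) q h(3) _ ab Mx])
    show "cmod (complex_of_real (exp (\<delta> * s))) \<le> (1 + 2 / \<delta>) * exp (\<delta> * b)" if "s \<in> {a..b}" for s
    proof -
      have "exp (\<delta> * s) \<le> 1 * exp (\<delta> * b)" using that d by simp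
      also have "\<dots> \<le> (1 + 2 / \<delta>) * exp (\<delta> * b)" using d by (intro mult_right_mono) auto
      finally show ?thesis by simp
    qed
    have "(\<integral>\<^sup>+s. ennreal (indicator {a<..b} s * cmod (complex_of_real (exp (\<delta> * s)))) \<partial>lborel) \<le> (\<integral>\<^sup>+s. ennreal (exp (\<delta> * b) * exp (- \<delta> * \<bar>s + - b\<bar>)) \<partial>lborel)"
      by (intro nn_integral_mono ennreal_leI) (auto simp: indicator_def exp_add[symmetric] algebra_simps)
    also have "\<dots> \<le> ennreal ((1 + 2 / \<delta>) * exp (\<delta> * b))" by (rule nn) simp
    finally show "(\<integral>\<^sup>+s. ennreal (indicator {a<..b} s * cmod (complex_of_real (exp (\<delta> * s)))) \<partial>lborel) \<le> ennreal ((1 + 2 / \<delta>) * exp (\<delta> * b))" .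
  qed (intro continuous_intros)
  then show "norm (integral {a..b} (\<lambda>t. exp (\<delta> * t) *\<^sub>R h t)) \<le> (1 + 2 / \<delta>) * exp (\<delta> * b) * K"
    by (simp only: scaleC_of_real)
  have "norm (integral {a..b} (\<lambda>t. complex_of_real (exp (- \<delta> * t)) *\<^sub>C h t)) \<le> ((1 + 2 / \<delta>) * exp (- \<delta> * a)) * K"
  proof (rule norm_weighted_integral_le[OF h(1,2) q h(3) _ ab Mx])
    show "cmod (complex_of_real (exp (- \<delta> * s))) \<le> (1 + 2 / \<delta>) * exp (- \<delta> * a)" if "s \<in> {a..b}" for s
    proof -
      have "exp (- \<delta> * s) \<le> 1 * exp (- \<delta> * a)" using that d by simp
      also have "\<dots> \<le> (1 + 2 / \<delta>) * exp (- \<delta> * a)" using d by (intro mult_right_mono) auto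
      finally show ?thesis by simp
    qed
    have "(\<integral>\<^sup>+s. ennreal (indicator {a<..b} s * cmod (complex_of_real (exp (- \<delta> * s)))) \<partial>lborel) \<le> (\<integral>\<^sup>+s. ennreal (exp (- \<delta> * a) * exp (- \<delta> * \<bar>s + - a\<bar>)) \<partial>lborel)"
      by (intro nn_integral_mono ennreal_leI) (auto simp: indicator_def exp_add[symmetric] algebra_simps)
    also have "\<dots> \<le> ennreal ((1 + 2 / \<delta>) * exp (- \<delta> * a))" by (rule nn) simp
    finally show "(\<integral>\<^sup>+s. ennreal (indicator {a<..b} s * cmod (complex_of_real (exp (- \<delta> * s)))) \<partial>lborel) \<le> ennreal ((1 + 2 / \<delta>) * exp (- \<delta> * a))" .
  qed (intro continuous_intros)
  then show "norm (integral {a..b} (\<lambda>t. exp (- \<delta> * t) *\<^sub>R h t)) \<le> (1 + 2 / \<delta>) * exp (- \<delta> * a) * K"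
    by (simp only: scaleC_of_real)
qed

text \<open>The truncated Calderon integral for curves that carry the weight e^(-\<theta> t), which
  the factor e^(\<theta> t) removes.\<close>

definition synth :: "(real \<Rightarrow> 'x) \<Rightarrow> nat \<Rightarrow> 'x" where
  "synth h n = integral {- real n..real n} (\<lambda>t. exp (\<theta> * t) *\<^sub>R eta m t (h t))"

text \<open>Towards -infinity the factor e^(\<theta> t) decays. Towards infinity
  \<open>eta_eta2\<close> turns it into e^(-(1 - \<theta>) t) at the price of the bounded operator
  A^-1. So a mixed-norm bound on h makes the sequence Cauchy in X.\<close>

lemma synth_convergent:
  obtains C where "C > 0"
    "\<And>h Hv K. continuous_on UNIV h \<Longrightarrow> version Hv h \<Longrightarrow> bfn q (LQ q Hv) K \<Longrightarrow> \<exists>L. synth h \<longlonglongrightarrow> L \<and> norm L \<le> C * K"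
proof -
  obtain C where C: "C > 0"
    "\<And>h Hv K G. continuous_on UNIV h \<Longrightarrow> version Hv h \<Longrightarrow> bfn q (LQ q Hv) K \<Longrightarrow> version G (\<lambda>t. eta m t (h t)) \<Longrightarrow> bfn q (LQ q G) (C * K)"
    "\<And>h Hv K G. continuous_on UNIV h \<Longrightarrow> version Hv h \<Longrightarrow> bfn q (LQ q Hv) K \<Longrightarrow> version G (\<lambda>t. eta2 t (h t)) \<Longrightarrow> bfn q (LQ q G) (C * K)"
    using eta_bfn by blast
  obtain D where D: "D \<ge> 0" "\<And>x. norm (Ai x) \<le> D * norm x" using bounded_clin_bound[OF Ai_bounded_clin] by blast
  define E1 where "E1 = (1 + 2 / \<theta>) * C"
  define E2 where "E2 = D * ((1 + 2 / (1 - \<theta>)) * C)"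
  have E: "E1 > 0" "E2 \<ge> 0" using \<theta> C D by (auto simp: E1_def E2_def intro!: mult_pos_pos add_pos_pos)
  show ?thesis
  proof (rule that[of "E1 + E2"])
    show "E1 + E2 > 0" using E by simp
    fix h Hv K assume h: "continuous_on UNIV h" "version Hv h" "bfn q (LQ q Hv) K"
    have K: "K \<ge> 0" by (rule bfn_nonneg[OF h(3)])
    have c1: "continuous_on UNIV (\<lambda>t. eta m t (h t))" by (rule eta_apply_continuous[OF h(1)])
    have c2: "continuous_on UNIV (\<lambda>t. eta2 t (h t))" by (rule eta2_apply_continuous[OF h(1)])
    obtain G1 where G1: "version G1 (\<lambda>t. eta m t (h t))" using version_exists[OF c1] by metis
    obtain G2 where G2: "version G2 (\<lambda>t. eta2 t (h t))" using version_exists[OF c2] by metis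
    note b1 = C(2)[OF h G1] and b2 = C(3)[OF h G2]
    let ?w = "\<lambda>t. exp (\<theta> * t) *\<^sub>R eta m t (h t)"
    have wc: "continuous_on S ?w" for S
      by (rule continuous_on_subset[of UNIV]) (auto intro!: continuous_intros c1)
    have wi: "?w integrable_on {a..b}" for a b by (rule integrable_continuous_real[OF wc])
    have left: "norm (integral {a..b} ?w) \<le> E1 * exp (\<theta> * b) * K" if "a \<le> b" for a b
      using weighted_piece(1)[OF c1 G1 b1 that \<theta>(1)] by (simp add: E1_def mult_ac)
    have right: "norm (integral {a..b} ?w) \<le> E2 * exp (- (1 - \<theta>) * a) * K" if ab: "a \<le> b" for a b
    proof -
      have i2: "(\<lambda>t. exp (- (1 - \<theta>) * t) *\<^sub>R eta2 t (h t)) integrable_on {a..b}"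
        by (rule integrable_continuous_real, rule continuous_on_subset[of UNIV]) (auto intro!: continuous_intros c2)
      have "?w = (\<lambda>t. Ai (exp (- (1 - \<theta>) * t) *\<^sub>R eta2 t (h t)))"
        by (rule ext) (simp add: eta_eta2 linear_cmul[OF bounded_linear.linear[OF bounded_clin_bounded_linear[OF Ai_bounded_clin]]] exp_add[symmetric] algebra_simps)
      then have "integral {a..b} ?w = Ai (integral {a..b} (\<lambda>t. exp (- (1 - \<theta>) * t) *\<^sub>R eta2 t (h t)))"
        using integral_linear[OF i2 bounded_clin_bounded_linear[OF Ai_bounded_clin]] by (simp add: o_def)
      also have "norm \<dots> \<le> D * norm (integral {a..b} (\<lambda>t. exp (- (1 - \<theta>) * t) *\<^sub>R eta2 t (h t)))" by (rule D(2))
      also have "\<dots> \<le> D * ((1 + 2 / (1 - \<theta>)) * exp (- (1 - \<theta>) * a) * (C * K))"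
        using weighted_piece(2)[OF c2 G2 b2 ab, of "1 - \<theta>"] \<theta> D(1) by (intro mult_left_mono) auto
      finally show ?thesis by (simp add: E2_def mult_ac)
    qed
    have step: "norm (synth h n' - synth h n) \<le> (E1 * exp (- \<theta> * real n) + E2 * exp (- (1 - \<theta>) * real n)) * K" if "n \<le> n'" for n n'
    proof -
      have "integral {- real n'..- real n} ?w + integral {- real n..real n} ?w = integral {- real n'..real n} ?w"
        using that by (intro Henstock_Kurzweil_Integration.integral_combine wi) auto
      moreover have "integral {- real n'..real n} ?w + integral {real n..real n'} ?w = integral {- real n'..real n'} ?w"
        using that by (intro Henstock_Kurzweil_Integration.integral_combine wi) auto
      ultimately have "synth h n' - synth h n = integral {- real n'..- real n} ?w + integral {real n..real n'} ?w"
        by (simp add: synth_def algebra_simps)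
      also have "norm \<dots> \<le> norm (integral {- real n'..- real n} ?w) + norm (integral {real n..real n'} ?w)" by (rule norm_triangle_ineq)
      also have "\<dots> \<le> E1 * exp (\<theta> * - real n) * K + E2 * exp (- (1 - \<theta>) * real n) * K"
        using that by (intro add_mono left right) auto
      finally show ?thesis by (simp add: algebra_simps)
    qed
    have lim0: "(\<lambda>n. (E1 * exp (- \<theta> * real n) + E2 * exp (- (1 - \<theta>) * real n)) * K) \<longlonglongrightarrow> 0"
    proof -
      have "(\<lambda>n. E1 * exp (- \<theta> * real n)) \<longlonglongrightarrow> 0" "(\<lambda>n. E2 * exp (- (1 - \<theta>) * real n)) \<longlonglongrightarrow> 0"
        using \<theta> by (intro exp_neg_tendsto_0; simp)+
      from tendsto_mult_right[OF tendsto_add[OF this], of K] show ?thesis by simp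
    qed
    have "Cauchy (synth h)"
    proof (rule metric_CauchyI)
      fix \<epsilon> :: real assume "\<epsilon> > 0"
      with lim0 have "\<forall>\<^sub>F n in sequentially. (E1 * exp (- \<theta> * real n) + E2 * exp (- (1 - \<theta>) * real n)) * K < \<epsilon>" by (rule order_tendstoD)
      then obtain N where N: "\<And>n. n \<ge> N \<Longrightarrow> (E1 * exp (- \<theta> * real n) + E2 * exp (- (1 - \<theta>) * real n)) * K < \<epsilon>"
        by (auto simp: eventually_sequentially)
      show "\<exists>N. \<forall>n\<ge>N. \<forall>n'\<ge>N. dist (synth h n) (synth h n') < \<epsilon>"
      proof (intro exI[of _ N] allI impI)
        fix n n' :: nat assume "N \<le> n" "N \<le> n'"
        then show "dist (synth h n) (synth h n') < \<epsilon>"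
          using step[of n n'] step[of n' n] N[of n] N[of n'] by (cases "n \<le> n'") (simp_all add: dist_norm norm_minus_commute)
      qed
    qed
    then obtain L where L: "synth h \<longlonglongrightarrow> L" using Cauchy_convergent convergent_def by blast
    \<comment> \<open>\<open>synth h 0\<close> is an integral over a single point and hence 0, so
      the Cauchy estimate from index 0 bounds every term.\<close>
    have "norm (synth h n) \<le> (E1 + E2) * K" for n
      using step[of 0 n] by (simp add: synth_def)
    then have "norm L \<le> (E1 + E2) * K" by (intro Lim_norm_ubound[OF _ L]) auto
    with L show "\<exists>L. synth h \<longlonglongrightarrow> L \<and> norm L \<le> (E1 + E2) * K" by blast
  qed
qed

lemma eta_scaleR: "eta m t (r *\<^sub>R x) = r *\<^sub>R eta m t x"
  by (rule linear_cmul[OF bounded_linear.linear[OF bounded_clin_bounded_linear[OF eta_bounded_clin]]])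

lemma synth_wPhi: "synth (wPhi y) n = integral {- real n..real n} (\<lambda>t. eta m t (Phi_at y t))"
  unfolding synth_def wPhi_def eta_scaleR by (simp add: exp_add[symmetric])

lemma synth_wPsi: "synth (wPsi y) n = integral {- real n..real n} (\<lambda>t. eta m t (Psi_at y t))"
  unfolding synth_def wPsi_def eta_scaleR by (simp add: exp_add[symmetric])

lemma eta_Phi_at_integrable: "(\<lambda>t. eta m t (Phi_at y t)) integrable_on {a..b}"
  by (rule integrable_continuous_real, rule continuous_on_subset[OF eta_apply_continuous[OF Phi_at_continuous]]) simp

lemma eta_Psi_at_integrable: "(\<lambda>t. eta m t (Psi_at y t)) integrable_on {a..b}"
  by (rule integrable_continuous_real, rule continuous_on_subset[OF eta_apply_continuous[OF Psi_at_continuous]]) simp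

lemma Ai_synth_wPhi: "Ai (synth (wPhi y) n) = synth (wPhi (Ai y)) n"
proof -
  have "Ai (synth (wPhi y) n) = integral {- real n..real n} (\<lambda>t. Ai (eta m t (Phi_at y t)))"
    unfolding synth_wPhi using integral_linear[OF eta_Phi_at_integrable bounded_clin_bounded_linear[OF Ai_bounded_clin]] by (simp add: o_def)
  then show ?thesis by (simp add: synth_wPhi Ai_eta Phi_at_def Ai_commute_Phi[OF dil_H[OF \<phi>]])
qed

lemma synth_wPhi_dom: "y \<in> op_dom A \<Longrightarrow> synth (wPhi y) \<longlonglongrightarrow> calderon_const \<phi> m *\<^sub>C y"
  using calderon[OF \<phi>, of y m] by (simp add: synth_wPhi[abs_def] Phi_at_def)

text \<open>\<open>calderon\<close> covers y in the domain of A. For general y it is applied to A^-1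
  y, and injectivity of A^-1 recovers the limit.\<close>

lemma synth_wPhi_limit:
  assumes "synth (wPhi y) \<longlonglongrightarrow> L" shows "L = calderon_const \<phi> m *\<^sub>C y"
proof -
  have "(\<lambda>n. Ai (synth (wPhi y) n)) \<longlonglongrightarrow> Ai L"
    by (rule bounded_linear.tendsto[OF bounded_clin_bounded_linear[OF Ai_bounded_clin] assms])
  then have "synth (wPhi (Ai y)) \<longlonglongrightarrow> Ai L" by (simp add: Ai_synth_wPhi)
  from LIMSEQ_unique[OF this synth_wPhi_dom[OF Ai_dom]] have "Ai (L - calderon_const \<phi> m *\<^sub>C y) = 0"
    by (simp add: bounded_clin_diff[OF Ai_bounded_clin] bounded_clin_scaleC[OF Ai_bounded_clin])
  from Ai_inj[OF this] show ?thesis by simp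
qed

text \<open>The reproducing formula makes the family \<Phi>_t separate points, so equalities in X
  can be proved by comparing all \<Phi>_t.\<close>

lemma Phi_at_zero:
  assumes "\<And>t. Phi_at y t = 0" shows "y = 0"
proof -
  have "synth (wPhi y) = (\<lambda>n. 0)" by (rule ext) (simp add: synth_wPhi assms bounded_clin_0[OF eta_bounded_clin])
  then have "synth (wPhi y) \<longlonglongrightarrow> 0" by simp
  from synth_wPhi_limit[OF this] show ?thesis using calderon_const by simp
qed

end


section \<open>The mixed-norm bound for \<Psi>\<close>

context tl_pair begin

lemma admissible_apply_continuous:
  assumes K: "admissible \<beta> K" and a: "a \<in> {-\<beta>,\<beta>}" and h: "continuous_on UNIV h"
  shows "continuous_on UNIV (\<lambda>(s,t). K (ray s a) (h t))" and "continuous_on UNIV (\<lambda>s. K (ray s a) (h s))"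
proof -
  obtain C where C: "\<forall>a\<in>{-\<beta>,\<beta>}. \<forall>s x. norm (K (ray s a) x) \<le> C * norm x"
    using K unfolding admissible_def by blast
  show c: "continuous_on UNIV (\<lambda>(s,t). K (ray s a) (h t))"
    by (rule strong_continuous_apply[OF bounded_clin_bounded_linear[OF admissible_bounded_clin[OF K a]] _ admissible_continuous[OF K a] h, of C])
      (use C a in blast)
  show "continuous_on UNIV (\<lambda>s. K (ray s a) (h s))"
    by (rule continuous_on_compose2[OF c, of UNIV "\<lambda>s. (s,s)", unfolded prod.case]) (auto intro!: continuous_intros)
qed

text \<open>The inner convolution, with t truncated; \<open>R1\<close> applies Q P on the ray and
  convolves again. The kernels see sums of variables because dilations act on a ray by
  translation.\<close>

definition G1 :: "'x \<Rightarrow> nat \<Rightarrow> real \<Rightarrow> real \<Rightarrow> 'x" where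
  "G1 y n a s = integral {- real n..real n} (\<lambda>t. kb a (t + s) *\<^sub>C wPhi y t)"

definition R1 :: "'x \<Rightarrow> nat \<Rightarrow> real \<Rightarrow> real \<Rightarrow> 'x" where
  "R1 y n a \<tau> = integral UNIV (\<lambda>s. ka a (s + \<tau>) *\<^sub>C QP (ray s a) (G1 y n a s))"

lemma G1_integrand:
  assumes a: "a \<in> {-\<beta>,\<beta>}"
  shows "continuous_on UNIV (\<lambda>(s,t). kb a (t + s) *\<^sub>C wPhi y t)"
proof -
  have "continuous_on UNIV (\<lambda>p::real\<times>real. wPhi y (snd p))" by (rule continuous_on_compose2[OF wPhi_continuous]) (auto intro!: continuous_intros)
  then show ?thesis using continuous_shift[OF kb_continuous[OF a]] unfolding case_prod_unfold by (intro scaleC.continuous_on)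
qed

lemma G1_continuous: "a \<in> {-\<beta>,\<beta>} \<Longrightarrow> continuous_on UNIV (G1 y n a)"
  unfolding G1_def[abs_def] by (rule integral_param_continuous[OF G1_integrand])

text \<open>This crude bound may depend on n and y: it makes the outer convolution converge and does
  not enter the final constant.\<close>

lemma QP_G1_bounded:
  assumes a: "a \<in> {-\<beta>,\<beta>}"
  obtains D where "D \<ge> 0" "\<And>s. norm (QP (ray s a) (G1 y n a s)) \<le> D"
proof -
  obtain CQ where CQ: "CQ \<ge> 0" "\<forall>a\<in>{-\<beta>,\<beta>}. \<forall>s x. norm (QP (ray s a) x) \<le> CQ * norm x"
    using QP_admissible unfolding admissible_def by blast
  obtain C e where C: "C > 0" "e > 0" "\<And>a v. a \<in> {-\<beta>,\<beta>} \<Longrightarrow> cmod (kb a v) \<le> C * exp (- e * \<bar>v\<bar>)"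
    using kb_bound by blast
  have kC: "cmod (kb a v) \<le> C" for v
  proof -
    have "C * exp (- e * \<bar>v\<bar>) \<le> C * 1" using C by (intro mult_left_mono) auto
    then show ?thesis using C(3)[OF a, of v] by simp
  qed
  have "bounded (wPhi y ` {- real n..real n})"
    by (intro compact_imp_bounded compact_continuous_image continuous_on_subset[OF wPhi_continuous]) auto
  then obtain S where S: "\<And>t. t \<in> {- real n..real n} \<Longrightarrow> norm (wPhi y t) \<le> S" unfolding bounded_iff by blast
  have S0: "S \<ge> 0" using order_trans[OF norm_ge_zero S[of 0]] by simp
  have "norm (G1 y n a s) \<le> (C * S) * (real n - - real n)" for s
    unfolding G1_def
  proof (rule integral_bound)
    show "continuous_on {- real n..real n} (\<lambda>t. kb a (t + s) *\<^sub>C wPhi y t)"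
      by (rule continuous_on_compose2[OF G1_integrand[OF a], of _ "\<lambda>t. (s,t)", unfolded prod.case]) (auto intro!: continuous_intros)
    show "norm (kb a (t + s) *\<^sub>C wPhi y t) \<le> C * S" if "t \<in> {- real n..real n}" for t
      unfolding norm_scaleC using kC S[OF that] C by (intro mult_mono) auto
  qed auto
  then have "CQ * norm (G1 y n a s) \<le> CQ * ((C * S) * (real n - - real n))" for s using CQ by (intro mult_left_mono) auto
  moreover have "norm (QP (ray s a) (G1 y n a s)) \<le> CQ * norm (G1 y n a s)" for s using CQ a by blast
  ultimately have b: "norm (QP (ray s a) (G1 y n a s)) \<le> CQ * ((C * S) * (real n - - real n))" for s by (meson order_trans)
  show ?thesis by (rule that[OF _ b]) (use CQ C S0 in auto)
qed

lemma R1_continuous: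
  assumes a: "a \<in> {-\<beta>,\<beta>}"
  shows "continuous_on UNIV (R1 y n a)"
proof -
  obtain C e where C: "C > 0" "e > 0" "\<And>a v. a \<in> {-\<beta>,\<beta>} \<Longrightarrow> cmod (ka a v) \<le> C * exp (- e * \<bar>v\<bar>)"
    using ka_bound by blast
  obtain D where D: "D \<ge> 0" "\<And>s. norm (QP (ray s a) (G1 y n a s)) \<le> D" using QP_G1_bounded[OF a] by blast
  have hc: "continuous_on UNIV (\<lambda>s. QP (ray s a) (G1 y n a s))" by (rule admissible_apply_continuous(2)[OF QP_admissible a G1_continuous[OF a]])
  have gc: "continuous_on UNIV (\<lambda>(\<tau>,s). ka a (s + \<tau>) *\<^sub>C QP (ray s a) (G1 y n a s))"
  proof -
    have "continuous_on UNIV (\<lambda>p::real\<times>real. QP (ray (snd p) a) (G1 y n a (snd p)))"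
      by (rule continuous_on_compose2[OF hc]) (auto intro!: continuous_intros)
    then show ?thesis using continuous_shift[OF ka_continuous[OF a]] unfolding case_prod_unfold by (intro scaleC.continuous_on)
  qed
  show ?thesis unfolding R1_def[abs_def]
  proof (rule exp_dec_param_continuous[OF gc C(2), where C="\<lambda>k. C * exp (e * k) * D"])
    fix k \<tau> s :: real assume k: "\<bar>\<tau>\<bar> \<le> k"
    have "cmod (ka a (s + \<tau>)) \<le> C * (exp (e * k) * exp (- e * \<bar>s\<bar>))"
      using C(3)[OF a, of "s + \<tau>"] mult_left_mono[OF exp_shift_bound[OF C(2) k, of s], of C] C(1) by linarith
    then have "cmod (ka a (s + \<tau>)) * norm (QP (ray s a) (G1 y n a s)) \<le> C * (exp (e * k) * exp (- e * \<bar>s\<bar>)) * D"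
      using D C by (intro mult_mono) auto
    then show "norm (ka a (s + \<tau>) *\<^sub>C QP (ray s a) (G1 y n a s)) \<le> C * exp (e * k) * D * exp (- e * \<bar>s\<bar>)"
      by (simp add: norm_scaleC mult_ac)
  qed
qed

text \<open>Fubini moves the t-integral inside the contour integral and behind Q P, which does not
  depend on t; there it becomes \<open>G1\<close>.\<close>

lemma Psi_synth_ray:
  assumes a: "a \<in> {-\<beta>,\<beta>}"
  shows "exp (- \<theta> * \<tau>) *\<^sub>R integral {- real n..real n} (\<lambda>t. integral UNIV (\<lambda>s. (\<phi> (ray (\<tau> + s) a) * etaf m 0 (ray (t + s) a)) *\<^sub>C QP (ray s a) (Phi_at y t))) = R1 y n a \<tau>"
    and "(\<lambda>t. integral UNIV (\<lambda>s. (\<phi> (ray (\<tau> + s) a) * etaf m 0 (ray (t + s) a)) *\<^sub>C QP (ray s a) (Phi_at y t))) integrable_on {- real n..real n}"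
proof -
  define g where "g t s = (\<phi> (ray (\<tau> + s) a) * etaf m 0 (ray (t + s) a)) *\<^sub>C QP (ray s a) (Phi_at y t)" for t s
  have a': "\<bar>a\<bar> < \<omega>" using a \<beta>0 \<beta>\<omega> by auto
  obtain C e where C: "C > 0" "e > 0" "\<And>s a. \<bar>a\<bar> < \<omega> \<Longrightarrow> cmod (\<phi> (ray s a)) \<le> C * exp (- e * \<bar>s\<bar>)"
    using H_infty_0_ray[OF \<omega>0 \<omega>pi \<phi>] by blast
  obtain D where D: "D > 0" "\<And>a v. a \<in> {-\<beta>,\<beta>} \<Longrightarrow> cmod (etaf m 0 (ray v a)) \<le> D" using etaf_ray_bound by metis
  obtain CQ where CQ: "CQ \<ge> 0" "\<forall>a\<in>{-\<beta>,\<beta>}. \<forall>s x. norm (QP (ray s a) x) \<le> CQ * norm x"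
    using QP_admissible unfolding admissible_def by blast
  obtain CP where CP: "CP \<ge> 0" "\<And>t x. norm (Phi (dil \<phi> t) x) \<le> CP * norm x" using cint_bound[OF \<phi> admissible_P] by blast
  have phc: "continuous_on UNIV (\<lambda>p::real\<times>real. \<phi> (ray (\<tau> + snd p) a))"
    by (rule continuous_on_compose2[OF hol_ray_continuous[OF H_infty_0_holo[OF \<phi>] a]]) (auto intro!: continuous_intros)
  have etc: "continuous_on UNIV (\<lambda>p::real\<times>real. etaf m 0 (ray (fst p + snd p) a))"
    by (rule continuous_on_compose2[OF hol_ray_continuous[OF etaf_holo a]]) (auto intro!: continuous_intros)
  have qpc: "continuous_on UNIV (\<lambda>p. QP (ray (snd p) a) (Phi_at y (fst p)))"
    by (rule continuous_on_compose2[OF admissible_apply_continuous(1)[OF QP_admissible a Phi_at_continuous], of UNIV "\<lambda>p. (snd p, fst p)", unfolded prod.case])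
      (auto intro!: continuous_intros)
  have gc: "continuous_on UNIV (\<lambda>(t,s). g t s)"
    unfolding g_def case_prod_unfold by (intro scaleC.continuous_on continuous_on_mult phc etc qpc)
  define E where "E = C * exp (e * \<bar>\<tau>\<bar>) * D * (CQ * (CP * norm y))"
  have gb: "norm (g t s) \<le> E * exp (- e * \<bar>s\<bar>)" for t s
  proof -
    have "cmod (\<phi> (ray (\<tau> + s) a)) \<le> C * exp (- e * \<bar>\<tau> + s\<bar>)" by (rule C(3)[OF a'])
    also have "\<dots> \<le> C * (exp (e * \<bar>\<tau>\<bar>) * exp (- e * \<bar>s\<bar>))"
      using exp_shift_bound[OF C(2) order_refl, of s \<tau>] C(1) by (intro mult_left_mono) (auto simp: add.commute)
    finally have 1: "cmod (\<phi> (ray (\<tau> + s) a)) \<le> C * (exp (e * \<bar>\<tau>\<bar>) * exp (- e * \<bar>s\<bar>))" .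
    have "norm (QP (ray s a) (Phi_at y t)) \<le> CQ * norm (Phi_at y t)" using CQ a by blast
    also have "\<dots> \<le> CQ * (CP * norm y)" unfolding Phi_at_def using CQ CP by (intro mult_left_mono) auto
    finally have 2: "norm (QP (ray s a) (Phi_at y t)) \<le> CQ * (CP * norm y)" .
    have "norm (g t s) \<le> (C * (exp (e * \<bar>\<tau>\<bar>) * exp (- e * \<bar>s\<bar>)) * D) * (CQ * (CP * norm y))"
      unfolding g_def norm_scaleC norm_mult using 1 2 D(2)[OF a, of "t + s"] C D CQ CP by (intro mult_mono) auto
    then show ?thesis by (simp add: E_def mult_ac)
  qed
  have ic: "continuous_on UNIV (\<lambda>t. integral UNIV (g t))"
    by (rule exp_dec_param_continuous[OF gc C(2), of "\<lambda>_. E"]) (rule gb)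
  show "(\<lambda>t. integral UNIV (\<lambda>s. (\<phi> (ray (\<tau> + s) a) * etaf m 0 (ray (t + s) a)) *\<^sub>C QP (ray s a) (Phi_at y t))) integrable_on {- real n..real n}"
    using integrable_continuous_real[OF continuous_on_subset[OF ic]] by (simp add: g_def[abs_def])
  have sw: "integral {- real n..real n} (\<lambda>t. integral UNIV (g t)) = integral UNIV (\<lambda>s. integral {- real n..real n} (\<lambda>t. g t s))"
    by (rule exp_dec_integral_swap(1)[OF gc C(2) _ gb ic]) simp
  have inner: "exp (- \<theta> * \<tau>) *\<^sub>R integral {- real n..real n} (\<lambda>t. g t s) = ka a (s + \<tau>) *\<^sub>C QP (ray s a) (G1 y n a s)" for s
  proof -
    note cQ = admissible_bounded_clin[OF QP_admissible a, of s]
    let ?e = "\<lambda>t. etaf m 0 (ray (t + s) a) *\<^sub>C Phi_at y t"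
    have i: "?e integrable_on {- real n..real n}"
    proof (rule integrable_continuous_real, intro scaleC.continuous_on continuous_on_subset[OF Phi_at_continuous])
      show "continuous_on {- real n..real n} (\<lambda>t. etaf m 0 (ray (t + s) a))"
        by (rule continuous_on_compose2[OF etc, of _ "\<lambda>t. (t, s)", unfolded fst_conv snd_conv]) (auto intro!: continuous_intros)
    qed simp
    have L: "bounded_clin (\<lambda>v. \<phi> (ray (\<tau> + s) a) *\<^sub>C QP (ray s a) v)" by (rule bounded_clin_scale[OF cQ])
    have "integral {- real n..real n} (\<lambda>t. g t s) = integral {- real n..real n} (\<lambda>t. \<phi> (ray (\<tau> + s) a) *\<^sub>C QP (ray s a) (?e t))"
      by (simp add: g_def bounded_clin_scaleC[OF cQ] scaleC_scaleC)
    also have "\<dots> = \<phi> (ray (\<tau> + s) a) *\<^sub>C QP (ray s a) (integral {- real n..real n} ?e)"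
      using integral_linear[OF i bounded_clin_bounded_linear[OF L]] by (simp add: o_def)
    finally have 1: "integral {- real n..real n} (\<lambda>t. g t s) = \<phi> (ray (\<tau> + s) a) *\<^sub>C QP (ray s a) (integral {- real n..real n} ?e)" .
    \<comment> \<open>The weights of \<open>kb\<close> and \<open>wPhi\<close> leave e^(\<theta> s),
      which is free of t and is absorbed by the weight of \<open>ka\<close>.\<close>
    have "kb a (t + s) *\<^sub>C wPhi y t = of_real (exp (\<theta> * s)) *\<^sub>C ?e t" for t
    proof -
      have "kb a (t + s) *\<^sub>C wPhi y t = (of_real (exp (\<theta> * (t + s))) * etaf m 0 (ray (t + s) a) * of_real (exp (- \<theta> * t))) *\<^sub>C Phi_at y t"
        by (simp add: kb_def wPhi_def scaleC_of_real[symmetric] scaleC_scaleC mult_ac)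
      also have "of_real (exp (\<theta> * (t + s))) * etaf m 0 (ray (t + s) a) * of_real (exp (- \<theta> * t)) = of_real (exp (\<theta> * (t + s)) * exp (- \<theta> * t)) * etaf m 0 (ray (t + s) a)"
        by simp
      also have "exp (\<theta> * (t + s)) * exp (- \<theta> * t) = exp (\<theta> * s)" by (simp add: exp_add[symmetric] algebra_simps)
      finally show ?thesis by (simp add: scaleC_scaleC)
    qed
    then have "G1 y n a s = of_real (exp (\<theta> * s)) *\<^sub>C integral {- real n..real n} ?e"
      unfolding G1_def using integral_linear[OF i bounded_linear_scaleC_right[of "of_real (exp (\<theta> * s))"]] by (simp add: o_def)
    then have "ka a (s + \<tau>) *\<^sub>C QP (ray s a) (G1 y n a s) = (ka a (s + \<tau>) * of_real (exp (\<theta> * s))) *\<^sub>C QP (ray s a) (integral {- real n..real n} ?e)"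
      by (simp add: bounded_clin_scaleC[OF cQ] scaleC_scaleC)
    also have "ka a (s + \<tau>) * of_real (exp (\<theta> * s)) = of_real (exp (- \<theta> * (s + \<tau>)) * exp (\<theta> * s)) * \<phi> (ray (\<tau> + s) a)"
      by (simp add: ka_def add.commute)
    also have "exp (- \<theta> * (s + \<tau>)) * exp (\<theta> * s) = exp (- \<theta> * \<tau>)" by (simp add: exp_add[symmetric] algebra_simps)
    finally show ?thesis unfolding 1 by (simp add: scaleC_of_real[symmetric] scaleC_scaleC)
  qed
  have "exp (- \<theta> * \<tau>) *\<^sub>R integral UNIV (\<lambda>s. integral {- real n..real n} (\<lambda>t. g t s)) = R1 y n a \<tau>"
  proof -
    have i: "(\<lambda>s. integral {- real n..real n} (\<lambda>t. g t s)) integrable_on UNIV"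
    proof (rule exp_dec_integrable(1)[OF _ C(2), where C="E * (real n - - real n)" and c=0])
      show "continuous_on UNIV (\<lambda>s. integral {- real n..real n} (\<lambda>t. g t s))"
        by (rule exp_dec_integral_swap(2)[OF gc C(2) _ gb ic]) simp
      show "norm (integral {- real n..real n} (\<lambda>t. g t s)) \<le> E * (real n - - real n) * exp (- e * \<bar>s + 0\<bar>)" for s
        using exp_dec_integral_swap(3)[OF gc C(2) _ gb ic, of "- real n" "real n" s] by simp
    qed
    show ?thesis unfolding R1_def inner[symmetric]
      using integral_linear[OF i bounded_linear_scaleR_right[of "exp (- \<theta> * \<tau>)"]] by (simp add: o_def)
  qed
  with sw show "exp (- \<theta> * \<tau>) *\<^sub>R integral {- real n..real n} (\<lambda>t. integral UNIV (\<lambda>s. (\<phi> (ray (\<tau> + s) a) * etaf m 0 (ray (t + s) a)) *\<^sub>C QP (ray s a) (Phi_at y t))) = R1 y n a \<tau>"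
    by (simp add: g_def[abs_def])
qed

lemma Psi_bounded_clin: "f \<in> H \<Longrightarrow> bounded_clin (Psi f)"
  unfolding Psi_def by (rule cint_bounded_clin[OF _ QP_admissible])

text \<open>\<open>Psi_eta\<close> absorbs \<eta>(e^t A) as a scalar factor into the contour
  integral, so a single kernel Q P carries both \<phi> and \<eta>.\<close>

lemma wPsi_synth: "wPsi (synth (wPhi y) n) \<tau> = (1 / (2 * complex_of_real pi * \<i>)) *\<^sub>C (R1 y n (-\<beta>) \<tau> - R1 y n \<beta> \<tau>)"
proof -
  let ?c = "1 / (2 * complex_of_real pi * \<i>)"
  let ?I = "\<lambda>a t. integral UNIV (\<lambda>s. (\<phi> (ray (\<tau> + s) a) * etaf m 0 (ray (t + s) a)) *\<^sub>C QP (ray s a) (Phi_at y t))"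
  have "Psi (dil \<phi> \<tau>) (eta m t (Phi_at y t)) = ?c *\<^sub>C (?I (-\<beta>) t - ?I \<beta> t)" for t
  proof -
    have e: "etaf m t (ray s a) = etaf m 0 (ray (t + s) a)" for s a using etaf_dil[of m t] by (simp add: dil_ray)
    show ?thesis unfolding Psi_eta[OF dil_H[OF \<phi>]] by (simp add: Psi_def cint_def dil_ray e)
  qed
  moreover have "Psi_at (synth (wPhi y) n) \<tau> = integral {- real n..real n} (\<lambda>t. Psi (dil \<phi> \<tau>) (eta m t (Phi_at y t)))"
    unfolding Psi_at_def synth_wPhi
    using integral_linear[OF eta_Phi_at_integrable bounded_clin_bounded_linear[OF Psi_bounded_clin[OF dil_H[OF \<phi>]]]] by (simp add: o_def)
  ultimately have "Psi_at (synth (wPhi y) n) \<tau> = integral {- real n..real n} (\<lambda>t. ?c *\<^sub>C (?I (-\<beta>) t - ?I \<beta> t))" by simp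
  also have "\<dots> = ?c *\<^sub>C (integral {- real n..real n} (?I (-\<beta>)) - integral {- real n..real n} (?I \<beta>))"
  proof -
    have i: "?I a integrable_on {- real n..real n}" if "a \<in> {-\<beta>,\<beta>}" for a by (rule Psi_synth_ray(2)[OF that])
    have d: "(\<lambda>t. ?I (-\<beta>) t - ?I \<beta> t) integrable_on {- real n..real n}" by (intro integrable_diff i) auto
    show ?thesis
      using integral_linear[OF d bounded_linear_scaleC_right[of ?c]] by (simp add: o_def integral_diff[OF i i])
  qed
  finally have "wPsi (synth (wPhi y) n) \<tau> = ?c *\<^sub>C (exp (- \<theta> * \<tau>) *\<^sub>R integral {- real n..real n} (?I (-\<beta>)) - exp (- \<theta> * \<tau>) *\<^sub>R integral {- real n..real n} (?I \<beta>))"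
    by (simp add: wPsi_def scaleC.scaleR_right flip: scaleR_diff_right)
  then show ?thesis using Psi_synth_ray(1)[of "-\<beta>" \<tau> n y] Psi_synth_ray(1)[of \<beta> \<tau> n y] by simp
qed

lemma Psi_at_bound:
  obtains C where "C \<ge> 0" "\<And>y t. norm (Psi_at y t) \<le> C * norm y"
proof -
  obtain C where "C \<ge> 0" "\<And>t x. norm (Psi (dil \<phi> t) x) \<le> C * norm x"
    using cint_bound[OF \<phi> QP_admissible] unfolding Psi_def by metis
  then show ?thesis by (intro that[of C]) (simp_all add: Psi_at_def)
qed

text \<open>Along each ray: convolution with \<open>kb\<close>, then P from TA, then Q from TB, then
  convolution with \<open>ka\<close>. Every stage keeps the mixed norm bounded, uniformly in the
  truncation n. Convergence of \<open>synth (wPhi y)\<close> in X makes the curves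
  \<open>wPsi\<close> converge locally uniformly, so the bound passes to the limit.\<close>

lemma wPsi_bound:
  obtains C where "C > 0"
    "\<And>y F K G. version F (wPhi y) \<Longrightarrow> bfn q (LQ q F) K \<Longrightarrow> synth (wPhi y) \<longlonglongrightarrow> calderon_const \<phi> m *\<^sub>C y \<Longrightarrow> version G (wPsi y) \<Longrightarrow> bfn q (LQ q G) (C * K)"
proof -
  obtain CA' where CA': "CA' > 0"
    "\<And>S f F G K. (\<And>t. S t \<in> TA) \<Longrightarrow> (\<And>x. continuous_on UNIV (\<lambda>t::real. S t x)) \<Longrightarrow> continuous_on UNIV f \<Longrightarrow>
        version F f \<Longrightarrow> bfn q (LQ q F) K \<Longrightarrow> version G (\<lambda>t. S t (f t)) \<Longrightarrow> bfn q (LQ q G) (CA' * K)"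
    using ellq_bounded_family[OF ellqA q] by blast
  obtain CB' where CB': "CB' > 0"
    "\<And>S f F G K. (\<And>t. S t \<in> TB) \<Longrightarrow> (\<And>x. continuous_on UNIV (\<lambda>t::real. S t x)) \<Longrightarrow> continuous_on UNIV f \<Longrightarrow>
        version F f \<Longrightarrow> bfn q (LQ q F) K \<Longrightarrow> version G (\<lambda>t. S t (f t)) \<Longrightarrow> bfn q (LQ q G) (CB' * K)"
    using ellq_bounded_family[OF ellqB q] by blast
  obtain Ca ea where Ca: "Ca > 0" "ea > 0" "\<And>a v. a \<in> {-\<beta>,\<beta>} \<Longrightarrow> cmod (ka a v) \<le> Ca * exp (- ea * \<bar>v\<bar>)"
    using ka_bound by blast
  obtain Cb eb where Cb: "Cb > 0" "eb > 0" "\<And>a v. a \<in> {-\<beta>,\<beta>} \<Longrightarrow> cmod (kb a v) \<le> Cb * exp (- eb * \<bar>v\<bar>)"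
    using kb_bound by blast
  obtain CP where CP: "CP \<ge> 0" "\<And>y t. norm (Psi_at y t) \<le> CP * norm y" using Psi_at_bound by blast
  \<comment> \<open>One factor for each of the four stages.\<close>
  define D where "D = Ca * (2 / ea) * (CB' * (CA' * (Cb * (2 / eb))))"
  have D: "D > 0" using Ca Cb CA' CB' by (simp add: D_def)
  let ?c = "1 / (2 * complex_of_real pi * \<i>)"
  define E where "E = cmod ?c * (2 * (D + D))"
  have E: "E > 0" using D by (simp add: E_def norm_mult norm_divide)
  show ?thesis
  proof (rule that[of "cmod (1 / calderon_const \<phi> m) * E"])
    show "cmod (1 / calderon_const \<phi> m) * E > 0" using E calderon_const by simp
    fix y F K G assume F: "version F (wPhi y)" "bfn q (LQ q F) K" and lim: "synth (wPhi y) \<longlonglongrightarrow> calderon_const \<phi> m *\<^sub>C y" and G: "version G (wPsi y)"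
    have R: "bfn q (LQ q RV) (D * K)" if a: "a \<in> {-\<beta>,\<beta>}" and RV: "version RV (R1 y n a)" for a n RV
    proof -
      obtain V1 where V1: "version V1 (G1 y n a)" using version_exists[OF G1_continuous[OF a]] by metis
      have b1: "bfn q (LQ q V1) (Cb * (2 / eb) * K)"
        by (rule bfn_convolution'[OF kb_continuous[OF a] Cb(1,2) Cb(3)[OF a] wPhi_continuous F(1) q F(2) _ V1[unfolded G1_def[abs_def]]]) simp
      have c2: "continuous_on UNIV (\<lambda>s. A.P (ray s a) (G1 y n a s))"
        by (rule admissible_apply_continuous(2)[OF admissible_P a G1_continuous[OF a]])
      obtain V2 where V2: "version V2 (\<lambda>s. A.P (ray s a) (G1 y n a s))" using version_exists[OF c2] by metis
      have b2: "bfn q (LQ q V2) (CA' * (Cb * (2 / eb) * K))"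
        by (rule CA'(2)[OF TA_P[OF a] admissible_continuous[OF admissible_P a] G1_continuous[OF a] V1 b1 V2])
      have c3: "continuous_on UNIV (\<lambda>s. QP (ray s a) (G1 y n a s))"
        by (rule admissible_apply_continuous(2)[OF QP_admissible a G1_continuous[OF a]])
      obtain V3 where V3: "version V3 (\<lambda>s. QP (ray s a) (G1 y n a s))" using version_exists[OF c3] by metis
      have b3: "bfn q (LQ q V3) (CB' * (CA' * (Cb * (2 / eb) * K)))"
        by (rule CB'(2)[OF TB_Q[OF a] admissible_continuous[OF Q_admissible a] c2 V2 b2 V3[unfolded QP_def]])
      obtain Bd where Bd: "\<And>s. norm (QP (ray s a) (G1 y n a s)) \<le> Bd" using QP_G1_bounded[OF a] by metis
      have "bfn q (LQ q RV) (Ca * (2 / ea) * (CB' * (CA' * (Cb * (2 / eb) * K))))"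
        by (rule bfn_convolution_UNIV[OF ka_continuous[OF a] Ca(1,2) Ca(3)[OF a] c3 V3 Bd q b3 RV[unfolded R1_def[abs_def]]])
      then show ?thesis by (simp add: D_def mult_ac)
    qed
    have gn: "bfn q (LQ q Gn) (E * K)" if Gn: "version Gn (wPsi (synth (wPhi y) n))" for n Gn
    proof -
      obtain V1 where V1: "version V1 (R1 y n (-\<beta>))" using version_exists[OF R1_continuous[of "-\<beta>"]] by (metis insertI1)
      obtain V2 where V2: "version V2 (R1 y n \<beta>)" using version_exists[OF R1_continuous[of \<beta>]] by (metis insertI1 insertI2)
      obtain V3 where V3: "version V3 (\<lambda>\<tau>. R1 y n (-\<beta>) \<tau> - R1 y n \<beta> \<tau>)"
        using version_exists[OF continuous_on_diff[OF R1_continuous[of "-\<beta>"] R1_continuous[of \<beta>]]] by (metis insertI1 insertI2)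
      have "bfn q (LQ q V3) (2 * (D * K + D * K))"
        by (rule bfn_LQ_diff[OF V1 R[OF _ V1] V2 R[OF _ V2] q V3]) auto
      then have "bfn q (LQ q Gn) (cmod ?c * (2 * (D * K + D * K)))"
        using Gn unfolding wPsi_synth[abs_def] by (intro bfn_LQ_scale[OF V3 _ q])
      then show ?thesis by (simp add: E_def algebra_simps)
    qed
    have "\<exists>G. version G (wPsi z)" for z using version_exists[OF wPsi_continuous[of z]] by blast
    then obtain VG where VG: "\<And>z. version (VG z) (wPsi z)" by metis
    define Gn where "Gn n = VG (synth (wPhi y) n)" for n
    have Gn: "version (Gn n) (wPsi (synth (wPhi y) n))" for n unfolding Gn_def by (rule VG)
    obtain V where V: "version V (wPsi (calderon_const \<phi> m *\<^sub>C y))" using VG by blast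
    have bV: "bfn q (LQ q V) (E * K)"
    proof (rule bfn_LQ_locally_uniform[OF Gn V q0])
      show "bfn q (LQ q (Gn n)) (E * K)" for n by (rule gn[OF Gn])
      fix k :: nat and \<epsilon> :: real assume eps: "\<epsilon> > 0"
      \<comment> \<open>exp(\<theta> k) bounds the weight on [-k, k] and CP bounds \<Psi>_t
        uniformly in t; the summand 1 makes c positive.\<close>
      define c where "c = exp (\<theta> * real k) * (CP + 1)"
      have c: "c > 0" using CP by (simp add: c_def)
      have "(\<lambda>n. norm (synth (wPhi y) n - calderon_const \<phi> m *\<^sub>C y)) \<longlonglongrightarrow> 0" using lim by (simp add: LIM_zero_iff tendsto_norm_zero)
      then have "\<forall>\<^sub>F n in sequentially. norm (synth (wPhi y) n - calderon_const \<phi> m *\<^sub>C y) < \<epsilon> / c"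
        using eps c by (intro order_tendstoD) auto
      then obtain n where n: "norm (synth (wPhi y) n - calderon_const \<phi> m *\<^sub>C y) < \<epsilon> / c" by (auto simp: eventually_sequentially)
      show "\<exists>n. \<forall>s. \<bar>s\<bar> \<le> real k \<longrightarrow> norm (wPsi (synth (wPhi y) n) s - wPsi (calderon_const \<phi> m *\<^sub>C y) s) \<le> \<epsilon>"
      proof (intro exI[of _ n] allI impI)
        fix s :: real assume s: "\<bar>s\<bar> \<le> real k"
        let ?d = "synth (wPhi y) n - calderon_const \<phi> m *\<^sub>C y"
        have "wPsi (synth (wPhi y) n) s - wPsi (calderon_const \<phi> m *\<^sub>C y) s = exp (- \<theta> * s) *\<^sub>R Psi_at ?d s"
          by (simp add: wPsi_def Psi_at_def bounded_clin_diff[OF Psi_bounded_clin[OF dil_H[OF \<phi>]]] scaleR_diff_right)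
        also have "norm \<dots> \<le> exp (\<theta> * real k) * ((CP + 1) * norm ?d)"
        proof -
          have "- \<theta> * s \<le> \<theta> * real k" using mult_left_mono[of "- s" "real k" \<theta>] s \<theta> by auto
          moreover have "norm (Psi_at ?d s) \<le> (CP + 1) * norm ?d" using CP(2)[of ?d s] by (simp add: algebra_simps add_increasing)
          ultimately show ?thesis by (simp add: mult_mono)
        qed
        also have "\<dots> = c * norm ?d" by (simp add: c_def)
        also have "\<dots> \<le> \<epsilon>" using n c by (simp add: pos_less_divide_eq mult.commute less_imp_le)
        finally show "norm (wPsi (synth (wPhi y) n) s - wPsi (calderon_const \<phi> m *\<^sub>C y) s) \<le> \<epsilon>" .
      qed
    qed
    have "wPsi y = (\<lambda>t. (1 / calderon_const \<phi> m) *\<^sub>C wPsi (calderon_const \<phi> m *\<^sub>C y) t)"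
      by (rule ext) (use calderon_const in \<open>simp add: wPsi_def Psi_at_def bounded_clin_scaleC[OF Psi_bounded_clin[OF dil_H[OF \<phi>]]] scaleC.scaleR_right scaleC_scaleC\<close>)
    then have "bfn q (LQ q G) (cmod (1 / calderon_const \<phi> m) * (E * K))"
      using G by (intro bfn_LQ_scale[OF V bV q]) simp
    then show "bfn q (LQ q G) (cmod (1 / calderon_const \<phi> m) * E * K)" by (simp add: mult.assoc)
  qed
qed

subsection \<open>The operator \<open>A (A + B)\<^sup>-\<^sup>1\<close>\<close>

text \<open>A bound through one version avoids the infimum in \<open>TL_ennorm\<close>; by
  \<open>bfn_LQ_cong\<close> the choice of the version does not matter.\<close>

definition TL_bounded :: "'x \<Rightarrow> real \<Rightarrow> bool" where
  "TL_bounded y K \<longleftrightarrow> (\<exists>F. version F (wPhi y) \<and> bfn q (LQ q F) K)"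

text \<open>The operator T, normalised by the Calderon constant. The value of \<open>lim\<close> is
  meaningful once the sequence converges, which \<open>synth_wPsi_TL_bounded\<close> shows for y of
  finite norm.\<close>

definition sum_inv :: "'x \<Rightarrow> 'x" where "sum_inv y = (1 / calderon_const \<phi> m) *\<^sub>C lim (synth (wPsi y))"

lemma wPhi_add: "wPhi (x + y) t = wPhi x t + wPhi y t"
  by (simp add: wPhi_def Phi_at_def bounded_clin_add[OF cint_bounded_clin[OF dil_H[OF \<phi>] admissible_P]] scaleR_add_right)

lemma wPhi_scaleC: "wPhi (c *\<^sub>C x) t = c *\<^sub>C wPhi x t"
  by (simp add: wPhi_def Phi_at_def bounded_clin_scaleC[OF cint_bounded_clin[OF dil_H[OF \<phi>] admissible_P]] scaleC.scaleR_right)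

lemma TL_bounded_add: "TL_bounded x K \<Longrightarrow> TL_bounded y L \<Longrightarrow> TL_bounded (x + y) (2 * (K + L))"
proof -
  assume "TL_bounded x K" "TL_bounded y L"
  then obtain F G where F: "version F (wPhi x)" "bfn q (LQ q F) K" and G: "version G (wPhi y)" "bfn q (LQ q G) L" by (auto simp: TL_bounded_def)
  obtain D where D: "version D (wPhi (x + y))" using version_exists[OF wPhi_continuous] by metis
  have "wPhi (x + y) = (\<lambda>t. wPhi x t + wPhi y t)" by (rule ext) (rule wPhi_add)
  then have "bfn q (LQ q D) (2 * (K + L))" using D by (intro bfn_LQ_add[OF F G q]) simp
  with D show ?thesis by (auto simp: TL_bounded_def)
qed

lemma TL_bounded_scaleC: "TL_bounded x K \<Longrightarrow> TL_bounded (c *\<^sub>C x) (cmod c * K)"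
proof -
  assume "TL_bounded x K"
  then obtain F where F: "version F (wPhi x)" "bfn q (LQ q F) K" by (auto simp: TL_bounded_def)
  obtain G where G: "version G (wPhi (c *\<^sub>C x))" using version_exists[OF wPhi_continuous] by metis
  have "wPhi (c *\<^sub>C x) = (\<lambda>t. c *\<^sub>C wPhi x t)" by (rule ext) (rule wPhi_scaleC)
  then have "bfn q (LQ q G) (cmod c * K)" using G by (intro bfn_LQ_scale[OF F q]) simp
  with G show ?thesis by (auto simp: TL_bounded_def)
qed

lemma TL_bounded_synth:
  obtains C where "C > 0" "\<And>y K. TL_bounded y K \<Longrightarrow> synth (wPhi y) \<longlonglongrightarrow> calderon_const \<phi> m *\<^sub>C y" "\<And>y K. TL_bounded y K \<Longrightarrow> norm y \<le> C * K"
proof -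
  obtain C where C: "C > 0"
    "\<And>h Hv K. continuous_on UNIV h \<Longrightarrow> version Hv h \<Longrightarrow> bfn q (LQ q Hv) K \<Longrightarrow> \<exists>L. synth h \<longlonglongrightarrow> L \<and> norm L \<le> C * K"
    using synth_convergent by blast
  have *: "synth (wPhi y) \<longlonglongrightarrow> calderon_const \<phi> m *\<^sub>C y \<and> norm (calderon_const \<phi> m *\<^sub>C y) \<le> C * K" if "TL_bounded y K" for y K
    using that C(2)[OF wPhi_continuous] synth_wPhi_limit unfolding TL_bounded_def by metis
  show ?thesis
  proof (rule that[of "C / cmod (calderon_const \<phi> m)"])
    show "norm y \<le> C / cmod (calderon_const \<phi> m) * K" if "TL_bounded y K" for y K
      using *[OF that] calderon_const by (simp add: norm_scaleC field_simps)
  qed (use * C calderon_const in auto)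
qed

lemma synth_wPsi_TL_bounded:
  assumes "TL_bounded y K"
  shows "synth (wPsi y) \<longlonglongrightarrow> calderon_const \<phi> m *\<^sub>C sum_inv y"
proof -
  obtain F where F: "version F (wPhi y)" "bfn q (LQ q F) K" using assms by (auto simp: TL_bounded_def)
  have lim: "synth (wPhi y) \<longlonglongrightarrow> calderon_const \<phi> m *\<^sub>C y" using TL_bounded_synth assms by metis
  obtain G where G: "version G (wPsi y)" using version_exists[OF wPsi_continuous] by metis
  obtain C where "bfn q (LQ q G) (C * K)" using wPsi_bound F lim G by metis
  then obtain L where L: "synth (wPsi y) \<longlonglongrightarrow> L" using synth_convergent wPsi_continuous G by metis
  then have "lim (synth (wPsi y)) = L" by (rule limI)
  then have "L = calderon_const \<phi> m *\<^sub>C sum_inv y" using calderon_const by (simp add: sum_inv_def scaleC_scaleC)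
  with L show ?thesis by simp
qed

text \<open>Under the truncated integral \<open>Phi_Psi_swap\<close> exchanges \<Phi>_\<tau>
  \<Psi>_t for \<Psi>_\<tau> \<Phi>_t, and both sides converge in X.\<close>

lemma Phi_at_sum_inv:
  assumes "TL_bounded y K"
  shows "Phi_at (sum_inv y) \<tau> = Psi_at y \<tau>"
proof -
  note cPhi = cint_bounded_clin[OF dil_H[OF \<phi>] admissible_P, of \<tau>] and cPsi = Psi_bounded_clin[OF dil_H[OF \<phi>], of \<tau>]
  have "Phi (dil \<phi> \<tau>) (synth (wPsi y) n) = Psi (dil \<phi> \<tau>) (synth (wPhi y) n)" for n
  proof -
    have "Phi (dil \<phi> \<tau>) (synth (wPsi y) n) = integral {- real n..real n} (\<lambda>t. Phi (dil \<phi> \<tau>) (eta m t (Psi_at y t)))"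
      unfolding synth_wPsi using integral_linear[OF eta_Psi_at_integrable bounded_clin_bounded_linear[OF cPhi]] by (simp add: o_def)
    also have "\<dots> = integral {- real n..real n} (\<lambda>t. Psi (dil \<phi> \<tau>) (eta m t (Phi_at y t)))"
      by (simp add: Phi_commute_eta[OF dil_H[OF \<phi>], symmetric] Psi_commute_eta[OF dil_H[OF \<phi>], symmetric] Psi_at_def Phi_at_def
          Phi_Psi_swap[OF dil_H[OF \<phi>] dil_H[OF \<phi>]])
    also have "\<dots> = Psi (dil \<phi> \<tau>) (synth (wPhi y) n)"
      unfolding synth_wPhi using integral_linear[OF eta_Phi_at_integrable bounded_clin_bounded_linear[OF cPsi]] by (simp add: o_def)
    finally show ?thesis .
  qed
  moreover have "(\<lambda>n. Phi (dil \<phi> \<tau>) (synth (wPsi y) n)) \<longlonglongrightarrow> Phi (dil \<phi> \<tau>) (calderon_const \<phi> m *\<^sub>C sum_inv y)"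
    by (rule bounded_linear.tendsto[OF bounded_clin_bounded_linear[OF cPhi] synth_wPsi_TL_bounded[OF assms]])
  moreover have "synth (wPhi y) \<longlonglongrightarrow> calderon_const \<phi> m *\<^sub>C y" using TL_bounded_synth assms by metis
  then have "(\<lambda>n. Psi (dil \<phi> \<tau>) (synth (wPhi y) n)) \<longlonglongrightarrow> Psi (dil \<phi> \<tau>) (calderon_const \<phi> m *\<^sub>C y)"
    by (rule bounded_linear.tendsto[OF bounded_clin_bounded_linear[OF cPsi]])
  ultimately have "Phi (dil \<phi> \<tau>) (calderon_const \<phi> m *\<^sub>C sum_inv y) = Psi (dil \<phi> \<tau>) (calderon_const \<phi> m *\<^sub>C y)"
    by (simp add: LIMSEQ_unique)
  then have "calderon_const \<phi> m *\<^sub>C (Phi_at (sum_inv y) \<tau> - Psi_at y \<tau>) = 0"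
    by (simp add: Phi_at_def Psi_at_def bounded_clin_scaleC[OF cPhi] bounded_clin_scaleC[OF cPsi] scaleC.diff_right)
  then show ?thesis using calderon_const by simp
qed

text \<open>\<open>wPhi (sum_inv y)\<close> is \<open>wPsi y\<close>, so \<open>wPsi_bound\<close>
  is the claim.\<close>

lemma TL_bounded_sum_inv:
  obtains C where "C > 0" "\<And>y K. TL_bounded y K \<Longrightarrow> TL_bounded (sum_inv y) (C * K)"
proof -
  obtain C where C: "C > 0"
    "\<And>y F K G. version F (wPhi y) \<Longrightarrow> bfn q (LQ q F) K \<Longrightarrow> synth (wPhi y) \<longlonglongrightarrow> calderon_const \<phi> m *\<^sub>C y \<Longrightarrow> version G (wPsi y) \<Longrightarrow> bfn q (LQ q G) (C * K)"
    using wPsi_bound by blast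
  have "TL_bounded (sum_inv y) (C * K)" if y: "TL_bounded y K" for y K
  proof -
    have lim: "synth (wPhi y) \<longlonglongrightarrow> calderon_const \<phi> m *\<^sub>C y" using TL_bounded_synth y by metis
    obtain G where G: "version G (wPsi y)" using version_exists[OF wPsi_continuous] by metis
    have "bfn q (LQ q G) (C * K)" using y C(2)[OF _ _ lim G] by (auto simp: TL_bounded_def)
    moreover have "wPhi (sum_inv y) = wPsi y" by (rule ext) (simp add: wPhi_def wPsi_def Phi_at_sum_inv[OF y])
    ultimately show ?thesis using G unfolding TL_bounded_def by metis
  qed
  with C(1) that show ?thesis by blast
qed

lemma sum_inv_sum:
  assumes "TL_bounded (op_app A u + op_app B u) K" "u \<in> op_dom A" "u \<in> op_dom B"
  shows "sum_inv (op_app A u + op_app B u) = op_app A u"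
proof -
  have "Phi_at (sum_inv (op_app A u + op_app B u) - op_app A u) t = 0" for t
    using Phi_at_sum_inv[OF assms(1), of t] Psi_sum[OF dil_H[OF \<phi>] assms(2,3), of t]
    by (simp add: Phi_at_def Psi_at_def bounded_clin_diff[OF cint_bounded_clin[OF dil_H[OF \<phi>] admissible_P]])
  from Phi_at_zero[OF this] show ?thesis by simp
qed

text \<open>As the \<Phi>_t separate points, additivity passes from \<Psi>_t to
  \<open>sum_inv\<close>.\<close>

lemma sum_inv_add:
  assumes "TL_bounded x K" "TL_bounded y L" shows "sum_inv (x + y) = sum_inv x + sum_inv y"
proof -
  have "Phi_at (sum_inv (x + y) - (sum_inv x + sum_inv y)) t = 0" for t
  proof -
    note c = cint_bounded_clin[OF dil_H[OF \<phi>] admissible_P, of t]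
    show ?thesis
      using Phi_at_sum_inv[OF TL_bounded_add[OF assms], of t] Phi_at_sum_inv[OF assms(1), of t] Phi_at_sum_inv[OF assms(2), of t]
      by (simp add: Phi_at_def Psi_at_def bounded_clin_diff[OF c] bounded_clin_add[OF c] bounded_clin_add[OF Psi_bounded_clin[OF dil_H[OF \<phi>]]])
  qed
  from Phi_at_zero[OF this] show ?thesis by simp
qed

lemma sum_inv_scaleC:
  assumes "TL_bounded x K" shows "sum_inv (c *\<^sub>C x) = c *\<^sub>C sum_inv x"
proof -
  have "Phi_at (sum_inv (c *\<^sub>C x) - c *\<^sub>C sum_inv x) t = 0" for t
  proof -
    note cc = cint_bounded_clin[OF dil_H[OF \<phi>] admissible_P, of t]
    show ?thesis
      using Phi_at_sum_inv[OF TL_bounded_scaleC[OF assms, of c], of t] Phi_at_sum_inv[OF assms, of t]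
      by (simp add: Phi_at_def Psi_at_def bounded_clin_diff[OF cc] bounded_clin_scaleC[OF cc] bounded_clin_scaleC[OF Psi_bounded_clin[OF dil_H[OF \<phi>]]])
  qed
  from Phi_at_zero[OF this] show ?thesis by simp
qed

text \<open>The norm enters only through \<open>N1\<close> and \<open>N2\<close>, which make N x the
  infimum of the admissible bounds K; hence the repeated arguments with an arbitrary slack.\<close>

lemma part_sum_closed_bounded:
  fixes X N defines "S \<equiv> op_sum (part_op A X) (part_op B X)"
  assumes X: "\<And>x. x \<in> X \<longleftrightarrow> (\<exists>K. TL_bounded x K)"
    and N1: "\<And>x K. TL_bounded x K \<Longrightarrow> N x \<le> K" and N2: "\<And>x \<epsilon>. x \<in> X \<Longrightarrow> \<epsilon> > 0 \<Longrightarrow> TL_bounded x (N x + \<epsilon>)"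
    and clA: "closed_op_on UNIV norm A" and clB: "closed_op_on UNIV norm B"
  shows "closed_op_on X N S \<and> inj_on (op_app S) (op_dom S) \<and>
         (\<exists>T. bounded_op_on X N T \<and>
              (\<forall>y \<in> op_app S ` op_dom S. T y = op_app (part_op A X) (inv_into (op_dom S) (op_app S) y)))"
proof -
  have dS: "u \<in> op_dom S \<longleftrightarrow> u \<in> op_dom A \<and> u \<in> op_dom B \<and> u \<in> X \<and> op_app A u \<in> X \<and> op_app B u \<in> X" for u
    by (auto simp: S_def op_sum_def part_op_def)
  have aS: "op_app S u = op_app A u + op_app B u" for u by (simp add: S_def op_sum_def part_op_def)
  have Xadd: "x + y \<in> X" if "x \<in> X" "y \<in> X" for x y using that X TL_bounded_add by meson
  have Xsc: "c *\<^sub>C x \<in> X" if "x \<in> X" for c x using that X TL_bounded_scaleC by meson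
  have Xdiff: "x - y \<in> X" if "x \<in> X" "y \<in> X" for x y
    using Xadd[OF that(1) Xsc[OF that(2), of "-1"]] by (simp add: scaleC.minus_left)
  obtain C1 where C1: "C1 > 0" "\<And>y K. TL_bounded y K \<Longrightarrow> norm y \<le> C1 * K" using TL_bounded_synth by metis
  obtain C2 where C2: "C2 > 0" "\<And>y K. TL_bounded y K \<Longrightarrow> TL_bounded (sum_inv y) (C2 * K)" using TL_bounded_sum_inv by metis
  have norm_le: "norm x \<le> C1 * N x" if "x \<in> X" for x
  proof (rule field_le_epsilon)
    fix \<epsilon> :: real assume "\<epsilon> > 0"
    then have "norm x \<le> C1 * (N x + \<epsilon> / C1)" using C1 by (intro C1(2) N2[OF that]) auto
    then show "norm x \<le> C1 * N x + \<epsilon>" using C1(1) by (simp add: distrib_left)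
  qed
  have TX: "sum_inv y \<in> X" if "y \<in> X" for y using that X C2(2) by meson
  have NT: "N (sum_inv y) \<le> C2 * N y" if "y \<in> X" for y
  proof (rule field_le_epsilon)
    fix \<epsilon> :: real assume "\<epsilon> > 0"
    then have "N (sum_inv y) \<le> C2 * (N y + \<epsilon> / C2)" using C2 by (intro N1 C2(2) N2[OF that]) auto
    then show "N (sum_inv y) \<le> C2 * N y + \<epsilon>" using C2(1) by (simp add: distrib_left)
  qed
  have TS: "sum_inv (op_app S u) = op_app A u" if "u \<in> op_dom S" for u
  proof -
    have "op_app A u + op_app B u \<in> X" using that dS Xadd by blast
    then obtain K where "TL_bounded (op_app A u + op_app B u) K" using X by blast
    from sum_inv_sum[OF this] that dS show ?thesis by (simp add: aS)
  qed
  have SX: "op_app S u \<in> X" if "u \<in> op_dom S" for u using that dS Xadd by (simp add: aS)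
  have Tdiff: "sum_inv (x - y) = sum_inv x - sum_inv y" if xy: "x \<in> X" "y \<in> X" for x y
  proof -
    obtain K L where K: "TL_bounded x K" and L: "TL_bounded y L" using xy X by meson
    show ?thesis using sum_inv_add[OF K TL_bounded_scaleC[OF L, of "-1"]] sum_inv_scaleC[OF L, of "-1"] by (simp add: scaleC.minus_left)
  qed
  have emb_lim: "(\<lambda>n. norm (f n)) \<longlonglongrightarrow> 0" if "\<And>n. f n \<in> X" "(\<lambda>n. N (f n)) \<longlonglongrightarrow> 0" for f :: "nat \<Rightarrow> 'x"
  proof (rule Lim_null_comparison)
    show "\<forall>\<^sub>F n in sequentially. norm (norm (f n)) \<le> C1 * N (f n)" using norm_le that by auto
    show "(\<lambda>n. C1 * N (f n)) \<longlonglongrightarrow> 0" using tendsto_mult_left[OF that(2), of C1] by simp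
  qed
  have "closed_op_on X N S"
    unfolding closed_op_on_def
  proof (intro allI ballI impI, elim conjE)
    fix u x y assume x: "x \<in> X" and y: "y \<in> X" and u: "\<forall>n. u n \<in> op_dom S"
      and lx: "(\<lambda>n. N (u n - x)) \<longlonglongrightarrow> 0" and ly: "(\<lambda>n. N (op_app S (u n) - y)) \<longlonglongrightarrow> 0"
    have uX: "u n \<in> X" for n using u dS by blast
    have 1: "(\<lambda>n. norm (u n - x)) \<longlonglongrightarrow> 0" by (rule emb_lim[OF Xdiff[OF uX x] lx])
    have 2: "(\<lambda>n. norm (op_app S (u n) - y)) \<longlonglongrightarrow> 0" by (rule emb_lim[OF Xdiff[OF SX y] ly]) (use u in blast)
    have "(\<lambda>n. N (sum_inv (op_app S (u n) - y))) \<longlonglongrightarrow> 0"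
    proof (rule tendsto_sandwich[OF _ _ tendsto_const])
      \<comment> \<open>A negative N z with slack -N z / 2 would yield a negative admissible
        bound.\<close>
      have "N z \<ge> 0" if "z \<in> X" for z
      proof (rule ccontr)
        assume "\<not> ?thesis"
        then have "TL_bounded z (N z + - N z / 2)" by (intro N2[OF that]) auto
        then have "N z + - N z / 2 \<ge> 0" unfolding TL_bounded_def using bfn_nonneg by blast
        then show False using \<open>\<not> N z \<ge> 0\<close> by simp
      qed
      then show "\<forall>\<^sub>F n in sequentially. 0 \<le> N (sum_inv (op_app S (u n) - y))" using TX Xdiff SX y u by simp
      show "\<forall>\<^sub>F n in sequentially. N (sum_inv (op_app S (u n) - y)) \<le> C2 * N (op_app S (u n) - y)" using NT Xdiff SX y u by simp
      show "(\<lambda>n. C2 * N (op_app S (u n) - y)) \<longlonglongrightarrow> 0" using tendsto_mult_left[OF ly, of C2] by simp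
    qed
    then have "(\<lambda>n. norm (sum_inv (op_app S (u n) - y))) \<longlonglongrightarrow> 0"
      by (intro emb_lim TX Xdiff SX y) (use u in auto)
    moreover have "sum_inv (op_app S (u n) - y) = op_app A (u n) - sum_inv y" for n
      using Tdiff[OF SX y] TS u by simp
    ultimately have 3: "(\<lambda>n. norm (op_app A (u n) - sum_inv y)) \<longlonglongrightarrow> 0" by simp
    \<comment> \<open>Closedness of A is used in the norm of X, which the Triebel-Lizorkin norm
      dominates.\<close>
    have xA: "x \<in> op_dom A" "op_app A x = sum_inv y"
      using clA 1 3 u dS unfolding closed_op_on_def by blast+
    have "(\<lambda>n. norm (op_app B (u n) - (y - sum_inv y))) \<longlonglongrightarrow> 0"
    proof (rule Lim_null_comparison)
      show "\<forall>\<^sub>F n in sequentially. norm (norm (op_app B (u n) - (y - sum_inv y))) \<le> norm (op_app S (u n) - y) + norm (op_app A (u n) - sum_inv y)"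
      proof (rule always_eventually, rule allI)
        fix n
        have "op_app B (u n) - (y - sum_inv y) = (op_app S (u n) - y) - (op_app A (u n) - sum_inv y)" by (simp add: aS)
        then show "norm (norm (op_app B (u n) - (y - sum_inv y))) \<le> norm (op_app S (u n) - y) + norm (op_app A (u n) - sum_inv y)"
          by (simp only: real_norm_def abs_norm_cancel norm_triangle_ineq4)
      qed
      show "(\<lambda>n. norm (op_app S (u n) - y) + norm (op_app A (u n) - sum_inv y)) \<longlonglongrightarrow> 0" using tendsto_add[OF 2 3] by simp
    qed
    then have xB: "x \<in> op_dom B" "op_app B x = y - sum_inv y"
      using clB 1 u dS unfolding closed_op_on_def by blast+
    show "x \<in> op_dom S \<and> op_app S x = y"
      using xA xB x TX[OF y] Xdiff[OF y TX[OF y]] by (simp add: dS aS)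
  qed
  moreover have inj: "inj_on (op_app S) (op_dom S)"
  proof (rule inj_onI)
    fix u v assume u: "u \<in> op_dom S" and v: "v \<in> op_dom S" and "op_app S u = op_app S v"
    \<comment> \<open>T recovers A u from (A + B) u, and A is injective because 0 is in its
      resolvent set.\<close>
    then have "op_app A u = op_app A v" using TS by metis
    then show "u = v" using Ai_A[of u] Ai_A[of v] u v dS by metis
  qed
  moreover have "bounded_op_on X N sum_inv"
    unfolding bounded_op_on_def clinear_on_def
    using TX NT sum_inv_add sum_inv_scaleC X by meson
  moreover have "\<forall>y \<in> op_app S ` op_dom S. sum_inv y = op_app (part_op A X) (inv_into (op_dom S) (op_app S) y)"
    using TS inv_into_f_f[OF inj] by (auto simp: part_op_def)
  ultimately show ?thesis by blast
qed

end


theorem theorem6p1: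
  fixes M :: "'a measure" and emb :: "'x::complex_banach \<Rightarrow> 'a \<Rightarrow> complex"
    and A B :: "'x unbounded_op" and q \<theta> \<omega>\<^sub>A \<omega>\<^sub>B \<omega>q\<^sub>A \<omega>q\<^sub>B \<rho> \<omega> \<nu> :: real
    and \<phi> :: "complex \<Rightarrow> complex"
  assumes "1 \<le> q" and "0 < \<theta>" and "\<theta> < 1"
    and "banach_function_space M emb" and "reflexive_space TYPE('x)"
    and "fatou_property M emb" and "abs_continuous_norm M emb"
    and "sectorial A \<omega>\<^sub>A" and "dense_dom_ran A"
    and "sectorial B \<omega>\<^sub>B" and "dense_dom_ran B"
    and "\<omega>\<^sub>A + \<omega>\<^sub>B < pi" and "resolvents_commute A B"
    and "Rq_sectorial M emb q A \<omega>\<^sub>A \<omega>q\<^sub>A" and "Rq_sectorial M emb q B \<omega>\<^sub>B \<omega>q\<^sub>B"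
    and "\<omega>q\<^sub>A + \<omega>q\<^sub>B < pi" and "\<omega>q\<^sub>A < \<rho>" and "\<rho> < pi - \<omega>q\<^sub>B"
    and "0 \<in> resolvent_set A"
    and "\<omega>q\<^sub>A < \<omega>" and "\<omega> < pi" and "\<phi> \<in> H_infty_0 \<omega>" and "\<exists>z\<in>sector \<omega>. \<phi> z \<noteq> 0"
    and "(\<lambda>z. z powr (- complex_of_real \<theta>) * \<phi> z) \<in> H_infty_0 \<omega>"
    and "\<omega>\<^sub>A < \<nu>" and "\<nu> < \<omega>"
  defines "X\<theta> \<equiv> TL_space M emb q \<theta> \<nu> \<phi> A" and "N \<equiv> TL_norm M emb q \<theta> \<nu> \<phi> A"
  defines "A\<theta> \<equiv> part_op A X\<theta>" and "B\<theta> \<equiv> part_op B X\<theta>"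
  defines "S \<equiv> op_sum A\<theta> B\<theta>"
  shows "closed_op_on X\<theta> N S \<and>
         inj_on (op_app S) (op_dom S) \<and>
         (\<exists>T. bounded_op_on X\<theta> N T \<and>
              (\<forall>y \<in> op_app S ` op_dom S. T y = op_app A\<theta> (inv_into (op_dom S) (op_app S) y)))"
proof -
  note asm = assms(1-26)
  have A0: "0 \<le> \<omega>\<^sub>A" "closed_op_on UNIV norm A" and B0: "0 \<le> \<omega>\<^sub>B" "closed_op_on UNIV norm B"
    using asm(8,10) by (auto simp: sectorial_def)
  have Aq: "\<omega>\<^sub>A \<le> \<omega>q\<^sub>A" and Bq: "\<omega>\<^sub>B \<le> \<omega>q\<^sub>B" using asm(14,15) by (auto simp: Rq_sectorial_def)
  \<comment> \<open>The midpoint of the usable angles: above \<open>\<omega>q\<^sub>A\<close> the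
    rays carry \<ell>^q-bounds for A, below \<open>pi - \<omega>q\<^sub>B\<close> their negatives
    carry those for B, and below \<omega> they stay in the sector of \<phi>.\<close>
  define \<beta> where "\<beta> = (\<omega>q\<^sub>A + min \<omega> (pi - \<omega>q\<^sub>B)) / 2"
  have \<beta>: "\<omega>q\<^sub>A < \<beta>" "\<beta> < \<omega>" "\<beta> < pi - \<omega>q\<^sub>B" using asm(16,20) by (auto simp: \<beta>_def min_def)
  have \<beta>b: "0 < \<beta>" "\<beta> < pi" using A0 Aq \<beta> asm(21) by auto
  \<comment> \<open>Below both \<nu> and \<beta>, so that the contour of the definition and the
    working contour lie in one region with a resolvent bound.\<close>
  define \<sigma>A where "\<sigma>A = (\<omega>\<^sub>A + min \<nu> \<beta>) / 2"
  have sA: "\<omega>\<^sub>A < \<sigma>A" "\<sigma>A < \<nu>" "\<sigma>A < \<beta>" "\<sigma>A < pi" using asm(25,26) \<beta> Aq \<beta>b by (auto simp: \<sigma>A_def min_def)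
  \<comment> \<open>Between \<open>\<omega>\<^sub>B\<close> and pi - \<beta>, which leaves room for
    -z with z in the closed sector of angle \<beta>.\<close>
  define \<sigma>B where "\<sigma>B = (\<omega>\<^sub>B + (pi - \<beta>)) / 2"
  have sB: "\<omega>\<^sub>B < \<sigma>B" "\<beta> < pi - \<sigma>B" "\<sigma>B < pi" using \<beta> Bq \<beta>b by (simp_all add: \<sigma>B_def field_simps)
  obtain CA where CA: "outer_resolvent A \<sigma>A CA" using sectorial_outer_resolvent[OF asm(8)] sA by metis
  obtain CB where CB: "outer_resolvent B \<sigma>B CB" using sectorial_outer_resolvent[OF asm(10)] sB by metis
  interpret op_pair \<beta> \<omega> A B \<sigma>A CA \<sigma>B CB
    by (intro op_pair.intro op_calculus.intro contour.intro op_calculus_axioms.intro op_pair_axioms.intro)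
      (use CA CB \<beta> \<beta>b sA sB asm in auto)
  obtain m where m: "calderon_const \<phi> m \<noteq> 0" using calderon_const_nonzero[OF asm(22,23)] by blast
  \<comment> \<open>The index sets are complements of open sectors, so the contour rays of angle
    \<beta> and their negatives, of angle pi - \<beta>, belong to them.\<close>
  define TA where "TA = (\<lambda>l x. l *\<^sub>C resolvent A l x) ` (- (sector \<beta> \<union> {0}))"
  define TB where "TB = (\<lambda>l x. l *\<^sub>C resolvent B l x) ` (- (sector (pi - \<beta>) \<union> {0}))"
  have TA: "A.P z \<in> TA" if "z \<in> - (sector \<beta> \<union> {0})" for z
    unfolding TA_def A.P_def[abs_def] by (rule imageI[OF that])
  have TB: "B.P z \<in> TB" if "z \<in> - (sector (pi - \<beta>) \<union> {0})" for z
    unfolding TB_def B.P_def[abs_def] by (rule imageI[OF that])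
  interpret tl_pair \<beta> \<omega> A B \<sigma>A CA \<sigma>B CB M emb q \<theta> \<phi> TA TB m
  proof (intro tl_pair.intro op_pair_axioms fatou_bfs.intro fatou_bfs_axioms.intro tl_pair_axioms.intro asm m)
    have "\<omega>q\<^sub>B < pi - \<beta>" "pi - \<beta> < pi" using \<beta> \<beta>b by auto
    then show "ellq_bounded M emb q TA" "ellq_bounded M emb q TB"
      using asm(14,15) \<beta>(1) \<beta>b(2) unfolding Rq_sectorial_def TA_def TB_def by blast+
    fix a s :: real assume a: "a \<in> {-\<beta>,\<beta>}"
    then have c: "cos a = cos \<beta>" by auto
    show "A.P (ray s a) \<in> TA" using \<beta>b by (intro TA) (auto simp: sector_eq Re_ray c)
    show "Q (ray s a) \<in> TB" unfolding Q_def using \<beta>b by (intro TB) (auto simp: sector_eq Re_ray c)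
  next
    fix t :: real
    have "- 1 * exp (- t) \<le> cos \<beta> * exp (- t)" by (intro mult_right_mono) auto
    then show "J t \<in> TA" unfolding J_def using \<beta>b by (intro TA) (auto simp: sector_eq Re_ray)
  qed
  have wPhi_eq: "exp (- \<theta> * s) *\<^sub>R dunford \<nu> (\<lambda>z. \<phi> (complex_of_real (exp s) * z)) A y = wPhi y s" for s y
    using A.dunford_cint[OF \<omega>0 \<omega>pi dil_H[OF \<phi>] sA(2) asm(26) sA(3) \<beta>(2)] by (simp add: wPhi_def Phi_at_def dil_def[abs_def])
  have TL_ennorm_le_TL_bounded: "TL_ennorm M emb q \<theta> \<nu> \<phi> A x \<le> ennreal K" if g: "TL_bounded x K" for x K
  proof -
    obtain F where F: "version F (wPhi x)" "bfn q (LQ q F) K" using g by (auto simp: TL_bounded_def)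
    obtain G where G: "version G (wPhi x)" "\<And>s. AE w in M. G (s, w) = emb (wPhi x s) w" using version_exists[OF wPhi_continuous] by metis
    show ?thesis
      by (rule TL_ennorm_le[OF version_measurable[OF G(1)] _ bfn_LQ_cong[OF F(1) G(1) F(2)] q]) (unfold wPhi_eq, rule G(2))
  qed
  have X: "x \<in> X\<theta> \<longleftrightarrow> (\<exists>K. TL_bounded x K)" and N2: "x \<in> X\<theta> \<Longrightarrow> \<epsilon> > 0 \<Longrightarrow> TL_bounded x (N x + \<epsilon>)" for x \<epsilon>
  proof -
    show N2: "TL_bounded x (N x + \<epsilon>)" if "x \<in> X\<theta>" "\<epsilon> > 0" for \<epsilon>
    proof -
      have "TL_ennorm M emb q \<theta> \<nu> \<phi> A x < \<infinity>" using that by (simp add: X\<theta>_def TL_space_def)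
      from TL_ennorm_finiteE[OF this that(2) q] show ?thesis unfolding TL_bounded_def N_def wPhi_eq by metis
    qed
    show "x \<in> X\<theta> \<longleftrightarrow> (\<exists>K. TL_bounded x K)"
    proof
      assume "\<exists>K. TL_bounded x K"
      then obtain K where "TL_ennorm M emb q \<theta> \<nu> \<phi> A x \<le> ennreal K" using TL_ennorm_le_TL_bounded by blast
      then show "x \<in> X\<theta>" by (simp add: X\<theta>_def TL_space_def le_less_trans[OF _ ennreal_less_top])
    qed (use N2[of 1] in auto)
  qed
  have N1: "N x \<le> K" if "TL_bounded x K" for x K
    using enn2real_leI[OF _ TL_ennorm_le_TL_bounded[OF that]] that bfn_nonneg by (auto simp: N_def TL_norm_def TL_bounded_def)
  show ?thesis
    unfolding S_def A\<theta>_def B\<theta>_def by (rule part_sum_closed_bounded[OF X N1 N2 A0(2) B0(2)])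
qed

end
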